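(* Let $\mathbb{H}$ be a complex Hilbert space, let $A$ be a sectorial operator of type $\omega\in(0,\pi)$ on $\mathbb{H}$, and suppose that $A$ is one-one. Let $\theta\in(\omega,\pi)$ and $0<\alpha<\frac{\theta-\omega}{2}$. Then the following assertions are equivalent: (i) $A$ has a bounded $H^\infty(\Sigma_\theta)$ functional calculus. (ii) For some (equivalently, for any) pair $(F,G)$ of nonzero functions in $H^\infty_0(\Sigma_{(\omega+\alpha)+})$, there is a constant $K>0$ such that $$\|x\|_{F,\alpha}\le K\|x\|\quad\text{and}\quad\|x\|^*_{G,\alpha}\le K\|x\|,\qquad\forall x\in\mathbb{H}.$$ (iii) For some (equivalently, for any) nonzero function $F\in H^\infty_0(\Sigma_{(\omega+\alpha)+})$, there is a constant $C>0$ such that $$C^{-1}\|x\|\le\|x\|_{F,\alpha}\le C\|x\|,\qquad\forall x\in\mathbb{H}.$$ Here "for some (equivalently, for any)" means that both the existential version and the universal version of (ii), respectively of (iii), are equivalent to (i).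
   Context: Sectors: for $\omega\in(0,\pi)$, $\Sigma_\omega=\{z\in\mathbb{C}\setminus\{0\}: |\mathrm{Arg}(z)|<\omega\}$. Sectorial operators: a closed densely defined operator $A$ on $\mathbb{H}$ is sectorial of type $\omega\in(0,\pi)$ if its spectrum satisfies $\sigma(A)\subset\overline{\Sigma}_\omega$ and for every $\theta'\in(\omega,\pi)$ there is a constant $K_{\theta'}>0$ with $\|zR(z,A)\|\le K_{\theta'}$ for all $z\in\mathbb{C}\setminus\overline{\Sigma}_{\theta'}$, where $R(z,A)=(z-A)^{-1}$. The adjoint $A^*$ is then also sectorial of type $\omega$. Function spaces: for $\theta\in(0,\pi)$, $H^\infty(\Sigma_\theta)$ is the algebra of bounded analytic functions $f:\Sigma_\theta\to\mathbb{C}$ with norm $\|f\|_{\infty,\theta}=\sup_{z\in\Sigma_\theta}|f(z)|$. $H^\infty_0(\Sigma_\theta)$ is the subalgebra of those $f$ for which there exist $s,c>0$ with $|f(z)|\le c\,|z|^s/(1+|z|)^{2s}$ for all $z\in\Sigma_\theta$. For $\mu\in(0,\pi)$, $H^\infty_0(\Sigma_{\mu+})=\bigcup_{\mu<\theta'<\pi}H^\infty_0(\Sigma_{\theta'})$. Functional calculus: if $A$ is sectorial of type $\omega$, $\theta\in(\omega,\pi)$ and $f\in H^\infty_0(\Sigma_\theta)$, then $f(A)=\frac{1}{2\pi i}\int_{\Gamma_\gamma}f(z)R(z,A)\,dz$, a bounded operator on $\mathbb{H}$, where $\gamma\in(\omega,\theta)$ and $\Gamma_\gamma$ is the boundary of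 $\Sigma_\gamma$ oriented counterclockwise ($\Gamma_\gamma(t)=-te^{i\gamma}$ for $t\le 0$ and $te^{-i\gamma}$ for $t\ge0$); this is independent of $\gamma$. $A$ has (admits) a bounded $H^\infty(\Sigma_\theta)$ functional calculus if there is a constant $K>0$ such that $\|f(A)\|\le K\|f\|_{\infty,\theta}$ for all $f\in H^\infty_0(\Sigma_\theta)$. Area integral functions: for $F\in H^\infty_0(\Sigma_{(\omega+\alpha)+})$, say $F\in H^\infty_0(\Sigma_{\theta'})$ with $\theta'\in(\omega+\alpha,\pi)$, and $z\in\Sigma_\alpha$, let $F_z(w)=F(zw)$ for $w\in\Sigma_{\theta'-\alpha}$; then $F_z\in H^\infty_0(\Sigma_{\theta'-\alpha})$ with $\theta'-\alpha>\omega$, and $F(zA)$ means $F_z(A)$, and $F(zA^* )$ means $F_z(A^* )$. With $dm$ the Lebesgue measure on $\mathbb{R}^2\cong\mathbb{C}$, for $x\in\mathbb{H}$, $$\|x\|_{F,\alpha}=\left(\int_{\Sigma_\alpha}\|F(zA)x\|^2\,\frac{dm(z)}{|z|^2}\right)^{1/2},\qquad \|x\|^*_{F,\alpha}=\left(\int_{\Sigma_\alpha}\|F(zA^* )x\|^2\,\frac{dm(z)}{|z|^2}\right)^{1/2},$$ both with values in $[0,\infty]$. *)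

theory Defs
  imports "HOL-Analysis.Analysis"
begin

section \<open>Complex Hilbert spaces\<close>

text \<open>
  The complex structure extends the library class of real inner product spaces, so that norm,
  topology and integration are those of the library. The complex inner product is linear in its
  first argument; its positive definiteness is inherited from \<^class>\<open>real_inner\<close> through
  \<open>inner x y = Re (cinner x y)\<close>.
\<close>

class complex_inner = real_inner +
  fixes scaleC :: "complex \<Rightarrow> 'a \<Rightarrow> 'a" (infixr \<open>*\<^sub>C\<close> 75)
    and cinner :: "'a \<Rightarrow> 'a \<Rightarrow> complex"
  assumes scaleC_add_right: "c *\<^sub>C (x + y) = c *\<^sub>C x + c *\<^sub>C y"
    and scaleC_add_left: "(c + d) *\<^sub>C x = c *\<^sub>C x + d *\<^sub>C x"
    and scaleC_scaleC: "c *\<^sub>C d *\<^sub>C x = (c * d) *\<^sub>C x"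
    and scaleC_of_real: "complex_of_real r *\<^sub>C x = r *\<^sub>R x"
    and cinner_commute: "cinner x y = cnj (cinner y x)"
    and cinner_add_left: "cinner (x + y) z = cinner x z + cinner y z"
    and cinner_scaleC_left: "cinner (c *\<^sub>C x) y = c * cinner x y"
    and inner_eq_Re_cinner: "inner x y = Re (cinner x y)"

class complex_hilbert = complex_inner + complete_space
begin

subclass banach ..

end

instantiation complex :: complex_hilbert
begin

definition scaleC_complex :: "complex \<Rightarrow> complex \<Rightarrow> complex"
  where "scaleC_complex c x = c * x"

definition cinner_complex :: "complex \<Rightarrow> complex \<Rightarrow> complex"
  where "cinner_complex x y = x * cnj y"

instance
  by standard
    (auto simp: scaleC_complex_def cinner_complex_def algebra_simps scaleR_conv_of_real
      inner_complex_def)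

end

lemma norm_scaleC: "norm (c *\<^sub>C x) = cmod c * norm (x :: 'a::complex_inner)"
proof -
  have "cinner (c *\<^sub>C x) (c *\<^sub>C x) = c * cnj c * cinner x x"
    by (metis cinner_commute cinner_scaleC_left complex_cnj_mult mult.assoc)
  also have "c * cnj c = complex_of_real ((cmod c)\<^sup>2)"
    by (rule complex_norm_square [symmetric])
  finally have "inner (c *\<^sub>C x) (c *\<^sub>C x) = (cmod c)\<^sup>2 * inner x x"
    by (simp add: inner_eq_Re_cinner del: of_real_power)
  then show ?thesis
    by (simp add: norm_eq_sqrt_inner real_sqrt_mult)
qed

lemma bounded_linear_scaleC: "bounded_linear (\<lambda>x :: 'a::complex_inner. c *\<^sub>C x)"
proof (rule bounded_linear_intro [where K = "cmod c"])
  show "c *\<^sub>C (r *\<^sub>R x) = r *\<^sub>R (c *\<^sub>C x)" for r and x :: 'a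
    by (simp add: scaleC_scaleC mult.commute flip: scaleC_of_real)
qed (simp_all add: scaleC_add_right norm_scaleC mult.commute)

lift_definition scaleC_blinfun ::
  "complex \<Rightarrow> ('b::real_normed_vector \<Rightarrow>\<^sub>L 'a::complex_inner) \<Rightarrow> ('b \<Rightarrow>\<^sub>L 'a)"
  is "\<lambda>c T x. c *\<^sub>C T x"
  by (rule bounded_linear_compose [OF bounded_linear_scaleC])


section \<open>Unbounded operators\<close>

text \<open>
  An operator on \<open>'a\<close> with domain \<open>dom A\<close> is a partial function \<open>A :: 'a \<rightharpoonup> 'a\<close>.
\<close>

definition linear_operator :: "('a::complex_inner \<rightharpoonup> 'a) \<Rightarrow> bool" where
  "linear_operator A \<longleftrightarrow> dom A \<noteq> {} \<and>
     (\<forall>x\<in>dom A. \<forall>y\<in>dom A. \<forall>c d.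
        A (c *\<^sub>C x + d *\<^sub>C y) = Some (c *\<^sub>C the (A x) + d *\<^sub>C the (A y)))"

definition closed_operator :: "('a::complex_inner \<rightharpoonup> 'a) \<Rightarrow> bool" where
  "closed_operator A \<longleftrightarrow> closed (Map.graph A)"

definition densely_defined :: "('a::complex_inner \<rightharpoonup> 'a) \<Rightarrow> bool" where
  "densely_defined A \<longleftrightarrow> closure (dom A) = UNIV"

text \<open>The vector \<open>z\<close> below is unique whenever \<open>A\<close> is densely defined.\<close>

definition adjoint_op :: "('a::complex_inner \<rightharpoonup> 'a) \<Rightarrow> ('a \<rightharpoonup> 'a)" where
  "adjoint_op A y =
     (if \<exists>z. \<forall>x\<in>dom A. cinner (the (A x)) y = cinner x z
      then Some (THE z. \<forall>x\<in>dom A. cinner (the (A x)) y = cinner x z)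
      else None)"

definition resolvent_fun :: "('a::complex_inner \<rightharpoonup> 'a) \<Rightarrow> complex \<Rightarrow> 'a \<Rightarrow> 'a" where
  "resolvent_fun A z = inv_into (dom A) (\<lambda>x. z *\<^sub>C x - the (A x))"

definition resolvent_set :: "('a::complex_inner \<rightharpoonup> 'a) \<Rightarrow> complex set" where
  "resolvent_set A =
     {z. bij_betw (\<lambda>x. z *\<^sub>C x - the (A x)) (dom A) UNIV \<and> bounded_linear (resolvent_fun A z)}"

definition spectrum :: "('a::complex_inner \<rightharpoonup> 'a) \<Rightarrow> complex set" where
  "spectrum A = - resolvent_set A"

text \<open>Meaningful only for \<open>z \<in> resolvent_set A\<close>.\<close>

definition resolvent :: "('a::complex_inner \<rightharpoonup> 'a) \<Rightarrow> complex \<Rightarrow> ('a \<Rightarrow>\<^sub>L 'a)" where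
  "resolvent A z = Blinfun (resolvent_fun A z)"


section \<open>Sectorial operators\<close>

definition sector :: "real \<Rightarrow> complex set" where
  "sector \<omega> = {z. z \<noteq> 0 \<and> \<bar>Arg z\<bar> < \<omega>}"

definition sectorial :: "real \<Rightarrow> ('a::complex_inner \<rightharpoonup> 'a) \<Rightarrow> bool" where
  "sectorial \<omega> A \<longleftrightarrow>
     linear_operator A \<and> closed_operator A \<and> densely_defined A \<and>
     spectrum A \<subseteq> closure (sector \<omega>) \<and>
     (\<forall>\<theta>'\<in>{\<omega><..<pi}. \<exists>K>0. \<forall>z\<in>- closure (sector \<theta>').
        norm (scaleC_blinfun z (resolvent A z)) \<le> K)"


section \<open>Bounded holomorphic functions on sectors\<close>

text \<open>
  Elements of these spaces are represented by total functions of which only the values on the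
  sector matter.
\<close>

definition Hinf :: "real \<Rightarrow> (complex \<Rightarrow> complex) set" where
  "Hinf \<theta> = {f. f holomorphic_on sector \<theta> \<and> bounded (f ` sector \<theta>)}"

definition Hinf_norm :: "real \<Rightarrow> (complex \<Rightarrow> complex) \<Rightarrow> real" where
  "Hinf_norm \<theta> f = (SUP z\<in>sector \<theta>. cmod (f z))"

definition Hinf0 :: "real \<Rightarrow> (complex \<Rightarrow> complex) set" where
  "Hinf0 \<theta> = {f \<in> Hinf \<theta>. \<exists>s>0. \<exists>c>0. \<forall>z\<in>sector \<theta>.
     cmod (f z) \<le> c * (cmod z powr s / (1 + cmod z) powr (2 * s))}"

text \<open>
  The union of the spaces \<open>Hinf0 \<theta>'\<close> over \<open>\<mu> < \<theta>' < pi\<close> consists of functions with different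
  domains; since functions are total here, a member is recorded as a pair of the angle \<open>\<theta>'\<close> of
  its domain and the function. Being nonzero refers to the values on that domain.
\<close>

definition Hinf0_plus :: "real \<Rightarrow> (real \<times> (complex \<Rightarrow> complex)) set" where
  "Hinf0_plus \<mu> = (SIGMA \<theta>':{\<mu><..<pi}. Hinf0 \<theta>')"

definition nonzero_Hinf0_plus :: "real \<Rightarrow> (real \<times> (complex \<Rightarrow> complex)) set" where
  "nonzero_Hinf0_plus \<mu> = {(\<theta>', F) \<in> Hinf0_plus \<mu>. \<exists>z\<in>sector \<theta>'. F z \<noteq> 0}"


section \<open>Functional calculus\<close>

definition sector_path :: "real \<Rightarrow> real \<Rightarrow> complex" where
  "sector_path \<gamma> t =
     (if t \<le> 0 then - complex_of_real t * exp (\<i> * complex_of_real \<gamma>)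
      else complex_of_real t * exp (- \<i> * complex_of_real \<gamma>))"

text \<open>
  The integral is a Henstock-Kurzweil integral in the Banach space of bounded operators, which
  needs no separability. The integrand is undefined at \<open>t = 0\<close> only, a null set.
\<close>

definition fcalc_path ::
  "real \<Rightarrow> ('a::complex_hilbert \<rightharpoonup> 'a) \<Rightarrow> (complex \<Rightarrow> complex) \<Rightarrow> ('a \<Rightarrow>\<^sub>L 'a)" where
  "fcalc_path \<gamma> A f =
     scaleC_blinfun (1 / (2 * complex_of_real pi * \<i>))
       (integral UNIV (\<lambda>t. scaleC_blinfun
          (f (sector_path \<gamma> t) * vector_derivative (sector_path \<gamma>) (at t))
          (resolvent A (sector_path \<gamma> t))))"

text \<open>
  For \<open>A\<close> sectorial of type \<open>\<omega>\<close> and \<open>f \<in> Hinf0 \<theta>\<close> the value of \<open>fcalc_path \<gamma> A f\<close> is the same for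
  all \<open>\<gamma>\<close> strictly between \<open>\<omega>\<close> and \<open>\<theta>\<close>, by Cauchy's theorem; the midpoint is one such \<open>\<gamma>\<close>.
\<close>

definition fcalc ::
  "real \<Rightarrow> real \<Rightarrow> ('a::complex_hilbert \<rightharpoonup> 'a) \<Rightarrow> (complex \<Rightarrow> complex) \<Rightarrow> ('a \<Rightarrow>\<^sub>L 'a)" where
  "fcalc \<omega> \<theta> A f = fcalc_path ((\<omega> + \<theta>) / 2) A f"

definition bounded_Hinf_calculus :: "real \<Rightarrow> real \<Rightarrow> ('a::complex_hilbert \<rightharpoonup> 'a) \<Rightarrow> bool" where
  "bounded_Hinf_calculus \<omega> \<theta> A \<longleftrightarrow>
     (\<exists>K>0. \<forall>f\<in>Hinf0 \<theta>. norm (fcalc \<omega> \<theta> A f) \<le> K * Hinf_norm \<theta> f)"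


section \<open>Area integral functions\<close>

definition ennreal_sqrt :: "ennreal \<Rightarrow> ennreal" where
  "ennreal_sqrt r = (if r = \<infinity> then \<infinity> else ennreal (sqrt (enn2real r)))"

text \<open>
  For \<open>F \<in> Hinf0 \<theta>'\<close> and \<open>z \<in> sector \<alpha>\<close>, the function \<open>\<lambda>w. F (z * w)\<close> is in \<open>Hinf0 (\<theta>' - \<alpha>)\<close>.
\<close>

definition area_norm ::
  "real \<Rightarrow> real \<Rightarrow> ('a::complex_hilbert \<rightharpoonup> 'a) \<Rightarrow> real \<times> (complex \<Rightarrow> complex) \<Rightarrow> 'a \<Rightarrow> ennreal"
where
  "area_norm \<omega> \<alpha> A = (\<lambda>(\<theta>', F) x.
     ennreal_sqrt (\<integral>\<^sup>+z\<in>sector \<alpha>.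
       ennreal ((norm (blinfun_apply (fcalc \<omega> (\<theta>' - \<alpha>) A (\<lambda>w. F (z * w))) x))\<^sup>2 / (cmod z)\<^sup>2)
       \<partial>lborel))"

end

theory Submission
  imports Defs "HOL-Complex_Analysis.Complex_Analysis"
begin

text \<open>
  The operator \<open>A\<close> and its adjoint enter only through their resolvents. The argument therefore runs for a
  family \<open>R\<close> that satisfies the resolvent identity and the sectorial bound; the families of \<open>A\<close> and of its
  adjoint are linked by \<open>R' z = (R (cnj z))\<^sup>*\<close>. In the coordinate \<open>\<zeta>\<close> with \<open>z = exp \<zeta>\<close> the contour at angle
  \<open>\<gamma>\<close> becomes the pair of lines \<open>Im \<zeta> = \<plusminus>\<gamma>\<close>, and membership in \<open>Hinf0\<close> becomes exponential decay in
  \<open>\<bar>Re \<zeta>\<bar>\<close>. Paired with two vectors, \<open>f(A)\<close> is a scalar integral over these lines (\<open>op_weak\<close>), and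
  Cauchy's theorem in strips gives independence of \<open>\<gamma>\<close>, multiplicativity (\<open>op_mult\<close>) and the rule for
  adjoints (\<open>op_adjoint\<close>).

  The measure \<open>dm / \<bar>z\<bar>\<^sup>2\<close> is invariant under dilations. For nonzero decaying \<open>\<Phi>\<close> the function
  \<open>w \<mapsto> \<Phi>(z w) cnj (\<Phi>(z cnj w))\<close> is holomorphic, and its integral over \<open>z\<close> is a positive constant: it does
  not change along the positive axis by dilation invariance, hence nowhere by the identity theorem. Thus
  \<open>f(A)\<close> is, weakly and up to that constant, the integral of the operators belonging to \<open>f\<close> times this
  kernel (\<open>reproducing\<close>). The formula is used twice.

  First, applied with \<open>\<psi>\<close> to \<open>f F\<^sub>z\<close>, where \<open>F\<^sub>z w = F (z w)\<close>, it bounds the square function of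
  \<open>f(A) F(z A) x\<close> by \<open>C sup \<bar>f\<bar>\<close> times the square function of \<open>x\<close> for \<open>\<psi>\<close>, through the Schur test
  (\<open>area_transfer\<close>). With \<open>f = 1\<close> all area functions are comparable, for all apertures; with general \<open>f\<close> and
  a two-sided estimate for \<open>F\<close> the calculus is bounded.

  Secondly, with \<open>\<Phi> = F G\<close>, one factor moves to the other side of the inner product as \<open>G\<close> of the adjoint,
  and the Cauchy-Schwarz inequality bounds \<open>\<bar>\<langle>f(A) x, y\<rangle>\<bar>\<close> by \<open>C sup \<bar>f\<bar>\<close> times the area functions of \<open>x\<close>
  and \<open>y\<close> (\<open>pairing_bound\<close>). So upper estimates for \<open>A\<close> and its adjoint also make the calculus bounded.

  Conversely let the calculus be bounded. Applying it to sums of the functions \<open>w \<mapsto> \<plusminus>\<psi>(e\<^sup>k z w)\<close>, with the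
  signs chosen so that the squares of the norms add up, bounds one area function (\<open>area_bound\<close>), and
  \<open>area_transfer\<close> carries the bound to every \<open>F\<close>; the same holds for the adjoint. The lower estimate follows
  from \<open>pairing_bound\<close> with \<open>f = e\<^sub>n\<close> and \<open>y = e\<^sub>n(A) x\<close> for an approximate unit \<open>e\<^sub>n\<close>, because
  \<open>e\<^sub>n(A) x\<close> tends to \<open>x\<close>. Here injectivity enters: on a Hilbert space it makes the range of \<open>A\<close> dense
  (\<open>dense_range\<close>), by an argument in the style of the mean ergodic theorem.
\<close>

section \<open>Complex Hilbert spaces\<close>

lemma cinner_add_right: "cinner x (y + z) = cinner x y + cinner x (z :: 'a::complex_inner)"
  by (metis cinner_add_left cinner_commute complex_cnj_add)

lemma cinner_scaleC_right: "cinner x (c *\<^sub>C y) = cnj c * cinner x (y :: 'a::complex_inner)"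
  by (metis cinner_commute cinner_scaleC_left complex_cnj_mult)

lemma scaleC_minus1: "(-1) *\<^sub>C x = - (x :: 'a::complex_inner)"
  using scaleC_of_real[of "-1" x] by simp

lemma scaleC_one: "1 *\<^sub>C x = (x :: 'a::complex_inner)"
  using scaleC_of_real[of 1 x] by simp

lemma scaleC_zero_left: "0 *\<^sub>C x = (0 :: 'a::complex_inner)"
  using scaleC_of_real[of 0 x] by simp

lemma cinner_minus_left: "cinner (- x) y = - cinner x (y :: 'a::complex_inner)"
  by (metis cinner_scaleC_left mult_minus1 scaleC_minus1)

lemma cinner_minus_right: "cinner x (- y) = - cinner x (y :: 'a::complex_inner)"
  by (metis cinner_minus_left cinner_commute complex_cnj_minus)

lemma cinner_diff_left: "cinner (x - y) z = cinner x z - cinner y (z :: 'a::complex_inner)"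
  by (metis cinner_add_left cinner_minus_left diff_conv_add_uminus)

lemma cinner_diff_right: "cinner x (y - z) = cinner x y - cinner x (z :: 'a::complex_inner)"
  by (metis cinner_add_right cinner_minus_right diff_conv_add_uminus)

lemma cinner_self: "cinner x x = complex_of_real ((norm (x :: 'a::complex_inner))\<^sup>2)"
proof -
  have "cnj (cinner x x) = cinner x x" by (metis cinner_commute)
  then have "cinner x x = complex_of_real (Re (cinner x x))"
    by (simp add: complex_eq_iff)
  then show ?thesis
    by (simp add: inner_eq_Re_cinner[symmetric] power2_norm_eq_inner)
qed

lemma norm_cinner_le: "cmod (cinner x y) \<le> norm x * norm (y :: 'a::complex_inner)"
proof (cases "cinner x y = 0")
  case False
  let ?c = "cnj (cinner x y) / cmod (cinner x y)"
  have "?c * cinner x y = cmod (cinner x y)"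
    using False by (simp add: field_simps complex_norm_square[symmetric] power2_eq_square flip: of_real_mult)
  then have "cmod (cinner x y) = inner (?c *\<^sub>C x) y"
    by (simp add: inner_eq_Re_cinner cinner_scaleC_left)
  also have "\<dots> \<le> norm (?c *\<^sub>C x) * norm y"
    by (rule norm_cauchy_schwarz)
  also have "\<dots> = norm x * norm y"
    using False by (simp add: norm_scaleC norm_divide)
  finally show ?thesis .
qed simp

lemma norm_le_if_cinner_le:
  fixes x :: "'a::complex_inner"
  assumes "\<And>y. cmod (cinner x y) \<le> C * norm y" "C \<ge> 0"
  shows "norm x \<le> C"
proof (cases "x = 0")
  case False
  have "(norm x)\<^sup>2 \<le> C * norm x"
    using assms(1)[of x] by (simp only: cinner_self) (simp add: norm_power)
  then show ?thesis using False by (simp add: power2_eq_square)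
qed (use assms in simp)

lemma cinner_ext:
  fixes x :: "'a::complex_inner"
  assumes "\<And>z. cinner x z = cinner y z"
  shows "x = y"
proof -
  have "cinner (x - y) (x - y) = 0" using assms by (simp add: cinner_diff_left)
  then show ?thesis by (simp only: cinner_self) simp
qed

lemma cinner_ext_right:
  fixes x :: "'a::complex_inner"
  assumes "\<And>z. cinner z x = cinner z y"
  shows "x = y"
  by (rule cinner_ext) (metis assms cinner_commute)

lemma bounded_linear_cinner_left: "bounded_linear (\<lambda>x. cinner x (y :: 'a::complex_inner))"
proof (rule bounded_linear_intro[where K = "norm y"])
  show "cinner (r *\<^sub>R x) y = r *\<^sub>R cinner x y" for r x
    by (metis cinner_scaleC_left scaleC_of_real scaleR_conv_of_real)
qed (simp_all add: cinner_add_left norm_cinner_le)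

text \<open>
  A substitute for weak compactness: the elements of almost minimal norm of the members of a
  decreasing sequence of bounded convex sets form a Cauchy sequence, by the parallelogram law.
\<close>

lemma nested_convex_Cauchy:
  fixes K :: "nat \<Rightarrow> 'a::real_inner set"
  assumes ne: "\<And>n. K n \<noteq> {}" and cv: "\<And>n. convex (K n)" and dec: "\<And>m n. m \<le> n \<Longrightarrow> K n \<subseteq> K m"
    and bd: "\<And>v. v \<in> K 0 \<Longrightarrow> norm v \<le> B"
  obtains v where "\<And>n. v n \<in> K n" "Cauchy v"
proof -
  define d where "d n = (INF v\<in>K n. (norm v)\<^sup>2)" for n
  have bb: "bdd_below ((\<lambda>v. (norm v)\<^sup>2) ` K n)" for n
    by (rule bdd_belowI[where m=0]) auto
  have dle: "d n \<le> (norm v)\<^sup>2" if "v \<in> K n" for n v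
    unfolding d_def by (rule cINF_lower[OF bb that])
  have "\<exists>v\<in>K n. (norm v)\<^sup>2 < d n + 1 / Suc n" for n
  proof -
    have "d n < d n + 1 / Suc n" by simp
    then show ?thesis unfolding d_def using cINF_less_iff[OF ne bb] by blast
  qed
  then obtain v where v: "\<And>n. v n \<in> K n" and vd: "\<And>n. (norm (v n))\<^sup>2 < d n + 1 / Suc n"
    by metis
  have dmono: "d m \<le> d n" if "m \<le> n" for m n
    unfolding d_def by (rule cINF_superset_mono[OF ne bb dec[OF that]]) auto
  have dB: "d n \<le> B\<^sup>2" for n
  proof -
    have "v n \<in> K 0" using v dec[of 0 n] by blast
    then show ?thesis using dle[OF v[of n]] bd by (meson norm_ge_zero order_trans power_mono)
  qed
  have "incseq d" using dmono by (simp add: incseq_def)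
  then obtain L where L: "d \<longlonglongrightarrow> L"
    by (rule incseq_convergent[of d "B\<^sup>2"]) (use dB in auto)
  have est: "(norm (v n - v m))\<^sup>2 \<le> 4 / Suc n + 2 * (d m - d n)" if "n \<le> m" for n m
  proof -
    have "v m \<in> K n" using v dec[OF that] by blast
    then have "(1/2) *\<^sub>R v n + (1/2) *\<^sub>R v m \<in> K n"
      using convexD[OF cv v] by auto
    then have "d n \<le> (norm ((1/2) *\<^sub>R v n + (1/2) *\<^sub>R v m))\<^sup>2" by (rule dle)
    also have "(1/2) *\<^sub>R v n + (1/2) *\<^sub>R v m = (1/2) *\<^sub>R (v n + v m)"
      by (simp add: scaleR_add_right)
    finally have 1: "4 * d n \<le> (norm (v n + v m))\<^sup>2" by (simp add: power_divide)
    have "(norm (v n - v m))\<^sup>2 = 2 * (norm (v n))\<^sup>2 + 2 * (norm (v m))\<^sup>2 - (norm (v n + v m))\<^sup>2"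
      by (simp add: power2_norm_eq_inner algebra_simps inner_commute)
    moreover have "1 / real (Suc m) \<le> 1 / real (Suc n)" using that by (simp add: frac_le)
    ultimately show ?thesis using 1 vd[of n] vd[of m] by argo
  qed
  have "Cauchy v"
  proof (rule CauchyI)
    fix e :: real assume "e > 0"
    then have e2: "e\<^sup>2 > 0" by simp
    have lim: "(\<lambda>n. 4 / real (Suc n)) \<longlonglongrightarrow> 0"
      using LIMSEQ_Suc[OF lim_const_over_n[of 4]] by simp
    have "\<forall>\<^sub>F n in sequentially. 4 / real (Suc n) < e\<^sup>2 / 4"
      using order_tendstoD(2)[OF lim, of "e\<^sup>2/4"] e2 by simp
    moreover have "\<forall>\<^sub>F n in sequentially. \<bar>d n - L\<bar> < e\<^sup>2 / 16"
      using tendstoD[OF L, of "e\<^sup>2/16"] e2 by (simp add: dist_real_def)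
    ultimately have "\<forall>\<^sub>F n in sequentially. 4 / real (Suc n) < e\<^sup>2 / 4 \<and> \<bar>d n - L\<bar> < e\<^sup>2 / 16"
      by eventually_elim auto
    then obtain N where N: "\<And>n. n \<ge> N \<Longrightarrow> 4 / real (Suc n) < e\<^sup>2 / 4 \<and> \<bar>d n - L\<bar> < e\<^sup>2 / 16"
      unfolding eventually_sequentially by blast
    have *: "norm (v n - v m) < e" if "N \<le> n" "n \<le> m" for n m
    proof -
      have "m \<ge> N" using that by simp
      have "(norm (v n - v m))\<^sup>2 < e\<^sup>2"
        using est[OF that(2)] N[OF that(1)] N[OF \<open>m \<ge> N\<close>] e2 by argo
      then show ?thesis using \<open>e > 0\<close> by (simp add: power_less_imp_less_base)
    qed
    show "\<exists>M. \<forall>m\<ge>M. \<forall>n\<ge>M. norm (v m - v n) < e"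
      by (metis * linorder_le_cases norm_minus_commute)
  qed
  then show ?thesis using that v by blast
qed

lemma quadratic_affine_vanish:
  fixes a b :: real
  assumes "\<And>t. 0 \<le> a * t\<^sup>2 + b * t"
  shows "b = 0"
proof (rule ccontr)
  assume b: "b \<noteq> 0"
  define k where "k = \<bar>a\<bar> + 1"
  have k: "k > 0" "a \<le> k - 1" by (auto simp: k_def)
  have "0 \<le> a * (- b / k)\<^sup>2 + b * (- b / k)" by (rule assms)
  also have "\<dots> = (b / k)\<^sup>2 * (a - k)" using k by (simp add: field_simps power2_eq_square)
  finally have "(b / k)\<^sup>2 * (a - k) \<ge> 0" .
  moreover have "(b / k)\<^sup>2 > 0" using b k by simp
  ultimately show False using k by (simp add: zero_le_mult_iff)
qed

text \<open>
  The functional is represented by the minimizer of \<open>\<parallel>v\<parallel>\<^sup>2 - 2 \<phi> v\<close>, which is the limit of a Cauchy sequence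
  taken from the sublevel sets.
\<close>

lemma riesz_representation:
  fixes \<phi> :: "'a::{real_inner, complete_space} \<Rightarrow> real"
  assumes "bounded_linear \<phi>"
  obtains v where "\<And>\<xi>. \<phi> \<xi> = inner \<xi> v"
proof -
  interpret bounded_linear \<phi> by fact
  obtain C where C: "\<And>x. norm (\<phi> x) \<le> norm x * C" "C > 0" using pos_bounded by blast
  define Q where "Q v = (norm v)\<^sup>2 - 2 * \<phi> v" for v
  have Qlow: "(norm v - C)\<^sup>2 - C\<^sup>2 \<le> Q v" for v
    using C(1)[of v] by (simp add: Q_def power2_eq_square algebra_simps abs_le_iff)
  have bb: "bdd_below (range Q)"
    by (rule bdd_belowI[where m="- C\<^sup>2"]) (auto intro: order_trans[OF _ Qlow])
  define d where "d = (INF v. Q v)"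
  have dle: "d \<le> Q v" for v unfolding d_def by (rule cINF_lower[OF bb]) simp
  define K where "K n = {v. Q v \<le> d + 1 / Suc n}" for n :: nat
  \<comment> \<open>The parallelogram law in the form of strict convexity; it makes the sublevel sets convex.\<close>
  have par: "Q (u *\<^sub>R x + w *\<^sub>R y) = u * Q x + w * Q y - u * w * (norm (x - y))\<^sup>2"
    if "u + w = 1" for u w x y
  proof -
    have u: "u = 1 - w" using that by simp
    have "Q (u *\<^sub>R x + w *\<^sub>R y) = u*u * inner x x + w*w* inner y y + 2 *u*w * inner x y - 2*(u * \<phi> x + w * \<phi> y)"
      by (simp add: Q_def power2_norm_eq_inner inner_add inner_commute add scaleR algebra_simps)
    also have "\<dots> = u * Q x + w * Q y - u * w * (norm (x - y))\<^sup>2"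
      unfolding u by (simp add: Q_def power2_norm_eq_inner inner_diff inner_commute algebra_simps)
    finally show ?thesis .
  qed
  obtain v where v: "\<And>n. v n \<in> K n" "Cauchy v"
  proof (rule nested_convex_Cauchy[of K "C + sqrt (C\<^sup>2 + d + 1)"])
    show "K n \<noteq> {}" for n
    proof -
      have "(INF v. Q v) < d + 1 / Suc n" unfolding d_def by simp
      then obtain v where "Q v < d + 1 / Suc n" using cINF_less_iff[OF _ bb] by auto
      then show ?thesis unfolding K_def by (auto intro: less_imp_le)
    qed
    show "convex (K n)" for n
    proof (rule convexI)
      fix x y u w :: _ assume *: "x \<in> K n" "y \<in> K n" "0 \<le> (u::real)" "0 \<le> (w::real)" "u + w = 1"
      have "Q (u *\<^sub>R x + w *\<^sub>R y) \<le> u * Q x + w * Q y" using par[OF *(5), of x y] *(3,4) by simp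
      also have "\<dots> \<le> u * (d + 1 / Suc n) + w * (d + 1 / Suc n)"
        using * by (intro add_mono mult_left_mono) (auto simp: K_def)
      also have "\<dots> = d + 1 / Suc n" using *(5) by (metis distrib_right mult_1)
      finally show "u *\<^sub>R x + w *\<^sub>R y \<in> K n" by (simp add: K_def)
    qed
    show "K n \<subseteq> K m" if "m \<le> n" for m n
    proof -
      have "1 / real (Suc n) \<le> 1 / real (Suc m)" using that by (simp add: frac_le)
      then show ?thesis by (auto simp: K_def)
    qed
    show "norm x \<le> C + sqrt (C\<^sup>2 + d + 1)" if "x \<in> K 0" for x
    proof -
      have "(norm x - C)\<^sup>2 \<le> C\<^sup>2 + d + 1" using Qlow[of x] that by (simp add: K_def)
      then have "norm x - C \<le> sqrt (C\<^sup>2 + d + 1)" by (rule real_le_rsqrt)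
      then show ?thesis by simp
    qed
  qed blast
  then obtain x where x: "v \<longlonglongrightarrow> x" using Cauchy_convergent convergent_def by blast
  have "(\<lambda>n. Q (v n)) \<longlonglongrightarrow> Q x" unfolding Q_def
    by (intro tendsto_intros x tendsto)
  moreover have "(\<lambda>n. 1 / real (Suc n)) \<longlonglongrightarrow> 0"
    using LIMSEQ_Suc[OF lim_const_over_n[of 1]] by simp
  then have "(\<lambda>n. d + 1 / real (Suc n)) \<longlonglongrightarrow> d + 0"
    by (rule tendsto_add[OF tendsto_const])
  ultimately have "Q x \<le> d + 0"
    by (rule LIMSEQ_le) (use v in \<open>auto simp: K_def\<close>)
  then have min: "Q x \<le> Q y" for y using dle[of y] by simp
  have "\<phi> \<xi> = inner \<xi> x" for \<xi>
  proof -
    have "0 \<le> (norm \<xi>)\<^sup>2 * t\<^sup>2 + 2 * (inner \<xi> x - \<phi> \<xi>) * t" for t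
    proof -
      have "Q x \<le> Q (x + t *\<^sub>R \<xi>)" by (rule min)
      also have "\<dots> = Q x + ((norm \<xi>)\<^sup>2 * t\<^sup>2 + 2 * (inner \<xi> x - \<phi> \<xi>) * t)"
        by (simp add: Q_def power2_norm_eq_inner inner_add inner_commute add scaleR power2_eq_square[of t] algebra_simps)
      finally show ?thesis by simp
    qed
    then have "2 * (inner \<xi> x - \<phi> \<xi>) = 0" by (rule quadratic_affine_vanish)
    then show ?thesis by simp
  qed
  then show ?thesis using that by blast
qed

lemma adjoint_exists:
  fixes T :: "'a::complex_hilbert \<Rightarrow>\<^sub>L 'a"
  assumes "\<And>c x. T (c *\<^sub>C x) = c *\<^sub>C T x"
  obtains v where "\<And>x. cinner (T x) y = cinner x v"
proof -
  have "bounded_linear (\<lambda>x. inner (T x) y)"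
    by (intro bounded_linear_inner_left_comp blinfun.bounded_linear_right)
  then obtain v where v: "\<And>x. inner (T x) y = inner x v"
    using riesz_representation by blast
  have "cinner (T x) y = cinner x v" for x
  proof -
    have "Re (cinner (T x) y) = Re (cinner x v)" for x
      using v[of x] by (simp add: inner_eq_Re_cinner)
    from this[of x] this[of "(-\<i>) *\<^sub>C x"] show ?thesis
      by (simp add: assms cinner_scaleC_left complex_eq_iff)
  qed
  then show ?thesis using that by blast
qed

section \<open>Exponential decay and the dilation invariant measure on a sector\<close>

lemma nn_integral_exp_decay: 
  assumes "s > (0::real)"
  shows "(\<integral>\<^sup>+u. ennreal (exp (- s * \<bar>u + v\<bar>)) \<partial>lborel) \<le> ennreal (2 / s)"
proof -
  have lim: "((\<lambda>x. - exp (- s * x) / s) \<longlongrightarrow> 0) at_top"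
  proof -
    have "((\<lambda>x. exp (- s * x)) \<longlongrightarrow> 0) at_top"
      by (rule filterlim_compose[OF exp_at_bot],
          rule filterlim_tendsto_neg_mult_at_bot[OF tendsto_const _ filterlim_ident])
        (use assms in simp)
    from tendsto_divide[OF tendsto_minus[OF this] tendsto_const[of s]] show ?thesis using assms by simp
  qed
  have half: "(\<integral>\<^sup>+x. ennreal (exp (- s * x)) * indicator {0..} x \<partial>lborel) = ennreal (1 / s)"
  proof -
    have "(\<integral>\<^sup>+x. ennreal (exp (- s * x)) * indicator {0..} x \<partial>lborel) = ennreal (0 - (- exp (- s * 0) / s))"
      by (rule nn_integral_FTC_atLeast[OF _ _ _ lim])
        (use assms in \<open>auto intro!: derivative_eq_intros simp: field_simps\<close>)
    then show ?thesis by simp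
  qed
  have half': "(\<integral>\<^sup>+x. ennreal (exp (- s * (-x))) * indicator {0..} (-x) \<partial>lborel) = ennreal (1 / s)"
    using nn_integral_real_affine[of "\<lambda>x. ennreal (exp (- s * x)) * indicator {0..} x" "-1" 0] half
    by simp
  have "(\<integral>\<^sup>+u. ennreal (exp (- s * \<bar>u + v\<bar>)) \<partial>lborel) = (\<integral>\<^sup>+u. ennreal (exp (- s * \<bar>u\<bar>)) \<partial>lborel)"
    using nn_integral_real_affine[of "\<lambda>u. ennreal (exp (- s * \<bar>u\<bar>))" 1 v] by (simp add: add.commute)
  also have "\<dots> \<le> (\<integral>\<^sup>+x. (ennreal (exp (- s * x)) * indicator {0..} x + ennreal (exp (- s * (-x))) * indicator {0..} (-x)) \<partial>lborel)"
    by (intro nn_integral_mono) (auto simp: indicator_def)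
  also have "\<dots> = ennreal (1 / s) + ennreal (1 / s)"
    by (subst nn_integral_add) (use half half' in auto)
  also have "\<dots> = ennreal (2 / s)"
    using assms by (simp flip: ennreal_plus)
  finally show ?thesis .
qed

lemma integrable_exp_decay:
  assumes "s > (0::real)"
  shows "integrable lborel (\<lambda>u. exp (- s * \<bar>u + v\<bar>))"
proof (rule integrableI_bounded)
  show "(\<integral>\<^sup>+ x. ennreal (norm (exp (- s * \<bar>x + v\<bar>))) \<partial>lborel) < \<infinity>"
    using order.strict_trans1[OF nn_integral_exp_decay[OF assms, of v]] by simp
qed simp

lemma integral_exp_decay:
  assumes "s > (0::real)"
  shows "(\<integral>u. exp (- s * \<bar>u + v\<bar>) \<partial>lborel) \<le> 2 / s"
proof -
  have "ennreal (\<integral>u. exp (- s * \<bar>u + v\<bar>) \<partial>lborel) \<le> ennreal (2 / s)"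
    using nn_integral_exp_decay[OF assms, of v]
    by (subst nn_integral_eq_integral[symmetric]) (use integrable_exp_decay[OF assms] in auto)
  then show ?thesis using assms by simp
qed

lemma integrable_exp_decay_bound:
  fixes f :: "real \<Rightarrow> complex"
  assumes "s > 0" "f \<in> borel_measurable borel" "\<And>u. cmod (f u) \<le> C * exp (- s * \<bar>u + v\<bar>)"
  shows "integrable lborel f" "cmod (\<integral>u. f u \<partial>lborel) \<le> C * (2 / s)"
proof -
  have C: "C \<ge> 0" using assms(3)[of 0] by (smt (verit) exp_gt_zero norm_ge_zero zero_le_mult_iff)
  have i: "integrable lborel (\<lambda>u. C * exp (- s * \<bar>u + v\<bar>))"
    by (intro integrable_mult_right integrable_exp_decay assms)
  show "integrable lborel f"
    by (rule Bochner_Integration.integrable_bound[OF i]) (use assms C in auto)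
  have "cmod (\<integral>u. f u \<partial>lborel) \<le> (\<integral>u. C * exp (- s * \<bar>u + v\<bar>) \<partial>lborel)"
    by (rule Bochner_Integration.integral_norm_bound_integral) (use i \<open>integrable lborel f\<close> assms in auto)
  also have "\<dots> \<le> C * (2 / s)"
    using mult_left_mono[OF integral_exp_decay[OF assms(1), of v] C] by simp
  finally show "cmod (\<integral>u. f u \<partial>lborel) \<le> C * (2 / s)" .
qed

subsection \<open>Sectors\<close>

lemma Arg_exp_strip: "- pi < Im \<zeta> \<Longrightarrow> Im \<zeta> \<le> pi \<Longrightarrow> Arg (exp \<zeta>) = Im \<zeta>"
  by (rule Arg_exp)

lemma exp_in_sector: "\<bar>Im \<zeta>\<bar> < \<theta> \<Longrightarrow> \<theta> \<le> pi \<Longrightarrow> exp \<zeta> \<in> sector \<theta>"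
  by (auto simp: sector_def Arg_exp_strip)

lemma sector_eq_exp: "0 < \<theta> \<Longrightarrow> \<theta> \<le> pi \<Longrightarrow> sector \<theta> = exp ` {\<zeta>. \<bar>Im \<zeta>\<bar> < \<theta>}"
  by (auto simp: exp_in_sector) (metis (mono_tags, lifting) Arg_def Ln_Arg exp_Ln image_eqI mem_Collect_eq sector_def)

lemma in_sector_Ln: "w \<in> sector \<theta> \<Longrightarrow> w = exp (Ln w) \<and> \<bar>Im (Ln w)\<bar> < \<theta>"
  by (auto simp: sector_def Arg_def)

lemma open_sector:
  assumes "\<theta> \<le> pi" shows "open (sector \<theta>)"
proof -
  have *: "sector \<theta> = {w \<in> - \<real>\<^sub>\<le>\<^sub>0. \<bar>Im (Ln w)\<bar> < \<theta>}"
    using assms Arg_def by (auto simp: sector_def Arg_def complex_nonpos_Reals_iff)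
      (metis Arg_def Arg_eq_pi abs_ge_self abs_le_D1 abs_of_pos complex_nonpos_Reals_iff leD linorder_neqE_linordered_idom order_less_le pi_gt_zero complex_eq_iff zero_complex.sel)
  have "open (- \<real>\<^sub>\<le>\<^sub>0 \<inter> (\<lambda>w. \<bar>Im (Ln w)\<bar>) -` {..<\<theta>})"
    by (intro continuous_open_preimage continuous_intros) auto
  also have "- \<real>\<^sub>\<le>\<^sub>0 \<inter> (\<lambda>w. \<bar>Im (Ln w)\<bar>) -` {..<\<theta>} = sector \<theta>"
    unfolding * by auto
  finally show ?thesis .
qed

lemma sector_mono: "\<theta> \<le> \<theta>' \<Longrightarrow> sector \<theta> \<subseteq> sector \<theta>'"
  by (auto simp: sector_def)

lemma sector_nonzero: "w \<in> sector \<theta> \<Longrightarrow> w \<noteq> 0"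
  by (auto simp: sector_def)

lemma sector_mult:
  assumes "z \<in> sector \<alpha>" "w \<in> sector \<beta>" "\<alpha> + \<beta> \<le> pi"
  shows "z * w \<in> sector (\<alpha> + \<beta>)"
proof -
  have "z * w = exp (Ln z + Ln w)" 
    using in_sector_Ln[OF assms(1)] in_sector_Ln[OF assms(2)] by (metis exp_add)
  moreover have "\<bar>Im (Ln z + Ln w)\<bar> < \<alpha> + \<beta>"
    using in_sector_Ln[OF assms(1)] in_sector_Ln[OF assms(2)] by auto
  ultimately show ?thesis using exp_in_sector assms(3) by metis
qed

lemma sector_cnj: "\<theta> \<le> pi \<Longrightarrow> w \<in> sector \<theta> \<Longrightarrow> cnj w \<in> sector \<theta>"
  using in_sector_Ln[of w \<theta>] exp_in_sector[of "cnj (Ln w)" \<theta>] by (auto simp: exp_cnj[symmetric])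

lemma sector_scale: "t > 0 \<Longrightarrow> of_real t * w \<in> sector \<theta> \<longleftrightarrow> w \<in> sector \<theta>"
  by (auto simp: sector_def Arg_times_of_real)

lemma connected_sector: "0 < \<theta> \<Longrightarrow> \<theta> \<le> pi \<Longrightarrow> connected (sector \<theta>)"
proof -
  assume "0 < \<theta>" "\<theta> \<le> pi"
  have "{\<zeta>. \<bar>Im \<zeta>\<bar> < \<theta>} = {\<zeta>. Im \<zeta> < \<theta>} \<inter> {\<zeta>. Im \<zeta> > - \<theta>}" by auto
  then have "convex {\<zeta>. \<bar>Im \<zeta>\<bar> < \<theta>}"
    by (simp add: convex_Int convex_halfspace_Im_lt convex_halfspace_Im_gt)
  then have "connected (exp ` {\<zeta>. \<bar>Im \<zeta>\<bar> < \<theta>})"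
    by (intro connected_continuous_image convex_connected continuous_intros)
  then show ?thesis using sector_eq_exp \<open>0 < \<theta>\<close> \<open>\<theta> \<le> pi\<close> by metis
qed

lemma one_in_sector: "0 < \<theta> \<Longrightarrow> 1 \<in> sector \<theta>"
  by (simp add: sector_def)

subsection \<open>The measure\<close>

text \<open>
  The measure \<open>dm / \<bar>z\<bar>\<^sup>2\<close>. It is restricted to the sector as a space, so that measurability of a function on
  it follows from continuity on the sector alone.
\<close>

definition sector_measure :: "real \<Rightarrow> complex measure" where
  "sector_measure \<beta> = density (restrict_space lborel (sector \<beta>)) (\<lambda>z. ennreal (1 / (cmod z)\<^sup>2))"

lemma space_sector_measure [simp]: "space (sector_measure \<beta>) = sector \<beta>"
  by (simp add: sector_measure_def space_restrict_space)

lemma sets_sector_measure: "sets (sector_measure \<beta>) = sets (restrict_space borel (sector \<beta>))"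
  by (simp add: sector_measure_def sets_restrict_space)

lemma measurable_sector_measure_cong: 
  "measurable (sector_measure \<beta>) N = measurable (restrict_space borel (sector \<beta>)) N"
  by (rule measurable_cong_sets) (simp_all add: sets_sector_measure)

lemma continuous_measurable_sector:
  fixes f :: "complex \<Rightarrow> 'b::{second_countable_topology,real_normed_vector}"
  shows "continuous_on (sector \<beta>) f \<Longrightarrow> f \<in> borel_measurable (sector_measure \<beta>)"
  unfolding measurable_sector_measure_cong by (rule borel_measurable_continuous_on_restrict)

lemma sector_borel [measurable]: "\<beta> \<le> pi \<Longrightarrow> sector \<beta> \<in> sets borel"
  by (simp add: open_sector borel_open)

lemma nn_integral_sector_measure:
  assumes "\<beta> \<le> pi" "f \<in> borel_measurable (sector_measure \<beta>)"
  shows "(\<integral>\<^sup>+z. f z \<partial>sector_measure \<beta>) = (\<integral>\<^sup>+z\<in>sector \<beta>. (f z * ennreal (1 / (cmod z)\<^sup>2)) \<partial>lborel)"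
proof -
  have [measurable]: "f \<in> borel_measurable (restrict_space borel (sector \<beta>))"
    using assms(2) by (simp add: measurable_sector_measure_cong)
  have m: "(\<lambda>z. ennreal (1 / (cmod z)\<^sup>2)) \<in> borel_measurable (restrict_space lborel (sector \<beta>))"
    by (intro measurable_restrict_space1) simp
  have "f \<in> borel_measurable (restrict_space lborel (sector \<beta>))" 
    using assms(2) by (simp add: measurable_sector_measure_cong cong: measurable_cong_sets sets_restrict_space_cong)
  then show ?thesis unfolding sector_measure_def
    using assms(1) m by (subst nn_integral_density) (auto simp: nn_integral_restrict_space sector_borel mult_ac)
qed

lemma sigma_finite_sector_measure: 
  assumes "\<beta> \<le> pi" shows "sigma_finite_measure (sector_measure \<beta>)"
proof -
  have "sigma_finite_measure (restrict_space lborel (sector \<beta>))"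
    by (intro sigma_finite_measure_restrict_space lborel.sigma_finite_measure_axioms) (simp add: sector_borel assms)
  then interpret sigma_finite_measure "restrict_space lborel (sector \<beta>)" .
  show ?thesis unfolding sector_measure_def
    by (subst sigma_finite_iff_density_finite) (auto intro: measurable_restrict_space1)
qed

lemma measurable_sector_scale:
  "t > 0 \<Longrightarrow> (\<lambda>z. of_real t * z) \<in> measurable (sector_measure \<beta>) (sector_measure \<beta>)"
  unfolding measurable_sector_measure_cong
  by (subst measurable_cong_sets[OF refl sets_sector_measure])
     (intro measurable_restrict_space2 measurable_restrict_space1, auto simp: space_restrict_space sector_scale)

lemma nn_integral_sector_scale:
  assumes "\<beta> \<le> pi" "f \<in> borel_measurable (sector_measure \<beta>)" "t > 0"
  shows "(\<integral>\<^sup>+z. f (of_real t * z) \<partial>sector_measure \<beta>) = (\<integral>\<^sup>+z. f z \<partial>sector_measure \<beta>)"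
proof -
  have m2: "(\<lambda>z. f (of_real t * z)) \<in> borel_measurable (sector_measure \<beta>)"
    using measurable_compose[OF measurable_sector_scale[OF assms(3)] assms(2)] by simp
  let ?g = "\<lambda>z. f z * ennreal (1 / (cmod z)\<^sup>2) * indicator (sector \<beta>) z"
  have f': "f \<in> borel_measurable (restrict_space borel (sector \<beta>))"
    using assms(2) by (simp add: measurable_sector_measure_cong)
  have "(\<lambda>z. f z * indicator (sector \<beta>) z) \<in> borel_measurable borel"
    using borel_measurable_restrict_space_iff_ennreal[of "sector \<beta>" borel f] f' assms(1) by (simp add: sector_borel)
  then have g: "?g \<in> borel_measurable borel"
    by (subst mult.assoc, subst (2) mult.commute, subst mult.assoc[symmetric]) simp
  have "(\<integral>\<^sup>+z. ?g z \<partial>lborel) = (\<integral>\<^sup>+z. ?g (0 + t *\<^sub>R z) * ennreal (t\<^sup>2) \<partial>lborel)"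
  proof -
    have "(\<integral>\<^sup>+z. ?g z \<partial>lborel) = (\<integral>\<^sup>+z. ?g z \<partial>density (distr lborel borel (\<lambda>z::complex. 0 + t *\<^sub>R z)) (\<lambda>_. ennreal (\<bar>t\<bar> ^ DIM(complex))))"
      using lborel_affine[of t "0::complex"] assms(3) by simp
    also have "\<dots> = (\<integral>\<^sup>+z. ennreal (\<bar>t\<bar> ^ DIM(complex)) * ?g z \<partial>distr lborel borel (\<lambda>z::complex. 0 + t *\<^sub>R z))"
      by (subst nn_integral_density) (use g in simp_all)
    also have "\<dots> = (\<integral>\<^sup>+z. ennreal (\<bar>t\<bar> ^ DIM(complex)) * ?g (0 + t *\<^sub>R z) \<partial>lborel)"
      by (subst nn_integral_distr) (use g in \<open>simp_all add: borel_measurable_times\<close>)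
    finally show ?thesis by (simp add: mult.commute)
  qed
  also have "\<dots> = (\<integral>\<^sup>+z. (f (of_real t * z) * ennreal (1 / (cmod z)\<^sup>2)) * indicator (sector \<beta>) z \<partial>lborel)"
  proof (intro nn_integral_cong)
    fix z :: complex
    have "ennreal (1 / (cmod (of_real t * z))\<^sup>2) * ennreal (t\<^sup>2) = ennreal (1 / (cmod z)\<^sup>2)"
      using assms(3) by (simp flip: ennreal_mult'' add: norm_mult power_mult_distrib)
    moreover have "indicator (sector \<beta>) (of_real t * z) = (indicator (sector \<beta>) z :: ennreal)"
      using sector_scale[OF assms(3)] by (simp add: indicator_def)
    ultimately show "?g (0 + t *\<^sub>R z) * ennreal (t\<^sup>2) = (f (of_real t * z) * ennreal (1 / (cmod z)\<^sup>2)) * indicator (sector \<beta>) z"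
      by (simp add: scaleR_conv_of_real mult_ac)
  qed
  finally show ?thesis 
    using nn_integral_sector_measure[OF assms(1) assms(2)] nn_integral_sector_measure[OF assms(1) m2] by simp
qed

lemma distr_sector_scale:
  assumes "\<beta> \<le> pi" "t > 0"
  shows "distr (sector_measure \<beta>) (sector_measure \<beta>) (\<lambda>z. of_real t * z) = sector_measure \<beta>"
proof (rule measure_eqI)
  fix A assume "A \<in> sets (distr (sector_measure \<beta>) (sector_measure \<beta>) (\<lambda>z. of_real t * z))"
  then have A: "A \<in> sets (sector_measure \<beta>)" by simp
  have "emeasure (distr (sector_measure \<beta>) (sector_measure \<beta>) (\<lambda>z. of_real t * z)) A
    = (\<integral>\<^sup>+z. indicator A z \<partial>distr (sector_measure \<beta>) (sector_measure \<beta>) (\<lambda>z. of_real t * z))"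
    using A by simp
  also have "\<dots> = (\<integral>\<^sup>+z. indicator A (of_real t * z) \<partial>sector_measure \<beta>)"
    using A measurable_sector_scale[OF assms(2)] by (subst nn_integral_distr) auto
  also have "\<dots> = emeasure (sector_measure \<beta>) A"
    using A nn_integral_sector_scale[OF assms(1) _ assms(2), of "indicator A"] by simp
  finally show "emeasure (distr (sector_measure \<beta>) (sector_measure \<beta>) (\<lambda>z. of_real t * z)) A = emeasure (sector_measure \<beta>) A" .
qed simp

lemma integral_sector_scale:
  fixes f :: "complex \<Rightarrow> complex"
  assumes "\<beta> \<le> pi" "f \<in> borel_measurable (sector_measure \<beta>)" "t > 0"
  shows "(\<integral>z. f (of_real t * z) \<partial>sector_measure \<beta>) = (\<integral>z. f z \<partial>sector_measure \<beta>)"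
  using integral_distr[OF measurable_sector_scale[OF assms(3)] assms(2)] distr_sector_scale[OF assms(1,3)]
  by simp


lemma emeasure_annulus_sector:
  assumes "\<beta> \<le> pi"
  shows "emeasure (sector_measure \<beta>) {z \<in> sector \<beta>. v - 1 \<le> ln (cmod z) \<and> ln (cmod z) \<le> v} \<le> ennreal (4 * exp 2)"
proof -
  let ?D = "{z \<in> sector \<beta>. v - 1 \<le> ln (cmod z) \<and> ln (cmod z) \<le> v}"
  let ?r = "exp v"
  have D: "?D \<in> sets (sector_measure \<beta>)"
    unfolding sets_sector_measure sets_restrict_space
    by (rule image_eqI[where x="{z. v - 1 \<le> ln (cmod z) \<and> ln (cmod z) \<le> v}"]) auto
  have "emeasure (sector_measure \<beta>) ?D = (\<integral>\<^sup>+z. indicator ?D z \<partial>sector_measure \<beta>)"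
    using D by simp
  also have "\<dots> = (\<integral>\<^sup>+z\<in>sector \<beta>. (indicator ?D z * ennreal (1 / (cmod z)\<^sup>2)) \<partial>lborel)"
    by (rule nn_integral_sector_measure[OF assms]) (use D in simp)
  \<comment> \<open>The part of the annulus in the sector lies in a square of side \<open>2 e\<^sup>v\<close>, and there \<open>1 / \<bar>z\<bar>\<^sup>2 \<le> e\<^sup>-\<^sup>2\<^sup>(\<^sup>v\<^sup>-\<^sup>1\<^sup>)\<close>.\<close>
  also have "\<dots> \<le> (\<integral>\<^sup>+z. ennreal (exp (-2 * (v - 1))) * indicator (cbox (Complex (-?r) (-?r)) (Complex ?r ?r)) z \<partial>lborel)"
  proof (intro nn_integral_mono)
    fix z :: complex
    show "indicator ?D z * ennreal (1 / (cmod z)\<^sup>2) * indicator (sector \<beta>) z 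
      \<le> ennreal (exp (-2 * (v - 1))) * indicator (cbox (Complex (-?r) (-?r)) (Complex ?r ?r)) z"
    proof (cases "z \<in> ?D")
      case True
      then have nz: "cmod z > 0" by (auto dest: sector_nonzero)
      have le: "cmod z \<le> ?r" using True nz by simp (metis exp_le_cancel_iff exp_ln zero_less_norm_iff)
      have "exp (v - 1) \<le> cmod z" using True nz by simp (metis exp_le_cancel_iff exp_ln zero_less_norm_iff)
      then have "(exp (v - 1))\<^sup>2 \<le> (cmod z)\<^sup>2" by (simp add: power_mono)
      then have "1 / (cmod z)\<^sup>2 \<le> 1 / (exp (v - 1))\<^sup>2" by (intro divide_left_mono) (use nz in auto)
      also have "\<dots> = exp (-2 * (v - 1))" by (simp add: exp_minus field_simps flip: exp_of_nat_mult exp_add)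
      finally have 1: "1 / (cmod z)\<^sup>2 \<le> exp (-2 * (v - 1))" .
      have "\<bar>Re z\<bar> \<le> ?r" "\<bar>Im z\<bar> \<le> ?r" using le abs_Re_le_cmod[of z] abs_Im_le_cmod[of z] by linarith+
      then have "z \<in> cbox (Complex (-?r) (-?r)) (Complex ?r ?r)" by (auto simp: in_cbox_complex_iff)
      then show ?thesis using True 1 by (simp add: ennreal_leI)
    qed simp
  qed
  also have "\<dots> = ennreal (exp (-2 * (v - 1))) * ennreal (2 * ?r * (2 * ?r))"
  proof -
    have "emeasure lborel (cbox (Complex (-?r) (-?r)) (Complex ?r ?r)) = ennreal (2 * ?r * (2 * ?r))"
      by (subst emeasure_lborel_cbox_eq) (simp add: Basis_complex_def complex_i_not_one)
    then show ?thesis by (simp add: nn_integral_cmult)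
  qed
  also have "\<dots> = ennreal (4 * exp 2)"
    by (simp flip: ennreal_mult'' add: exp_diff exp_minus field_simps exp_add[symmetric])
  finally show ?thesis .
qed

text \<open>
  Averaging the kernel over unit intervals of the logarithmic radius replaces polar coordinates:
  only the measure of annuli enters.
\<close>

lemma nn_integral_radial_decay:
  assumes "\<beta> \<le> pi" "s > 0"
  shows "(\<integral>\<^sup>+z. ennreal (exp (- s * \<bar>u + ln (cmod z)\<bar>)) \<partial>sector_measure \<beta>) \<le> ennreal (exp s * (2 / s) * (4 * exp 2))"
proof -
  interpret S: sigma_finite_measure "sector_measure \<beta>" by (rule sigma_finite_sector_measure) fact
  interpret P: pair_sigma_finite "sector_measure \<beta>" lborel ..
  let ?I = "\<lambda>z v. indicator {v. v - 1 \<le> ln (cmod z) \<and> ln (cmod z) \<le> v} (v::real) :: ennreal"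
  have lnm: "(\<lambda>z. ln (cmod z)) \<in> borel_measurable (sector_measure \<beta>)"
    unfolding measurable_sector_measure_cong by (rule measurable_restrict_space1) simp
  note [measurable] = lnm
  have "(\<integral>\<^sup>+z. ennreal (exp (- s * \<bar>u + ln (cmod z)\<bar>)) \<partial>sector_measure \<beta>)
     \<le> (\<integral>\<^sup>+z. (\<integral>\<^sup>+v. ennreal (exp s * exp (- s * \<bar>u + v\<bar>)) * ?I z v \<partial>lborel) \<partial>sector_measure \<beta>)"
  proof (intro nn_integral_mono)
    fix z
    let ?l = "ln (cmod z)"
    have set: "{v. v - 1 \<le> ?l \<and> ?l \<le> v} = {?l..?l+1}" by auto
    have "ennreal (exp (- s * \<bar>u + ?l\<bar>)) = (\<integral>\<^sup>+v. ennreal (exp (- s * \<bar>u + ?l\<bar>)) * ?I z v \<partial>lborel)"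
      unfolding set by (simp add: nn_integral_cmult)
    also have "\<dots> \<le> (\<integral>\<^sup>+v. ennreal (exp s * exp (- s * \<bar>u + v\<bar>)) * ?I z v \<partial>lborel)"
    proof (intro nn_integral_mono)
      fix v
      show "ennreal (exp (- s * \<bar>u + ?l\<bar>)) * ?I z v \<le> ennreal (exp s * exp (- s * \<bar>u + v\<bar>)) * ?I z v"
      proof (cases "v - 1 \<le> ?l \<and> ?l \<le> v")
        case True
        then have "\<bar>u + v\<bar> \<le> \<bar>u + ?l\<bar> + 1" by linarith
        then have "s * \<bar>u + v\<bar> \<le> s * (\<bar>u + ?l\<bar> + 1)" using assms(2) by (intro mult_left_mono) auto
        then have "exp (- s * \<bar>u + ?l\<bar>) \<le> exp s * exp (- s * \<bar>u + v\<bar>)"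
          by (simp add: exp_add[symmetric] algebra_simps)
        then show ?thesis by (intro mult_right_mono ennreal_leI) auto
      qed simp
    qed
    finally show "ennreal (exp (- s * \<bar>u + ?l\<bar>)) \<le> (\<integral>\<^sup>+v. ennreal (exp s * exp (- s * \<bar>u + v\<bar>)) * ?I z v \<partial>lborel)" .
  qed
  also have "\<dots> = (\<integral>\<^sup>+v. (\<integral>\<^sup>+z. ennreal (exp s * exp (- s * \<bar>u + v\<bar>)) * ?I z v \<partial>sector_measure \<beta>) \<partial>lborel)"
    by (rule P.Fubini'[symmetric]) measurable
  also have "\<dots> \<le> (\<integral>\<^sup>+v. ennreal (exp s * exp (- s * \<bar>u + v\<bar>)) * ennreal (4 * exp 2) \<partial>lborel)"
  proof (intro nn_integral_mono)
    fix v :: real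
    let ?D = "{z \<in> sector \<beta>. v - 1 \<le> ln (cmod z) \<and> ln (cmod z) \<le> v}"
    have D: "?D \<in> sets (sector_measure \<beta>)"
      unfolding sets_sector_measure sets_restrict_space
      by (rule image_eqI[where x="{z. v - 1 \<le> ln (cmod z) \<and> ln (cmod z) \<le> v}"]) auto
    have "(\<integral>\<^sup>+z. ennreal (exp s * exp (- s * \<bar>u + v\<bar>)) * ?I z v \<partial>sector_measure \<beta>)
      = (\<integral>\<^sup>+z. ennreal (exp s * exp (- s * \<bar>u + v\<bar>)) * indicator ?D z \<partial>sector_measure \<beta>)"
      by (intro nn_integral_cong) (auto simp: indicator_def)
    also have "\<dots> = ennreal (exp s * exp (- s * \<bar>u + v\<bar>)) * emeasure (sector_measure \<beta>) ?D"
      by (rule nn_integral_cmult_indicator[OF D])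
    also have "\<dots> \<le> ennreal (exp s * exp (- s * \<bar>u + v\<bar>)) * ennreal (4 * exp 2)"
      by (intro mult_left_mono emeasure_annulus_sector assms) simp
    finally show "(\<integral>\<^sup>+z. ennreal (exp s * exp (- s * \<bar>u + v\<bar>)) * ?I z v \<partial>sector_measure \<beta>) \<le> \<dots>" .
  qed
  also have "\<dots> = ennreal (exp s) * (\<integral>\<^sup>+v. ennreal (exp (- s * \<bar>u + v\<bar>)) \<partial>lborel) * ennreal (4 * exp 2)"
    by (subst nn_integral_multc) (auto simp: ennreal_mult nn_integral_cmult)
  also have "\<dots> \<le> ennreal (exp s) * ennreal (2 / s) * ennreal (4 * exp 2)"
    using nn_integral_exp_decay[OF assms(2), of u]
    by (intro mult_right_mono mult_left_mono) (auto simp: add.commute)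
  also have "\<dots> = ennreal (exp s * (2 / s) * (4 * exp 2))"
    using assms(2) by (subst (2) ennreal_mult, simp, simp, subst ennreal_mult) simp_all
  finally show ?thesis .
qed

lemma integrable_radial_decay_bound:
  fixes f :: "complex \<Rightarrow> complex"
  assumes "\<beta> \<le> pi" "s > 0" "f \<in> borel_measurable (sector_measure \<beta>)" 
    and "\<And>z. z \<in> sector \<beta> \<Longrightarrow> cmod (f z) \<le> C * exp (- s * \<bar>u + ln (cmod z)\<bar>)" "C \<ge> 0"
  shows "integrable (sector_measure \<beta>) f"
proof (rule integrableI_bounded)
  have "(\<integral>\<^sup>+z. ennreal (cmod (f z)) \<partial>sector_measure \<beta>) \<le> (\<integral>\<^sup>+z. ennreal C * ennreal (exp (- s * \<bar>u + ln (cmod z)\<bar>)) \<partial>sector_measure \<beta>)"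
    using assms(4,5) by (intro nn_integral_mono) (simp flip: ennreal_mult'')
  also have "\<dots> = ennreal C * (\<integral>\<^sup>+z. ennreal (exp (- s * \<bar>u + ln (cmod z)\<bar>)) \<partial>sector_measure \<beta>)"
  proof (rule nn_integral_cmult)
    show "(\<lambda>z. ennreal (exp (- s * \<bar>u + ln (cmod z)\<bar>))) \<in> borel_measurable (sector_measure \<beta>)"
      unfolding measurable_sector_measure_cong by (rule measurable_restrict_space1) simp
  qed
  also have "\<dots> \<le> ennreal C * ennreal (exp s * (2 / s) * (4 * exp 2))"
    by (intro mult_left_mono nn_integral_radial_decay assms) simp
  also have "\<dots> < \<infinity>" by (simp flip: ennreal_mult'' add: ennreal_mult_less_top)
  finally show "(\<integral>\<^sup>+z. ennreal (cmod (f z)) \<partial>sector_measure \<beta>) < \<infinity>" .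
qed fact

text \<open>
  If the sums of \<open>g\<close> along the orbits of the dilation by \<open>e\<close> are bounded, then integrating over one
  fundamental annulus bounds the integral of \<open>g\<close> over the sector.
\<close>

lemma nn_integral_sector_orbit_bound:
  assumes "\<beta> \<le> pi" and g: "g \<in> borel_measurable (sector_measure \<beta>)"
    and bound: "\<And>z N. z \<in> sector \<beta> \<Longrightarrow> (\<Sum>k<2*N. g (of_real (exp (real k - real N)) * z)) \<le> C"
  shows "(\<integral>\<^sup>+z. g z \<partial>sector_measure \<beta>) \<le> C * ennreal (4 * exp 2)"
proof -
  let ?M = "sector_measure \<beta>"
  let ?D = "{z \<in> sector \<beta>. 0 \<le> ln (cmod z) \<and> ln (cmod z) < 1}"
  let ?D' = "{z \<in> sector \<beta>. 1 - 1 \<le> ln (cmod z) \<and> ln (cmod z) \<le> 1}"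
  define E where "E N = {z \<in> sector \<beta>. - real N \<le> ln (cmod z) \<and> ln (cmod z) < real N}" for N
  have D: "?D \<in> sets ?M"
    unfolding sets_sector_measure sets_restrict_space
    by (rule image_eqI[where x="{z. 0 \<le> ln (cmod z) \<and> ln (cmod z) < 1}"]) auto
  have D': "?D' \<in> sets ?M"
    unfolding sets_sector_measure sets_restrict_space
    by (rule image_eqI[where x="{z. 1-1 \<le> ln (cmod z) \<and> ln (cmod z) \<le> 1}"]) auto
  have E [measurable]: "E N \<in> sets ?M" for N
    unfolding sets_sector_measure sets_restrict_space E_def
    by (rule image_eqI[where x="{z. - real N \<le> ln (cmod z) \<and> ln (cmod z) < real N}"]) auto
  note [measurable] = g D
  have mE: "(\<integral>\<^sup>+z. g z * indicator (E N) z \<partial>?M) \<le> C * ennreal (4 * exp 2)" for N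
  proof -
    let ?t = "\<lambda>k. exp (real N - real k)"
    have sc [measurable]: "(\<lambda>z. of_real t * z) \<in> measurable ?M ?M" if "t > 0" for t
      by (rule measurable_sector_scale[OF that])
    have m1: "(\<lambda>z. indicator ?D (of_real (?t k) * z) :: ennreal) \<in> borel_measurable ?M" for k
      by (rule measurable_compose[OF sc]) auto
    have m2: "(\<lambda>z. g (of_real (exp (real k - real N)) * z)) \<in> borel_measurable ?M" for k
      by (rule measurable_compose[OF sc]) auto
    have "(\<integral>\<^sup>+z. g z * indicator (E N) z \<partial>?M) \<le> (\<integral>\<^sup>+z. (\<Sum>k<2*N. indicator ?D (of_real (?t k) * z) * g z) \<partial>?M)"
    proof (intro nn_integral_mono)
      fix z assume "z \<in> space ?M"
      then have z: "z \<in> sector \<beta>" by simp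
      then have nz: "z \<noteq> 0" by (rule sector_nonzero)
      show "g z * indicator (E N) z \<le> (\<Sum>k<2*N. indicator ?D (of_real (?t k) * z) * g z)"
      proof (cases "z \<in> E N")
        case True
        \<comment> \<open>The index of the dilation that moves \<open>z\<close> into the fundamental annulus \<open>0 \<le> ln \<bar>z\<bar> < 1\<close>.\<close>
        define k where "k = nat \<lfloor>ln (cmod z) + real N\<rfloor>"
        have kr: "real k = of_int \<lfloor>ln (cmod z) + real N\<rfloor>" 
        proof -
          have "0 \<le> \<lfloor>ln (cmod z) + real N\<rfloor>" using True by (simp only: zero_le_floor) (simp add: E_def)
          then show ?thesis unfolding k_def by (rule of_nat_nat)
        qed
        have k1: "real k \<le> ln (cmod z) + real N" "ln (cmod z) + real N < real k + 1"
          unfolding kr by linarith+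
        have "real k < real (2 * N)" using k1 True by (simp add: E_def)
        then have "k < 2 * N" by simp
        have "of_real (?t k) * z \<in> ?D"
          using z nz k1 by (simp add: sector_scale norm_mult ln_mult)
        then have "g z * indicator (E N) z = indicator ?D (of_real (?t k) * z) * g z" using True by simp
        also have "\<dots> \<le> (\<Sum>k<2*N. indicator ?D (of_real (?t k) * z) * g z)"
          by (rule member_le_sum) (use \<open>k < 2 * N\<close> in auto)
        finally show ?thesis .
      qed simp
    qed
    also have "\<dots> = (\<Sum>k<2*N. (\<integral>\<^sup>+z. indicator ?D (of_real (?t k) * z) * g z \<partial>?M))"
      by (rule nn_integral_sum) (use m1 in simp)
    also have "\<dots> = (\<Sum>k<2*N. (\<integral>\<^sup>+z. indicator ?D z * g (of_real (exp (real k - real N)) * z) \<partial>?M))"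
    proof (intro sum.cong refl)
      fix k
      have eq: "?t k * exp (real k - real N) = 1" by (simp flip: exp_add)
      have "(\<integral>\<^sup>+z. indicator ?D (of_real (?t k) * z) * g z \<partial>?M)
        = (\<integral>\<^sup>+z. indicator ?D (of_real (?t k) * (of_real (exp (real k - real N)) * z)) * g (of_real (exp (real k - real N)) * z) \<partial>?M)"
        by (rule nn_integral_sector_scale[OF assms(1), symmetric]) (use m1 in auto)
      also have "\<dots> = (\<integral>\<^sup>+z. indicator ?D z * g (of_real (exp (real k - real N)) * z) \<partial>?M)"
        unfolding mult.assoc[symmetric] of_real_mult[symmetric] eq by simp
      finally show "(\<integral>\<^sup>+z. indicator ?D (of_real (?t k) * z) * g z \<partial>?M) = \<dots>" .
    qed
    also have "\<dots> = (\<integral>\<^sup>+z. indicator ?D z * (\<Sum>k<2*N. g (of_real (exp (real k - real N)) * z)) \<partial>?M)"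
      unfolding sum_distrib_left by (rule nn_integral_sum[symmetric]) (use m2 in simp)
    also have "\<dots> \<le> (\<integral>\<^sup>+z. C * indicator ?D' z \<partial>?M)"
      using bound by (intro nn_integral_mono) (auto simp: indicator_def)
    also have "\<dots> \<le> C * ennreal (4 * exp 2)"
      by (subst nn_integral_cmult_indicator[OF D']) (intro mult_left_mono emeasure_annulus_sector assms, simp)
    finally show ?thesis .
  qed
  have inc: "incseq (\<lambda>N z. g z * indicator (E N) z)"
    by (auto simp: incseq_def le_fun_def E_def indicator_def)
  have sup: "(SUP N. g z * indicator (E N) z) = g z" if z: "z \<in> sector \<beta>" for z
  proof (rule antisym)
    show "(SUP N. g z * indicator (E N) z) \<le> g z"
      by (rule SUP_least) (simp add: indicator_def)
    obtain N :: nat where "\<bar>ln (cmod z)\<bar> < real N" using reals_Archimedean2 by blast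
    then have "z \<in> E N" using z by (auto simp: E_def abs_less_iff)
    then have "g z = g z * indicator (E N) z" by simp
    also have "\<dots> \<le> (SUP N. g z * indicator (E N) z)" by (rule SUP_upper) simp
    finally show "g z \<le> (SUP N. g z * indicator (E N) z)" .
  qed
  have "(\<integral>\<^sup>+z. g z \<partial>?M) = (\<integral>\<^sup>+z. (SUP N. g z * indicator (E N) z) \<partial>?M)"
    using sup by (intro nn_integral_cong) simp
  also have "\<dots> = (SUP N. (\<integral>\<^sup>+z. g z * indicator (E N) z \<partial>?M))"
    by (rule nn_integral_monotone_convergence_SUP[OF inc]) measurable
  also have "\<dots> \<le> C * ennreal (4 * exp 2)"
    by (rule SUP_least) (rule mE)
  finally show ?thesis .
qed

subsection \<open>Integral operators with kernels\<close>

text \<open>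
  Cauchy-Schwarz for the splitting of \<open>k x y * g y\<close> into \<open>sqrt (k x y)\<close> and \<open>sqrt (k x y) * g y\<close>.
\<close>

lemma schur_test:
  assumes "sigma_finite_measure M" "sigma_finite_measure N"
    and k: "(\<lambda>(x, y). k x y) \<in> borel_measurable (M \<Otimes>\<^sub>M N)" and g: "g \<in> borel_measurable N"
    and T: "\<And>x. x \<in> space M \<Longrightarrow> T x \<le> (\<integral>\<^sup>+y. k x y * g y \<partial>N)"
    and a: "\<And>x. x \<in> space M \<Longrightarrow> (\<integral>\<^sup>+y. k x y \<partial>N) \<le> a"
    and b: "\<And>y. y \<in> space N \<Longrightarrow> (\<integral>\<^sup>+x. k x y \<partial>M) \<le> b"
  shows "(\<integral>\<^sup>+x. (T x)\<^sup>2 \<partial>M) \<le> a * b * (\<integral>\<^sup>+y. (g y)\<^sup>2 \<partial>N)"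
proof -
  interpret M: sigma_finite_measure M by fact
  interpret N: sigma_finite_measure N by fact
  interpret P: pair_sigma_finite M N ..
  note [measurable] = k g
  define r where "r = ennreal_sqrt"
  have r2: "r t * r t = t" for t 
    by (cases t) (auto simp: r_def ennreal_sqrt_def ennreal_mult'[symmetric])
  have [measurable]: "r \<in> borel_measurable borel" unfolding r_def ennreal_sqrt_def[abs_def] by measurable
  have kx [measurable]: "k x \<in> borel_measurable N" if "x \<in> space M" for x
    using measurable_compose[OF measurable_Pair1' k] that by simp
  have "(T x)\<^sup>2 \<le> a * (\<integral>\<^sup>+y. k x y * (g y)\<^sup>2 \<partial>N)" if x: "x \<in> space M" for x
  proof -
    have "(T x)\<^sup>2 \<le> (\<integral>\<^sup>+y. r (k x y) * (r (k x y) * g y) \<partial>N)\<^sup>2"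
      using T[OF x] by (simp add: power_mono mult.assoc[symmetric] r2)
    also have "\<dots> \<le> (\<integral>\<^sup>+y. (r (k x y))\<^sup>2 \<partial>N) * (\<integral>\<^sup>+y. (r (k x y) * g y)\<^sup>2 \<partial>N)"
    proof (rule Cauchy_Schwarz_nn_integral)
      note [measurable] = kx[OF x]
      show "(\<lambda>y. r (k x y)) \<in> borel_measurable N" by measurable
      show "(\<lambda>y. r (k x y) * g y) \<in> borel_measurable N" by measurable
    qed
    also have "\<dots> = (\<integral>\<^sup>+y. k x y \<partial>N) * (\<integral>\<^sup>+y. k x y * (g y)\<^sup>2 \<partial>N)"
      by (simp only: power_mult_distrib) (simp only: power2_eq_square r2)
    also have "\<dots> \<le> a * (\<integral>\<^sup>+y. k x y * (g y)\<^sup>2 \<partial>N)"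
      by (intro mult_right_mono a x) simp
    finally show ?thesis .
  qed
  then have "(\<integral>\<^sup>+x. (T x)\<^sup>2 \<partial>M) \<le> (\<integral>\<^sup>+x. a * (\<integral>\<^sup>+y. k x y * (g y)\<^sup>2 \<partial>N) \<partial>M)"
    by (intro nn_integral_mono)
  also have "\<dots> = a * (\<integral>\<^sup>+x. (\<integral>\<^sup>+y. k x y * (g y)\<^sup>2 \<partial>N) \<partial>M)"
    by (rule nn_integral_cmult) measurable
  also have "(\<integral>\<^sup>+x. (\<integral>\<^sup>+y. k x y * (g y)\<^sup>2 \<partial>N) \<partial>M) = (\<integral>\<^sup>+y. (\<integral>\<^sup>+x. k x y * (g y)\<^sup>2 \<partial>M) \<partial>N)"
    by (rule P.Fubini'[symmetric]) measurable
  also have "\<dots> \<le> (\<integral>\<^sup>+y. b * (g y)\<^sup>2 \<partial>N)"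
  proof (intro nn_integral_mono)
    fix y assume y: "y \<in> space N"
    have "(\<lambda>x. k x y) \<in> borel_measurable M"
      using measurable_compose[OF measurable_Pair2' k] y by simp
    then have "(\<integral>\<^sup>+x. k x y * (g y)\<^sup>2 \<partial>M) = (\<integral>\<^sup>+x. k x y \<partial>M) * (g y)\<^sup>2"
      by (rule nn_integral_multc)
    also have "\<dots> \<le> b * (g y)\<^sup>2" by (intro mult_right_mono b y) simp
    finally show "(\<integral>\<^sup>+x. k x y * (g y)\<^sup>2 \<partial>M) \<le> b * (g y)\<^sup>2" .
  qed
  also have "\<dots> = b * (\<integral>\<^sup>+y. (g y)\<^sup>2 \<partial>N)" by (rule nn_integral_cmult) measurable
  finally show ?thesis by (simp add: mult_left_mono mult.assoc)
qed

section \<open>Integrals over the real line and over lines in a strip\<close>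

lemma has_integral_UNIV_limit:
  fixes f :: "real \<Rightarrow> 'b::banach"
  assumes "(f has_integral I) UNIV"
  shows "(\<lambda>N::nat. integral {-real N..real N} f) \<longlonglongrightarrow> I"
proof (rule LIMSEQ_I)
  fix e :: real assume "e > 0"
  from assms have "\<forall>e>0. \<exists>B>0. \<forall>a b. ball 0 B \<subseteq> cbox a b \<longrightarrow> norm (integral (cbox a b) f - I) < e"
    unfolding has_integral_alt'[of f] by simp
  with \<open>e > 0\<close> obtain B where B: "\<And>a b. ball 0 B \<subseteq> cbox a b \<Longrightarrow> norm (integral (cbox a b) f - I) < e"
    by metis
  obtain N0 :: nat where N0: "B \<le> real N0" using real_arch_simple by blast
  have "norm (integral {-real N..real N} f - I) < e" if "N \<ge> N0" for N
  proof -
    have "B \<le> real N" using N0 that by (meson of_nat_le_iff order_trans)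
    then have "ball 0 B \<subseteq> cbox (- real N) (real N)" by (auto simp: dist_real_def)
    then show ?thesis using B by auto
  qed
  then show "\<exists>no. \<forall>n\<ge>no. norm (integral {-real n..real n} f - I) < e" by blast
qed

lemma has_integral_UNIV_FTC:
  fixes U :: "real \<Rightarrow> 'b::banach"
  assumes cont: "\<And>t. isCont U t" and deriv: "\<And>t. t \<noteq> 0 \<Longrightarrow> (U has_vector_derivative u t) (at t)"
    and bot: "(U \<longlongrightarrow> L1) at_bot" and top: "(U \<longlongrightarrow> L2) at_top"
  shows "(u has_integral (L2 - L1)) UNIV"
  unfolding has_integral_alt'[of u]
proof (intro conjI allI impI)
  have hi: "(u has_integral (U b - U a)) {a..b}" if "a \<le> b" for a b
    by (rule fundamental_theorem_of_calculus_interior_strong[of "{0}"])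
      (use that cont deriv in \<open>auto intro!: continuous_at_imp_continuous_on\<close>)
  show "(\<lambda>x. if x \<in> UNIV then u x else 0) integrable_on cbox a b" for a b :: real
    by (cases "a \<le> b") (use hi in auto)
  fix e :: real assume e: "e > 0"
  have "\<forall>\<^sub>F x in at_bot. norm (U x - L1) < e / 2"
    using tendstoD[OF bot, of "e/2"] e by (simp add: dist_norm)
  then obtain b1 where b1: "\<And>x. x \<le> b1 \<Longrightarrow> norm (U x - L1) < e / 2"
    unfolding eventually_at_bot_linorder by blast
  have "\<forall>\<^sub>F x in at_top. norm (U x - L2) < e / 2"
    using tendstoD[OF top, of "e/2"] e by (simp add: dist_norm)
  then obtain b2 where b2: "\<And>x. x \<ge> b2 \<Longrightarrow> norm (U x - L2) < e / 2"
    unfolding eventually_at_top_linorder by blast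
  define B where "B = \<bar>b1\<bar> + \<bar>b2\<bar> + 1"
  have "norm (integral (cbox a b) (\<lambda>x. if x \<in> UNIV then u x else 0) - (L2 - L1)) < e" if sub: "ball 0 B \<subseteq> cbox a b" for a b
  proof -
    have "- (\<bar>b1\<bar> + \<bar>b2\<bar>) \<in> ball 0 B" "\<bar>b1\<bar> + \<bar>b2\<bar> \<in> ball 0 B"
      by (auto simp: B_def dist_real_def)
    then have "- (\<bar>b1\<bar> + \<bar>b2\<bar>) \<in> cbox a b" "\<bar>b1\<bar> + \<bar>b2\<bar> \<in> cbox a b" using sub by blast+
    then have ab: "a \<le> b1" "b \<ge> b2" "a \<le> b" unfolding cbox_interval atLeastAtMost_iff B_def by linarith+
    then have "integral (cbox a b) (\<lambda>x. if x \<in> UNIV then u x else 0) = U b - U a"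
      using hi[OF ab(3)] by (simp add: integral_unique)
    moreover have "U b - U a - (L2 - L1) = (U b - L2) - (U a - L1)" by simp
    ultimately have "norm (integral (cbox a b) (\<lambda>x. if x \<in> UNIV then u x else 0) - (L2 - L1)) = norm ((U b - L2) - (U a - L1))"
      by (simp only:)
    also have "\<dots> < e" using norm_triangle_ineq4[of "U b - L2" "U a - L1"] b1[OF ab(1)] b2[OF ab(2)] by linarith
    finally show ?thesis .
  qed
  moreover have "B > 0" by (simp add: B_def)
  ultimately show "\<exists>B>0. \<forall>a b. ball 0 B \<subseteq> cbox a b \<longrightarrow>
    norm (integral (cbox a b) (\<lambda>x. if x \<in> UNIV then u x else 0) - (L2 - L1)) < e" by blast
qed

text \<open>
  The increments of \<open>W\<close> are bounded by those of an exponential, so the values along the integers form a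
  Cauchy sequence.
\<close>

lemma exp_decay_derivative_has_limit:
  fixes W :: "real \<Rightarrow> 'b::banach"
  assumes s: "s > 0" and deriv: "\<And>u. (W has_vector_derivative w u) (at u)"
    and bound: "\<And>u. u \<ge> 0 \<Longrightarrow> norm (w u) \<le> C * exp (- s * u)"
  obtains L where "(W \<longlongrightarrow> L) at_top"
proof -
  have C: "C \<ge> 0" using bound[of 0] by (simp add: order_trans[OF norm_ge_zero])
  have est: "norm (W v - W u) \<le> C / s * exp (- s * u)" if "0 \<le> u" "u \<le> v" for u v
  proof (cases "u = v")
    case False
    then have "u < v" using that by simp
    have "norm (W v - W u) \<le> (\<lambda>x. - (C / s) * exp (- s * x)) v - (\<lambda>x. - (C / s) * exp (- s * x)) u"
    proof (rule differentiable_bound_general[OF \<open>u < v\<close>])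
      show "continuous_on {u..v} W"
        by (intro continuous_at_imp_continuous_on ballI has_vector_derivative_continuous[OF deriv])
      show "continuous_on {u..v} (\<lambda>x. - (C / s) * exp (- s * x))" by (intro continuous_intros)
      fix x assume x: "u < x" "x < v"
      show "(W has_vector_derivative w x) (at x)" by (rule deriv)
      show "((\<lambda>x. - (C / s) * exp (- s * x)) has_vector_derivative (C * exp (- s * x))) (at x)"
        unfolding has_real_derivative_iff_has_vector_derivative[symmetric]
        using s by (auto intro!: derivative_eq_intros)
      show "norm (w x) \<le> C * exp (- s * x)" using bound x that by simp
    qed
    also have "\<dots> \<le> C / s * exp (- s * u)" using C s by simp
    finally show ?thesis .
  qed (use C s in simp)
  have lim0: "((\<lambda>x. C / s * exp (- s * x)) \<longlongrightarrow> 0) at_top"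
  proof -
    have "((\<lambda>x. exp (- s * x)) \<longlongrightarrow> 0) at_top"
      by (rule filterlim_compose[OF exp_at_bot],
          rule filterlim_tendsto_neg_mult_at_bot[OF tendsto_const _ filterlim_ident])
        (use s in simp)
    from tendsto_mult_left[OF this, of "C / s"] show ?thesis by simp
  qed
  have lim0': "(\<lambda>n::nat. C / s * exp (- s * real n)) \<longlonglongrightarrow> 0"
    by (rule filterlim_compose[OF lim0 filterlim_real_sequentially])
  have "Cauchy (\<lambda>n::nat. W (real n))"
  proof (rule CauchyI)
    fix e :: real assume "e > 0"
    then have "\<forall>\<^sub>F n in sequentially. C / s * exp (- s * real n) < e"
      using order_tendstoD(2)[OF lim0'] by blast
    then obtain N where N: "\<And>n. n \<ge> N \<Longrightarrow> C / s * exp (- s * real n) < e"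
      unfolding eventually_sequentially by blast
    have *: "norm (W (real m) - W (real n)) < e" if "N \<le> n" "n \<le> m" for m n
      using est[of "real n" "real m"] N[OF that(1)] that by simp
    show "\<exists>M. \<forall>m\<ge>M. \<forall>n\<ge>M. norm (W (real m) - W (real n)) < e"
      by (metis * linorder_le_cases norm_minus_commute)
  qed
  then obtain L where L: "(\<lambda>n::nat. W (real n)) \<longlonglongrightarrow> L" using Cauchy_convergent convergent_def by blast
  have "norm (W u - L) \<le> C / s * exp (- s * u)" if "u \<ge> 0" for u
  proof (rule LIMSEQ_le_const2)
    show "(\<lambda>n::nat. norm (W u - W (real n))) \<longlonglongrightarrow> norm (W u - L)" by (intro tendsto_intros L)
    show "\<exists>N. \<forall>n\<ge>N. norm (W u - W (real n)) \<le> C / s * exp (- s * u)"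
    proof (intro exI allI impI)
      fix n assume "n \<ge> nat \<lceil>u\<rceil>"
      then have "u \<le> real n" using that by linarith
      then show "norm (W u - W (real n)) \<le> C / s * exp (- s * u)"
        using est[OF that, of "real n"] by (simp add: norm_minus_commute)
    qed
  qed
  then have "\<forall>\<^sub>F u in at_top. norm (W u - L) \<le> C / s * exp (- s * u)"
    by (intro eventually_mono[OF eventually_ge_at_top[of 0]])
  then have "((\<lambda>u. W u - L) \<longlongrightarrow> 0) at_top" by (rule Lim_null_comparison[OF _ lim0])
  then have "(W \<longlongrightarrow> L) at_top" by (simp add: Lim_null[symmetric])
  then show ?thesis by (rule that)
qed

lemma exp_decay_antiderivative:
  fixes w :: "real \<Rightarrow> 'b::banach"
  assumes s: "s > 0" and cont: "continuous_on UNIV w" and bound: "\<And>u. norm (w u) \<le> C * exp (- s * \<bar>u\<bar>)"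
  obtains W a where "\<And>u. (W has_vector_derivative w u) (at u)" "(W \<longlongrightarrow> 0) at_bot" "(W \<longlongrightarrow> a) at_top"
proof -
  define W where "W u = integral {0..u} w - integral {u..0} w" for u
  have ci: "w integrable_on {a..b}" for a b
    by (rule integrable_continuous_interval) (rule continuous_on_subset[OF cont], simp)
  have d: "(W has_vector_derivative w u) (at u)" for u
  proof -
    define N where "N = \<bar>u\<bar> + 1"
    have N: "-N < u" "u < N" "N > 0" by (auto simp: N_def)
    have "((\<lambda>x. integral {-N..x} w) has_vector_derivative w u) (at u within {-N..N})"
      by (rule integral_has_vector_derivative) (use N continuous_on_subset[OF cont] in auto)
    then have "((\<lambda>x. integral {-N..x} w) has_vector_derivative w u) (at u)"
      using N by (simp add: at_within_Icc_at)
    then have "((\<lambda>x. integral {-N..x} w - integral {-N..0} w) has_vector_derivative w u) (at u)"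
      by (auto intro!: derivative_eq_intros)
    then show ?thesis
    proof (rule has_vector_derivative_transform_within_open[of _ _ _ "{-N<..<N}"])
      fix x assume x: "x \<in> {-N<..<N}"
      show "integral {-N..x} w - integral {-N..0} w = W x"
      proof (cases "x \<ge> 0")
        case True
        have "integral {-N..0} w + integral {0..x} w = integral {-N..x} w"
          by (rule Henstock_Kurzweil_Integration.integral_combine) (use True N ci in auto)
        then show ?thesis using True by (cases "x = 0") (auto simp: W_def algebra_simps)
      next
        case False
        have "integral {-N..x} w + integral {x..0} w = integral {-N..0} w"
          by (rule Henstock_Kurzweil_Integration.integral_combine) (use False x N ci in auto)
        then show ?thesis using False by (auto simp: W_def algebra_simps)
      qed
    qed (use N in auto)
  qed
  obtain L2 where L2: "(W \<longlongrightarrow> L2) at_top"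
    by (rule exp_decay_derivative_has_limit[OF s d, of C]) (metis bound abs_of_nonneg)
  have d': "((\<lambda>u. W (- u)) has_vector_derivative - w (- u)) (at u)" for u
  proof -
    have "(uminus has_vector_derivative (-1 :: real)) (at u)"
      unfolding has_real_derivative_iff_has_vector_derivative[symmetric] by (auto intro!: derivative_eq_intros)
    from vector_diff_chain_at[OF this d] show ?thesis by (simp add: o_def)
  qed
  obtain L1 where "((\<lambda>u. W (- u)) \<longlongrightarrow> L1) at_top"
    by (rule exp_decay_derivative_has_limit[OF s d', of C]) (metis bound abs_minus_cancel abs_of_nonneg norm_minus_cancel)
  then have L1: "(W \<longlongrightarrow> L1) at_bot" by (simp add: filterlim_at_bot_mirror)
  show ?thesis
  proof (rule that[of "\<lambda>u. W u - L1" "L2 - L1"])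
    show "((\<lambda>u. W u - L1) has_vector_derivative w u) (at u)" for u
      using d[of u] by (auto intro!: derivative_eq_intros)
    show "((\<lambda>u. W u - L1) \<longlongrightarrow> 0) at_bot" using tendsto_diff[OF L1 tendsto_const[of L1]] by simp
    show "((\<lambda>u. W u - L1) \<longlongrightarrow> L2 - L1) at_top" by (intro tendsto_intros L2)
  qed
qed

text \<open>
  Substituting \<open>t = exp u\<close> and \<open>t = - exp u\<close> in the antiderivatives, which extend continuously to \<open>t = 0\<close>,
  and applying the fundamental theorem of calculus gives existence of the integral over the whole path and
  its value under every bounded functional.
\<close>

lemma has_integral_two_rays:
  fixes w1 w2 :: "real \<Rightarrow> 'b::banach"
  assumes s: "s > 0" 
    and w1: "continuous_on UNIV w1" "\<And>u. norm (w1 u) \<le> C * exp (- s * \<bar>u\<bar>)"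
    and w2: "continuous_on UNIV w2" "\<And>u. norm (w2 u) \<le> C * exp (- s * \<bar>u\<bar>)"
    and neg: "\<And>t. t < 0 \<Longrightarrow> h t = (1 / t) *\<^sub>R w1 (ln (- t))"
    and pos: "\<And>t. t > 0 \<Longrightarrow> h t = (1 / t) *\<^sub>R w2 (ln t)"
  obtains I where "(h has_integral I) UNIV"
    "\<And>\<phi> :: 'b \<Rightarrow> complex. bounded_linear \<phi> \<Longrightarrow> \<phi> I = (\<integral>u. \<phi> (w2 u) \<partial>lborel) - (\<integral>u. \<phi> (w1 u) \<partial>lborel)"
proof -
  obtain W1 a1 where W1: "\<And>u. (W1 has_vector_derivative w1 u) (at u)" "(W1 \<longlongrightarrow> 0) at_bot" "(W1 \<longlongrightarrow> a1) at_top"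
    using exp_decay_antiderivative[OF s w1] by blast
  obtain W2 a2 where W2: "\<And>u. (W2 has_vector_derivative w2 u) (at u)" "(W2 \<longlongrightarrow> 0) at_bot" "(W2 \<longlongrightarrow> a2) at_top"
    using exp_decay_antiderivative[OF s w2] by blast
  define U where "U t = (if t < 0 then W1 (ln (- t)) else if t = 0 then 0 else W2 (ln t))" for t
  have lnm: "filterlim (\<lambda>t. ln (- t)) at_top (at_bot :: real filter)"
    by (rule filterlim_compose[OF ln_at_top]) (rule filterlim_uminus_at_top_at_bot)
  have lnm0: "filterlim (\<lambda>t. ln (- t)) at_bot (at_left (0::real))"
    by (subst filterlim_at_left_to_right) (simp add: ln_at_0)
  have top: "(U \<longlongrightarrow> a2) at_top"
    by (rule Lim_transform_eventually[OF filterlim_compose[OF W2(3) ln_at_top]])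
      (auto simp: U_def intro: eventually_mono[OF eventually_gt_at_top[of 0]])
  have bot: "(U \<longlongrightarrow> a1) at_bot"
    by (rule Lim_transform_eventually[OF filterlim_compose[OF W1(3) lnm]])
      (auto simp: U_def intro: eventually_mono[OF eventually_gt_at_bot[of 0]])
  have r0: "(U \<longlongrightarrow> 0) (at_right 0)"
    by (rule Lim_transform_eventually[OF filterlim_compose[OF W2(2) ln_at_0]])
      (auto simp: U_def eventually_at_filter)
  have l0: "(U \<longlongrightarrow> 0) (at_left 0)"
    by (rule Lim_transform_eventually[OF filterlim_compose[OF W1(2) lnm0]])
      (auto simp: U_def eventually_at_filter)
  have dn: "(U has_vector_derivative h t) (at t)" if t: "t < 0" for t
  proof -
    have l: "((\<lambda>t. ln (- t)) has_vector_derivative (1 / t)) (at t)"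
      unfolding has_real_derivative_iff_has_vector_derivative[symmetric]
      using t by (auto intro!: derivative_eq_intros simp: field_simps)
    have "((\<lambda>t. W1 (ln (- t))) has_vector_derivative h t) (at t)"
      using vector_diff_chain_at[OF l W1(1)] neg[OF t] by (simp add: o_def)
    then show ?thesis
      by (rule has_vector_derivative_transform_within_open[of _ _ _ "{..<0}"]) (use t in \<open>auto simp: U_def\<close>)
  qed
  have dp: "(U has_vector_derivative h t) (at t)" if t: "t > 0" for t
  proof -
    have l: "(ln has_vector_derivative (1 / t)) (at t)"
      unfolding has_real_derivative_iff_has_vector_derivative[symmetric]
      using t by (auto intro!: derivative_eq_intros simp: field_simps)
    have "((\<lambda>t. W2 (ln t)) has_vector_derivative h t) (at t)"
      using vector_diff_chain_at[OF l W2(1)] pos[OF t] by (simp add: o_def)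
    then show ?thesis
      by (rule has_vector_derivative_transform_within_open[of _ _ _ "{0<..}"]) (use t in \<open>auto simp: U_def\<close>)
  qed
  have hI: "(h has_integral (a2 - a1)) UNIV"
  proof (rule has_integral_UNIV_FTC[OF _ _ bot top])
    show "(U has_vector_derivative h t) (at t)" if "t \<noteq> 0" for t
      using dn dp that by (cases "t < 0") auto
    show "isCont U t" for t
    proof (cases "t = 0")
      case True
      have "U 0 = 0" by (simp add: U_def)
      then show ?thesis using True r0 l0 by (simp add: isCont_def filterlim_split_at)
    next
      case False
      then have "(U has_vector_derivative h t) (at t)" using dn dp by (cases "t < 0") auto
      then show ?thesis by (rule has_vector_derivative_continuous)
    qed
  qed
  have val: "\<phi> a = (\<integral>u. \<phi> (w u) \<partial>lborel)"
    if \<phi>: "bounded_linear \<phi>" and W: "\<And>u. (W has_vector_derivative w u) (at u)" "(W \<longlongrightarrow> 0) at_bot" "(W \<longlongrightarrow> a) at_top"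
      and w: "continuous_on UNIV w" "\<And>u. norm (w u) \<le> C * exp (- s * \<bar>u\<bar>)"
    for \<phi> :: "'b \<Rightarrow> complex" and W w a
  proof -
    interpret bounded_linear \<phi> by fact
    obtain K where K: "\<And>x. norm (\<phi> x) \<le> norm x * K" "K > 0" using pos_bounded by blast
    have "(w has_integral (a - 0)) UNIV"
      by (rule has_integral_UNIV_FTC[OF _ W(1) W(2) W(3)]) (rule has_vector_derivative_continuous[OF W(1)])
    then have 1: "((\<lambda>u. \<phi> (w u)) has_integral \<phi> a) UNIV"
      using has_integral_linear[OF _ \<phi>, where f=w and y=a and S=UNIV] by (simp add: o_def)
    have "integrable lborel (\<lambda>u. \<phi> (w u))"
    proof (rule integrable_exp_decay_bound(1)[OF s, of _ "C * K" 0])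
      show "(\<lambda>u. \<phi> (w u)) \<in> borel_measurable borel"
        by (intro borel_measurable_continuous_onI continuous_on w(1))
      show "cmod (\<phi> (w u)) \<le> C * K * exp (- s * \<bar>u + 0\<bar>)" for u
        using order_trans[OF K(1)[of "w u"] mult_right_mono[OF w(2)[of u] less_imp_le[OF K(2)]]] by (simp add: mult_ac)
    qed
    then have 2: "((\<lambda>u. \<phi> (w u)) has_integral (\<integral>u. \<phi> (w u) \<partial>lborel)) UNIV"
      by (rule has_integral_integral_lborel)
    show ?thesis using 1 2 by (rule has_integral_unique)
  qed
  show ?thesis
  proof (rule that[OF hI])
    fix \<phi> :: "'b \<Rightarrow> complex" assume \<phi>: "bounded_linear \<phi>"
    show "\<phi> (a2 - a1) = (\<integral>u. \<phi> (w2 u) \<partial>lborel) - (\<integral>u. \<phi> (w1 u) \<partial>lborel)"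
      using val[OF \<phi> W1 w1] val[OF \<phi> W2 w2] by (simp add: linear_diff[OF bounded_linear.linear[OF \<phi>]])
  qed
qed


subsection \<open>Residues in a strip\<close>

lemma contour_integral_linepath_same_Im:
  assumes "a < b"
  shows "contour_integral (linepath (Complex a c) (Complex b c)) f = integral {a..b} (\<lambda>x. f (Complex x c))"
proof -
  have "contour_integral (linepath (Complex a c) (Complex b c)) f =
         (Complex b c - Complex a c) * integral {0..1} (\<lambda>x. f (linepath (Complex a c) (Complex b c) x))"
    by (simp add: contour_integral_integral)
  also have "Complex b c - Complex a c = of_real (b - a)"
    by (simp add: complex_eq_iff)
  also have "integral {0..1} (\<lambda>x. f (linepath (Complex a c) (Complex b c) x)) =
             integral {0..(b - a) / (b - a)} (\<lambda>x. f (Complex (a + (b - a) * x) c))"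
  proof -
    have "linepath (Complex a c) (Complex b c) x = Complex (a + (b - a) * x) c" for x
      by (simp add: linepath_def complex_eq_iff algebra_simps)
    then show ?thesis using assms by simp
  qed
  also have "{0..(b - a) / (b - a)} = (\<lambda>x. x / (b - a)) ` {0..b - a}"
    using \<open>a < b\<close> by simp
  also have "integral \<dots> (\<lambda>x. f (Complex (a + (b - a) * x) c)) =
             integral {a-a..b-a} (\<lambda>x. f (Complex (x + a) c)) / of_real (b - a)"
    using \<open>a < b\<close> by (subst integral_stretch_real) (auto simp: scaleR_conv_of_real add_ac)
  also have "\<dots> = integral {a..b} (\<lambda>x. f (Complex x c)) / of_real (b - a)"
    by (subst integral_shift_real_ivl) (rule refl)
  finally show ?thesis
    using \<open>a < b\<close> by simp
qed

lemma contour_integral_rectpath: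
  assumes ab: "a < b" "c < d" and cont: "continuous_on (path_image (rectpath (Complex a c) (Complex b d))) f"
  shows "contour_integral (rectpath (Complex a c) (Complex b d)) f =
    (integral {a..b} (\<lambda>x. f (Complex x c)) - integral {a..b} (\<lambda>x. f (Complex x d)))
    + \<i> * (integral {c..d} (\<lambda>y. f (Complex b y)) - integral {c..d} (\<lambda>y. f (Complex a y)))"
proof -
  let ?p = "Complex a c" and ?q = "Complex b c" and ?r = "Complex b d" and ?s = "Complex a d"
  have "path_image (rectpath ?p ?r) = closed_segment ?p ?q \<union> closed_segment ?q ?r \<union> closed_segment ?r ?s \<union> closed_segment ?s ?p"
    by (simp add: rectpath_def Let_def path_image_join Un_assoc)
  then have c: "continuous_on (closed_segment ?p ?q) f" "continuous_on (closed_segment ?q ?r) f"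
      "continuous_on (closed_segment ?r ?s) f" "continuous_on (closed_segment ?s ?p) f"
    using cont by (auto elim!: continuous_on_subset)
  then have i: "f contour_integrable_on linepath ?p ?q" "f contour_integrable_on linepath ?q ?r"
     "f contour_integrable_on linepath ?r ?s" "f contour_integrable_on linepath ?s ?p"
    by (auto intro: contour_integrable_continuous_linepath)
  have "contour_integral (rectpath ?p ?r) f = contour_integral (linepath ?p ?q) f + (contour_integral (linepath ?q ?r) f
     + (contour_integral (linepath ?r ?s) f + contour_integral (linepath ?s ?p) f))"
    by (simp add: rectpath_def Let_def i contour_integrable_joinI valid_path_join)
  also have "contour_integral (linepath ?r ?s) f = - contour_integral (linepath ?s ?r) f"
    by (rule contour_integral_reverse_linepath) (rule c)
  also have "contour_integral (linepath ?s ?p) f = - contour_integral (linepath ?p ?s) f"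
    by (rule contour_integral_reverse_linepath) (rule c)
  also have "contour_integral (linepath ?q ?r) f = \<i> * integral {c..d} (\<lambda>y. f (Complex b y))"
    using ab by (intro contour_integral_linepath_same_Re) auto
  also have "contour_integral (linepath ?p ?s) f = \<i> * integral {c..d} (\<lambda>y. f (Complex a y))"
    using ab by (intro contour_integral_linepath_same_Re) auto
  finally show ?thesis using ab by (simp add: contour_integral_linepath_same_Im algebra_simps)
qed

text \<open>
  The holomorphic extension of \<open>\<zeta> / (exp \<zeta> - 1)\<close> across its removable singularity.
\<close>

definition exp_quot :: "complex \<Rightarrow> complex" where
  "exp_quot \<zeta> = (if \<zeta> = 0 then 1 else \<zeta> / (exp \<zeta> - 1))"

lemma exp_eq_1_strip: "\<bar>Im \<zeta>\<bar> < 2 * pi \<Longrightarrow> exp \<zeta> = 1 \<longleftrightarrow> \<zeta> = 0"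
proof
  assume *: "\<bar>Im \<zeta>\<bar> < 2 * pi" "exp \<zeta> = 1"
  then obtain n :: int where n: "Re \<zeta> = 0" "Im \<zeta> = of_int (2 * n) * pi" by (auto simp: exp_eq_1)
  then have "\<bar>of_int n\<bar> * (2 * pi) < 1 * (2 * pi)" using * by (simp add: abs_mult)
  then have "\<bar>of_int n\<bar> < (1::real)" using mult_less_cancel_right_pos[of "2 * pi"] by simp
  then have "n = 0" by linarith
  then show "\<zeta> = 0" using n by (simp add: complex_eq_iff)
qed simp

lemma holomorphic_exp_quot: "exp_quot holomorphic_on {\<zeta>. \<bar>Im \<zeta>\<bar> < 2 * pi}"
proof (rule no_isolated_singularity[of _ _ "{0}"])
  let ?S = "{\<zeta>::complex. \<bar>Im \<zeta>\<bar> < 2 * pi}"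
  have S: "?S = {\<zeta>. Im \<zeta> < 2*pi} \<inter> {\<zeta>. Im \<zeta> > -2*pi}" by auto
  show op: "open ?S" unfolding S by (intro open_Int open_halfspace_Im_lt open_halfspace_Im_gt)
  have "(\<lambda>\<zeta>. \<zeta> / (exp \<zeta> - 1)) holomorphic_on ?S - {0}"
    by (intro holomorphic_intros) (use exp_eq_1_strip in auto)
  then show hol: "exp_quot holomorphic_on ?S - {0}"
    by (rule holomorphic_transform) (auto simp: exp_quot_def)
  have "((\<lambda>\<zeta>::complex. (exp \<zeta> - exp 0) / (\<zeta> - 0)) \<longlongrightarrow> exp 0) (at 0)"
    using DERIV_exp[of "0::complex"] by (simp only: has_field_derivative_iff)
  then have "((\<lambda>\<zeta>::complex. inverse ((exp \<zeta> - exp 0) / (\<zeta> - 0))) \<longlongrightarrow> inverse (exp 0)) (at 0)"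
    by (rule tendsto_inverse) simp
  then have "((\<lambda>\<zeta>::complex. \<zeta> / (exp \<zeta> - 1)) \<longlongrightarrow> 1) (at 0)" by simp
  then have "(exp_quot \<longlongrightarrow> 1) (at 0)"
    by (rule Lim_transform_eventually) (auto simp: exp_quot_def eventually_at_filter)
  then have "isCont exp_quot 0" by (simp add: isCont_def exp_quot_def)
  moreover have "isCont exp_quot z" if "z \<in> ?S - {0}" for z
    using holomorphic_on_imp_continuous_on[OF hol] that op
    by (simp add: continuous_on_eq_continuous_at open_delete)
  ultimately show "continuous_on ?S exp_quot" by (auto intro!: continuous_at_imp_continuous_on)
qed simp

text \<open>
  The integrand is \<open>P \<zeta> * exp_quot (\<zeta> - z) / (\<zeta> - z)\<close>, and \<open>P \<zeta> * exp_quot (\<zeta> - z)\<close> is holomorphic in the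
  strip because the strip has width at most \<open>2 \<pi>\<close>. This reduces the claim to Cauchy's integral formula.
\<close>

lemma rectangle_residue:
  assumes P: "P holomorphic_on {\<zeta>. a < Im \<zeta> \<and> Im \<zeta> < b}" and ab: "b - a \<le> 2 * pi" and v: "a < v1" "v1 < v2" "v2 < b"
    and z: "v1 < Im z" "Im z < v2" "\<bar>Re z\<bar> < N"
  shows "((\<lambda>\<zeta>. P \<zeta> / (exp (\<zeta> - z) - 1)) has_contour_integral (2 * pi * \<i> * P z)) (rectpath (Complex (- N) v1) (Complex N v2))"
proof -
  let ?S = "{\<zeta>. a < Im \<zeta> \<and> Im \<zeta> < b}"
  let ?g = "rectpath (Complex (- N) v1) (Complex N v2)"
  have S: "?S = {\<zeta>. Im \<zeta> < b} \<inter> {\<zeta>. Im \<zeta> > a}" by auto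
  have opS: "open ?S" unfolding S by (intro open_Int open_halfspace_Im_lt open_halfspace_Im_gt)
  have cvS: "convex ?S" unfolding S by (simp add: convex_Int convex_halfspace_Im_lt convex_halfspace_Im_gt)
  have zS: "z \<in> ?S" using v z by auto
  have hol: "(\<lambda>\<zeta>. P \<zeta> * exp_quot (\<zeta> - z)) holomorphic_on ?S"
  proof (intro holomorphic_on_mult P)
    have "(exp_quot \<circ> (\<lambda>\<zeta>. \<zeta> - z)) holomorphic_on ?S"
      by (rule holomorphic_on_compose_gen[OF _ holomorphic_exp_quot]) (use zS ab in \<open>auto intro!: holomorphic_intros\<close>)
    then show "(\<lambda>\<zeta>. exp_quot (\<zeta> - z)) holomorphic_on ?S" by (simp add: o_def)
  qed
  have zbox: "z \<in> box (Complex (- N) v1) (Complex N v2)"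
    using z by (auto simp: in_box_complex_iff)
  have pim: "path_image ?g \<subseteq> ?S - {z}"
    using v z by (subst path_image_rectpath) auto
  have "((\<lambda>\<zeta>. (P \<zeta> * exp_quot (\<zeta> - z)) / (\<zeta> - z)) has_contour_integral (2*pi * \<i> * winding_number ?g z * (P z * exp_quot (z - z)))) ?g"
    by (rule Cauchy_integral_formula_convex_simple[OF cvS hol _ _ pim]) (use zS opS in \<open>auto simp: interior_open\<close>)
  moreover have "winding_number ?g z = 1" by (rule winding_number_rectpath[OF zbox])
  ultimately have "((\<lambda>\<zeta>. (P \<zeta> * exp_quot (\<zeta> - z)) / (\<zeta> - z)) has_contour_integral (2*pi * \<i> * P z)) ?g"
    by (simp add: exp_quot_def)
  then show ?thesis
    by (rule has_contour_integral_eq) (use pim in \<open>auto simp: exp_quot_def\<close>)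
qed

text \<open>
  Residues at two poles, as the limit of integrals over long rectangles. Decay is required of the sum \<open>Q\<close>
  because for the approximate units below the two fractions decay only after cancellation.
\<close>

lemma strip_residue:
  assumes P: "P holomorphic_on {\<zeta>. a < Im \<zeta> \<and> Im \<zeta> < b}" and P0: "P0 holomorphic_on {\<zeta>. a < Im \<zeta> \<and> Im \<zeta> < b}"
    and ab: "b - a \<le> 2 * pi" and v: "a < v1" "v1 < v2" "v2 < b"
    and z: "v1 < Im z1" "Im z1 < v2" "v1 < Im z2" "Im z2 < v2"
    and Q: "\<And>\<zeta>. a < Im \<zeta> \<Longrightarrow> Im \<zeta> < b \<Longrightarrow> \<zeta> \<noteq> z1 \<Longrightarrow> \<zeta> \<noteq> z2 \<Longrightarrow>
       Q \<zeta> = P0 \<zeta> + P \<zeta> * (c1 / (exp (\<zeta> - z1) - 1) + c2 / (exp (\<zeta> - z2) - 1))"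
    and s: "s > 0" and decay: "\<And>\<zeta>. v1 \<le> Im \<zeta> \<Longrightarrow> Im \<zeta> \<le> v2 \<Longrightarrow> \<bar>Re \<zeta>\<bar> \<ge> N0 \<Longrightarrow> cmod (Q \<zeta>) \<le> C * exp (- s * \<bar>Re \<zeta>\<bar>)"
    and i1: "integrable lborel (\<lambda>u. Q (Complex u v1))" and i2: "integrable lborel (\<lambda>u. Q (Complex u v2))"
  shows "(\<integral>u. Q (Complex u v1) \<partial>lborel) - (\<integral>u. Q (Complex u v2) \<partial>lborel) = 2 * pi * \<i> * (c1 * P z1 + c2 * P z2)"
proof -
  let ?S = "{\<zeta>. a < Im \<zeta> \<and> Im \<zeta> < b}"
  let ?g = "\<lambda>N. rectpath (Complex (- N) v1) (Complex N v2)"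
  let ?R = "2 * pi * \<i> * (c1 * P z1 + c2 * P z2)"
  have S: "?S = {\<zeta>. Im \<zeta> < b} \<inter> {\<zeta>. Im \<zeta> > a}" by auto
  have cvS: "convex ?S" unfolding S by (simp add: convex_Int convex_halfspace_Im_lt convex_halfspace_Im_gt)
  define N1 where "N1 = max (\<bar>N0\<bar> + 1) (max (\<bar>Re z1\<bar> + 1) (\<bar>Re z2\<bar> + 1))"
  have C: "C \<ge> 0"
  proof -
    have "cmod (Q (Complex \<bar>N0\<bar> v1)) \<le> C * exp (- s * \<bar>Re (Complex \<bar>N0\<bar> v1)\<bar>)"
      using decay[of "Complex \<bar>N0\<bar> v1"] v by auto
    then have "0 \<le> C * exp (- s * \<bar>Re (Complex \<bar>N0\<bar> v1)\<bar>)"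
      by (rule order_trans[OF norm_ge_zero])
    then show ?thesis by (simp add: zero_le_mult_iff)
  qed
  have rect: "(integral {-N..N} (\<lambda>x. Q (Complex x v1)) - integral {-N..N} (\<lambda>x. Q (Complex x v2)))
    + \<i> * (integral {v1..v2} (\<lambda>y. Q (Complex N y)) - integral {v1..v2} (\<lambda>y. Q (Complex (-N) y))) = ?R"
    and contQ: "continuous_on {v1..v2} (\<lambda>y. Q (Complex N y))" "continuous_on {v1..v2} (\<lambda>y. Q (Complex (-N) y))"
    if N: "N \<ge> N1" for N
  proof -
    have N': "N > 0" "\<bar>Re z1\<bar> < N" "\<bar>Re z2\<bar> < N" using N by (auto simp: N1_def)
    have pim: "path_image (?g N) \<subseteq> ?S - {z1, z2}"
      using v z N' by (subst path_image_rectpath) auto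
    have h1: "((\<lambda>\<zeta>. P \<zeta> / (exp (\<zeta> - z1) - 1)) has_contour_integral (2 * pi * \<i> * P z1)) (?g N)"
      by (rule rectangle_residue[OF P ab v]) (use z N' in auto)
    have h2: "((\<lambda>\<zeta>. P \<zeta> / (exp (\<zeta> - z2) - 1)) has_contour_integral (2 * pi * \<i> * P z2)) (?g N)"
      by (rule rectangle_residue[OF P ab v]) (use z N' in auto)
    have h0: "(P0 has_contour_integral 0) (?g N)"
      by (rule Cauchy_theorem_convex_simple[OF P0 cvS]) (use pim in auto)
    have "((\<lambda>\<zeta>. P0 \<zeta> + (c1 * (P \<zeta> / (exp (\<zeta> - z1) - 1)) + c2 * (P \<zeta> / (exp (\<zeta> - z2) - 1)))) has_contour_integral
      (0 + (c1 * (2 * pi * \<i> * P z1) + c2 * (2 * pi * \<i> * P z2)))) (?g N)"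
      by (intro has_contour_integral_add has_contour_integral_lmul h0 h1 h2)
    then have "(Q has_contour_integral (0 + (c1 * (2 * pi * \<i> * P z1) + c2 * (2 * pi * \<i> * P z2)))) (?g N)"
      by (rule has_contour_integral_eq) (use pim Q in \<open>auto simp: subset_iff algebra_simps\<close>)
    then have cQ: "contour_integral (?g N) Q = ?R"
      by (simp add: contour_integral_unique algebra_simps)
    have "continuous_on (path_image (?g N)) (\<lambda>\<zeta>. P0 \<zeta> + P \<zeta> * (c1 / (exp (\<zeta> - z1) - 1) + c2 / (exp (\<zeta> - z2) - 1)))"
    proof (intro continuous_intros)
      have "path_image (?g N) \<subseteq> ?S" using pim by blast
      then show "continuous_on (path_image (?g N)) P0" "continuous_on (path_image (?g N)) P"
        using continuous_on_subset holomorphic_on_imp_continuous_on P P0 by blast+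
      show "\<forall>x\<in>path_image (?g N). exp (x - z1) - 1 \<noteq> 0" "\<forall>x\<in>path_image (?g N). exp (x - z2) - 1 \<noteq> 0"
      proof (safe)
        fix x assume x: "x \<in> path_image (?g N)"
        then have xx: "a < Im x" "Im x < b" "x \<noteq> z1" "x \<noteq> z2" using pim by auto
        have "\<bar>Im (x - z1)\<bar> < 2 * pi" "\<bar>Im (x - z2)\<bar> < 2 * pi" using xx z v ab by auto
        then show "exp (x - z1) - 1 = 0 \<Longrightarrow> False" "exp (x - z2) - 1 = 0 \<Longrightarrow> False" using xx exp_eq_1_strip by auto
      qed
    qed
    then have co: "continuous_on (path_image (?g N)) Q"
      by (rule continuous_on_cong[THEN iffD1, rotated -1]) (use pim Q in \<open>auto simp: subset_iff\<close>)
    show "(integral {-N..N} (\<lambda>x. Q (Complex x v1)) - integral {-N..N} (\<lambda>x. Q (Complex x v2)))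
    + \<i> * (integral {v1..v2} (\<lambda>y. Q (Complex N y)) - integral {v1..v2} (\<lambda>y. Q (Complex (-N) y))) = ?R"
      using contour_integral_rectpath[OF _ v(2) co] N' cQ by simp
    have *: "continuous_on {v1..v2} (\<lambda>y. Q (Complex r y))" if "r = N \<or> r = -N" for r
    proof (rule continuous_on_compose2[OF co])
      show "continuous_on {v1..v2} (\<lambda>y. Complex r y)" unfolding Complex_eq by (intro continuous_intros)
      show "Complex r ` {v1..v2} \<subseteq> path_image (?g N)" using that v N' by (subst path_image_rectpath) auto
    qed
    show "continuous_on {v1..v2} (\<lambda>y. Q (Complex N y))" "continuous_on {v1..v2} (\<lambda>y. Q (Complex (-N) y))"
      using * by auto
  qed
  obtain n0 :: nat where n0: "N1 \<le> real n0" using real_arch_simple by blast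
  have side: "cmod (integral {v1..v2} (\<lambda>y. Q (Complex r y))) \<le> (v2 - v1) * (C * exp (- s * real n))"
    if n: "n \<ge> n0" and r: "r = real n \<or> r = - real n" for n r
  proof -
    have nn: "real n \<ge> N1" using n0 n by (meson of_nat_le_iff order_trans)
    have "norm (integral {v1..v2} (\<lambda>y. Q (Complex r y))) \<le> (C * exp (- s * real n)) * (v2 - v1)"
    proof (rule integral_bound)
      show "continuous_on {v1..v2} (\<lambda>y. Q (Complex r y))" using contQ[OF nn] r by auto
      fix y assume "y \<in> {v1..v2}"
      moreover have "\<bar>r\<bar> = real n" using r by auto
      moreover have "real n \<ge> N0" using nn by (auto simp: N1_def)
      ultimately show "norm (Q (Complex r y)) \<le> C * exp (- s * real n)" using decay[of "Complex r y"] by auto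
    qed (use v in auto)
    then show ?thesis by (simp add: mult.commute)
  qed
  have lim0: "(\<lambda>n::nat. 2 * ((v2 - v1) * (C * exp (- s * real n)))) \<longlonglongrightarrow> 0"
  proof -
    have "((\<lambda>x. exp (- s * x)) \<longlongrightarrow> 0) at_top"
      by (rule filterlim_compose[OF exp_at_bot],
          rule filterlim_tendsto_neg_mult_at_bot[OF tendsto_const _ filterlim_ident])
        (use s in simp)
    then have "(\<lambda>n::nat. exp (- s * real n)) \<longlonglongrightarrow> 0" by (rule filterlim_compose[OF _ filterlim_real_sequentially])
    from tendsto_mult_left[OF this, of "2 * ((v2 - v1) * C)"] show ?thesis
      by (simp only: mult.assoc mult_zero_right)
  qed
  let ?L = "\<lambda>n::nat. integral {-real n..real n} (\<lambda>x. Q (Complex x v1)) - integral {-real n..real n} (\<lambda>x. Q (Complex x v2))"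
  have "?L \<longlonglongrightarrow> (\<integral>u. Q (Complex u v1) \<partial>lborel) - (\<integral>u. Q (Complex u v2) \<partial>lborel)"
    by (intro tendsto_diff has_integral_UNIV_limit has_integral_integral_lborel i1 i2)
  moreover have "?L \<longlonglongrightarrow> ?R"
  proof -
    have "(\<lambda>n. ?L n - ?R) \<longlonglongrightarrow> 0"
    proof (rule Lim_null_comparison[OF _ lim0], rule eventually_sequentiallyI[of n0])
      fix n assume n: "n \<ge> n0"
      let ?a = "integral {v1..v2} (\<lambda>y. Q (Complex (real n) y))" and ?b = "integral {v1..v2} (\<lambda>y. Q (Complex (-real n) y))"
      have "real n \<ge> N1" using n0 n by (meson of_nat_le_iff order_trans)
      then have "?L n - ?R = - \<i> * (?a - ?b)" using rect[of "real n"] by (simp add: algebra_simps)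
      then have "norm (?L n - ?R) = norm (?a - ?b)" by (simp add: norm_mult)
      also have "\<dots> \<le> norm ?a + norm ?b" by (rule norm_triangle_ineq4)
      finally show "norm (?L n - ?R) \<le> 2 * ((v2 - v1) * (C * exp (- s * real n)))"
        using side[OF n, of "real n"] side[OF n, of "- real n"] by simp
    qed
    then show ?thesis by (simp add: Lim_null[symmetric])
  qed
  ultimately show ?thesis by (rule LIMSEQ_unique)
qed

section \<open>Decaying functions on sectors and contour integrals\<close>

lemma fubini_swap:
  fixes F :: "'x \<Rightarrow> 'y \<Rightarrow> complex"
  assumes "sigma_finite_measure M" "sigma_finite_measure N"
    and [measurable]: "(\<lambda>(x, y). F x y) \<in> borel_measurable (M \<Otimes>\<^sub>M N)"
    and fin: "(\<integral>\<^sup>+x. (\<integral>\<^sup>+y. ennreal (cmod (F x y)) \<partial>N) \<partial>M) < \<infinity>"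
  shows "(\<integral>x. (\<integral>y. F x y \<partial>N) \<partial>M) = (\<integral>y. (\<integral>x. F x y \<partial>M) \<partial>N)"
    and "integrable M (\<lambda>x. (\<integral>y. F x y \<partial>N))"
    and "integrable N (\<lambda>y. (\<integral>x. F x y \<partial>M))"
proof -
  interpret M: sigma_finite_measure M by fact
  interpret N: sigma_finite_measure N by fact
  interpret P: pair_sigma_finite M N ..
  have int: "integrable (M \<Otimes>\<^sub>M N) (\<lambda>(x, y). F x y)"
  proof (rule integrableI_bounded)
    have "(\<integral>\<^sup>+p. ennreal (norm (case p of (x, y) \<Rightarrow> F x y)) \<partial>(M \<Otimes>\<^sub>M N)) = (\<integral>\<^sup>+x. (\<integral>\<^sup>+y. ennreal (cmod (F x y)) \<partial>N) \<partial>M)"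
      by (subst N.nn_integral_fst[symmetric]) auto
    then show "(\<integral>\<^sup>+p. ennreal (norm (case p of (x, y) \<Rightarrow> F x y)) \<partial>(M \<Otimes>\<^sub>M N)) < \<infinity>" using fin by simp
  qed simp
  show "(\<integral>x. (\<integral>y. F x y \<partial>N) \<partial>M) = (\<integral>y. (\<integral>x. F x y \<partial>M) \<partial>N)"
    by (rule P.Fubini_integral[OF int, symmetric])
  show "integrable M (\<lambda>x. (\<integral>y. F x y \<partial>N))" by (rule P.integrable_fst[OF int])
  show "integrable N (\<lambda>y. (\<integral>x. F x y \<partial>M))" by (rule P.integrable_snd[OF int])
qed

text \<open>
  In terms of \<open>u = ln \<bar>w\<bar>\<close> the bound is \<open>c exp (- s \<bar>u\<bar>)\<close>, which is equivalent to the bound that defines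
  \<open>Hinf0\<close> and is stable under dilations up to a factor.
\<close>

definition sector_decay :: "real \<Rightarrow> real \<Rightarrow> real \<Rightarrow> (complex \<Rightarrow> complex) \<Rightarrow> bool" where
  "sector_decay \<theta> s c f \<longleftrightarrow> f holomorphic_on sector \<theta> \<and>
     (\<forall>w\<in>sector \<theta>. cmod (f w) \<le> c * exp (- s * \<bar>ln (cmod w)\<bar>))"

lemma sector_decay_exp:
  assumes "sector_decay \<theta> s c f" "\<theta> \<le> pi" "\<bar>Im \<zeta>\<bar> < \<theta>"
  shows "cmod (f (exp \<zeta>)) \<le> c * exp (- s * \<bar>Re \<zeta>\<bar>)"
  using assms exp_in_sector[of \<zeta> \<theta>] by (fastforce simp: sector_decay_def)

lemma sector_decay_nonneg: 
  assumes "sector_decay \<theta> s c f" "0 < \<theta>" shows "0 \<le> c"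
proof -
  have "cmod (f 1) \<le> c" using assms one_in_sector[of \<theta>] by (force simp: sector_decay_def)
  then show ?thesis using norm_ge_zero order_trans by blast
qed

lemma sector_decay_mono: "sector_decay \<theta> s c f \<Longrightarrow> \<theta>' \<le> \<theta> \<Longrightarrow> sector_decay \<theta>' s c f"
  unfolding sector_decay_def using sector_mono[of \<theta>' \<theta>] by (auto intro: holomorphic_on_subset)

lemma sector_decay_weaken:
  assumes "sector_decay \<theta> s c f" "0 < \<theta>" "s' \<le> s" shows "sector_decay \<theta> s' c f"
proof -
  have c: "0 \<le> c" by (rule sector_decay_nonneg) fact+
  have "cmod (f w) \<le> c * exp (- s' * \<bar>ln (cmod w)\<bar>)" if "w \<in> sector \<theta>" for w
  proof -
    have "s' * \<bar>ln (cmod w)\<bar> \<le> s * \<bar>ln (cmod w)\<bar>" using assms(3) by (intro mult_right_mono) auto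
    then have "c * exp (- s * \<bar>ln (cmod w)\<bar>) \<le> c * exp (- s' * \<bar>ln (cmod w)\<bar>)"
      using c by (intro mult_left_mono) auto
    then show ?thesis using assms(1) that by (force simp: sector_decay_def)
  qed
  then show ?thesis using assms(1) by (simp add: sector_decay_def)
qed

lemma sector_decay_mult_bounded:
  assumes "sector_decay \<theta> s c f" "0 < \<theta>" "g holomorphic_on sector \<theta>" "\<And>w. w \<in> sector \<theta> \<Longrightarrow> cmod (g w) \<le> B"
  shows "sector_decay \<theta> s (B * c) (\<lambda>w. g w * f w)"
proof -
  have c: "0 \<le> c" by (rule sector_decay_nonneg) fact+
  have B: "0 \<le> B" using assms(4)[of 1] one_in_sector[OF assms(2)] norm_ge_zero order_trans by blast
  show ?thesis unfolding sector_decay_def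
  proof (intro conjI ballI)
    show "(\<lambda>w. g w * f w) holomorphic_on sector \<theta>"
      using assms by (intro holomorphic_on_mult) (auto simp: sector_decay_def)
    fix w assume w: "w \<in> sector \<theta>"
    have "cmod (g w * f w) \<le> B * (c * exp (- s * \<bar>ln (cmod w)\<bar>))"
      unfolding norm_mult using assms w B by (intro mult_mono) (auto simp: sector_decay_def)
    then show "cmod (g w * f w) \<le> B * c * exp (- s * \<bar>ln (cmod w)\<bar>)" by (simp add: mult_ac)
  qed
qed

lemma sector_decay_bound:
  assumes "sector_decay \<theta> s c f" "0 < \<theta>" "s \<ge> 0" "w \<in> sector \<theta>"
  shows "cmod (f w) \<le> c"
proof -
  have c: "0 \<le> c" by (rule sector_decay_nonneg) fact+
  have "cmod (f w) \<le> c * exp (- s * \<bar>ln (cmod w)\<bar>)" using assms by (auto simp: sector_decay_def)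
  also have "\<dots> \<le> c * 1" using c assms(3) by (intro mult_left_mono) auto
  finally show ?thesis by simp
qed

lemma holomorphic_exp_sector:
  assumes "f holomorphic_on sector \<theta>" "\<theta> \<le> pi" "\<And>\<zeta>. \<zeta> \<in> S \<Longrightarrow> \<bar>Im \<zeta>\<bar> < \<theta>"
  shows "(\<lambda>\<zeta>. f (exp \<zeta>)) holomorphic_on S"
proof -
  have "(f \<circ> exp) holomorphic_on S"
    by (rule holomorphic_on_compose_gen[OF _ assms(1)]) (use assms exp_in_sector in \<open>auto intro: holomorphic_intros\<close>)
  then show ?thesis by (simp add: o_def)
qed

lemma continuous_line:
  assumes "h holomorphic_on S" "\<And>u. Complex u v \<in> S"
  shows "continuous_on UNIV (\<lambda>u. h (Complex u v))"
proof (rule continuous_on_compose2[OF holomorphic_on_imp_continuous_on[OF assms(1)]])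
  show "continuous_on UNIV (\<lambda>u. Complex u v)" unfolding Complex_eq by (intro continuous_intros)
qed (use assms in auto)

text \<open>
  The contour integral along the boundary of a sector in the coordinate \<open>\<zeta>\<close> with \<open>z = exp \<zeta>\<close>. The upper ray
  is run through from infinity to \<open>0\<close>, whence the sign of the second integral; the factor \<open>z\<close> from
  \<open>dz = z d\<zeta>\<close> belongs to the integrand.
\<close>

definition Cint :: "real \<Rightarrow> (complex \<Rightarrow> complex) \<Rightarrow> complex" where
  "Cint \<gamma> h = (1 / (2 * pi * \<i>)) * ((\<integral>u. h (Complex u (- \<gamma>)) \<partial>lborel) - (\<integral>u. h (Complex u \<gamma>) \<partial>lborel))"

lemma Cint_cong: 
  "(\<And>u. h (Complex u (-\<gamma>)) = k (Complex u (-\<gamma>))) \<Longrightarrow> (\<And>u. h (Complex u \<gamma>) = k (Complex u \<gamma>)) \<Longrightarrow> Cint \<gamma> h = Cint \<gamma> k"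
  by (simp add: Cint_def)

lemma Cint_cmult: "Cint \<gamma> (\<lambda>\<zeta>. c * h \<zeta>) = c * Cint \<gamma> h"
  by (simp add: Cint_def algebra_simps)

lemma Cint_mult_right: "Cint \<gamma> (\<lambda>\<zeta>. h \<zeta> * c) = Cint \<gamma> h * c"
  by (simp add: Cint_def algebra_simps)

lemma Cint_add:
  assumes "integrable lborel (\<lambda>u. h (Complex u \<gamma>))" "integrable lborel (\<lambda>u. h (Complex u (-\<gamma>)))"
   "integrable lborel (\<lambda>u. k (Complex u \<gamma>))" "integrable lborel (\<lambda>u. k (Complex u (-\<gamma>)))"
  shows "Cint \<gamma> (\<lambda>\<zeta>. h \<zeta> + k \<zeta>) = Cint \<gamma> h + Cint \<gamma> k"
  using assms by (simp add: Cint_def algebra_simps)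

lemma Cint_swap:
  fixes H :: "complex \<Rightarrow> complex \<Rightarrow> complex"
  assumes s: "s > 0"
    and meas: "\<And>v v'. \<bar>v\<bar> = \<gamma> \<Longrightarrow> \<bar>v'\<bar> = \<delta> \<Longrightarrow> continuous_on UNIV (\<lambda>p::real\<times>real. H (Complex (fst p) v) (Complex (snd p) v'))"
    and bound: "\<And>\<eta> \<zeta>. \<bar>Im \<eta>\<bar> = \<gamma> \<Longrightarrow> \<bar>Im \<zeta>\<bar> = \<delta> \<Longrightarrow> cmod (H \<eta> \<zeta>) \<le> C * exp (- s * \<bar>Re \<eta>\<bar>) * exp (- s * \<bar>Re \<zeta>\<bar>)"
    and g: "\<gamma> > 0" "\<delta> > 0"
  shows "Cint \<gamma> (\<lambda>\<eta>. Cint \<delta> (\<lambda>\<zeta>. H \<eta> \<zeta>)) = Cint \<delta> (\<lambda>\<zeta>. Cint \<gamma> (\<lambda>\<eta>. H \<eta> \<zeta>))"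
proof -
  have C: "C \<ge> 0" 
  proof -
    have "cmod (H (Complex 0 \<gamma>) (Complex 0 \<delta>)) \<le> C"
      using bound[of "Complex 0 \<gamma>" "Complex 0 \<delta>"] g by simp
    then show ?thesis using norm_ge_zero order_trans by blast
  qed
  have sw: "(\<integral>u. (\<integral>u'. H (Complex u v) (Complex u' v') \<partial>lborel) \<partial>lborel) = (\<integral>u'. (\<integral>u. H (Complex u v) (Complex u' v') \<partial>lborel) \<partial>lborel)"
    and i1: "integrable lborel (\<lambda>u. \<integral>u'. H (Complex u v) (Complex u' v') \<partial>lborel)"
    and i2: "integrable lborel (\<lambda>u'. \<integral>u. H (Complex u v) (Complex u' v') \<partial>lborel)"
    if v: "\<bar>v\<bar> = \<gamma>" "\<bar>v'\<bar> = \<delta>" for v v'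
  proof -
    have m: "(\<lambda>(u, u'). H (Complex u v) (Complex u' v')) \<in> borel_measurable (lborel \<Otimes>\<^sub>M lborel)"
      using borel_measurable_continuous_onI[OF meas[OF v]] by (simp add: lborel_prod split_def)
    have "(\<integral>\<^sup>+u. (\<integral>\<^sup>+u'. ennreal (cmod (H (Complex u v) (Complex u' v'))) \<partial>lborel) \<partial>lborel)
      \<le> (\<integral>\<^sup>+u. (\<integral>\<^sup>+u'. ennreal (C * exp (- s * \<bar>u + 0\<bar>)) * ennreal (exp (- s * \<bar>u' + 0\<bar>)) \<partial>lborel) \<partial>lborel)"
      using bound[of "Complex _ v" "Complex _ v'"] v C by (intro nn_integral_mono) (simp flip: ennreal_mult'')
    also have "\<dots> \<le> (\<integral>\<^sup>+u. ennreal (C * exp (- s * \<bar>u + 0\<bar>)) * ennreal (2 / s) \<partial>lborel)"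
      using nn_integral_exp_decay[OF s, of 0] by (intro nn_integral_mono) (simp add: nn_integral_cmult mult_left_mono)
    also have "\<dots> = ennreal C * (\<integral>\<^sup>+u. ennreal (exp (- s * \<bar>u + 0\<bar>)) \<partial>lborel) * ennreal (2 / s)"
      using C by (simp add: ennreal_mult nn_integral_cmult nn_integral_multc)
    also have "\<dots> \<le> ennreal C * ennreal (2 / s) * ennreal (2 / s)"
      using nn_integral_exp_decay[OF s, of 0] by (intro mult_right_mono mult_left_mono) auto
    also have "\<dots> < \<infinity>" by (simp add: ennreal_mult_less_top)
    finally have fin: "(\<integral>\<^sup>+u. (\<integral>\<^sup>+u'. ennreal (cmod (H (Complex u v) (Complex u' v'))) \<partial>lborel) \<partial>lborel) < \<infinity>" .
    note fub = fubini_swap[OF lborel.sigma_finite_measure_axioms lborel.sigma_finite_measure_axioms m fin]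
    show "(\<integral>u. (\<integral>u'. H (Complex u v) (Complex u' v') \<partial>lborel) \<partial>lborel) = (\<integral>u'. (\<integral>u. H (Complex u v) (Complex u' v') \<partial>lborel) \<partial>lborel)"
      by (rule fub(1))
    show "integrable lborel (\<lambda>u. \<integral>u'. H (Complex u v) (Complex u' v') \<partial>lborel)" by (rule fub(2))
    show "integrable lborel (\<lambda>u'. \<integral>u. H (Complex u v) (Complex u' v') \<partial>lborel)" by (rule fub(3))
  qed
  have "\<bar>\<gamma>\<bar> = \<gamma>" "\<bar>-\<gamma>\<bar> = \<gamma>" "\<bar>\<delta>\<bar> = \<delta>" "\<bar>-\<delta>\<bar> = \<delta>" using g by auto
  note v = this
  show ?thesis
    unfolding Cint_def
    by (simp add: i1[OF v(1,3)] i1[OF v(1,4)] i1[OF v(2,3)] i1[OF v(2,4)]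
      i2[OF v(1,3)] i2[OF v(1,4)] i2[OF v(2,3)] i2[OF v(2,4)]
      sw[OF v(1,3)] sw[OF v(1,4)] sw[OF v(2,3)] sw[OF v(2,4)] algebra_simps)
qed

text \<open>
  The law of cosines: with moduli \<open>a\<close>, \<open>b\<close> and angle \<open>p\<close> the squared distance is
  \<open>(a - b)\<^sup>2 + 4 a b sin\<^sup>2 (p / 2)\<close>, which dominates \<open>(a + b)\<^sup>2 sin\<^sup>2 (\<delta> / 2)\<close>.
\<close>

lemma cmod_exp_diff_ge:
  assumes "\<delta> \<le> \<bar>Im \<zeta> - Im \<eta>\<bar>" "\<bar>Im \<zeta> - Im \<eta>\<bar> \<le> 2 * pi - \<delta>" "0 < \<delta>"
  shows "(cmod (exp \<zeta>) + cmod (exp \<eta>)) * sin (\<delta> / 2) \<le> cmod (exp \<zeta> - exp \<eta>)"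
proof -
  define p where "p = \<bar>Im \<zeta> - Im \<eta>\<bar>"
  define a b where "a = exp (Re \<zeta>)" and "b = exp (Re \<eta>)"
  have ab: "a > 0" "b > 0" by (auto simp: a_def b_def)
  have d: "\<delta> \<le> pi" using assms by linarith
  have "(cmod (exp \<zeta> - exp \<eta>))\<^sup>2 = (a * cos (Im \<zeta>) - b * cos (Im \<eta>))\<^sup>2 + (a * sin (Im \<zeta>) - b * sin (Im \<eta>))\<^sup>2"
    by (simp add: cmod_power2 Re_exp Im_exp a_def b_def)
  also have "\<dots> = a\<^sup>2 * ((sin (Im \<zeta>))\<^sup>2 + (cos (Im \<zeta>))\<^sup>2) + b\<^sup>2 * ((sin (Im \<eta>))\<^sup>2 + (cos (Im \<eta>))\<^sup>2)
      - 2 * a * b * (cos (Im \<zeta>) * cos (Im \<eta>) + sin (Im \<zeta>) * sin (Im \<eta>))"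
    by algebra
  also have "\<dots> = a\<^sup>2 + b\<^sup>2 - 2 * a * b * cos (Im \<zeta> - Im \<eta>)"
    by (simp only: sin_cos_squared_add mult_1_right cos_diff)
  also have "cos (Im \<zeta> - Im \<eta>) = cos p" by (simp add: p_def)
  also have "cos p = 1 - 2 * (sin (p / 2))\<^sup>2"
    using cos_double_sin[of "p / 2"] by simp
  finally have eq: "(cmod (exp \<zeta> - exp \<eta>))\<^sup>2 = (a - b)\<^sup>2 + 4 * (a * b) * (sin (p / 2))\<^sup>2"
    by (simp add: power2_eq_square algebra_simps)
  have "sin (\<delta> / 2) \<le> sin (p / 2)"
  proof (cases "p \<le> pi")
    case True
    then show ?thesis using assms by (intro sin_monotone_2pi_le) (auto simp: p_def)
  next
    case False
    have "sin (\<delta> / 2) \<le> sin ((2 * pi - p) / 2)"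
      using assms False by (intro sin_monotone_2pi_le) (auto simp: p_def)
    also have "\<dots> = sin (p / 2)" using sin_pi_minus[of "p / 2"] by (simp add: diff_divide_distrib)
    finally show ?thesis .
  qed
  moreover have s0: "sin (\<delta> / 2) \<ge> 0" using assms d by (intro sin_ge_zero) auto
  ultimately have sq: "(sin (\<delta> / 2))\<^sup>2 \<le> (sin (p / 2))\<^sup>2" by (rule power_mono)
  have s1: "(sin (\<delta> / 2))\<^sup>2 \<le> 1" by (simp add: abs_square_le_1)
  have "((a + b) * sin (\<delta> / 2))\<^sup>2 = (a - b)\<^sup>2 * (sin (\<delta> / 2))\<^sup>2 + 4 * (a * b) * (sin (\<delta> / 2))\<^sup>2"
    by (simp add: power2_eq_square algebra_simps)
  also have "\<dots> \<le> (a - b)\<^sup>2 * 1 + 4 * (a * b) * (sin (p / 2))\<^sup>2"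
    using ab sq s1 by (intro add_mono mult_left_mono) auto
  finally have "((a + b) * sin (\<delta> / 2))\<^sup>2 \<le> (cmod (exp \<zeta> - exp \<eta>))\<^sup>2" using eq by simp
  then have "(a + b) * sin (\<delta> / 2) \<le> cmod (exp \<zeta> - exp \<eta>)"
    by (rule power2_le_imp_le) simp
  then show ?thesis by (simp add: a_def b_def)
qed

lemma exp_outside_sector:
  assumes "0 < \<theta>" "\<theta> < \<bar>Im \<zeta>\<bar>" "\<bar>Im \<zeta>\<bar> < 2 * pi - \<theta>"
  shows "exp \<zeta> \<in> - closure (sector \<theta>)"
proof -
  have th: "\<theta> < pi" using assms by linarith
  \<comment> \<open>A closed set that contains the sector, and outside of which \<open>exp \<zeta>\<close> lies.\<close>
  let ?H = "{w. cos \<theta> * cmod w \<le> Re w}"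
  have cl: "closed ?H" by (intro closed_Collect_le continuous_intros)
  have "sector \<theta> \<subseteq> ?H"
  proof
    fix w assume w: "w \<in> sector \<theta>"
    have e: "w = exp (Ln w)" "\<bar>Im (Ln w)\<bar> < \<theta>" using in_sector_Ln[OF w] by auto
    have "cos \<theta> \<le> cos \<bar>Im (Ln w)\<bar>"
      using e th by (intro cos_monotone_0_pi_le) auto
    then have "cos \<theta> \<le> cos (Im (Ln w))" by simp
    then have "cos \<theta> * cmod (exp (Ln w)) \<le> Re (exp (Ln w))" by (simp add: Re_exp mult.commute)
    then show "w \<in> ?H" using e(1) by simp
  qed
  then have sub: "closure (sector \<theta>) \<subseteq> ?H" using cl by (rule closure_minimal)
  have "cos \<bar>Im \<zeta>\<bar> < cos \<theta>"
  proof (cases "\<bar>Im \<zeta>\<bar> \<le> pi")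
    case True then show ?thesis using assms by (intro cos_monotone_0_pi) auto
  next
    case False
    have "cos (2 * pi - \<bar>Im \<zeta>\<bar>) < cos \<theta>" using assms False by (intro cos_monotone_0_pi) auto
    then show ?thesis by simp
  qed
  then have "Re (exp \<zeta>) < cos \<theta> * cmod (exp \<zeta>)" by (simp add: Re_exp mult.commute)
  then show ?thesis using sub by auto
qed

lemma norm_scaleC_blinfun:
  fixes T :: "'b::real_normed_vector \<Rightarrow>\<^sub>L 'a::complex_inner"
  shows "norm (scaleC_blinfun c T) = cmod c * norm T"
proof (rule antisym)
  show le: "norm (scaleC_blinfun c T) \<le> cmod c * norm T" for c and T :: "'b \<Rightarrow>\<^sub>L 'a"
    by (rule norm_blinfun_bound)
      (auto simp: scaleC_blinfun.rep_eq norm_scaleC mult.assoc intro!: mult_left_mono norm_blinfun)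
  show "cmod c * norm T \<le> norm (scaleC_blinfun c T)"
  proof (cases "c = 0")
    case False
    have "scaleC_blinfun (inverse c) (scaleC_blinfun c T) = T"
      by (rule blinfun_eqI) (use False in \<open>simp add: scaleC_blinfun.rep_eq scaleC_scaleC scaleC_one\<close>)
    then have "norm T \<le> cmod (inverse c) * norm (scaleC_blinfun c T)" using le[of "inverse c" "scaleC_blinfun c T"] by simp
    then have "cmod c * norm T \<le> cmod c * (cmod (inverse c) * norm (scaleC_blinfun c T))" by (rule mult_left_mono) simp
    also have "\<dots> = norm (scaleC_blinfun c T)" using False by (simp add: norm_inverse flip: mult.assoc)
    finally show ?thesis .
  qed simp
qed

lemma bounded_bilinear_scaleC_blinfun:
  "bounded_bilinear (scaleC_blinfun :: complex \<Rightarrow> ('b::real_normed_vector \<Rightarrow>\<^sub>L 'a::complex_inner) \<Rightarrow> ('b \<Rightarrow>\<^sub>L 'a))"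
proof
  show "scaleC_blinfun (a + a') b = scaleC_blinfun a b + scaleC_blinfun a' b" for a a' and b :: "'b \<Rightarrow>\<^sub>L 'a"
    by (rule blinfun_eqI) (simp add: scaleC_blinfun.rep_eq blinfun.add_left scaleC_add_left)
  show "scaleC_blinfun a (b + b') = scaleC_blinfun a b + scaleC_blinfun a b'" for a and b b' :: "'b \<Rightarrow>\<^sub>L 'a"
    by (rule blinfun_eqI) (simp add: scaleC_blinfun.rep_eq blinfun.add_left scaleC_add_right)
  show "scaleC_blinfun (r *\<^sub>R a) b = r *\<^sub>R scaleC_blinfun a b" for r a and b :: "'b \<Rightarrow>\<^sub>L 'a"
    by (rule blinfun_eqI) (simp add: scaleC_blinfun.rep_eq blinfun.scaleR_left scaleR_conv_of_real flip: scaleC_scaleC scaleC_of_real)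
  show "scaleC_blinfun a (r *\<^sub>R b) = r *\<^sub>R scaleC_blinfun a b" for r a and b :: "'b \<Rightarrow>\<^sub>L 'a"
    by (rule blinfun_eqI) (simp add: scaleC_blinfun.rep_eq blinfun.scaleR_left scaleC_scaleC mult.commute flip: scaleC_of_real)
  show "\<exists>K. \<forall>a (b :: 'b \<Rightarrow>\<^sub>L 'a). norm (scaleC_blinfun a b) \<le> norm a * norm b * K"
    by (rule exI[of _ 1]) (simp add: norm_scaleC_blinfun)
qed

lemma bounded_linear_cinner_blinfun:
  "bounded_linear (\<lambda>T :: 'a::complex_inner \<Rightarrow>\<^sub>L 'a. cinner (T x) y)"
  by (rule bounded_linear_compose[OF bounded_linear_cinner_left]) (rule blinfun.bounded_linear_left)

section \<open>The functional calculus of a sectorial pseudo-resolvent\<close>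

text \<open>
  What the functional calculus uses of the resolvent of a sectorial operator. The resolvent of the adjoint
  satisfies the same conditions, so that every result below is available for both operators.
\<close>

locale sectorial_family =
  fixes \<omega> :: real and R :: "complex \<Rightarrow> 'a::complex_hilbert \<Rightarrow>\<^sub>L 'a"
  assumes omega: "0 < \<omega>" "\<omega> < pi"
    and R_scaleC: "\<And>z c x. z \<in> - closure (sector \<omega>) \<Longrightarrow> R z (c *\<^sub>C x) = c *\<^sub>C R z x"
    and R_identity: "\<And>z w x. z \<in> - closure (sector \<omega>) \<Longrightarrow> w \<in> - closure (sector \<omega>) \<Longrightarrow>
       R z x - R w x = (w - z) *\<^sub>C R z (R w x)"
    and R_bound: "\<And>\<theta>'. \<omega> < \<theta>' \<Longrightarrow> \<theta>' < pi \<Longrightarrow> \<exists>K>0. \<forall>z\<in>- closure (sector \<theta>'). cmod z * norm (R z) \<le> K"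
begin

lemma R_dist:
  assumes "z \<in> - closure (sector \<omega>)" "w \<in> - closure (sector \<omega>)"
  shows "norm (R z - R w) \<le> cmod (z - w) * norm (R w) * norm (R z)"
proof (rule norm_blinfun_bound)
  fix x
  have "(R z - R w) x = - (R w x - R z x)" by (simp add: blinfun.diff_left)
  also have "R w x - R z x = (z - w) *\<^sub>C R w (R z x)" by (rule R_identity) fact+
  finally have "norm ((R z - R w) x) = cmod (z - w) * norm (R w (R z x))" by (simp add: norm_scaleC)
  also have "\<dots> \<le> cmod (z - w) * (norm (R w) * (norm (R z) * norm x))"
    by (intro mult_left_mono order_trans[OF norm_blinfun] norm_blinfun) auto
  finally show "norm ((R z - R w) x) \<le> cmod (z - w) * norm (R w) * norm (R z) * norm x" by (simp add: mult_ac)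
qed simp

lemma R_tendsto:
  assumes w: "w \<in> - closure (sector \<omega>)"
  shows "(R \<longlongrightarrow> R w) (at w)"
proof -
  let ?U = "- closure (sector \<omega>)"
  let ?d = "1 / (2 * (norm (R w) + 1))"
  have "\<forall>\<^sub>F z in at w. z \<in> ?U" 
    using w by (intro eventually_at_in_open') auto
  moreover have "\<forall>\<^sub>F z in at w. dist z w < ?d"
    by (rule eventually_at_ball'[THEN eventually_mono, of ?d w UNIV]) (auto simp: dist_commute add_nonneg_pos)
  ultimately have ev: "\<forall>\<^sub>F z in at w. norm (R z - R w) \<le> cmod (z - w) * (2 * norm (R w) * norm (R w))"
  proof eventually_elim
    case (elim z)
    have p: "norm (R w) + 1 > 0" by (simp add: add_nonneg_pos)
    have e: "cmod (z - w) < ?d" using elim(2) by (simp add: dist_norm)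
    have h: "cmod (z - w) * norm (R w) \<le> 1 / 2"
    proof -
      have "cmod (z - w) * norm (R w) \<le> ?d * (norm (R w) + 1)"
        using e p by (intro mult_mono) auto
      also have "\<dots> = 1 / 2" using p by simp
      finally show ?thesis .
    qed
    \<comment> \<open>Absorbing the term with \<open>norm (R z)\<close> bounds the family near \<open>w\<close>.\<close>
    have "norm (R z) \<le> norm (R w) + norm (R z - R w)" using norm_triangle_ineq[of "R w" "R z - R w"] by simp
    also have "\<dots> \<le> norm (R w) + (cmod (z - w) * norm (R w)) * norm (R z)"
      using R_dist[OF elim(1) w] by simp
    also have "\<dots> \<le> norm (R w) + 1 / 2 * norm (R z)" using h by (intro add_left_mono mult_right_mono) auto
    finally have b: "norm (R z) \<le> 2 * norm (R w)" by simp
    have "norm (R z - R w) \<le> cmod (z - w) * norm (R w) * norm (R z)" by (rule R_dist[OF elim(1) w])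
    also have "\<dots> \<le> cmod (z - w) * norm (R w) * (2 * norm (R w))" using b by (intro mult_left_mono) auto
    finally show ?case by (simp add: mult_ac)
  qed
  have "((\<lambda>z. cmod (z - w) * (2 * norm (R w) * norm (R w))) \<longlongrightarrow> cmod (w - w) * (2 * norm (R w) * norm (R w))) (at w)"
    by (intro tendsto_intros)
  then have "((\<lambda>z. R z - R w) \<longlongrightarrow> 0) (at w)"
    by (intro Lim_null_comparison[OF ev]) simp
  then show ?thesis by (simp add: Lim_null[symmetric])
qed

lemma R_continuous: "continuous_on (- closure (sector \<omega>)) R"
  by (auto intro!: continuous_at_imp_continuous_on simp: isCont_def R_tendsto)

lemma R_holomorphic: "(\<lambda>z. cinner (R z x) y) holomorphic_on - closure (sector \<omega>)"
proof (rule holomorphic_onI)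
  fix w assume w: "w \<in> - closure (sector \<omega>)"
  have "((\<lambda>z. - cinner (R z (R w x)) y) \<longlongrightarrow> - cinner (R w (R w x)) y) (at w)"
    by (intro tendsto_minus bounded_linear.tendsto[OF bounded_linear_cinner_blinfun] R_tendsto w)
  then have "((\<lambda>z. (cinner (R z x) y - cinner (R w x) y) / (z - w)) \<longlongrightarrow> - cinner (R w (R w x)) y) (at w)"
  proof (rule Lim_transform_eventually)
    have "\<forall>\<^sub>F z in at w. z \<in> - closure (sector \<omega>) - {w}" using w by (intro eventually_at_in_open) auto
    then show "\<forall>\<^sub>F z in at w. - cinner (R z (R w x)) y = (cinner (R z x) y - cinner (R w x) y) / (z - w)"
    proof eventually_elim
      case (elim z)
      have "cinner (R z x) y - cinner (R w x) y = (w - z) * cinner (R z (R w x)) y"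
        using R_identity[of z w x] elim w by (simp flip: cinner_diff_left add: cinner_scaleC_left)
      then show ?case using elim by (simp add: field_simps)
    qed
  qed
  then have "((\<lambda>z. cinner (R z x) y) has_field_derivative - cinner (R w (R w x)) y) (at w)"
    by (simp add: has_field_derivative_iff)
  then show "(\<lambda>z. cinner (R z x) y) field_differentiable at w within - closure (sector \<omega>)"
    using field_differentiable_at_within field_differentiable_def by blast
qed

text \<open>
  The scalar integrand of the calculus in the coordinate \<open>\<zeta>\<close>, including the factor from \<open>dz = z d\<zeta>\<close>. It is
  bounded where \<open>\<bar>Im \<zeta>\<bar>\<close> lies in a compact subinterval of the open interval from \<open>\<omega>\<close> to \<open>2 \<pi> - \<omega>\<close>.
\<close>

definition M :: "complex \<Rightarrow> 'a \<Rightarrow> 'a \<Rightarrow> complex" where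
  "M \<zeta> x y = exp \<zeta> * cinner (R (exp \<zeta>) x) y"

lemma M_holomorphic:
  assumes "\<And>\<zeta>. \<zeta> \<in> S \<Longrightarrow> \<omega> < \<bar>Im \<zeta>\<bar> \<and> \<bar>Im \<zeta>\<bar> < 2 * pi - \<omega>"
  shows "(\<lambda>\<zeta>. M \<zeta> x y) holomorphic_on S"
proof -
  have "((\<lambda>z. cinner (R z x) y) \<circ> exp) holomorphic_on S"
    by (rule holomorphic_on_compose_gen[OF _ R_holomorphic])
      (use assms omega exp_outside_sector in \<open>auto intro!: holomorphic_intros simp del: Compl_iff\<close>)
  then show ?thesis unfolding M_def o_def by (intro holomorphic_intros)
qed

lemma R_strip_bound:
  assumes "\<omega> < \<gamma>" "\<gamma> < pi"
  shows "\<exists>K>0. \<forall>\<zeta>. \<gamma> \<le> \<bar>Im \<zeta>\<bar> \<longrightarrow> \<bar>Im \<zeta>\<bar> \<le> 2 * pi - \<gamma> \<longrightarrow> cmod (exp \<zeta>) * norm (R (exp \<zeta>)) \<le> K"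
proof -
  define \<theta>' where "\<theta>' = (\<omega> + \<gamma>) / 2"
  have t: "\<omega> < \<theta>'" "\<theta>' < \<gamma>" "\<theta>' < pi" "0 < \<theta>'" using assms omega by (auto simp: \<theta>'_def)
  obtain K where K: "K > 0" "\<And>z. z \<in> - closure (sector \<theta>') \<Longrightarrow> cmod z * norm (R z) \<le> K"
    using R_bound[OF t(1,3)] by blast
  have b: "cmod (exp \<zeta>) * norm (R (exp \<zeta>)) \<le> K" if "\<gamma> \<le> \<bar>Im \<zeta>\<bar>" "\<bar>Im \<zeta>\<bar> \<le> 2 * pi - \<gamma>" for \<zeta>
    by (rule K(2), rule exp_outside_sector) (use t that in auto)
  then show ?thesis using K(1) by auto
qed

lemma M_bound:
  assumes "\<omega> < \<gamma>" "\<gamma> < pi"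
  shows "\<exists>K>0. \<forall>\<zeta> x y. \<gamma> \<le> \<bar>Im \<zeta>\<bar> \<longrightarrow> \<bar>Im \<zeta>\<bar> \<le> 2 * pi - \<gamma> \<longrightarrow> cmod (M \<zeta> x y) \<le> K * norm x * norm y"
proof -
  obtain K where K: "K > 0"
   and b: "\<And>\<zeta>. \<gamma> \<le> \<bar>Im \<zeta>\<bar> \<Longrightarrow> \<bar>Im \<zeta>\<bar> \<le> 2 * pi - \<gamma> \<Longrightarrow> cmod (exp \<zeta>) * norm (R (exp \<zeta>)) \<le> K"
    using R_strip_bound[OF assms] by auto
  have "cmod (M \<zeta> x y) \<le> K * norm x * norm y" if "\<gamma> \<le> \<bar>Im \<zeta>\<bar>" "\<bar>Im \<zeta>\<bar> \<le> 2 * pi - \<gamma>" for \<zeta> x y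
  proof -
    have "cmod (M \<zeta> x y) \<le> cmod (exp \<zeta>) * (norm (R (exp \<zeta>)) * norm x * norm y)"
      unfolding M_def norm_mult
      by (intro mult_left_mono order_trans[OF norm_cinner_le] mult_right_mono norm_blinfun) auto
    also have "\<dots> = (cmod (exp \<zeta>) * norm (R (exp \<zeta>))) * (norm x * norm y)" by (simp only: mult_ac)
    also have "\<dots> \<le> K * (norm x * norm y)" by (rule mult_right_mono[OF b[OF that]]) simp
    finally show ?thesis by (simp only: mult_ac)
  qed
  then show ?thesis using K by auto
qed

text \<open>
  The integral that defines \<open>fcalc_path\<close>, with \<open>R\<close> in place of the resolvent of an operator.
\<close>

definition op :: "real \<Rightarrow> (complex \<Rightarrow> complex) \<Rightarrow> ('a \<Rightarrow>\<^sub>L 'a)" where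
  "op \<gamma> f = scaleC_blinfun (1 / (2 * complex_of_real pi * \<i>))
       (integral UNIV (\<lambda>t. scaleC_blinfun
          (f (sector_path \<gamma> t) * vector_derivative (sector_path \<gamma>) (at t))
          (R (sector_path \<gamma> t))))"

lemma sector_path_neg:
  assumes "t < 0"
  shows "sector_path \<gamma> t = exp (Complex (ln (- t)) \<gamma>)"
    "vector_derivative (sector_path \<gamma>) (at t) = - exp (\<i> * of_real \<gamma>)"
proof -
  show "sector_path \<gamma> t = exp (Complex (ln (- t)) \<gamma>)"
    using assms by (simp add: sector_path_def Complex_eq exp_add exp_of_real)
  have "((\<lambda>t. - complex_of_real t * exp (\<i> * of_real \<gamma>)) has_vector_derivative (- exp (\<i> * of_real \<gamma>))) (at t)"
    by (auto intro!: derivative_eq_intros)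
  then have "(sector_path \<gamma> has_vector_derivative (- exp (\<i> * of_real \<gamma>))) (at t)"
    by (rule has_vector_derivative_transform_within_open[of _ _ _ "{..<0}"]) (use assms in \<open>auto simp: sector_path_def\<close>)
  then show "vector_derivative (sector_path \<gamma>) (at t) = - exp (\<i> * of_real \<gamma>)"
    by (rule vector_derivative_at)
qed

lemma sector_path_pos:
  assumes "t > 0"
  shows "sector_path \<gamma> t = exp (Complex (ln t) (- \<gamma>))"
    "vector_derivative (sector_path \<gamma>) (at t) = exp (- \<i> * of_real \<gamma>)"
proof -
  show "sector_path \<gamma> t = exp (Complex (ln t) (- \<gamma>))"
    using assms by (simp add: sector_path_def Complex_eq exp_diff exp_minus exp_of_real field_simps)
  have "((\<lambda>t. complex_of_real t * exp (- \<i> * of_real \<gamma>)) has_vector_derivative (exp (- \<i> * of_real \<gamma>))) (at t)"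
    by (auto intro!: derivative_eq_intros)
  then have "(sector_path \<gamma> has_vector_derivative (exp (- \<i> * of_real \<gamma>))) (at t)"
    by (rule has_vector_derivative_transform_within_open[of _ _ _ "{0<..}"]) (use assms in \<open>auto simp: sector_path_def\<close>)
  then show "vector_derivative (sector_path \<gamma>) (at t) = exp (- \<i> * of_real \<gamma>)"
    by (rule vector_derivative_at)
qed

text \<open>
  The substitution \<open>z = exp \<zeta>\<close> in the integral of operators, after pairing with two vectors. All further
  properties of \<open>op\<close> are derived from these scalar integrals.
\<close>

lemma op_weak:
  assumes f: "sector_decay \<theta> s c f" "s > 0" and g: "\<omega> < \<gamma>" "\<gamma> < \<theta>" "\<theta> \<le> pi"
  shows "cinner (op \<gamma> f x) y = Cint \<gamma> (\<lambda>\<zeta>. f (exp \<zeta>) * M \<zeta> x y)"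
proof -
  have gp: "\<gamma> < pi" "0 < \<gamma>" "0 < \<theta>" using g omega by linarith+
  obtain K where K: "K > 0" "\<And>\<zeta>. \<gamma> \<le> \<bar>Im \<zeta>\<bar> \<Longrightarrow> \<bar>Im \<zeta>\<bar> \<le> 2 * pi - \<gamma> \<Longrightarrow> cmod (exp \<zeta>) * norm (R (exp \<zeta>)) \<le> K"
    using R_strip_bound[OF g(1) gp(1)] by auto
  have c: "c \<ge> 0" using sector_decay_nonneg[OF f(1) gp(3)] .
  define w where "w v u = scaleC_blinfun (f (exp (Complex u v)) * exp (Complex u v)) (R (exp (Complex u v)))" for v u
  have fh: "(\<lambda>\<zeta>. f (exp \<zeta>)) holomorphic_on {\<zeta>. \<bar>Im \<zeta>\<bar> < \<theta>}"
    by (rule holomorphic_exp_sector) (use f g in \<open>auto simp: sector_decay_def\<close>)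
  have cont: "continuous_on UNIV (w v)" if v: "\<bar>v\<bar> = \<gamma>" for v
    unfolding w_def
  proof (intro bounded_bilinear.continuous_on[OF bounded_bilinear_scaleC_blinfun] continuous_intros)
    show "continuous_on UNIV (\<lambda>u. f (exp (Complex u v)))"
      by (rule continuous_line[OF fh]) (use v g in auto)
    show "continuous_on UNIV (\<lambda>u. R (exp (Complex u v)))"
    proof (rule continuous_on_compose2[OF R_continuous])
      show "continuous_on UNIV (\<lambda>u. exp (Complex u v))" unfolding Complex_eq by (intro continuous_intros)
      show "range (\<lambda>u. exp (Complex u v)) \<subseteq> - closure (sector \<omega>)"
        by (rule image_subsetI, rule exp_outside_sector[OF omega(1)]) (use v g gp in auto)
    qed
  qed
  have bound: "norm (w v u) \<le> (c * K) * exp (- s * \<bar>u\<bar>)" if v: "\<bar>v\<bar> = \<gamma>" for u v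
  proof -
    have "norm (w v u) = cmod (f (exp (Complex u v))) * (cmod (exp (Complex u v)) * norm (R (exp (Complex u v))))"
      by (simp add: w_def norm_scaleC_blinfun norm_mult mult_ac)
    also have "\<dots> \<le> (c * exp (- s * \<bar>u\<bar>)) * K"
      using sector_decay_exp[OF f(1) g(3), of "Complex u v"] K(2)[of "Complex u v"] v g gp c
      by (intro mult_mono) auto
    finally show ?thesis by (simp add: mult_ac)
  qed
  let ?h = "\<lambda>t. scaleC_blinfun (f (sector_path \<gamma> t) * vector_derivative (sector_path \<gamma>) (at t)) (R (sector_path \<gamma> t))"
  have sc: "r *\<^sub>R scaleC_blinfun k T = scaleC_blinfun (of_real r * k) T" for r k and T :: "'a \<Rightarrow>\<^sub>L 'a"
    by (rule blinfun_eqI) (simp add: blinfun.scaleR_left scaleC_blinfun.rep_eq flip: scaleC_of_real scaleC_scaleC)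
  have neg: "?h t = (1 / t) *\<^sub>R w \<gamma> (ln (- t))" if "t < 0" for t
  proof -
    have "exp (Complex (ln (- t)) \<gamma>) = - of_real t * exp (\<i> * of_real \<gamma>)"
      using that by (simp add: Complex_eq exp_add exp_of_real)
    then show ?thesis unfolding w_def sc sector_path_neg[OF that] using that by simp
  qed
  have pos: "?h t = (1 / t) *\<^sub>R w (-\<gamma>) (ln t)" if "t > 0" for t
  proof -
    have "exp (Complex (ln t) (- \<gamma>)) = of_real t * exp (- \<i> * of_real \<gamma>)"
      using that by (simp add: Complex_eq exp_diff exp_minus exp_of_real field_simps)
    then show ?thesis unfolding w_def sc sector_path_pos[OF that] using that by simp
  qed
  obtain I where I: "(?h has_integral I) UNIV"
    "\<And>\<phi> :: ('a \<Rightarrow>\<^sub>L 'a) \<Rightarrow> complex. bounded_linear \<phi> \<Longrightarrow> \<phi> I = (\<integral>u. \<phi> (w (-\<gamma>) u) \<partial>lborel) - (\<integral>u. \<phi> (w \<gamma> u) \<partial>lborel)"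
  proof -
    have v: "\<bar>\<gamma>\<bar> = \<gamma>" "\<bar>- \<gamma>\<bar> = \<gamma>" using gp by auto
    show ?thesis
      using has_integral_two_rays[OF f(2) cont[OF v(1)] bound[OF v(1)] cont[OF v(2)] bound[OF v(2)] neg pos] that
      by auto
  qed
  have "cinner (op \<gamma> f x) y = 1 / (2 * complex_of_real pi * \<i>) * cinner (blinfun_apply I x) y"
    unfolding op_def using I(1) by (simp add: integral_unique scaleC_blinfun.rep_eq cinner_scaleC_left)
  also have "cinner (blinfun_apply I x) y = (\<integral>u. cinner (blinfun_apply (w (-\<gamma>) u) x) y \<partial>lborel) - (\<integral>u. cinner (blinfun_apply (w \<gamma> u) x) y \<partial>lborel)"
    by (rule I(2)[OF bounded_linear_cinner_blinfun])
  finally show ?thesis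
    by (simp add: Cint_def w_def scaleC_blinfun.rep_eq cinner_scaleC_left M_def mult_ac)
qed

lemma integrand_integrable:
  assumes f: "sector_decay \<theta> s c f" "s > 0" and g: "\<omega> < \<gamma>" "\<gamma> < \<theta>" "\<theta> \<le> pi" and v: "\<bar>v\<bar> = \<gamma>"
  shows "integrable lborel (\<lambda>u. f (exp (Complex u v)) * M (Complex u v) x y)"
proof -
  have gp: "\<gamma> < pi" "0 < \<gamma>" "0 < \<theta>" using g omega by linarith+
  obtain K where K: "K > 0" 
    "\<And>\<zeta> x y. \<gamma> \<le> \<bar>Im \<zeta>\<bar> \<Longrightarrow> \<bar>Im \<zeta>\<bar> \<le> 2 * pi - \<gamma> \<Longrightarrow> cmod (M \<zeta> x y) \<le> K * norm x * norm y"
    using M_bound[OF g(1) gp(1)] by auto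
  have c: "c \<ge> 0" using sector_decay_nonneg[OF f(1) gp(3)] .
  show ?thesis
  proof (rule integrable_exp_decay_bound(1)[OF f(2), of _ "c * (K * norm x * norm y)" 0])
    have "(\<lambda>\<zeta>. f (exp \<zeta>) * M \<zeta> x y) holomorphic_on {\<zeta>. \<omega> < \<bar>Im \<zeta>\<bar> \<and> \<bar>Im \<zeta>\<bar> < \<theta>}"
      using f g by (intro holomorphic_on_mult holomorphic_exp_sector[of _ \<theta>] M_holomorphic) (auto simp: sector_decay_def)
    then have "continuous_on UNIV (\<lambda>u. f (exp (Complex u v)) * M (Complex u v) x y)"
      by (rule continuous_line) (use g v in auto)
    then show "(\<lambda>u. f (exp (Complex u v)) * M (Complex u v) x y) \<in> borel_measurable borel"
      by (rule borel_measurable_continuous_onI)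
    show "cmod (f (exp (Complex u v)) * M (Complex u v) x y) \<le> c * (K * norm x * norm y) * exp (- s * \<bar>u + 0\<bar>)" for u
    proof -
      have "cmod (f (exp (Complex u v)) * M (Complex u v) x y) \<le> (c * exp (- s * \<bar>u\<bar>)) * (K * norm x * norm y)"
        unfolding norm_mult
        using sector_decay_exp[OF f(1) g(3), of "Complex u v"] K(2)[of "Complex u v" x y] v g gp c
        by (intro mult_mono) auto
      then show ?thesis by (simp add: mult_ac)
    qed
  qed
qed

text \<open>
  By Cauchy's theorem in the strips between the lines \<open>Im \<zeta> = \<gamma>\<close> and \<open>Im \<zeta> = \<delta>\<close>, above and below the real
  axis.
\<close>

lemma op_independent:
  assumes f: "sector_decay \<theta> s c f" "s > 0" and g: "\<omega> < \<gamma>" "\<gamma> < \<theta>" "\<omega> < \<delta>" "\<delta> < \<theta>" "\<theta> \<le> pi"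
  shows "op \<gamma> f = op \<delta> f"
proof -
  have *: "op \<gamma> f = op \<delta> f" if g: "\<omega> < \<gamma>" "\<gamma> < \<delta>" "\<delta> < \<theta>" for \<gamma> \<delta>
  proof (rule blinfun_eqI, rule cinner_ext)
    fix x y
    have gp: "\<gamma> < pi" "0 < \<gamma>" "0 < \<theta>" "\<gamma> < \<theta>" "\<omega> < \<delta>" using g omega \<open>\<theta> \<le> pi\<close> by linarith+
    have c: "c \<ge> 0" using sector_decay_nonneg[OF f(1) gp(3)] .
    obtain K where K: "K > 0" 
      "\<And>\<zeta> x y. \<gamma> \<le> \<bar>Im \<zeta>\<bar> \<Longrightarrow> \<bar>Im \<zeta>\<bar> \<le> 2 * pi - \<gamma> \<Longrightarrow> cmod (M \<zeta> x y) \<le> K * norm x * norm y"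
      using M_bound[OF g(1) gp(1)] by auto
    let ?Q = "\<lambda>\<zeta>. f (exp \<zeta>) * M \<zeta> x y"
    have hol: "?Q holomorphic_on {\<zeta>. \<omega> < \<bar>Im \<zeta>\<bar> \<and> \<bar>Im \<zeta>\<bar> < \<theta>}"
      using f \<open>\<theta> \<le> pi\<close> by (intro holomorphic_on_mult holomorphic_exp_sector[of _ \<theta>] M_holomorphic) (auto simp: sector_decay_def)
    have bd: "cmod (?Q \<zeta>) \<le> (c * (K * norm x * norm y)) * exp (- s * \<bar>Re \<zeta>\<bar>)" if "\<gamma> \<le> \<bar>Im \<zeta>\<bar>" "\<bar>Im \<zeta>\<bar> \<le> \<delta>" for \<zeta>
    proof -
      have "cmod (?Q \<zeta>) \<le> (c * exp (- s * \<bar>Re \<zeta>\<bar>)) * (K * norm x * norm y)"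
        unfolding norm_mult
        using sector_decay_exp[OF f(1) \<open>\<theta> \<le> pi\<close>, of \<zeta>] K(2)[of \<zeta> x y] that g gp c \<open>\<theta> \<le> pi\<close>
        by (intro mult_mono) auto
      then show ?thesis by (simp add: mult_ac)
    qed
    \<comment> \<open>The case of a holomorphic integrand: the residue terms are given coefficient \<open>0\<close> and placed at an
      arbitrary point of the strip.\<close>
    have up: "(\<integral>u. ?Q (Complex u \<gamma>) \<partial>lborel) - (\<integral>u. ?Q (Complex u \<delta>) \<partial>lborel) = 2 * pi * \<i> * (0 * 0 + 0 * 0)"
    proof (rule strip_residue[where P = "\<lambda>_. 0" and ?P0.0 = ?Q and a = \<omega> and b = \<theta> and ?z1.0 = "Complex 0 ((\<gamma>+\<delta>)/2)" 
          and ?z2.0 = "Complex 0 ((\<gamma>+\<delta>)/2)" and s = s and C = "c * (K * norm x * norm y)" and ?N0.0 = 0])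
      show "?Q holomorphic_on {\<zeta>. \<omega> < Im \<zeta> \<and> Im \<zeta> < \<theta>}"
        by (rule holomorphic_on_subset[OF hol]) (use omega in auto)
      show "integrable lborel (\<lambda>u. ?Q (Complex u \<gamma>))" "integrable lborel (\<lambda>u. ?Q (Complex u \<delta>))"
        by (rule integrand_integrable[OF f], use g gp \<open>\<theta> \<le> pi\<close> omega in auto)+
    qed (use g gp omega f \<open>\<theta> \<le> pi\<close> bd in auto)
    have down: "(\<integral>u. ?Q (Complex u (-\<delta>)) \<partial>lborel) - (\<integral>u. ?Q (Complex u (-\<gamma>)) \<partial>lborel) = 2 * pi * \<i> * (0 * 0 + 0 * 0)"
    proof (rule strip_residue[where P = "\<lambda>_. 0" and ?P0.0 = ?Q and a = "-\<theta>" and b = "-\<omega>" and ?z1.0 = "Complex 0 (-(\<gamma>+\<delta>)/2)" 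
          and ?z2.0 = "Complex 0 (-(\<gamma>+\<delta>)/2)" and s = s and C = "c * (K * norm x * norm y)" and ?N0.0 = 0])
      show "?Q holomorphic_on {\<zeta>. -\<theta> < Im \<zeta> \<and> Im \<zeta> < -\<omega>}"
        by (rule holomorphic_on_subset[OF hol]) (use omega in auto)
      show "integrable lborel (\<lambda>u. ?Q (Complex u (-\<gamma>)))" "integrable lborel (\<lambda>u. ?Q (Complex u (-\<delta>)))"
        by (rule integrand_integrable[OF f], use g gp \<open>\<theta> \<le> pi\<close> omega in auto)+
    qed (use g gp omega f \<open>\<theta> \<le> pi\<close> bd in auto)
    have "Cint \<gamma> ?Q = Cint \<delta> ?Q" using up down by (simp add: Cint_def)
    then show "cinner (op \<gamma> f x) y = cinner (op \<delta> f x) y"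
      using op_weak[OF f] g gp \<open>\<theta> \<le> pi\<close> by simp
  qed
  consider "\<gamma> < \<delta>" | "\<gamma> = \<delta>" | "\<delta> < \<gamma>" by linarith
  then show ?thesis by cases (use * g in auto)
qed

lemma op_norm_le:
  assumes f: "sector_decay \<theta> s c f" "s > 0" and g: "\<omega> < \<gamma>" "\<gamma> < \<theta>" "\<theta> \<le> pi"
    and K: "K \<ge> 0" "\<And>\<zeta> x y. \<bar>Im \<zeta>\<bar> = \<gamma> \<Longrightarrow> cmod (M \<zeta> x y) \<le> K * norm x * norm y"
    and h: "integrable lborel h" "\<And>u v. \<bar>v\<bar> = \<gamma> \<Longrightarrow> cmod (f (exp (Complex u v))) \<le> h u"
  shows "norm (op \<gamma> f) \<le> K / pi * (\<integral>u. h u \<partial>lborel)"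
proof -
  have gp: "\<gamma> < pi" "0 < \<gamma>" "0 < \<theta>" using g omega by linarith+
  have hn: "h u \<ge> 0" for u using h(2)[of \<gamma> u] gp by (meson abs_of_pos norm_ge_zero order_trans)
  have h0: "(\<integral>u. h u \<partial>lborel) \<ge> 0" using hn by simp
  show ?thesis
  proof (rule norm_blinfun_bound)
    show "0 \<le> K / pi * (\<integral>u. h u \<partial>lborel)" using K h0 by simp
    fix x
    show "norm (op \<gamma> f x) \<le> K / pi * (\<integral>u. h u \<partial>lborel) * norm x"
    proof (rule norm_le_if_cinner_le)
      show "0 \<le> K / pi * (\<integral>u. h u \<partial>lborel) * norm x" using K h0 by simp
      fix y
      let ?Q = "\<lambda>\<zeta>. f (exp \<zeta>) * M \<zeta> x y"
      have b: "cmod (\<integral>u. ?Q (Complex u v) \<partial>lborel) \<le> (\<integral>u. h u \<partial>lborel) * (K * norm x * norm y)" if v: "\<bar>v\<bar> = \<gamma>" for v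
      proof -
        have "cmod (\<integral>u. ?Q (Complex u v) \<partial>lborel) \<le> (\<integral>u. h u * (K * norm x * norm y) \<partial>lborel)"
        proof (rule Bochner_Integration.integral_norm_bound_integral)
          show "integrable lborel (\<lambda>u. ?Q (Complex u v))" by (rule integrand_integrable[OF f g v])
          show "integrable lborel (\<lambda>u. h u * (K * norm x * norm y))" using h by simp
          show "cmod (?Q (Complex u v)) \<le> h u * (K * norm x * norm y)" for u
            unfolding norm_mult using h(2)[OF v] K(2)[of "Complex u v"] hn v by (intro mult_mono) auto
        qed
        then show ?thesis by simp
      qed
      have "cmod (cinner (op \<gamma> f x) y) = 1 / (2 * pi) * cmod ((\<integral>u. ?Q (Complex u (-\<gamma>)) \<partial>lborel) - (\<integral>u. ?Q (Complex u \<gamma>) \<partial>lborel))"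
        unfolding op_weak[OF f g] Cint_def by (simp add: norm_mult norm_divide)
      also have "\<dots> \<le> 1 / (2 * pi) * ((\<integral>u. h u \<partial>lborel) * (K * norm x * norm y) + (\<integral>u. h u \<partial>lborel) * (K * norm x * norm y))"
        using b[of \<gamma>] b[of "-\<gamma>"] gp by (intro mult_left_mono order_trans[OF norm_triangle_ineq4] add_mono) auto
      also have "\<dots> = K / pi * (\<integral>u. h u \<partial>lborel) * norm x * norm y" by (simp add: field_simps)
      finally show "cmod (cinner (op \<gamma> f x) y) \<le> K / pi * (\<integral>u. h u \<partial>lborel) * norm x * norm y" .
    qed
  qed
qed

end

lemma line_integrable:
  assumes "h holomorphic_on S" "\<And>u. Complex u v \<in> S" "s > 0" "\<And>u. cmod (h (Complex u v)) \<le> C * exp (- s * \<bar>u\<bar>)"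
  shows "integrable lborel (\<lambda>u. h (Complex u v))"
  by (rule integrable_exp_decay_bound(1)[where C = C and v = 0, OF assms(3) borel_measurable_continuous_onI[OF continuous_line[OF assms(1,2)]]])
    (use assms(4) in simp)

text \<open>
  The kernels of Cauchy's formula in the coordinate \<open>\<zeta>\<close> are bounded when the arguments are separated.
\<close>

lemma exp_quotient_le:
  assumes "\<delta> \<le> \<bar>Im \<zeta> - Im \<eta>\<bar>" "\<bar>Im \<zeta> - Im \<eta>\<bar> \<le> 2 * pi - \<delta>" "0 < \<delta>"
  shows "exp \<zeta> \<noteq> exp \<eta>" "cmod (exp \<zeta> / (exp \<zeta> - exp \<eta>)) \<le> 1 / sin (\<delta> / 2)"
    "cmod (exp \<eta> / (exp \<zeta> - exp \<eta>)) \<le> 1 / sin (\<delta> / 2)" "sin (\<delta> / 2) > 0"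
proof -
  have "\<delta> \<le> pi" using assms by linarith
  then show s: "sin (\<delta> / 2) > 0" using assms(3) by (intro sin_gt_zero) auto
  have ge: "(cmod (exp \<zeta>) + cmod (exp \<eta>)) * sin (\<delta> / 2) \<le> cmod (exp \<zeta> - exp \<eta>)"
    by (rule cmod_exp_diff_ge[OF assms])
  have "0 < (cmod (exp \<zeta>) + cmod (exp \<eta>)) * sin (\<delta> / 2)" using s by (intro mult_pos_pos add_pos_pos) auto
  then have pos: "0 < cmod (exp \<zeta> - exp \<eta>)" using ge by linarith
  then show "exp \<zeta> \<noteq> exp \<eta>" by auto
  have "cmod (exp \<zeta>) * sin (\<delta> / 2) \<le> cmod (exp \<zeta> - exp \<eta>)" "cmod (exp \<eta>) * sin (\<delta> / 2) \<le> cmod (exp \<zeta> - exp \<eta>)"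
    using ge s by (auto simp: distrib_right intro: order_trans[rotated])
  then show "cmod (exp \<zeta> / (exp \<zeta> - exp \<eta>)) \<le> 1 / sin (\<delta> / 2)" "cmod (exp \<eta> / (exp \<zeta> - exp \<eta>)) \<le> 1 / sin (\<delta> / 2)"
    using pos s by (simp_all add: norm_divide field_simps)
qed

text \<open>
  Cauchy's integral formula for the sector. Since
  \<open>exp \<zeta> / (exp \<zeta> - exp \<eta>) = 1 + 1 / (exp (\<zeta> - \<eta>) - 1)\<close>, it is a residue in the strip.
\<close>

lemma Cint_cauchy_inside:
  assumes P: "P holomorphic_on {\<zeta>. \<bar>Im \<zeta>\<bar> < \<theta>}" "\<theta> \<le> pi" and s: "s > 0"
    and b: "\<And>\<zeta>. \<bar>Im \<zeta>\<bar> < \<theta> \<Longrightarrow> cmod (P \<zeta>) \<le> C * exp (- s * \<bar>Re \<zeta>\<bar>)"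
    and z: "\<bar>Im \<eta>\<bar> < \<gamma>" "\<gamma> < \<theta>"
  shows "Cint \<gamma> (\<lambda>\<zeta>. P \<zeta> * (exp \<zeta> / (exp \<zeta> - exp \<eta>))) = P \<eta>"
proof -
  have g: "0 < \<gamma>" "0 < \<theta>" using z by auto
  let ?Q = "\<lambda>\<zeta>. P \<zeta> * (exp \<zeta> / (exp \<zeta> - exp \<eta>))"
  have C: "C \<ge> 0" using b[of 0] g by (simp add: order_trans[OF norm_ge_zero])
  have S: "{\<zeta>. - \<theta> < Im \<zeta> \<and> Im \<zeta> < \<theta>} = {\<zeta>. \<bar>Im \<zeta>\<bar> < \<theta>}" by auto
  define \<delta> where "\<delta> = \<gamma> - \<bar>Im \<eta>\<bar>"
  have ne: "exp \<zeta> \<noteq> exp \<eta>" if "\<bar>Im \<zeta>\<bar> < \<theta>" "\<zeta> \<noteq> \<eta>" for \<zeta>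
  proof -
    have "exp (\<zeta> - \<eta>) \<noteq> 1" using exp_eq_1_strip[of "\<zeta> - \<eta>"] that z \<open>\<theta> \<le> pi\<close> by auto
    then show ?thesis by (auto simp: exp_diff)
  qed
  have li: "integrable lborel (\<lambda>u. ?Q (Complex u v))" if v: "\<bar>v\<bar> = \<gamma>" for v
  proof (rule line_integrable[OF _ _ s])
    show "?Q holomorphic_on {\<zeta>. \<bar>Im \<zeta>\<bar> < \<theta>} - {\<eta>}"
      by (intro holomorphic_intros holomorphic_on_subset[OF P(1)]) (use ne in auto)
    show "Complex u v \<in> {\<zeta>. \<bar>Im \<zeta>\<bar> < \<theta>} - {\<eta>}" for u using v z by auto
    show "cmod (?Q (Complex u v)) \<le> (C * (1 / sin (\<delta> / 2))) * exp (- s * \<bar>u\<bar>)" for u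
    proof -
      have "cmod (exp (Complex u v) / (exp (Complex u v) - exp \<eta>)) \<le> 1 / sin (\<delta> / 2)"
        by (rule exp_quotient_le(2)) (use v z \<open>\<theta> \<le> pi\<close> in \<open>auto simp: \<delta>_def\<close>)
      moreover have "cmod (P (Complex u v)) \<le> C * exp (- s * \<bar>u\<bar>)" using b[of "Complex u v"] v z by simp
      ultimately have "cmod (?Q (Complex u v)) \<le> (C * exp (- s * \<bar>u\<bar>)) * (1 / sin (\<delta> / 2))"
        unfolding norm_mult using C by (intro mult_mono) auto
      then show ?thesis by (simp only: mult_ac)
    qed
  qed
  have "(\<integral>u. ?Q (Complex u (-\<gamma>)) \<partial>lborel) - (\<integral>u. ?Q (Complex u \<gamma>) \<partial>lborel) = 2 * pi * \<i> * (1 * P \<eta> + 0 * P \<eta>)"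
  proof (rule strip_residue[where P = P and ?P0.0 = P and a = "-\<theta>" and b = \<theta> and s = s and C = "C * 2" and ?N0.0 = "\<bar>Re \<eta>\<bar> + 1"])
    show "P holomorphic_on {\<zeta>. - \<theta> < Im \<zeta> \<and> Im \<zeta> < \<theta>}" "P holomorphic_on {\<zeta>. - \<theta> < Im \<zeta> \<and> Im \<zeta> < \<theta>}"
      unfolding S using P by auto
    show "?Q \<zeta> = P \<zeta> + P \<zeta> * (1 / (exp (\<zeta> - \<eta>) - 1) + 0 / (exp (\<zeta> - \<eta>) - 1))"
      if "- \<theta> < Im \<zeta>" "Im \<zeta> < \<theta>" "\<zeta> \<noteq> \<eta>" for \<zeta>
    proof -
      have "exp \<zeta> - exp \<eta> \<noteq> 0" using ne[of \<zeta>] that by auto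
      then show ?thesis by (simp add: exp_diff field_simps)
    qed
    show "cmod (?Q \<zeta>) \<le> C * 2 * exp (- s * \<bar>Re \<zeta>\<bar>)" if "- \<gamma> \<le> Im \<zeta>" "Im \<zeta> \<le> \<gamma>" "\<bar>Re \<eta>\<bar> + 1 \<le> \<bar>Re \<zeta>\<bar>" for \<zeta>
    proof -
      have e1: "2 \<le> exp (1::real)" using exp_ge_add_one_self[of 1] by simp
      have "cmod (exp \<zeta>) / 2 \<le> cmod (exp \<zeta> - exp \<eta>)"
      proof (cases "Re \<zeta> \<ge> Re \<eta> + 1")
        case True
        have "2 * exp (Re \<eta>) \<le> exp 1 * exp (Re \<eta>)" using e1 by (intro mult_right_mono) auto
        also have "\<dots> \<le> exp (Re \<zeta>)" using True by (simp flip: exp_add)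
        finally show ?thesis using norm_triangle_ineq2[of "exp \<zeta>" "exp \<eta>"] by simp
      next
        case False
        then have F: "Re \<zeta> + 1 \<le> Re \<eta>" using that by linarith
        have "2 * exp (Re \<zeta>) \<le> exp 1 * exp (Re \<zeta>)" using e1 by (intro mult_right_mono) auto
        also have "\<dots> \<le> exp (Re \<eta>)" using F by (simp flip: exp_add)
        finally show ?thesis using norm_triangle_ineq3[of "exp \<zeta>" "exp \<eta>"] by (simp add: abs_le_iff)
      qed
      then have "cmod (exp \<zeta> / (exp \<zeta> - exp \<eta>)) \<le> 2"
        by (simp add: norm_divide divide_le_eq)
      moreover have "cmod (P \<zeta>) \<le> C * exp (- s * \<bar>Re \<zeta>\<bar>)" by (rule b) (use that z in auto)
      ultimately have "cmod (?Q \<zeta>) \<le> (C * exp (- s * \<bar>Re \<zeta>\<bar>)) * 2"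
        unfolding norm_mult using C by (intro mult_mono) auto
      then show ?thesis by simp
    qed
    show "integrable lborel (\<lambda>u. ?Q (Complex u (-\<gamma>)))" "integrable lborel (\<lambda>u. ?Q (Complex u \<gamma>))"
      using li g by auto
  qed (use z g s \<open>\<theta> \<le> pi\<close> in auto)
  then show ?thesis by (simp add: Cint_def)
qed

lemma Cint_zero:
  assumes P: "P holomorphic_on {\<zeta>. \<bar>Im \<zeta>\<bar> < \<theta>}" "\<theta> \<le> pi" and s: "s > 0"
    and b: "\<And>\<zeta>. \<bar>Im \<zeta>\<bar> \<le> \<gamma> \<Longrightarrow> cmod (P \<zeta>) \<le> C * exp (- s * \<bar>Re \<zeta>\<bar>)"
    and z: "0 < \<gamma>" "\<gamma> < \<theta>"
  shows "Cint \<gamma> P = 0"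
proof -
  have S: "{\<zeta>. - \<theta> < Im \<zeta> \<and> Im \<zeta> < \<theta>} = {\<zeta>. \<bar>Im \<zeta>\<bar> < \<theta>}" by auto
  have li: "integrable lborel (\<lambda>u. P (Complex u v))" if v: "\<bar>v\<bar> = \<gamma>" for v
    by (rule line_integrable[OF P(1) _ s, of _ C]) (use b[of "Complex _ v"] v z in auto)
  have "(\<integral>u. P (Complex u (-\<gamma>)) \<partial>lborel) - (\<integral>u. P (Complex u \<gamma>) \<partial>lborel) = 2 * pi * \<i> * (0 * 0 + 0 * 0)"
    by (rule strip_residue[where P = "\<lambda>_. 0" and ?P0.0 = P and a = "-\<theta>" and b = \<theta> and s = s and C = C and ?N0.0 = 0 and ?z1.0 = 0 and ?z2.0 = 0])
      (use z s \<open>\<theta> \<le> pi\<close> b li P S in auto)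
  then show ?thesis by (simp add: Cint_def)
qed

context sectorial_family
begin

text \<open>
  The resolvent identity splits \<open>R (exp \<eta>) R (exp \<zeta>)\<close> into a multiple of \<open>R (exp \<zeta>)\<close> and a multiple of
  \<open>R (exp \<eta>)\<close>. The second part contributes the contour integral of a function that is holomorphic inside the
  contour, which vanishes because \<open>exp \<eta>\<close> lies outside.
\<close>

lemma op_resolvent:
  assumes f: "sector_decay \<theta> s c f" "s > 0" and g: "\<omega> < \<gamma>" "\<gamma> < \<theta>" "\<theta> \<le> pi"
    and e: "\<gamma> < \<bar>Im \<eta>\<bar>" "\<bar>Im \<eta>\<bar> \<le> pi"
  shows "cinner (R (exp \<eta>) (op \<gamma> f x)) y = Cint \<gamma> (\<lambda>\<zeta>. f (exp \<zeta>) / (exp \<eta> - exp \<zeta>) * M \<zeta> x y)"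
proof -
  have gp: "\<gamma> < pi" "0 < \<gamma>" "0 < \<theta>" using g omega by linarith+
  have c: "c \<ge> 0" using sector_decay_nonneg[OF f(1) gp(3)] .
  obtain K where K: "K > 0" 
    "\<And>\<zeta> x y. \<gamma> \<le> \<bar>Im \<zeta>\<bar> \<Longrightarrow> \<bar>Im \<zeta>\<bar> \<le> 2 * pi - \<gamma> \<Longrightarrow> cmod (M \<zeta> x y) \<le> K * norm x * norm y"
    using M_bound[OF g(1) gp(1)] by auto
  define \<theta>' where "\<theta>' = min \<theta> \<bar>Im \<eta>\<bar>"
  have t': "\<gamma> < \<theta>'" "\<theta>' \<le> \<theta>" "\<theta>' \<le> \<bar>Im \<eta>\<bar>" using g e by (auto simp: \<theta>'_def)
  define \<delta> where "\<delta> = \<bar>Im \<eta>\<bar> - \<gamma>"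
  have d: "\<delta> > 0" using e by (simp add: \<delta>_def)
  let ?U = "- closure (sector \<omega>)"
  have eU: "exp \<eta> \<in> ?U" by (rule exp_outside_sector) (use omega g e in auto)
  obtain y' where y': "\<And>x. cinner (R (exp \<eta>) x) y = cinner x y'"
    using adjoint_exists[of "R (exp \<eta>)" y] R_scaleC[OF eU] by blast
  have ne: "exp \<zeta> \<noteq> exp \<eta>" if "\<bar>Im \<zeta>\<bar> < \<theta>'" for \<zeta>
  proof -
    have "exp (\<zeta> - \<eta>) \<noteq> 1" using exp_eq_1_strip[of "\<zeta> - \<eta>"] that t' e by auto
    then show ?thesis by (auto simp: exp_diff)
  qed
  have ne': "exp \<eta> \<noteq> exp \<zeta>" if "\<bar>Im \<zeta>\<bar> < \<theta>'" for \<zeta> using ne[OF that] by simp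
  have q: "cmod (exp \<zeta> / (exp \<zeta> - exp \<eta>)) \<le> 1 / sin (\<delta> / 2)" "cmod (exp \<eta> / (exp \<zeta> - exp \<eta>)) \<le> 1 / sin (\<delta> / 2)" if "\<bar>Im \<zeta>\<bar> \<le> \<gamma>" for \<zeta>
    by (rule exp_quotient_le(2,3); use that e d in \<open>auto simp: \<delta>_def\<close>)+
  have fh: "(\<lambda>\<zeta>. f (exp \<zeta>)) holomorphic_on {\<zeta>. \<bar>Im \<zeta>\<bar> < \<theta>'}"
    by (rule holomorphic_exp_sector[of _ \<theta>]) (use f g t' in \<open>auto simp: sector_decay_def\<close>)
  let ?k = "cinner (R (exp \<eta>) x) y"
  let ?A = "\<lambda>\<zeta>. f (exp \<zeta>) * (exp \<zeta> / (exp \<zeta> - exp \<eta>))"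
  let ?B = "\<lambda>\<zeta>. f (exp \<zeta>) / (exp \<eta> - exp \<zeta>) * M \<zeta> x y"
  have Ah: "?A holomorphic_on {\<zeta>. \<bar>Im \<zeta>\<bar> < \<theta>'}"
    by (intro holomorphic_intros fh) (use ne in auto)
  have Ab: "cmod (?A \<zeta>) \<le> c * (1 / sin (\<delta> / 2)) * exp (- s * \<bar>Re \<zeta>\<bar>)" if "\<bar>Im \<zeta>\<bar> \<le> \<gamma>" for \<zeta>
  proof -
    have "cmod (?A \<zeta>) \<le> (c * exp (- s * \<bar>Re \<zeta>\<bar>)) * (1 / sin (\<delta> / 2))"
      unfolding norm_mult
      using q(1)[OF that] sector_decay_exp[OF f(1) g(3), of \<zeta>] that g c by (intro mult_mono) auto
    then show ?thesis by (simp only: mult_ac)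
  qed
  have A0: "Cint \<gamma> ?A = 0"
    by (rule Cint_zero[OF Ah _ f(2) Ab]) (use t' g gp in auto)
  have Bh: "?B holomorphic_on {\<zeta>. \<omega> < \<bar>Im \<zeta>\<bar> \<and> \<bar>Im \<zeta>\<bar> < \<theta>'}"
    by (intro holomorphic_on_mult holomorphic_on_divide holomorphic_on_diff holomorphic_on_const holomorphic_on_exp
         holomorphic_on_ident M_holomorphic holomorphic_on_subset[OF fh]) (use ne' t' g omega in auto)
  have Bb: "cmod (?B \<zeta>) \<le> c * (1 / cmod (exp \<eta>) * (1 / sin (\<delta> / 2))) * (K * norm x * norm y) * exp (- s * \<bar>Re \<zeta>\<bar>)" if "\<bar>Im \<zeta>\<bar> = \<gamma>" for \<zeta>
  proof -
    have "?B \<zeta> = f (exp \<zeta>) * (- (1 / exp \<eta> * (exp \<eta> / (exp \<zeta> - exp \<eta>)))) * M \<zeta> x y"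
      using ne[of \<zeta>] that t' by (simp add: field_simps)
    also have "cmod \<dots> \<le> (c * exp (- s * \<bar>Re \<zeta>\<bar>)) * (1 / cmod (exp \<eta>) * (1 / sin (\<delta> / 2))) * (K * norm x * norm y)"
    proof -
      have 1: "cmod (1 / exp \<eta> * (exp \<eta> / (exp \<zeta> - exp \<eta>))) \<le> 1 / cmod (exp \<eta>) * (1 / sin (\<delta> / 2))"
        unfolding norm_mult using q(2)[of \<zeta>] that by (intro mult_mono) (auto simp: norm_divide)
      have 2: "cmod (f (exp \<zeta>)) \<le> c * exp (- s * \<bar>Re \<zeta>\<bar>)" 
        using sector_decay_exp[OF f(1) g(3), of \<zeta>] that g by auto
      have 3: "cmod (M \<zeta> x y) \<le> K * norm x * norm y" by (rule K(2)) (use that gp in auto)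
      have s0: "0 \<le> 1 / cmod (exp \<eta>) * (1 / sin (\<delta> / 2))" using 1 norm_ge_zero order_trans by blast
      show ?thesis unfolding norm_mult[of "_ * _" "M \<zeta> x y"] norm_mult[of "f (exp \<zeta>)"] norm_minus_cancel
        by (intro mult_mono 1 2 3 mult_nonneg_nonneg s0) (use c K in auto)
    qed
    finally show ?thesis by (simp only: mult_ac)
  qed
  have Ai: "integrable lborel (\<lambda>u. ?k * ?A (Complex u v))" if "\<bar>v\<bar> = \<gamma>" for v
  proof (rule integrable_mult_right, rule line_integrable[OF Ah _ f(2)])
    show "Complex u v \<in> {\<zeta>. \<bar>Im \<zeta>\<bar> < \<theta>'}" for u using that t' by simp
    show "cmod (?A (Complex u v)) \<le> c * (1 / sin (\<delta> / 2)) * exp (- s * \<bar>u\<bar>)" for u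
      using Ab[of "Complex u v"] that by (simp only: complex.sel)
  qed
  have Bi: "integrable lborel (\<lambda>u. ?B (Complex u v))" if "\<bar>v\<bar> = \<gamma>" for v
  proof (rule line_integrable[OF Bh _ f(2)])
    show "Complex u v \<in> {\<zeta>. \<omega> < \<bar>Im \<zeta>\<bar> \<and> \<bar>Im \<zeta>\<bar> < \<theta>'}" for u using that t' g by simp
    show "cmod (?B (Complex u v)) \<le> c * (1 / cmod (exp \<eta>) * (1 / sin (\<delta> / 2))) * (K * norm x * norm y) * exp (- s * \<bar>u\<bar>)" for u
      using Bb[of "Complex u v"] that by (simp only: complex.sel)
  qed
  have "cinner (R (exp \<eta>) (op \<gamma> f x)) y = Cint \<gamma> (\<lambda>\<zeta>. f (exp \<zeta>) * M \<zeta> x y')"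
    unfolding y' by (rule op_weak[OF f g])
  also have "\<dots> = Cint \<gamma> (\<lambda>\<zeta>. ?k * ?A \<zeta> + ?B \<zeta>)"
  proof -
    have "f (exp \<zeta>) * M \<zeta> x y' = ?k * ?A \<zeta> + ?B \<zeta>" if z: "\<bar>Im \<zeta>\<bar> = \<gamma>" for \<zeta>
    proof -
      have zU: "exp \<zeta> \<in> ?U" by (rule exp_outside_sector) (use omega g z gp in auto)
      have n: "exp \<zeta> - exp \<eta> \<noteq> 0" "exp \<eta> - exp \<zeta> \<noteq> 0" using ne[of \<zeta>] z t' by auto
      have "cinner (R (exp \<eta>) x) y - cinner (R (exp \<zeta>) x) y = (exp \<zeta> - exp \<eta>) * cinner (R (exp \<eta>) (R (exp \<zeta>) x)) y"
        using R_identity[OF eU zU, of x] by (simp flip: cinner_diff_left add: cinner_scaleC_left)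
      then have "cinner (R (exp \<eta>) (R (exp \<zeta>) x)) y = (?k - cinner (R (exp \<zeta>) x) y) / (exp \<zeta> - exp \<eta>)"
        using n by (simp add: field_simps)
      then have "M \<zeta> x y' = exp \<zeta> * ((?k - cinner (R (exp \<zeta>) x) y) / (exp \<zeta> - exp \<eta>))"
        by (simp add: M_def y'[symmetric])
      moreover have "a * (E * ((k - m) / D)) = k * (a * (E / D)) + a / (- D) * (E * m)" for a E k m D :: complex
        by (cases "D = 0") (simp_all add: field_simps)
      moreover have "exp \<eta> - exp \<zeta> = - (exp \<zeta> - exp \<eta>)" by simp
      ultimately show ?thesis unfolding M_def[of \<zeta> x y] by (simp only:)
    qed
    then show ?thesis using gp by (intro Cint_cong) auto
  qed
  also have "\<dots> = Cint \<gamma> (\<lambda>\<zeta>. ?k * ?A \<zeta>) + Cint \<gamma> ?B"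
    by (rule Cint_add) (use Ai Bi gp in auto)
  also have "Cint \<gamma> (\<lambda>\<zeta>. ?k * ?A \<zeta>) = 0" using A0 by (simp only: Cint_cmult mult_zero_right)
  finally show ?thesis by simp
qed

text \<open>
  The outer operator is computed on a contour of larger angle \<open>\<gamma>1\<close>. Then \<open>op_resolvent\<close> expresses the product
  as a double integral, and after Fubini the integral over the outer contour is Cauchy's formula for \<open>f\<close> at a
  point inside.
\<close>

lemma op_mult:
  assumes f: "sector_decay \<theta> s c f" "s > 0" and h: "sector_decay \<theta> s' d h" "s' > 0"
    and g: "\<omega> < \<gamma>" "\<gamma> < \<theta>" "\<theta> \<le> pi"
  shows "op \<gamma> f (op \<gamma> h x) = op \<gamma> (\<lambda>w. f w * h w) x"
proof -
  have gp: "\<gamma> < pi" "0 < \<gamma>" "0 < \<theta>" using g omega by linarith+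
  define s0 where "s0 = min s s'"
  have s0: "s0 > 0" using f h by (simp add: s0_def)
  have f0: "sector_decay \<theta> s0 c f" by (rule sector_decay_weaken[OF f(1) gp(3)]) (simp add: s0_def)
  have h0: "sector_decay \<theta> s0 d h" by (rule sector_decay_weaken[OF h(1) gp(3)]) (simp add: s0_def)
  have c: "c \<ge> 0" "d \<ge> 0" using sector_decay_nonneg[OF f(1) gp(3)] sector_decay_nonneg[OF h(1) gp(3)] by auto
  have fb: "cmod (f w) \<le> c" if "w \<in> sector \<theta>" for w
    by (rule sector_decay_bound[OF f0 gp(3) _ that]) (use s0 in simp)
  have fh: "sector_decay \<theta> s0 (c * d) (\<lambda>w. f w * h w)"
    by (rule sector_decay_mult_bounded[OF h0 gp(3) _ fb]) (use f0 in \<open>auto simp: sector_decay_def\<close>)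
  define \<gamma>1 where "\<gamma>1 = (\<gamma> + \<theta>) / 2"
  have g1: "\<gamma> < \<gamma>1" "\<gamma>1 < \<theta>" "\<omega> < \<gamma>1" "\<gamma>1 < pi" "0 < \<gamma>1" using g gp by (auto simp: \<gamma>1_def)
  obtain K where K: "K > 0" 
    "\<And>\<zeta> x y. \<gamma> \<le> \<bar>Im \<zeta>\<bar> \<Longrightarrow> \<bar>Im \<zeta>\<bar> \<le> 2 * pi - \<gamma> \<Longrightarrow> cmod (M \<zeta> x y) \<le> K * norm x * norm y"
    using M_bound[OF g(1) gp(1)] by auto
  define \<delta> where "\<delta> = \<gamma>1 - \<gamma>"
  have d: "\<delta> > 0" using g1 by (simp add: \<delta>_def)
  have q: "exp \<eta> \<noteq> exp \<zeta>" "cmod (exp \<eta> / (exp \<eta> - exp \<zeta>)) \<le> 1 / sin (\<delta> / 2)" "sin (\<delta> / 2) > 0" if "\<bar>Im \<eta>\<bar> = \<gamma>1" "\<bar>Im \<zeta>\<bar> = \<gamma>" for \<eta> \<zeta>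
  proof -
    have dd: "\<delta> \<le> \<bar>Im \<eta> - Im \<zeta>\<bar>" "\<bar>Im \<eta> - Im \<zeta>\<bar> \<le> 2 * pi - \<delta>"
      using that g1 g unfolding \<delta>_def by linarith+
    show "exp \<eta> \<noteq> exp \<zeta>" "cmod (exp \<eta> / (exp \<eta> - exp \<zeta>)) \<le> 1 / sin (\<delta> / 2)" "sin (\<delta> / 2) > 0"
      using exp_quotient_le[OF dd d] by auto
  qed
  have fl: "(\<lambda>\<zeta>. f (exp \<zeta>)) holomorphic_on {\<zeta>. \<bar>Im \<zeta>\<bar> < \<theta>}" and hl: "(\<lambda>\<zeta>. h (exp \<zeta>)) holomorphic_on {\<zeta>. \<bar>Im \<zeta>\<bar> < \<theta>}"
    by (rule holomorphic_exp_sector[of _ \<theta>]; use f h g in \<open>auto simp: sector_decay_def\<close>)+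
  have "op \<gamma>1 f (op \<gamma> h x) = op \<gamma> (\<lambda>w. f w * h w) x"
  proof (rule cinner_ext)
    fix y
    let ?H = "\<lambda>\<eta> \<zeta>. f (exp \<eta>) * (exp \<eta> / (exp \<eta> - exp \<zeta>)) * (h (exp \<zeta>) * M \<zeta> x y)"
    have "cinner (op \<gamma>1 f (op \<gamma> h x)) y = Cint \<gamma>1 (\<lambda>\<eta>. f (exp \<eta>) * M \<eta> (op \<gamma> h x) y)"
      by (rule op_weak[OF f0 s0]) (use g1 g in auto)
    also have "\<dots> = Cint \<gamma>1 (\<lambda>\<eta>. Cint \<gamma> (\<lambda>\<zeta>. ?H \<eta> \<zeta>))"
    proof -
      have "f (exp \<eta>) * M \<eta> (op \<gamma> h x) y = Cint \<gamma> (\<lambda>\<zeta>. ?H \<eta> \<zeta>)" if e: "\<bar>Im \<eta>\<bar> = \<gamma>1" for \<eta>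
      proof -
        have "f (exp \<eta>) * M \<eta> (op \<gamma> h x) y = (f (exp \<eta>) * exp \<eta>) * Cint \<gamma> (\<lambda>\<zeta>. h (exp \<zeta>) / (exp \<eta> - exp \<zeta>) * M \<zeta> x y)"
          unfolding M_def[of \<eta>] by (subst op_resolvent[OF h0 s0 g]) (use e g1 in auto)
        also have "\<dots> = Cint \<gamma> (\<lambda>\<zeta>. (f (exp \<eta>) * exp \<eta>) * (h (exp \<zeta>) / (exp \<eta> - exp \<zeta>) * M \<zeta> x y))"
          by (rule Cint_cmult[symmetric])
        finally show ?thesis by (simp add: mult_ac)
      qed
      then show ?thesis using g1 by (intro Cint_cong) auto
    qed
    also have "\<dots> = Cint \<gamma> (\<lambda>\<zeta>. Cint \<gamma>1 (\<lambda>\<eta>. ?H \<eta> \<zeta>))"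
    proof (rule Cint_swap[OF s0 _ _ g1(5) gp(2)])
      fix v v' assume v: "\<bar>v\<bar> = \<gamma>1" "\<bar>v'\<bar> = \<gamma>"
      have c1: "continuous_on UNIV (\<lambda>p::real\<times>real. k (Complex (fst p) u))" if "continuous_on UNIV (\<lambda>t. k (Complex t u))" for k :: "complex \<Rightarrow> complex" and u
        by (rule continuous_on_compose2[OF that]) (auto intro!: continuous_intros)
      have c2: "continuous_on UNIV (\<lambda>p::real\<times>real. k (Complex (snd p) u))" if "continuous_on UNIV (\<lambda>t. k (Complex t u))" for k :: "complex \<Rightarrow> complex" and u
        by (rule continuous_on_compose2[OF that]) (auto intro!: continuous_intros)
      show "continuous_on UNIV (\<lambda>p::real\<times>real. ?H (Complex (fst p) v) (Complex (snd p) v'))"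
      proof (intro continuous_on_mult continuous_on_divide continuous_on_diff)
        show "continuous_on UNIV (\<lambda>p::real\<times>real. f (exp (Complex (fst p) v)))"
          by (rule c1[of "\<lambda>\<zeta>. f (exp \<zeta>)"], rule continuous_line[OF fl]) (use v g1 in auto)
        show "continuous_on UNIV (\<lambda>p::real\<times>real. h (exp (Complex (snd p) v')))"
          by (rule c2[of "\<lambda>\<zeta>. h (exp \<zeta>)"], rule continuous_line[OF hl]) (use v g in auto)
        show "continuous_on UNIV (\<lambda>p::real\<times>real. M (Complex (snd p) v') x y)"
          by (rule c2[of "\<lambda>\<zeta>. M \<zeta> x y"], rule continuous_line[OF M_holomorphic[of "{\<zeta>. \<bar>Im \<zeta>\<bar> = \<gamma>}"]]) (use v g in auto)
        show "continuous_on UNIV (\<lambda>p::real\<times>real. exp (Complex (fst p) v))" "continuous_on UNIV (\<lambda>p::real\<times>real. exp (Complex (fst p) v))"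
            "continuous_on UNIV (\<lambda>p::real\<times>real. exp (Complex (snd p) v'))"
          unfolding Complex_eq by (intro continuous_intros)+
        show "\<forall>p\<in>UNIV. exp (Complex (fst p) v) - exp (Complex (snd p) v') \<noteq> 0" using q(1) v by auto
      qed
    next
      fix \<eta> \<zeta> assume v: "\<bar>Im \<eta>\<bar> = \<gamma>1" "\<bar>Im \<zeta>\<bar> = \<gamma>"
      have 1: "cmod (f (exp \<eta>)) \<le> c * exp (- s0 * \<bar>Re \<eta>\<bar>)" by (rule sector_decay_exp[OF f0 g(3)]) (use v g1 in auto)
      have 2: "cmod (h (exp \<zeta>)) \<le> d * exp (- s0 * \<bar>Re \<zeta>\<bar>)" by (rule sector_decay_exp[OF h0 g(3)]) (use v g in auto)
      have 3: "cmod (M \<zeta> x y) \<le> K * norm x * norm y" by (rule K(2)) (use v gp in auto)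
      have "cmod (?H \<eta> \<zeta>) \<le> ((c * exp (- s0 * \<bar>Re \<eta>\<bar>)) * (1 / sin (\<delta> / 2))) * ((d * exp (- s0 * \<bar>Re \<zeta>\<bar>)) * (K * norm x * norm y))"
        unfolding norm_mult
        by (intro mult_mono 1 2 3 q(2)[OF v] mult_nonneg_nonneg) (use c q(3)[OF v] K in auto)
      then show "cmod (?H \<eta> \<zeta>) \<le> (c * (1 / sin (\<delta> / 2)) * d * (K * norm x * norm y)) * exp (- s0 * \<bar>Re \<eta>\<bar>) * exp (- s0 * \<bar>Re \<zeta>\<bar>)"
        by (simp only: mult_ac)
    qed
    also have "\<dots> = Cint \<gamma> (\<lambda>\<zeta>. (f (exp \<zeta>) * h (exp \<zeta>)) * M \<zeta> x y)"
    proof -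
      have "Cint \<gamma>1 (\<lambda>\<eta>. ?H \<eta> \<zeta>) = (f (exp \<zeta>) * h (exp \<zeta>)) * M \<zeta> x y" if z: "\<bar>Im \<zeta>\<bar> = \<gamma>" for \<zeta>
      proof -
        have "Cint \<gamma>1 (\<lambda>\<eta>. f (exp \<eta>) * (exp \<eta> / (exp \<eta> - exp \<zeta>))) = f (exp \<zeta>)"
          by (rule Cint_cauchy_inside[OF fl g(3) s0, of c]) (use z g1 sector_decay_exp[OF f0 g(3)] in auto)
        then show ?thesis unfolding Cint_mult_right by (simp only: mult.assoc)
      qed
      then show ?thesis using gp by (intro Cint_cong) auto
    qed
    also have "\<dots> = cinner (op \<gamma> (\<lambda>w. f w * h w) x) y"
      by (rule op_weak[OF fh s0 g, symmetric])
    finally show "cinner (op \<gamma>1 f (op \<gamma> h x)) y = cinner (op \<gamma> (\<lambda>w. f w * h w) x) y" .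
  qed
  moreover have "op \<gamma>1 f = op \<gamma> f" by (rule op_independent[OF f0 s0]) (use g1 g in auto)
  ultimately show ?thesis by simp
qed

end

section \<open>Holomorphic families on a sector and their integrals\<close>

text \<open>
  Cauchy's inequality turns the local integrable bound on \<open>q\<close> into one on the difference quotients, so that
  dominated convergence applies to them.
\<close>

lemma holomorphic_on_integral:
  fixes q :: "'x \<Rightarrow> complex \<Rightarrow> complex"
  assumes S: "open S" and hol: "\<And>z. z \<in> space M \<Longrightarrow> q z holomorphic_on S"
    and meas: "\<And>w. w \<in> S \<Longrightarrow> (\<lambda>z. q z w) \<in> borel_measurable M"
    and dom: "\<And>w0. w0 \<in> S \<Longrightarrow> \<exists>r>0. cball w0 r \<subseteq> S \<and> (\<exists>g. integrable M (g :: 'x \<Rightarrow> real) \<and> (\<forall>z\<in>space M. \<forall>w\<in>cball w0 r. cmod (q z w) \<le> g z))"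
  shows "(\<lambda>w. \<integral>z. q z w \<partial>M) holomorphic_on S"
proof (rule holomorphic_onI)
  fix w0 assume w0: "w0 \<in> S"
  obtain r g where r: "r > 0" "cball w0 r \<subseteq> S" and g: "integrable M g" "\<And>z w. z \<in> space M \<Longrightarrow> w \<in> cball w0 r \<Longrightarrow> cmod (q z w) \<le> g z"
    using dom[OF w0] by blast
  let ?B = "ball w0 (r / 2)"
  have BS: "?B \<subseteq> S" using r by (auto simp: subset_iff)
  have int: "integrable M (\<lambda>z. q z w)" if "w \<in> ?B" for w
  proof (rule Bochner_Integration.integrable_bound[OF g(1) meas])
    show "w \<in> S" using that BS by blast
    have "w \<in> cball w0 r" using that r by simp
    then show "AE z in M. norm (q z w) \<le> norm (g z)"
      using g(2) by (intro AE_I2) (metis abs_ge_self order_trans real_norm_def)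
  qed
  have db: "cmod (deriv (q z) \<xi>) \<le> g z / (r / 2)" if z: "z \<in> space M" and \<xi>: "\<xi> \<in> ?B" for z \<xi>
  proof -
    have sub: "cball \<xi> (r / 2) \<subseteq> cball w0 r"
    proof
      fix t assume "t \<in> cball \<xi> (r/2)"
      then show "t \<in> cball w0 r" using \<xi> dist_triangle[of w0 t \<xi>] by simp
    qed
    have "norm ((deriv ^^ 1) (q z) \<xi>) \<le> fact 1 * g z / (r / 2) ^ 1"
    proof (rule Cauchy_inequality)
      show "q z holomorphic_on ball \<xi> (r / 2)" using hol[OF z] sub r by (auto elim!: holomorphic_on_subset simp: subset_iff)
      show "continuous_on (cball \<xi> (r / 2)) (q z)"
        using holomorphic_on_imp_continuous_on[OF hol[OF z]] sub r by (auto elim!: continuous_on_subset)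
      show "norm (q z x) \<le> g z" if "norm (\<xi> - x) = r / 2" for x
        using g(2)[OF z] sub that by (auto simp: subset_iff dist_norm)
    qed (use r in auto)
    then show ?thesis by simp
  qed
  have der: "(q z has_field_derivative deriv (q z) \<xi>) (at \<xi>)" if "z \<in> space M" "\<xi> \<in> ?B" for z \<xi>
    using hol[OF that(1)] BS that(2) S holomorphic_derivI by blast
  have quot: "cmod ((q z w - q z w0) / (w - w0)) \<le> g z / (r / 2)" if z: "z \<in> space M" and w: "w \<in> ?B - {w0}" for z w
  proof -
    have "norm (q z w - q z w0) \<le> g z / (r / 2) * norm (w - w0)"
      by (rule field_differentiable_bound[of ?B _ "deriv (q z)"])
        (use z w r db der in \<open>auto intro: has_field_derivative_at_within\<close>)
    then show ?thesis using w by (simp add: norm_divide divide_le_eq)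
  qed
  let ?L = "\<integral>z. deriv (q z) w0 \<partial>M"
  have "((\<lambda>w. ((\<integral>z. q z w \<partial>M) - (\<integral>z. q z w0 \<partial>M)) / (w - w0)) \<longlongrightarrow> ?L) (at w0 within ?B)"
    unfolding tendsto_at_iff_sequentially
  proof (intro allI impI)
    fix X assume X: "\<forall>i. X i \<in> ?B - {w0}" "X \<longlonglongrightarrow> w0"
    have w0B: "w0 \<in> ?B" using r by simp
    have lim: "(\<lambda>i. (q z (X i) - q z w0) / (X i - w0)) \<longlonglongrightarrow> deriv (q z) w0" if "z \<in> space M" for z
    proof -
      have "((\<lambda>w. (q z w - q z w0) / (w - w0)) \<longlongrightarrow> deriv (q z) w0) (at w0)"
        using der[OF that w0B] by (simp add: has_field_derivative_iff)
      then show ?thesis using X unfolding tendsto_at_iff_sequentially[of _ _ _ UNIV] by (auto simp: o_def)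
    qed
    have m: "(\<lambda>z. (q z (X i) - q z w0) / (X i - w0)) \<in> borel_measurable M" for i
    proof -
      have "X i \<in> S" using X BS by blast
      from meas[OF this] meas[OF w0] show ?thesis by (intro borel_measurable_divide borel_measurable_diff) auto
    qed
    have "(\<lambda>i. \<integral>z. (q z (X i) - q z w0) / (X i - w0) \<partial>M) \<longlonglongrightarrow> ?L"
    proof (rule integral_dominated_convergence)
      show "(\<lambda>z. deriv (q z) w0) \<in> borel_measurable M"
        by (rule borel_measurable_LIMSEQ_metric[OF m lim])
      show "integrable M (\<lambda>z. g z / (r / 2))" using g(1) by simp
    qed (use m lim quot X in auto)
    moreover have "(\<integral>z. (q z (X i) - q z w0) / (X i - w0) \<partial>M) = ((\<integral>z. q z (X i) \<partial>M) - (\<integral>z. q z w0 \<partial>M)) / (X i - w0)" for i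
      using int[of "X i"] int[OF w0B] X by simp
    ultimately show "((\<lambda>w. ((\<integral>z. q z w \<partial>M) - (\<integral>z. q z w0 \<partial>M)) / (w - w0)) \<circ> X) \<longlonglongrightarrow> ?L"
      by (simp only: o_def)
  qed
  then have "((\<lambda>w. \<integral>z. q z w \<partial>M) has_field_derivative ?L) (at w0)"
    unfolding has_field_derivative_iff using at_within_open[of w0 ?B] r by simp
  then show "(\<lambda>w. \<integral>z. q z w \<partial>M) field_differentiable at w0 within S"
    unfolding field_differentiable_def by (blast intro: has_field_derivative_at_within)
qed

lemma continuous_on_dilate:
  assumes "F holomorphic_on sector \<theta>" "\<theta> \<le> pi" "w \<in> sector (\<theta> - \<alpha>)"
  shows "continuous_on (sector \<alpha>) (\<lambda>z. F (z * w))"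
proof (rule continuous_on_compose2[OF holomorphic_on_imp_continuous_on[OF assms(1)]])
  show "(\<lambda>z. z * w) ` sector \<alpha> \<subseteq> sector \<theta>" using sector_mult[of _ \<alpha> w "\<theta> - \<alpha>"] assms by auto
qed (intro continuous_intros)

lemma sector_decay_dilate_bound:
  assumes "sector_decay \<theta> s c F" "\<theta> \<le> pi" "z \<in> sector \<alpha>" "w \<in> sector (\<theta> - \<alpha>)"
  shows "cmod (F (z * w)) \<le> c * exp (- s * \<bar>ln (cmod w) + ln (cmod z)\<bar>)"
proof -
  have "z * w \<in> sector \<theta>" using sector_mult[OF assms(3,4)] assms(2) by simp
  then have "cmod (F (z * w)) \<le> c * exp (- s * \<bar>ln (cmod (z * w))\<bar>)" using assms(1) by (simp add: sector_decay_def)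
  also have "ln (cmod (z * w)) = ln (cmod w) + ln (cmod z)"
    using sector_nonzero[OF assms(3)] sector_nonzero[OF assms(4)] by (simp add: norm_mult ln_mult)
  finally show ?thesis .
qed

lemma holomorphic_dilate:
  assumes "F holomorphic_on sector \<theta>" "\<theta> \<le> pi" "z \<in> sector \<alpha>"
  shows "(\<lambda>w. F (z * w)) holomorphic_on sector (\<theta> - \<alpha>)"
proof -
  have "(F \<circ> (\<lambda>w. z * w)) holomorphic_on sector (\<theta> - \<alpha>)"
  proof (rule holomorphic_on_compose_gen[OF _ assms(1)])
    show "(\<lambda>w. z * w) ` sector (\<theta> - \<alpha>) \<subseteq> sector \<theta>" using sector_mult[of z \<alpha> _ "\<theta> - \<alpha>"] assms by auto
  qed (intro holomorphic_intros)
  then show ?thesis by (simp add: o_def)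
qed

lemma sector_decay_dilate:
  assumes "sector_decay \<theta> s c F" "s > 0" "\<theta> \<le> pi" "z \<in> sector \<alpha>" "0 < \<theta>"
  shows "sector_decay (\<theta> - \<alpha>) s (c * exp (s * \<bar>ln (cmod z)\<bar>)) (\<lambda>w. F (z * w))"
  unfolding sector_decay_def
proof (intro conjI ballI holomorphic_dilate[OF _ assms(3,4)])
  show "F holomorphic_on sector \<theta>" using assms by (simp add: sector_decay_def)
  fix w assume w: "w \<in> sector (\<theta> - \<alpha>)"
  have c: "c \<ge> 0" using sector_decay_nonneg assms by blast
  have "s * \<bar>ln (cmod w)\<bar> \<le> s * (\<bar>ln (cmod w) + ln (cmod z)\<bar> + \<bar>ln (cmod z)\<bar>)"
    using assms(2) by (intro mult_left_mono) auto
  then have "exp (- s * \<bar>ln (cmod w) + ln (cmod z)\<bar>) \<le> exp (s * \<bar>ln (cmod z)\<bar>) * exp (- s * \<bar>ln (cmod w)\<bar>)"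
    by (simp add: exp_add[symmetric] algebra_simps)
  then show "cmod (F (z * w)) \<le> c * exp (s * \<bar>ln (cmod z)\<bar>) * exp (- s * \<bar>ln (cmod w)\<bar>)"
    using sector_decay_dilate_bound[OF assms(1,3,4) w] c mult_left_mono[of _ _ c] by (fastforce simp: mult.assoc)
qed

text \<open>
  The function that satisfies \<open>f(A)\<^sup>* = (cnj_fun f)(A\<^sup>*)\<close>.
\<close>

definition cnj_fun :: "(complex \<Rightarrow> complex) \<Rightarrow> complex \<Rightarrow> complex" where
  "cnj_fun f w = cnj (f (cnj w))"

lemma cnj_fun_holomorphic:
  assumes "f holomorphic_on sector \<theta>" "\<theta> \<le> pi"
  shows "cnj_fun f holomorphic_on sector \<theta>"
proof -
  have "cnj ` sector \<theta> = sector \<theta>"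
    using sector_cnj[OF assms(2)] by (auto intro: image_eqI[of _ cnj "cnj _"])
  then have "f holomorphic_on cnj ` sector \<theta>" using assms by simp
  then have "(cnj \<circ> f \<circ> cnj) holomorphic_on sector \<theta>"
    using holomorphic_on_compose_cnj_cnj[of f "sector \<theta>"] open_sector[OF assms(2)] by simp
  then show ?thesis by (simp add: o_def cnj_fun_def[abs_def])
qed

lemma cnj_fun_decay: "sector_decay \<theta> s c f \<Longrightarrow> \<theta> \<le> pi \<Longrightarrow> sector_decay \<theta> s c (cnj_fun f)"
  unfolding sector_decay_def
proof (elim conjE, intro conjI ballI)
  fix w assume "\<theta> \<le> pi" "w \<in> sector \<theta>" and b: "\<forall>w\<in>sector \<theta>. cmod (f w) \<le> c * exp (- s * \<bar>ln (cmod w)\<bar>)"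
  then have "cnj w \<in> sector \<theta>" by (intro sector_cnj)
  from bspec[OF b this] show "cmod (cnj_fun f w) \<le> c * exp (- s * \<bar>ln (cmod w)\<bar>)" by (simp add: cnj_fun_def)
qed (rule cnj_fun_holomorphic)

text \<open>
  The product \<open>\<Phi>(z w) cnj (\<Phi>(z cnj w))\<close>, which is holomorphic in \<open>w\<close> and equals \<open>\<bar>\<Phi>(z w)\<bar>\<^sup>2\<close> for \<open>w > 0\<close>.
\<close>

definition square_kernel :: "(complex \<Rightarrow> complex) \<Rightarrow> complex \<Rightarrow> complex \<Rightarrow> complex" where
  "square_kernel \<Phi> z w = \<Phi> (z * w) * cnj_fun \<Phi> (cnj z * w)"

lemma square_kernel_bound:
  assumes "sector_decay \<theta> s c \<Phi>" "\<theta> \<le> pi" "0 < \<theta>" "\<alpha> \<le> pi" "z \<in> sector \<alpha>" "w \<in> sector (\<theta> - \<alpha>)"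
  shows "cmod (square_kernel \<Phi> z w) \<le> c\<^sup>2 * exp (- (2 * s) * \<bar>ln (cmod w) + ln (cmod z)\<bar>)"
proof -
  have c: "c \<ge> 0" using sector_decay_nonneg assms by blast
  have "cmod (square_kernel \<Phi> z w) \<le> (c * exp (- s * \<bar>ln (cmod w) + ln (cmod z)\<bar>)) * (c * exp (- s * \<bar>ln (cmod w) + ln (cmod z)\<bar>))"
    unfolding square_kernel_def norm_mult
    using sector_decay_dilate_bound[OF assms(1,2,5,6)] sector_decay_dilate_bound[OF cnj_fun_decay[OF assms(1,2)] assms(2) sector_cnj[OF assms(4,5)] assms(6)] c
    by (intro mult_mono) auto
  also have "\<dots> = c\<^sup>2 * exp (- (2 * s) * \<bar>ln (cmod w) + ln (cmod z)\<bar>)"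
    by (simp add: power2_eq_square exp_add[symmetric])
  finally show ?thesis .
qed

lemma square_kernel_holomorphic:
  assumes "\<Phi> holomorphic_on sector \<theta>" "\<theta> \<le> pi" "\<alpha> \<le> pi" "z \<in> sector \<alpha>"
  shows "square_kernel \<Phi> z holomorphic_on sector (\<theta> - \<alpha>)"
  unfolding square_kernel_def[abs_def]
  by (rule holomorphic_on_mult[OF holomorphic_dilate[OF assms(1,2,4)]
        holomorphic_dilate[OF cnj_fun_holomorphic[OF assms(1,2)] assms(2) sector_cnj[OF assms(3,4)]]])

lemma continuous_square_kernel:
  assumes "\<Phi> holomorphic_on sector \<theta>" "\<theta> \<le> pi" "\<alpha> \<le> pi" "w \<in> sector (\<theta> - \<alpha>)"
  shows "continuous_on (sector \<alpha>) (\<lambda>z. square_kernel \<Phi> z w)"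
proof -
  have "continuous_on (sector \<alpha>) (\<lambda>z. cnj_fun \<Phi> (cnj z * w))"
    by (rule continuous_on_compose2[OF continuous_on_dilate[OF cnj_fun_holomorphic[OF assms(1,2)] assms(2,4)], where f = cnj])
      (use sector_cnj assms in \<open>auto intro: continuous_intros\<close>)
  then show ?thesis
    unfolding square_kernel_def by (rule continuous_on_mult[OF continuous_on_dilate[OF assms(1,2,4)]])
qed

text \<open>
  The integral of \<open>\<Phi> (z w) cnj (\<Phi> (z cnj w))\<close> over \<open>z\<close> does not depend on \<open>w\<close>: for \<open>w > 0\<close> by dilation
  invariance, and then for all \<open>w\<close> because it is holomorphic in \<open>w\<close>. At \<open>w = 1\<close> it is positive.
\<close>

lemma square_kernel_integral:
  assumes \<Phi>: "sector_decay \<theta> s c \<Phi>" "s > 0" and a: "0 < \<alpha>" "\<alpha> < \<theta>" "\<theta> \<le> pi"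
    and nz: "\<exists>z\<in>sector \<theta>. \<Phi> z \<noteq> 0"
  obtains C0 :: real where "C0 > 0"
    "\<And>w. w \<in> sector (\<theta> - \<alpha>) \<Longrightarrow> (\<integral>z. square_kernel \<Phi> z w \<partial>sector_measure \<alpha>) = of_real C0"
proof -
  let ?M = "sector_measure \<alpha>"
  have p: "\<alpha> \<le> pi" "0 < \<theta>" "\<theta> - \<alpha> \<le> pi" "0 < \<theta> - \<alpha>" "2 * s > 0" using a \<Phi> by auto
  have h: "\<Phi> holomorphic_on sector \<theta>" using \<Phi> by (simp add: sector_decay_def)
  have meas: "(\<lambda>z. square_kernel \<Phi> z w) \<in> borel_measurable ?M" if "w \<in> sector (\<theta> - \<alpha>)" for w
    by (rule continuous_measurable_sector, rule continuous_square_kernel[OF h a(3) p(1) that])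
  define J where "J w = (\<integral>z. square_kernel \<Phi> z w \<partial>?M)" for w
  have Jhol: "J holomorphic_on sector (\<theta> - \<alpha>)"
    unfolding J_def
  proof (rule holomorphic_on_integral[OF open_sector[OF p(3)] _ meas])
    show "square_kernel \<Phi> z holomorphic_on sector (\<theta> - \<alpha>)" if "z \<in> space ?M" for z
      using square_kernel_holomorphic[OF h a(3) p(1)] that by simp
    fix w0 assume w0: "w0 \<in> sector (\<theta> - \<alpha>)"
    then have n0: "cmod w0 > 0" using sector_nonzero by auto
    obtain r0 where r0: "r0 > 0" "cball w0 r0 \<subseteq> sector (\<theta> - \<alpha>)"
      using w0 open_sector[OF p(3)] by (auto simp: open_contains_cball)
    \<comment> \<open>In a disc of this radius \<open>ln \<bar>w\<bar>\<close> differs from \<open>ln \<bar>w0\<bar>\<close> by at most \<open>ln 2\<close>.\<close>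
    define r where "r = min r0 (cmod w0 / 2)"
    have r: "r > 0" "r \<le> cmod w0 / 2" "cball w0 r \<subseteq> sector (\<theta> - \<alpha>)" using r0 n0 by (auto simp: r_def)
    let ?g = "\<lambda>z. c\<^sup>2 * exp (2 * s * ln 2) * exp (- (2 * s) * \<bar>ln (cmod w0) + ln (cmod z)\<bar>)"
    have "integrable ?M (\<lambda>z. complex_of_real (?g z))"
      by (rule integrable_radial_decay_bound[OF p(1,5), of _ "c\<^sup>2 * exp (2 * s * ln 2)" "ln (cmod w0)"])
        (auto simp: norm_mult norm_power measurable_sector_measure_cong intro!: measurable_restrict_space1)
    then have "integrable ?M (\<lambda>z. Re (complex_of_real (?g z)))" by (rule integrable_Re)
    then have gi: "integrable ?M ?g" by simp
    have "cmod (square_kernel \<Phi> z w) \<le> ?g z" if z: "z \<in> space ?M" and w: "w \<in> cball w0 r" for z w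
    proof -
      have ws: "w \<in> sector (\<theta> - \<alpha>)" using r w by blast
      then have nw: "cmod w > 0" using sector_nonzero by auto
      have "cmod (w0 - w) \<le> cmod w0 / 2" using w r by (simp add: dist_norm)
      then have b: "cmod w \<le> 2 * cmod w0" "cmod w0 \<le> 2 * cmod w"
        using norm_triangle_ineq3[of w0 w] n0 by linarith+
      have "ln (cmod w) \<le> ln (2 * cmod w0)" "ln (cmod w0) \<le> ln (2 * cmod w)"
        using b n0 nw by (auto intro!: ln_mono)
      then have "\<bar>ln (cmod w0) + ln (cmod z)\<bar> \<le> \<bar>ln (cmod w) + ln (cmod z)\<bar> + ln 2"
        using n0 nw by (simp add: ln_mult)
      then have "2 * s * \<bar>ln (cmod w0) + ln (cmod z)\<bar> \<le> 2 * s * (\<bar>ln (cmod w) + ln (cmod z)\<bar> + ln 2)"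
        using \<Phi>(2) by (intro mult_left_mono) auto
      then have "exp (- (2 * s) * \<bar>ln (cmod w) + ln (cmod z)\<bar>) \<le> exp (2 * s * ln 2) * exp (- (2 * s) * \<bar>ln (cmod w0) + ln (cmod z)\<bar>)"
        by (simp only: exp_add[symmetric] exp_le_cancel_iff) (simp add: algebra_simps)
      then have "c\<^sup>2 * exp (- (2 * s) * \<bar>ln (cmod w) + ln (cmod z)\<bar>) \<le> c\<^sup>2 * (exp (2 * s * ln 2) * exp (- (2 * s) * \<bar>ln (cmod w0) + ln (cmod z)\<bar>))"
        by (intro mult_left_mono) auto
      then show ?thesis using square_kernel_bound[OF \<Phi>(1) a(3) p(2,1) _ ws, of z] z by (simp add: mult.assoc)
    qed
    then show "\<exists>r>0. cball w0 r \<subseteq> sector (\<theta> - \<alpha>) \<and> (\<exists>g. integrable ?M (g :: complex \<Rightarrow> real) \<and> (\<forall>z\<in>space ?M. \<forall>w\<in>cball w0 r. cmod (square_kernel \<Phi> z w) \<le> g z))"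
      using r gi by blast
  qed
  have one: "1 \<in> sector (\<theta> - \<alpha>)" by (rule one_in_sector[OF p(4)])
  have Jpos: "J (of_real t) = J 1" if t: "t > 0" for t
  proof -
    have "J 1 = (\<integral>z. square_kernel \<Phi> (of_real t * z) 1 \<partial>?M)"
      unfolding J_def by (rule integral_sector_scale[OF p(1) meas[OF one] t, symmetric])
    also have "(\<lambda>z. square_kernel \<Phi> (of_real t * z) 1) = (\<lambda>z. square_kernel \<Phi> z (of_real t))"
      by (simp add: square_kernel_def mult.commute)
    finally show ?thesis by (simp add: J_def)
  qed
  have Jc: "J w = J 1" if w: "w \<in> sector (\<theta> - \<alpha>)" for w
  proof -
    let ?U = "complex_of_real ` {0<..}"
    have "1 islimpt ?U"
      unfolding islimpt_approachable
    proof (intro allI impI)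
      fix e :: real assume e: "e > 0"
      show "\<exists>x'\<in>?U. x' \<noteq> 1 \<and> dist x' 1 < e"
      proof (rule bexI)
        show "complex_of_real (1 + e / 2) \<in> ?U" by (rule imageI) (use e in simp)
      qed (use e in \<open>auto simp: dist_norm\<close>)
    qed
    note isl = this
    have "J w - J 1 = 0"
    proof (rule analytic_continuation[OF _ open_sector[OF p(3)] connected_sector[OF p(4,3)] _ one isl, where f = "\<lambda>w. J w - J 1"])
      show "(\<lambda>w. J w - J 1) holomorphic_on sector (\<theta> - \<alpha>)" by (intro holomorphic_intros Jhol)
      show "?U \<subseteq> sector (\<theta> - \<alpha>)"
        by (rule image_subsetI) (use p(4) in \<open>simp add: sector_def\<close>)
      show "J z - J 1 = 0" if "z \<in> ?U" for z
        using that Jpos by (elim imageE) simp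
      show "w \<in> sector (\<theta> - \<alpha>)" by (rule w)
    qed
    then show ?thesis by simp
  qed
  define C0 where "C0 = (\<integral>z. (cmod (\<Phi> z))\<^sup>2 \<partial>?M)"
  have sq: "square_kernel \<Phi> z 1 = of_real ((cmod (\<Phi> z))\<^sup>2)" for z
    unfolding square_kernel_def cnj_fun_def complex_norm_square by simp
  have J1: "J 1 = of_real C0" unfolding J_def C0_def sq by (rule integral_complex_of_real)
  have contS: "continuous_on (sector \<alpha>) \<Phi>" 
    by (rule continuous_on_subset[OF holomorphic_on_imp_continuous_on[OF h] sector_mono]) (use a in simp)
  have ci: "integrable ?M (\<lambda>z. square_kernel \<Phi> z 1)"
    by (rule integrable_radial_decay_bound[OF p(1,5) meas[OF one], of "c\<^sup>2" "ln (cmod 1)"]) (use square_kernel_bound[OF \<Phi>(1) a(3) p(2,1) _ one] in auto)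
  then have "integrable ?M (\<lambda>z. Re (square_kernel \<Phi> z 1))" by (rule integrable_Re)
  then have ri: "integrable ?M (\<lambda>z. (cmod (\<Phi> z))\<^sup>2)" unfolding sq by simp
  have "C0 \<noteq> 0"
  proof
    assume "C0 = 0"
    then have "AE z in ?M. (cmod (\<Phi> z))\<^sup>2 = 0"
      using integral_nonneg_eq_0_iff_AE[OF ri] by (simp add: C0_def)
    then have "AE z in ?M. \<Phi> z = 0" by simp
    then have "AE z in restrict_space lborel (sector \<alpha>). 0 < ennreal (1 / (cmod z)\<^sup>2) \<longrightarrow> \<Phi> z = 0"
      unfolding sector_measure_def by (subst (asm) AE_density) (auto intro: measurable_restrict_space1)
    then have "AE z in lborel. z \<in> sector \<alpha> \<longrightarrow> 0 < ennreal (1 / (cmod z)\<^sup>2) \<longrightarrow> \<Phi> z = 0"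
      by (subst (asm) AE_restrict_space_iff) (use p(1) in \<open>auto simp: sector_borel\<close>)
    then have ae: "AE z in lborel. \<not> (z \<in> sector \<alpha> \<and> \<Phi> z \<noteq> 0)"
      by (rule AE_mp) (auto dest: sector_nonzero)
    let ?U = "sector \<alpha> \<inter> \<Phi> -` (- {0})"
    have oU: "open ?U" by (rule continuous_open_preimage[OF contS open_sector[OF p(1)]]) auto
    have "emeasure lborel ?U = 0" 
      using ae oU by (subst (asm) AE_iff_measurable[of ?U]) auto
    then have "?U \<in> null_sets lborel" using oU by auto
    then have "?U \<in> null_sets lebesgue" by (rule null_sets_completionI)
    then have "negligible ?U" by (simp add: negligible_iff_null_sets)
    then have emp: "?U = {}" using open_not_negligible[OF oU] by blast
    have "\<Phi> z = 0" if "z \<in> sector \<theta>" for z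
    proof (rule analytic_continuation_open[where s = "sector \<alpha>" and s' = "sector \<theta>" and f = \<Phi> and g = "\<lambda>_. 0"])
      show "sector \<alpha> \<subseteq> sector \<theta>" by (rule sector_mono) (use a in simp)
      show "sector \<alpha> \<noteq> {}" using one_in_sector[OF a(1)] by blast
      show "\<Phi> z = 0" if "z \<in> sector \<alpha>" for z using emp that by blast
    qed (use open_sector p a connected_sector h that in auto)
    then show False using nz by blast
  qed
  moreover have "C0 \<ge> 0" unfolding C0_def by simp
  ultimately have "C0 > 0" by simp
  then show ?thesis
    by (rule that) (use Jc J1 in \<open>simp add: J_def\<close>)
qed

lemma measurable_pair_sector:
  fixes F :: "complex \<times> real \<Rightarrow> complex"
  assumes "\<beta> \<le> pi" "continuous_on (sector \<beta> \<times> UNIV) F"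
  shows "F \<in> borel_measurable (sector_measure \<beta> \<Otimes>\<^sub>M (lborel :: real measure))"
proof -
  let ?G = "\<lambda>p. indicator (sector \<beta> \<times> UNIV) p *\<^sub>R F p"
  have "?G \<in> borel_measurable borel"
    by (rule borel_measurable_continuous_on_indicator[OF _ assms(2)]) (simp add: open_sector[OF assms(1)] open_Times)
  then have G: "?G \<in> borel_measurable (borel \<Otimes>\<^sub>M borel)" by (simp add: borel_prod)
  have "(\<lambda>p. (fst p, snd p)) \<in> measurable (sector_measure \<beta> \<Otimes>\<^sub>M (lborel :: real measure)) (borel \<Otimes>\<^sub>M borel)"
  proof (rule measurable_Pair)
    have 1: "(\<lambda>z. z) \<in> measurable (sector_measure \<beta>) borel"
      unfolding measurable_sector_measure_cong by (rule measurable_restrict_space1) simp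
    have 2: "fst \<in> measurable (sector_measure \<beta> \<Otimes>\<^sub>M (lborel :: real measure)) (sector_measure \<beta>)" by (rule measurable_fst)
    from measurable_compose[OF 2 1] show "fst \<in> measurable (sector_measure \<beta> \<Otimes>\<^sub>M (lborel :: real measure)) borel" by simp
    have "snd \<in> measurable (sector_measure \<beta> \<Otimes>\<^sub>M (lborel :: real measure)) (lborel :: real measure)" by (rule measurable_snd)
    then show "snd \<in> measurable (sector_measure \<beta> \<Otimes>\<^sub>M (lborel :: real measure)) borel" by simp
  qed
  from measurable_compose[OF this G] have "?G \<in> borel_measurable (sector_measure \<beta> \<Otimes>\<^sub>M (lborel :: real measure))" by simp
  then show ?thesis
    by (rule measurable_cong[THEN iffD1, rotated]) (auto simp: space_pair_measure)
qed

section \<open>Square functions\<close>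

subsection \<open>The reproducing formula\<close>

lemma sector_decay_add_scaled:
  assumes "sector_decay \<nu> s c f" "sector_decay \<nu> s d g" "0 < \<nu>"
  shows "sector_decay \<nu> s (c + cmod a * d) (\<lambda>w. f w + a * g w)"
  unfolding sector_decay_def
proof (intro conjI ballI)
  show "(\<lambda>w. f w + a * g w) holomorphic_on sector \<nu>"
    using assms by (auto simp: sector_decay_def intro!: holomorphic_intros)
  fix w assume w: "w \<in> sector \<nu>"
  have "cmod (f w + a * g w) \<le> c * exp (- s * \<bar>ln (cmod w)\<bar>) + cmod a * (d * exp (- s * \<bar>ln (cmod w)\<bar>))"
    using assms w by (intro order_trans[OF norm_triangle_ineq] add_mono) (auto simp: sector_decay_def norm_mult intro: mult_left_mono)
  then show "cmod (f w + a * g w) \<le> (c + cmod a * d) * exp (- s * \<bar>ln (cmod w)\<bar>)" by (simp add: algebra_simps)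
qed

context sectorial_family
begin

lemma op_add_scaled:
  assumes f: "sector_decay \<nu> s c f" "sector_decay \<nu> s d g" "s > 0" and g: "\<omega> < \<gamma>" "\<gamma> < \<nu>" "\<nu> \<le> pi"
  shows "op \<gamma> (\<lambda>w. f w + a * g w) x = op \<gamma> f x + a *\<^sub>C op \<gamma> g x"
proof (rule cinner_ext)
  fix y
  have p: "0 < \<nu>" "0 < \<gamma>" using g omega by linarith+
  have i: "integrable lborel (\<lambda>u. f (exp (Complex u v)) * M (Complex u v) x y)"
    "integrable lborel (\<lambda>u. a * (g (exp (Complex u v)) * M (Complex u v) x y))" if "\<bar>v\<bar> = \<gamma>" for v
    using integrand_integrable[OF f(1,3) g that] integrand_integrable[OF f(2,3) g that] by auto
  have "cinner (op \<gamma> (\<lambda>w. f w + a * g w) x) y = Cint \<gamma> (\<lambda>\<zeta>. f (exp \<zeta>) * M \<zeta> x y + a * (g (exp \<zeta>) * M \<zeta> x y))"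
    by (subst op_weak[OF sector_decay_add_scaled[OF f(1,2) p(1)] f(3) g]) (simp add: algebra_simps)
  also have "\<dots> = Cint \<gamma> (\<lambda>\<zeta>. f (exp \<zeta>) * M \<zeta> x y) + Cint \<gamma> (\<lambda>\<zeta>. a * (g (exp \<zeta>) * M \<zeta> x y))"
    by (rule Cint_add) (use i p in auto)
  also have "\<dots> = cinner (op \<gamma> f x + a *\<^sub>C op \<gamma> g x) y"
    by (simp add: Cint_cmult op_weak[OF f(1,3) g] op_weak[OF f(2,3) g] cinner_add_left cinner_scaleC_left)
  finally show "cinner (op \<gamma> (\<lambda>w. f w + a * g w) x) y = cinner (op \<gamma> f x + a *\<^sub>C op \<gamma> g x) y" .
qed

text \<open>
  Dominated convergence on the contour: near \<open>z0\<close> the bound, which depends on \<open>z\<close>, is replaced by one with the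
  factor \<open>exp (s B)\<close>, where \<open>B\<close> bounds \<open>\<bar>ln \<bar>z\<bar>\<bar>\<close> along the sequence.
\<close>

lemma op_family_continuous:
  assumes G: "\<And>z. z \<in> sector \<alpha> \<Longrightarrow> sector_decay \<nu> s (c z) (G z)" "s > 0" and g: "\<omega> < \<gamma>" "\<gamma> < \<nu>" "\<nu> \<le> pi"
    and cont: "\<And>w. w \<in> sector \<nu> \<Longrightarrow> continuous_on (sector \<alpha>) (\<lambda>z. G z w)"
    and bound: "\<And>z w. z \<in> sector \<alpha> \<Longrightarrow> w \<in> sector \<nu> \<Longrightarrow> cmod (G z w) \<le> C * exp (- s * \<bar>ln (cmod w) + ln (cmod z)\<bar>)"
  shows "continuous_on (sector \<alpha>) (\<lambda>z. op \<gamma> (G z))"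
  unfolding continuous_on_sequentially
proof (intro allI ballI impI, elim conjE)
  fix Z z0 assume z0: "z0 \<in> sector \<alpha>" and Z: "\<forall>n. Z n \<in> sector \<alpha>" "Z \<longlonglongrightarrow> z0"
  have p: "0 < \<nu>" "0 < \<gamma>" "\<gamma> < pi" using g omega by linarith+
  have nz: "z0 \<noteq> 0" using z0 sector_nonzero by blast
  have "cmod (G z0 1) \<le> C * exp (- s * \<bar>ln (cmod 1) + ln (cmod z0)\<bar>)" by (rule bound[OF z0 one_in_sector[OF p(1)]])
  then have C: "C \<ge> 0" by (smt (verit) exp_gt_zero norm_ge_zero zero_le_mult_iff)
  obtain K where K: "K > 0" 
    "\<And>\<zeta> x y. \<gamma> \<le> \<bar>Im \<zeta>\<bar> \<Longrightarrow> \<bar>Im \<zeta>\<bar> \<le> 2 * pi - \<gamma> \<Longrightarrow> cmod (M \<zeta> x y) \<le> K * norm x * norm y"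
    using M_bound[OF g(1) p(3)] by auto
  have lim: "(\<lambda>n. ln (cmod (Z n))) \<longlonglongrightarrow> ln (cmod z0)" by (intro tendsto_intros Z) (use nz in auto)
  then obtain B where B: "\<And>n. \<bar>ln (cmod (Z n))\<bar> \<le> B"
    by (metis convergent_imp_Bseq convergentI BseqE real_norm_def)
  have B0: "\<bar>ln (cmod z0)\<bar> \<le> B"
    by (rule LIMSEQ_le_const2[OF tendsto_rabs[OF lim]]) (use B in auto)
  have Gb: "cmod (G z (exp (Complex u v))) \<le> C * exp (s * B) * exp (- s * \<bar>u + 0\<bar>)" if "z \<in> sector \<alpha>" "\<bar>ln (cmod z)\<bar> \<le> B" "\<bar>v\<bar> = \<gamma>" for z u v
  proof -
    have "exp (Complex u v) \<in> sector \<nu>" by (rule exp_in_sector) (use that g in auto)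
    from bound[OF that(1) this] have "cmod (G z (exp (Complex u v))) \<le> C * exp (- s * \<bar>u + ln (cmod z)\<bar>)" by simp
    also have "\<dots> \<le> C * (exp (s * B) * exp (- s * \<bar>u + 0\<bar>))"
    proof (rule mult_left_mono[OF _ C])
      have "s * \<bar>u\<bar> \<le> s * (\<bar>u + ln (cmod z)\<bar> + B)" using that(2) G(2) by (intro mult_left_mono) auto
      then show "exp (- s * \<bar>u + ln (cmod z)\<bar>) \<le> exp (s * B) * exp (- s * \<bar>u + 0\<bar>)"
        by (simp add: exp_add[symmetric] algebra_simps)
    qed
    finally show ?thesis by (simp add: mult.assoc)
  qed
  define D where "D n v u = cmod (G (Z n) (exp (Complex u v)) - G z0 (exp (Complex u v)))" for n v u
  let ?w = "\<lambda>u. 4 * (C * exp (s * B)) * exp (- s * \<bar>u + 0\<bar>)"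
  have wi: "integrable lborel ?w" by (intro integrable_mult_right integrable_exp_decay G)
  have Db: "D n v u \<le> 2 * (C * exp (s * B)) * exp (- s * \<bar>u + 0\<bar>)" if "\<bar>v\<bar> = \<gamma>" for n v u
    unfolding D_def using norm_triangle_ineq4[of "G (Z n) (exp (Complex u v))" "G z0 (exp (Complex u v))"]
      Gb[of "Z n" v u] Gb[OF z0 B0 that, of u] Z B that by (simp add: mult.assoc)
  have Gm: "(\<lambda>u. G z (exp (Complex u v))) \<in> borel_measurable borel" if "z \<in> sector \<alpha>" "\<bar>v\<bar> = \<gamma>" for z v
  proof (rule borel_measurable_continuous_onI)
    have "(\<lambda>\<zeta>. G z (exp \<zeta>)) holomorphic_on {\<zeta>. \<bar>Im \<zeta>\<bar> < \<nu>}"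
      by (rule holomorphic_exp_sector[of _ \<nu>]) (use G(1)[OF that(1)] g in \<open>auto simp: sector_decay_def\<close>)
    then show "continuous_on UNIV (\<lambda>u. G z (exp (Complex u v)))" by (rule continuous_line) (use that g in auto)
  qed
  have Dm: "(\<lambda>u. D n v u) \<in> borel_measurable lborel" if "\<bar>v\<bar> = \<gamma>" for n v
  proof -
    have "Z n \<in> sector \<alpha>" using Z by simp
    note [measurable] = Gm[OF this that] Gm[OF z0 that]
    show ?thesis unfolding D_def by measurable
  qed
  let ?h = "\<lambda>n u. D n \<gamma> u + D n (-\<gamma>) u"
  have v: "\<bar>\<gamma>\<bar> = \<gamma>" "\<bar>-\<gamma>\<bar> = \<gamma>" using p by auto
  have hb: "norm (?h n u) \<le> ?w u" for n u
    using Db[OF v(1), of n u] Db[OF v(2), of n u] by (simp add: D_def)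
  have hi: "integrable lborel (?h n)" for n
  proof (rule Bochner_Integration.integrable_bound[OF wi])
    show "?h n \<in> borel_measurable lborel" using Dm v by auto
    show "AE u in lborel. norm (?h n u) \<le> norm (?w u)"
      by (rule AE_I2, rule order_trans[OF hb]) simp
  qed
  have lim0: "(\<lambda>n. \<integral>u. ?h n u \<partial>lborel) \<longlonglongrightarrow> (\<integral>u. 0 \<partial>(lborel :: real measure))"
  proof (rule integral_dominated_convergence[where w = ?w])
    have Dl: "(\<lambda>n. D n v u) \<longlonglongrightarrow> 0" if "\<bar>v\<bar> = \<gamma>" for u v
    proof -
      have "exp (Complex u v) \<in> sector \<nu>" by (rule exp_in_sector) (use that g in auto)
      from cont[OF this] have "(\<lambda>n. G (Z n) (exp (Complex u v))) \<longlonglongrightarrow> G z0 (exp (Complex u v))"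
        using Z z0 unfolding continuous_on_sequentially by (auto simp: o_def)
      from tendsto_norm[OF tendsto_diff[OF this tendsto_const[of "G z0 (exp (Complex u v))"]]] show ?thesis by (simp add: D_def)
    qed
    show "AE u in lborel. (\<lambda>n. ?h n u) \<longlonglongrightarrow> 0"
    proof (rule AE_I2)
      fix u :: real
      show "(\<lambda>n. ?h n u) \<longlonglongrightarrow> 0" using tendsto_add[OF Dl[OF v(1), of u] Dl[OF v(2), of u]] by simp
    qed
  qed (use Dm v hb wi in auto)
  have le: "norm (op \<gamma> (G (Z n)) - op \<gamma> (G z0)) \<le> K / pi * (\<integral>u. ?h n u \<partial>lborel)" for n
  proof -
    have zn: "Z n \<in> sector \<alpha>" using Z by simp
    have dd: "sector_decay \<nu> s (c (Z n) + cmod (-1) * c z0) (\<lambda>w. G (Z n) w + (-1) * G z0 w)"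
      by (rule sector_decay_add_scaled[OF G(1)[OF zn] G(1)[OF z0] p(1)])
    have "op \<gamma> (G (Z n)) - op \<gamma> (G z0) = op \<gamma> (\<lambda>w. G (Z n) w + (-1) * G z0 w)"
      by (rule blinfun_eqI) (subst op_add_scaled[OF G(1)[OF zn] G(1)[OF z0] G(2) g], simp add: blinfun.diff_left scaleC_minus1)
    also have "norm \<dots> \<le> K / pi * (\<integral>u. ?h n u \<partial>lborel)"
    proof (rule op_norm_le[OF dd G(2) g _ _ hi])
      show "cmod (M \<zeta> x y) \<le> K * norm x * norm y" if "\<bar>Im \<zeta>\<bar> = \<gamma>" for \<zeta> x y by (rule K(2)) (use that p in auto)
      show "cmod (G (Z n) (exp (Complex u v)) + (-1) * G z0 (exp (Complex u v))) \<le> ?h n u" if "\<bar>v\<bar> = \<gamma>" for u v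
      proof -
        have "v = \<gamma> \<or> v = -\<gamma>" using that by auto
        then show ?thesis by (auto simp: D_def)
      qed
    qed (use K in simp)
    finally show ?thesis .
  qed
  have "(\<lambda>n. op \<gamma> (G (Z n)) - op \<gamma> (G z0)) \<longlonglongrightarrow> 0"
    by (rule Lim_null_comparison[where g = "\<lambda>n. K / pi * (\<integral>u. ?h n u \<partial>lborel)"])
      (use le tendsto_mult_left[OF lim0, of "K / pi"] in auto)
  then show "((\<lambda>z. op \<gamma> (G z)) \<circ> Z) \<longlonglongrightarrow> op \<gamma> (G z0)" by (simp add: o_def Lim_null[symmetric])
qed

lemma op_dilate_continuous:
  assumes F: "sector_decay \<theta> s c F" "s > 0" and a: "0 < \<alpha>" "\<alpha> < \<theta>" "\<theta> \<le> pi" and g: "\<omega> < \<gamma>" "\<gamma> < \<nu>" "\<nu> \<le> \<theta> - \<alpha>"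
    and f: "f holomorphic_on sector \<nu>" "\<And>w. w \<in> sector \<nu> \<Longrightarrow> cmod (f w) \<le> B"
  shows "continuous_on (sector \<alpha>) (\<lambda>z. op \<gamma> (\<lambda>w. f w * F (z * w)))"
proof (rule op_family_continuous[OF _ F(2) g(1,2)])
  have p: "0 < \<nu>" "\<nu> \<le> pi" "0 < \<theta>" using g omega a by linarith+
  have B: "B \<ge> 0" using f(2)[OF one_in_sector[OF p(1)]] norm_ge_zero order_trans by blast
  show "\<nu> \<le> pi" by fact
  have sub: "w \<in> sector (\<theta> - \<alpha>)" if "w \<in> sector \<nu>" for w using sector_mono[OF g(3)] that by blast
  show "sector_decay \<nu> s (B * (c * exp (s * \<bar>ln (cmod z)\<bar>))) (\<lambda>w. f w * F (z * w))" if "z \<in> sector \<alpha>" for z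
    by (rule sector_decay_mult_bounded[OF sector_decay_mono[OF sector_decay_dilate[OF F a(3) that p(3)] g(3)] p(1) f])
  show "continuous_on (sector \<alpha>) (\<lambda>z. f w * F (z * w))" if "w \<in> sector \<nu>" for w
    by (intro continuous_on_mult continuous_on_const continuous_on_dilate[OF _ a(3) sub[OF that]]) (use F in \<open>simp add: sector_decay_def\<close>)
  show "cmod (f w * F (z * w)) \<le> (B * c) * exp (- s * \<bar>ln (cmod w) + ln (cmod z)\<bar>)" if "z \<in> sector \<alpha>" "w \<in> sector \<nu>" for z w
    unfolding norm_mult mult.assoc using sector_decay_dilate_bound[OF F(1) a(3) that(1) sub[OF that(2)]] f(2)[OF that(2)] B
    by (intro mult_mono) auto
qed

text \<open>
  Fubini for the contour integral and the integral over \<open>z\<close>; the inner integral is the constant of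
  \<open>square_kernel_integral\<close>.
\<close>

lemma reproducing:
  assumes \<Phi>: "sector_decay \<theta> s c \<Phi>" "s > 0" and a: "0 < \<alpha>" "\<alpha> < \<theta>" "\<theta> \<le> pi"
    and g: "\<omega> < \<gamma>" "\<gamma> < \<nu>" "\<nu> \<le> \<theta> - \<alpha>"
    and f: "sector_decay \<nu> s' d f" "s' > 0"
    and C0: "\<And>w. w \<in> sector (\<theta> - \<alpha>) \<Longrightarrow> (\<integral>z. square_kernel \<Phi> z w \<partial>sector_measure \<alpha>) = of_real C0"
  shows "(\<integral>z. cinner (op \<gamma> (\<lambda>w. f w * square_kernel \<Phi> z w) x) y \<partial>sector_measure \<alpha>) = of_real C0 * cinner (op \<gamma> f x) y" (is ?eq)
    and "integrable (sector_measure \<alpha>) (\<lambda>z. cinner (op \<gamma> (\<lambda>w. f w * square_kernel \<Phi> z w) x) y)" (is ?int)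
proof -
  let ?M = "sector_measure \<alpha>"
  have p: "0 < \<nu>" "\<nu> \<le> pi" "0 < \<theta>" "\<alpha> \<le> pi" "\<gamma> < pi" "0 < \<gamma>" "2 * s > 0" using g omega a \<Phi> by linarith+
  have h: "\<Phi> holomorphic_on sector \<theta>" using \<Phi> by (simp add: sector_decay_def)
  have c: "c \<ge> 0" "d \<ge> 0" using sector_decay_nonneg[OF \<Phi>(1) p(3)] sector_decay_nonneg[OF f(1) p(1)] by auto
  have sub: "w \<in> sector (\<theta> - \<alpha>)" if "w \<in> sector \<nu>" for w using sector_mono[OF g(3)] that by blast
  obtain K where K: "K > 0" 
    "\<And>\<zeta> x y. \<gamma> \<le> \<bar>Im \<zeta>\<bar> \<Longrightarrow> \<bar>Im \<zeta>\<bar> \<le> 2 * pi - \<gamma> \<Longrightarrow> cmod (M \<zeta> x y) \<le> K * norm x * norm y"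
    using M_bound[OF g(1) p(5)] by auto
  have kb: "cmod (square_kernel \<Phi> z w) \<le> c\<^sup>2 * exp (- (2 * s) * \<bar>ln (cmod w) + ln (cmod z)\<bar>)" if "z \<in> sector \<alpha>" "w \<in> sector \<nu>" for z w
    by (rule square_kernel_bound[OF \<Phi>(1) a(3) p(3,4) that(1) sub[OF that(2)]])
  have fk: "sector_decay \<nu> s' (c\<^sup>2 * d) (\<lambda>w. square_kernel \<Phi> z w * f w)" if z: "z \<in> sector \<alpha>" for z
  proof (rule sector_decay_mult_bounded[OF f(1) p(1)])
    show "square_kernel \<Phi> z holomorphic_on sector \<nu>"
      by (rule holomorphic_on_subset[OF square_kernel_holomorphic[OF h a(3) p(4) z]]) (use sub in blast)
    fix w assume w: "w \<in> sector \<nu>"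
    have "c\<^sup>2 * exp (- (2 * s) * \<bar>ln (cmod w) + ln (cmod z)\<bar>) \<le> c\<^sup>2 * 1"
      by (rule mult_left_mono) (use \<Phi>(2) in auto)
    then show "cmod (square_kernel \<Phi> z w) \<le> c\<^sup>2" using kb[OF z w] by simp
  qed
  have weak: "cinner (op \<gamma> (\<lambda>w. f w * square_kernel \<Phi> z w) x) y = Cint \<gamma> (\<lambda>\<zeta>. square_kernel \<Phi> z (exp \<zeta>) * f (exp \<zeta>) * M \<zeta> x y)"
    if z: "z \<in> sector \<alpha>" for z
    using op_weak[OF fk[OF z] f(2) g(1,2) p(2), of x y] by (simp add: mult.commute)
  let ?F = "\<lambda>v u z. square_kernel \<Phi> z (exp (Complex u v)) * (f (exp (Complex u v)) * M (Complex u v) x y)"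
  have fub: "(\<integral>u. (\<integral>z. ?F v u z \<partial>?M) \<partial>lborel) = (\<integral>z. (\<integral>u. ?F v u z \<partial>lborel) \<partial>?M)"
    "integrable ?M (\<lambda>z. (\<integral>u. ?F v u z \<partial>lborel))" if v: "\<bar>v\<bar> = \<gamma>" for v
  proof -
    have es: "exp (Complex u v) \<in> sector \<nu>" for u by (rule exp_in_sector) (use v g p in auto)
    have cl: "continuous_on UNIV (\<lambda>u. f (exp (Complex u v)) * M (Complex u v) x y)"
    proof (rule continuous_line)
      show "(\<lambda>\<zeta>. f (exp \<zeta>) * M \<zeta> x y) holomorphic_on {\<zeta>. \<omega> < \<bar>Im \<zeta>\<bar> \<and> \<bar>Im \<zeta>\<bar> < \<nu>}"
        using f p by (intro holomorphic_on_mult holomorphic_exp_sector[of _ \<nu>] M_holomorphic) (auto simp: sector_decay_def)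
      show "Complex u v \<in> {\<zeta>. \<omega> < \<bar>Im \<zeta>\<bar> \<and> \<bar>Im \<zeta>\<bar> < \<nu>}" for u using v g by simp
    qed
    have ce: "continuous_on S (\<lambda>p::complex\<times>real. exp (Complex (snd p) v))" for S
      unfolding Complex_eq by (intro continuous_intros)
    have cp: "continuous_on (sector \<alpha> \<times> UNIV) (\<lambda>p. \<Psi> (fst p * exp (Complex (snd p) v)))" if "\<Psi> holomorphic_on sector \<theta>" for \<Psi>
    proof (rule continuous_on_compose2[OF holomorphic_on_imp_continuous_on[OF that]])
      show "(\<lambda>p. fst p * exp (Complex (snd p) v)) ` (sector \<alpha> \<times> UNIV) \<subseteq> sector \<theta>"
        using sector_mult[of _ \<alpha> _ "\<theta> - \<alpha>"] sub[OF es] a by auto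
    qed (intro continuous_intros ce)
    have cpc: "continuous_on (sector \<alpha> \<times> UNIV) (\<lambda>p. \<Psi> (cnj (fst p) * exp (Complex (snd p) v)))" if "\<Psi> holomorphic_on sector \<theta>" for \<Psi>
    proof (rule continuous_on_compose2[OF holomorphic_on_imp_continuous_on[OF that]])
      show "(\<lambda>p. cnj (fst p) * exp (Complex (snd p) v)) ` (sector \<alpha> \<times> UNIV) \<subseteq> sector \<theta>"
        using sector_mult[of _ \<alpha> _ "\<theta> - \<alpha>"] sub[OF es] a sector_cnj[OF p(4)] by auto
    qed (intro continuous_intros ce)
    have "continuous_on (sector \<alpha> \<times> UNIV) (\<lambda>p. ?F v (snd p) (fst p))"
      unfolding square_kernel_def
    proof (intro continuous_on_mult[OF continuous_on_mult] cp[OF h] cpc[OF cnj_fun_holomorphic[OF h a(3)]])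
      show "continuous_on (sector \<alpha> \<times> UNIV) (\<lambda>p. f (exp (Complex (snd p) v)) * M (Complex (snd p) v) x y)"
        by (rule continuous_on_compose2[OF cl]) (auto intro: continuous_intros)
    qed
    then have "(\<lambda>p. ?F v (snd p) (fst p)) \<in> borel_measurable (?M \<Otimes>\<^sub>M lborel)" by (rule measurable_pair_sector[OF p(4)])
    then have "(\<lambda>p. ?F v (fst p) (snd p)) \<in> borel_measurable (lborel \<Otimes>\<^sub>M ?M)"
      by (subst (asm) measurable_pair_swap_iff) (simp add: split_def)
    then have m: "(\<lambda>(u, z). ?F v u z) \<in> borel_measurable (lborel \<Otimes>\<^sub>M ?M)" by (simp add: split_def)
    let ?B = "ennreal (exp (2 * s) * (2 / (2 * s)) * (4 * exp 2))"
    let ?E = "d * (K * norm x * norm y)"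
    have E0: "?E \<ge> 0" using c K by simp
    have "(\<integral>\<^sup>+u. (\<integral>\<^sup>+z. ennreal (cmod (?F v u z)) \<partial>?M) \<partial>lborel)
      \<le> (\<integral>\<^sup>+u. (\<integral>\<^sup>+z. ennreal (c\<^sup>2 * ?E * exp (- s' * \<bar>u + 0\<bar>)) * ennreal (exp (- (2 * s) * \<bar>u + ln (cmod z)\<bar>)) \<partial>?M) \<partial>lborel)"
    proof (intro nn_integral_mono)
      fix u z assume "z \<in> space ?M"
      then have z: "z \<in> sector \<alpha>" by simp
      have "cmod (?F v u z) \<le> (c\<^sup>2 * exp (- (2 * s) * \<bar>u + ln (cmod z)\<bar>)) * ((d * exp (- s' * \<bar>u\<bar>)) * (K * norm x * norm y))"
        unfolding norm_mult
        using kb[OF z es[of u]] sector_decay_exp[OF f(1) p(2), of "Complex u v"] K(2)[of "Complex u v" x y] v g p c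
        by (intro mult_mono) auto
      also have "\<dots> = (c\<^sup>2 * ?E * exp (- s' * \<bar>u + 0\<bar>)) * exp (- (2 * s) * \<bar>u + ln (cmod z)\<bar>)" by simp
      finally show "ennreal (cmod (?F v u z)) \<le> ennreal (c\<^sup>2 * ?E * exp (- s' * \<bar>u + 0\<bar>)) * ennreal (exp (- (2 * s) * \<bar>u + ln (cmod z)\<bar>))"
        by (simp only: ennreal_mult''[symmetric] exp_ge_zero ennreal_leI)
    qed
    also have "\<dots> = (\<integral>\<^sup>+u. ennreal (c\<^sup>2 * ?E * exp (- s' * \<bar>u + 0\<bar>)) * (\<integral>\<^sup>+z. ennreal (exp (- (2 * s) * \<bar>u + ln (cmod z)\<bar>)) \<partial>?M) \<partial>lborel)"
      by (intro nn_integral_cong nn_integral_cmult) (auto simp: measurable_sector_measure_cong intro!: measurable_restrict_space1)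
    also have "\<dots> \<le> (\<integral>\<^sup>+u. ennreal (c\<^sup>2 * ?E * exp (- s' * \<bar>u + 0\<bar>)) * ?B \<partial>lborel)"
      by (intro nn_integral_mono mult_left_mono nn_integral_radial_decay p) auto
    also have "\<dots> = ennreal (c\<^sup>2 * ?E) * (\<integral>\<^sup>+u. ennreal (exp (- s' * \<bar>u + 0\<bar>)) \<partial>lborel) * ?B"
      using E0 by (subst nn_integral_multc) (auto simp: ennreal_mult nn_integral_cmult)
    also have "\<dots> \<le> ennreal (c\<^sup>2 * ?E) * ennreal (2 / s') * ?B"
      by (intro mult_right_mono mult_left_mono nn_integral_exp_decay f) auto
    also have "\<dots> < \<infinity>" by (simp add: ennreal_mult_less_top)
    finally have fin: "(\<integral>\<^sup>+u. (\<integral>\<^sup>+z. ennreal (cmod (?F v u z)) \<partial>?M) \<partial>lborel) < \<infinity>" .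
    note fs = fubini_swap[OF lborel.sigma_finite_measure_axioms sigma_finite_sector_measure[OF p(4)] m fin]
    show "(\<integral>u. (\<integral>z. ?F v u z \<partial>?M) \<partial>lborel) = (\<integral>z. (\<integral>u. ?F v u z \<partial>lborel) \<partial>?M)" by (rule fs(1))
    show "integrable ?M (\<lambda>z. (\<integral>u. ?F v u z \<partial>lborel))" by (rule fs(3))
  qed
  have v: "\<bar>\<gamma>\<bar> = \<gamma>" "\<bar>-\<gamma>\<bar> = \<gamma>" using p by auto
  let ?k = "1 / (2 * pi * \<i>)"
  have weak': "cinner (op \<gamma> (\<lambda>w. f w * square_kernel \<Phi> z w) x) y = ?k * ((\<integral>u. ?F (-\<gamma>) u z \<partial>lborel) - (\<integral>u. ?F \<gamma> u z \<partial>lborel))"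
    if "z \<in> space ?M" for z
    using weak[of z] that by (simp add: Cint_def mult.assoc)
  have "integrable ?M (\<lambda>z. ?k * ((\<integral>u. ?F (-\<gamma>) u z \<partial>lborel) - (\<integral>u. ?F \<gamma> u z \<partial>lborel)))"
    by (intro integrable_mult_right Bochner_Integration.integrable_diff fub(2) v)
  then show ?int using weak' by (subst Bochner_Integration.integrable_cong[OF refl]) auto
  have in1: "(\<integral>z. ?F v u z \<partial>?M) = of_real C0 * (f (exp (Complex u v)) * M (Complex u v) x y)" if "\<bar>v\<bar> = \<gamma>" for u v
    using C0[OF sub[OF exp_in_sector[of "Complex u v" \<nu>]]] that g p by simp
  have "(\<integral>z. cinner (op \<gamma> (\<lambda>w. f w * square_kernel \<Phi> z w) x) y \<partial>?M)
     = (\<integral>z. ?k * ((\<integral>u. ?F (-\<gamma>) u z \<partial>lborel) - (\<integral>u. ?F \<gamma> u z \<partial>lborel)) \<partial>?M)"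
    by (rule Bochner_Integration.integral_cong[OF refl weak'])
  also have "\<dots> = ?k * ((\<integral>z. (\<integral>u. ?F (-\<gamma>) u z \<partial>lborel) \<partial>?M) - (\<integral>z. (\<integral>u. ?F \<gamma> u z \<partial>lborel) \<partial>?M))"
    using fub(2)[OF v(1)] fub(2)[OF v(2)] by simp
  also have "\<dots> = ?k * ((\<integral>u. (\<integral>z. ?F (-\<gamma>) u z \<partial>?M) \<partial>lborel) - (\<integral>u. (\<integral>z. ?F \<gamma> u z \<partial>?M) \<partial>lborel))"
    by (simp only: fub(1)[OF v(1)] fub(1)[OF v(2)])
  also have "\<dots> = of_real C0 * Cint \<gamma> (\<lambda>\<zeta>. f (exp \<zeta>) * M \<zeta> x y)"
    unfolding in1[OF v(1)] in1[OF v(2)] Cint_def by (simp add: algebra_simps)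
  also have "Cint \<gamma> (\<lambda>\<zeta>. f (exp \<zeta>) * M \<zeta> x y) = cinner (op \<gamma> f x) y"
    by (rule op_weak[OF f g(1,2) p(2), symmetric])
  finally show ?eq .
qed

end

subsection \<open>Estimates for square functions\<close>

lemma sector_decay_mult_bounded_right:
  assumes "sector_decay \<theta> s c f" "0 < \<theta>" "g holomorphic_on sector \<theta>" "\<And>w. w \<in> sector \<theta> \<Longrightarrow> cmod (g w) \<le> B"
  shows "sector_decay \<theta> s (B * c) (\<lambda>w. f w * g w)"
  using sector_decay_mult_bounded[OF assms] by (simp only: mult.commute[of "g _"])

text \<open>
  Each new sign is chosen so that the inner product of the new term with the previous sum is nonnegative.
\<close>

lemma exists_signs:
  fixes v :: "nat \<Rightarrow> 'a::real_inner"
  shows "\<exists>\<epsilon> :: nat \<Rightarrow> real. (\<forall>k. \<epsilon> k = 1 \<or> \<epsilon> k = -1) \<and> (\<Sum>k<n. (norm (v k))\<^sup>2) \<le> (norm (\<Sum>k<n. \<epsilon> k *\<^sub>R v k))\<^sup>2"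
proof (induction n)
  case 0
  show ?case by (rule exI[of _ "\<lambda>_. 1"]) simp
next
  case (Suc n)
  then obtain \<epsilon> :: "nat \<Rightarrow> real" where e: "\<And>k. \<epsilon> k = 1 \<or> \<epsilon> k = -1" and le: "(\<Sum>k<n. (norm (v k))\<^sup>2) \<le> (norm (\<Sum>k<n. \<epsilon> k *\<^sub>R v k))\<^sup>2"
    by blast
  let ?S = "\<Sum>k<n. \<epsilon> k *\<^sub>R v k"
  define t :: real where "t = (if inner ?S (v n) \<ge> 0 then 1 else -1)"
  have t: "t = 1 \<or> t = -1" "t * inner ?S (v n) \<ge> 0" by (auto simp: t_def)
  have eq: "(\<Sum>k<Suc n. (\<epsilon>(n := t)) k *\<^sub>R v k) = ?S + t *\<^sub>R v n" by simp
  have "(norm (?S + t *\<^sub>R v n))\<^sup>2 = (norm ?S)\<^sup>2 + 2 * (t * inner ?S (v n)) + t * t * (norm (v n))\<^sup>2"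
    by (simp add: power2_norm_eq_inner inner_add inner_commute algebra_simps)
  also have "t * t = 1" using t(1) by auto
  finally have "(\<Sum>k<Suc n. (norm (v k))\<^sup>2) \<le> (norm (\<Sum>k<Suc n. (\<epsilon>(n := t)) k *\<^sub>R v k))\<^sup>2"
    unfolding eq using le t(2) by simp
  then show ?case using e t(1) by (intro exI[of _ "\<epsilon>(n := t)"]) auto
qed

text \<open>
  On \<open>[k, k + 1]\<close> the summand is at most \<open>e\<^sup>s\<close> times the integrand \<open>exp (- s \<bar>u + r\<bar>)\<close>.
\<close>

lemma sum_exp_decay_le:
  assumes "s > (0::real)"
  shows "(\<Sum>k<n. exp (- s * \<bar>real k + r\<bar>)) \<le> exp s * (2 / s)"
proof -
  have ie: "integrable lborel (\<lambda>u. exp s * exp (- s * \<bar>u + r\<bar>))"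
    by (rule integrable_mult_right, rule integrable_exp_decay[OF assms])
  have i: "(\<lambda>u. exp s * exp (- s * \<bar>u + r\<bar>)) integrable_on {a..b}" for a b
    by (intro integrable_continuous_interval continuous_intros)
  have "(\<Sum>k<n. exp (- s * \<bar>real k + r\<bar>)) \<le> integral {0..real n} (\<lambda>u. exp s * exp (- s * \<bar>u + r\<bar>))"
  proof (induction n)
    case (Suc n)
    have "exp (- s * \<bar>real n + r\<bar>) = integral {real n..real (Suc n)} (\<lambda>u. exp (- s * \<bar>real n + r\<bar>))"
      by simp
    also have "\<dots> \<le> integral {real n..real (Suc n)} (\<lambda>u. exp s * exp (- s * \<bar>u + r\<bar>))"
    proof (rule integral_le[OF _ i])
      fix u assume u: "u \<in> {real n..real (Suc n)}"
      then have "\<bar>u + r\<bar> \<le> \<bar>real n + r\<bar> + 1" by auto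
      then have "s * \<bar>u + r\<bar> \<le> s * (\<bar>real n + r\<bar> + 1)" using assms by (intro mult_left_mono) auto
      then show "exp (- s * \<bar>real n + r\<bar>) \<le> exp s * exp (- s * \<bar>u + r\<bar>)"
        by (simp add: exp_add[symmetric] algebra_simps)
    qed (intro integrable_const_ivl)
    finally have "(\<Sum>k<Suc n. exp (- s * \<bar>real k + r\<bar>)) \<le> integral {0..real n} (\<lambda>u. exp s * exp (- s * \<bar>u + r\<bar>)) + integral {real n..real (Suc n)} (\<lambda>u. exp s * exp (- s * \<bar>u + r\<bar>))"
      using Suc.IH by simp
    also have "\<dots> = integral {0..real (Suc n)} (\<lambda>u. exp s * exp (- s * \<bar>u + r\<bar>))"
      by (rule Henstock_Kurzweil_Integration.integral_combine) (use i in auto)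
    finally show ?case .
  qed simp
  also have "\<dots> \<le> integral UNIV (\<lambda>u. exp s * exp (- s * \<bar>u + r\<bar>))"
    by (rule integral_subset_le[OF _ i integrable_on_lborel[OF ie]]) auto
  also have "\<dots> = exp s * (\<integral>u. exp (- s * \<bar>u + r\<bar>) \<partial>lborel)"
    by (subst integral_lborel[OF ie]) simp
  also have "\<dots> \<le> exp s * (2 / s)" by (intro mult_left_mono integral_exp_decay assms) simp
  finally show ?thesis .
qed

text \<open>
  The decay, on the contour, of the product of a function dilated by \<open>z\<close> and one dilated by \<open>\<zeta>\<close>. As an
  integral over \<open>u\<close> its integrals over \<open>z\<close> and over \<open>\<zeta>\<close> factor, by Fubini, into radial ones.
\<close>

definition decay_kernel :: "real \<Rightarrow> real \<Rightarrow> complex \<Rightarrow> complex \<Rightarrow> ennreal" where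
  "decay_kernel s s' z \<zeta> = (\<integral>\<^sup>+u. ennreal (exp (- s * \<bar>u + ln (cmod z)\<bar>) * exp (- s' * \<bar>u + ln (cmod \<zeta>)\<bar>)) \<partial>lborel)"

lemma measurable_ln_sector [measurable]: "(\<lambda>z. ln (cmod z)) \<in> borel_measurable (sector_measure \<alpha>)"
  unfolding measurable_sector_measure_cong by (rule measurable_restrict_space1) simp

lemma decay_kernel_measurable:
  "(\<lambda>(z, \<zeta>). decay_kernel s s' z \<zeta>) \<in> borel_measurable (sector_measure \<alpha> \<Otimes>\<^sub>M sector_measure \<beta>)"
  unfolding decay_kernel_def by measurable

lemma decay_kernel_row:
  assumes "s > 0" "s' > 0" "\<beta> \<le> pi"
  shows "(\<integral>\<^sup>+\<zeta>. decay_kernel s s' z \<zeta> \<partial>sector_measure \<beta>) \<le> ennreal (2 / s) * ennreal (exp s' * (2 / s') * (4 * exp 2))"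
proof -
  interpret S: sigma_finite_measure "sector_measure \<beta>" by (rule sigma_finite_sector_measure) fact
  interpret P: pair_sigma_finite lborel "sector_measure \<beta>" ..
  have "(\<integral>\<^sup>+\<zeta>. decay_kernel s s' z \<zeta> \<partial>sector_measure \<beta>)
    = (\<integral>\<^sup>+u. (\<integral>\<^sup>+\<zeta>. ennreal (exp (- s * \<bar>u + ln (cmod z)\<bar>) * exp (- s' * \<bar>u + ln (cmod \<zeta>)\<bar>)) \<partial>sector_measure \<beta>) \<partial>lborel)"
    unfolding decay_kernel_def by (rule P.Fubini') measurable
  also have "\<dots> = (\<integral>\<^sup>+u. ennreal (exp (- s * \<bar>u + ln (cmod z)\<bar>)) * (\<integral>\<^sup>+\<zeta>. ennreal (exp (- s' * \<bar>u + ln (cmod \<zeta>)\<bar>)) \<partial>sector_measure \<beta>) \<partial>lborel)"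
    by (intro nn_integral_cong) (subst nn_integral_cmult[symmetric], measurable, simp add: ennreal_mult)
  also have "\<dots> \<le> (\<integral>\<^sup>+u. ennreal (exp (- s * \<bar>u + ln (cmod z)\<bar>)) * ennreal (exp s' * (2 / s') * (4 * exp 2)) \<partial>lborel)"
    by (intro nn_integral_mono mult_left_mono nn_integral_radial_decay assms) simp
  also have "\<dots> = (\<integral>\<^sup>+u. ennreal (exp (- s * \<bar>u + ln (cmod z)\<bar>)) \<partial>lborel) * ennreal (exp s' * (2 / s') * (4 * exp 2))"
    by (rule nn_integral_multc) simp
  also have "\<dots> \<le> ennreal (2 / s) * ennreal (exp s' * (2 / s') * (4 * exp 2))"
    by (intro mult_right_mono nn_integral_exp_decay assms) simp
  finally show ?thesis .
qed

lemma decay_kernel_commute: "decay_kernel s s' z \<zeta> = decay_kernel s' s \<zeta> z"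
  by (simp add: decay_kernel_def mult.commute)

lemma norm_measurable_sector:
  fixes T :: "complex \<Rightarrow> 'b::real_normed_vector"
  assumes "continuous_on (sector \<alpha>) T"
  shows "(\<lambda>z. ennreal (norm (T z))) \<in> borel_measurable (sector_measure \<alpha>)"
proof -
  have "(\<lambda>z. norm (T z)) \<in> borel_measurable (sector_measure \<alpha>)"
    by (rule continuous_measurable_sector) (intro continuous_intros assms)
  then show ?thesis by measurable
qed

context sectorial_family
begin

text \<open>
  The square of the area integral norm; the contour angle is a parameter because several functions have to be
  treated on a common contour.
\<close>

definition area :: "real \<Rightarrow> real \<Rightarrow> (complex \<Rightarrow> complex) \<Rightarrow> 'a \<Rightarrow> ennreal" where
  "area \<alpha> \<gamma> F x = (\<integral>\<^sup>+z. (ennreal (norm (op \<gamma> (\<lambda>w. F (z * w)) x)))\<^sup>2 \<partial>sector_measure \<alpha>)"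

lemma dilate_continuous:
  assumes F: "sector_decay \<theta> s c F" "s > 0" and a: "0 < \<alpha>" "\<alpha> < \<theta>" "\<theta> \<le> pi" and g: "\<omega> < \<gamma>" "\<gamma> < \<theta> - \<alpha>"
  shows "continuous_on (sector \<alpha>) (\<lambda>z. op \<gamma> (\<lambda>w. F (z * w)))"
  using op_dilate_continuous[OF F a g(1,2) order_refl, of "\<lambda>_. 1" 1] by simp

text \<open>
  The square function of \<open>F\<close> is controlled by that of \<open>\<psi>\<close>, even with a bounded factor \<open>f\<close>: the function
  \<open>f F\<^sub>z\<close> with \<open>F\<^sub>z w = F (z w)\<close> is expanded by the reproducing formula for \<open>\<psi>\<close>. One factor of the square
  kernel acts on \<open>x\<close>; the other, multiplied by \<open>f F\<^sub>z\<close>, gives operators whose norms are controlled by a kernel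
  to which the Schur test applies.
\<close>

lemma area_transfer:
  assumes F: "sector_decay \<theta>1 s1 c1 F" "s1 > 0" "0 < \<alpha>" "\<alpha> < \<theta>1" "\<theta>1 \<le> pi"
    and \<psi>: "sector_decay \<theta>2 s2 c2 \<psi>" "s2 > 0" "0 < \<beta>" "\<beta> < \<theta>2" "\<theta>2 \<le> pi" "\<exists>z\<in>sector \<theta>2. \<psi> z \<noteq> 0"
    and g: "\<omega> < \<gamma>" "\<gamma> < \<nu>" "\<nu> \<le> \<theta>1 - \<alpha>" "\<nu> \<le> \<theta>2 - \<beta>"
  shows "\<exists>C\<ge>0. \<forall>f B x. f holomorphic_on sector \<nu> \<longrightarrow> (\<forall>w\<in>sector \<nu>. cmod (f w) \<le> B) \<longrightarrow>
    (\<integral>\<^sup>+z. (ennreal (norm (op \<gamma> (\<lambda>w. f w * F (z * w)) x)))\<^sup>2 \<partial>sector_measure \<alpha>) \<le> ennreal ((C * B)\<^sup>2) * area \<beta> \<gamma> \<psi> x"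
proof -
  have p: "0 < \<nu>" "\<nu> \<le> pi" "0 < \<theta>1" "0 < \<theta>2" "\<alpha> \<le> pi" "\<beta> \<le> pi" "\<gamma> < pi" "0 < \<gamma>" using g omega F \<psi> by linarith+
  have sub1: "w \<in> sector (\<theta>1 - \<alpha>)" "w \<in> sector (\<theta>2 - \<beta>)" if "w \<in> sector \<nu>" for w using sector_mono[OF g(3)] sector_mono[OF g(4)] that by blast+
  have c: "c1 \<ge> 0" "c2 \<ge> 0" using sector_decay_nonneg[OF F(1) p(3)] sector_decay_nonneg[OF \<psi>(1) p(4)] by auto
  have \<psi>h: "\<psi> holomorphic_on sector \<theta>2" using \<psi> by (simp add: sector_decay_def)
  obtain K where K: "K > 0" 
    "\<And>\<zeta> x y. \<gamma> \<le> \<bar>Im \<zeta>\<bar> \<Longrightarrow> \<bar>Im \<zeta>\<bar> \<le> 2 * pi - \<gamma> \<Longrightarrow> cmod (M \<zeta> x y) \<le> K * norm x * norm y"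
    using M_bound[OF g(1) p(7)] by auto
  obtain C0 where C0: "C0 > 0" "\<And>w. w \<in> sector (\<theta>2 - \<beta>) \<Longrightarrow> (\<integral>z. square_kernel \<psi> z w \<partial>sector_measure \<beta>) = complex_of_real C0"
    using square_kernel_integral[OF \<psi>] by metis
  define A where "A = K / pi * c1 * c2 / C0"
  have A: "A \<ge> 0" using K c C0 by (simp add: A_def)
  define b1 where "b1 = 2 / s1 * (exp s2 * (2 / s2) * (4 * exp 2))"
  define b2 where "b2 = 2 / s2 * (exp s1 * (2 / s1) * (4 * exp 2))"
  have b: "b1 \<ge> 0" "b2 \<ge> 0" using F(2) \<psi>(2) by (auto simp: b1_def b2_def)
  have be: "ennreal b1 = ennreal (2 / s1) * ennreal (exp s2 * (2 / s2) * (4 * exp 2))"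
    "ennreal b2 = ennreal (2 / s2) * ennreal (exp s1 * (2 / s1) * (4 * exp 2))"
    unfolding b1_def b2_def by (rule ennreal_mult; use F(2) \<psi>(2) in simp)+
  define C where "C = A * sqrt (b1 * b2)"
  have "(\<integral>\<^sup>+z. (ennreal (norm (op \<gamma> (\<lambda>w. f w * F (z * w)) x)))\<^sup>2 \<partial>sector_measure \<alpha>) \<le> ennreal ((C * B)\<^sup>2) * area \<beta> \<gamma> \<psi> x"
    if f: "f holomorphic_on sector \<nu>" "\<And>w. w\<in>sector \<nu> \<Longrightarrow> cmod (f w) \<le> B" for f B x
  proof -
    have B: "B \<ge> 0" using f(2)[OF one_in_sector[OF p(1)]] norm_ge_zero order_trans by blast
    let ?T = "\<lambda>z. op \<gamma> (\<lambda>w. f w * F (z * w)) x"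
    let ?k = "\<lambda>z \<zeta>. ennreal (A * B) * decay_kernel s1 s2 z \<zeta>"
    have fF: "sector_decay \<nu> s1 (B * (c1 * exp (s1 * \<bar>ln (cmod z)\<bar>))) (\<lambda>w. f w * F (z * w))" if "z \<in> sector \<alpha>" for z
      by (rule sector_decay_mult_bounded[OF sector_decay_mono[OF sector_decay_dilate[OF F(1,2,5) that p(3)] g(3)] p(1) f])
    have ps: "sector_decay \<nu> s2 (c2 * exp (s2 * \<bar>ln (cmod z)\<bar>)) (\<lambda>w. \<psi> (z * w))" if "z \<in> sector \<beta>" for z
      by (rule sector_decay_mono[OF sector_decay_dilate[OF \<psi>(1,2,5) that p(4)] g(4)])
    have psc: "sector_decay \<nu> s2 (c2 * exp (s2 * \<bar>ln (cmod (cnj z))\<bar>)) (\<lambda>w. cnj_fun \<psi> (cnj z * w))" if "z \<in> sector \<beta>" for z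
      by (rule sector_decay_mono[OF sector_decay_dilate[OF cnj_fun_decay[OF \<psi>(1,5)] \<psi>(2,5) sector_cnj[OF p(6) that] p(4)] g(4)])
    have kn: "ennreal (norm (op \<gamma> (\<lambda>w. f w * F (z * w) * cnj_fun \<psi> (cnj \<zeta> * w)))) \<le> ennreal (C0 * A * B) * decay_kernel s1 s2 z \<zeta>"
      if z: "z \<in> sector \<alpha>" "\<zeta> \<in> sector \<beta>" for z \<zeta>
    proof -
      let ?e = "\<lambda>u. exp (- s1 * \<bar>u + ln (cmod z)\<bar>) * exp (- s2 * \<bar>u + ln (cmod \<zeta>)\<bar>)"
      have ei: "integrable lborel ?e"
        by (rule Bochner_Integration.integrable_bound[OF integrable_exp_decay[OF F(2), of "ln (cmod z)"]])
          (use \<psi>(2) in \<open>auto intro!: AE_I2 mult_left_le\<close>)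
      have pb: "cmod (cnj_fun \<psi> (cnj \<zeta> * w)) \<le> c2 * exp (- s2 * \<bar>ln (cmod w) + ln (cmod \<zeta>)\<bar>)" if "w \<in> sector \<nu>" for w
        using sector_decay_dilate_bound[OF cnj_fun_decay[OF \<psi>(1,5)] \<psi>(5) sector_cnj[OF p(6) z(2)] sub1(2)[OF that]] by simp
      have pb1: "cmod (cnj_fun \<psi> (cnj \<zeta> * w)) \<le> c2" if "w \<in> sector \<nu>" for w
      proof -
        have "c2 * exp (- s2 * \<bar>ln (cmod w) + ln (cmod \<zeta>)\<bar>) \<le> c2 * 1"
          by (rule mult_left_mono) (use \<psi>(2) c in auto)
        then show ?thesis using pb[OF that] by simp
      qed
      have dec: "sector_decay \<nu> s1 (c2 * (B * (c1 * exp (s1 * \<bar>ln (cmod z)\<bar>)))) (\<lambda>w. f w * F (z * w) * cnj_fun \<psi> (cnj \<zeta> * w))"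
        by (rule sector_decay_mult_bounded_right[OF fF[OF z(1)] p(1) _ pb1]) (use psc[OF z(2)] in \<open>simp_all add: sector_decay_def\<close>)
      have "norm (op \<gamma> (\<lambda>w. f w * F (z * w) * cnj_fun \<psi> (cnj \<zeta> * w))) \<le> K / pi * (\<integral>u. B * c1 * c2 * ?e u \<partial>lborel)"
      proof (rule op_norm_le[OF dec F(2) g(1,2) p(2)])
        show "cmod (M \<zeta> x y) \<le> K * norm x * norm y" if "\<bar>Im \<zeta>\<bar> = \<gamma>" for \<zeta> x y by (rule K(2)) (use that p in auto)
        show "integrable lborel (\<lambda>u. B * c1 * c2 * ?e u)" using ei by simp
        show "cmod (f (exp (Complex u v)) * F (z * exp (Complex u v)) * cnj_fun \<psi> (cnj \<zeta> * exp (Complex u v))) \<le> B * c1 * c2 * ?e u" if v: "\<bar>v\<bar> = \<gamma>" for u v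
        proof -
          have es: "exp (Complex u v) \<in> sector \<nu>" by (rule exp_in_sector) (use v g p in auto)
          have "cmod (f (exp (Complex u v)) * F (z * exp (Complex u v)) * cnj_fun \<psi> (cnj \<zeta> * exp (Complex u v)))
            \<le> B * (c1 * exp (- s1 * \<bar>u + ln (cmod z)\<bar>)) * (c2 * exp (- s2 * \<bar>u + ln (cmod \<zeta>)\<bar>))"
            unfolding norm_mult using f(2)[OF es] sector_decay_dilate_bound[OF F(1,5) z(1) sub1(1)[OF es]] pb[OF es] B c
            by (intro mult_mono) auto
          then show ?thesis by (simp only: mult_ac)
        qed
      qed (use K in simp)
      also have "\<dots> = C0 * A * B * (\<integral>u. ?e u \<partial>lborel)" using C0 by (simp add: A_def)
      finally have "ennreal (norm (op \<gamma> (\<lambda>w. f w * F (z * w) * cnj_fun \<psi> (cnj \<zeta> * w)))) \<le> ennreal (C0 * A * B * (\<integral>u. ?e u \<partial>lborel))"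
        by (rule ennreal_leI)
      also have "\<dots> = ennreal (C0 * A * B) * ennreal (\<integral>u. ?e u \<partial>lborel)"
        by (rule ennreal_mult) (use C0 A B in auto)
      also have "ennreal (\<integral>u. ?e u \<partial>lborel) = decay_kernel s1 s2 z \<zeta>"
        unfolding decay_kernel_def by (rule nn_integral_eq_integral[OF ei, symmetric]) auto
      finally show ?thesis .
    qed
    have T: "ennreal (norm (?T z)) \<le> (\<integral>\<^sup>+\<zeta>. ?k z \<zeta> * ennreal (norm (op \<gamma> (\<lambda>w. \<psi> (\<zeta> * w)) x)) \<partial>sector_measure \<beta>)" if "z \<in> space (sector_measure \<alpha>)" for z
    proof -
      have z: "z \<in> sector \<alpha>" using that by simp
      let ?g = "\<lambda>\<zeta>. cinner (op \<gamma> (\<lambda>w. (f w * F (z * w)) * square_kernel \<psi> \<zeta> w) x) (?T z)"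
      \<comment> \<open>Pairing with the vector itself recovers its norm from the weak formula; one factor \<open>norm (?T z)\<close> is
        cancelled at the end.\<close>
      note rp = reproducing[OF \<psi>(1-5) g(1,2,4) fF[OF z] F(2) C0(2), of x "?T z"]
      have "ennreal (norm (?T z)) * ennreal (norm (?T z)) * ennreal C0 = ennreal (cmod (of_real C0 * cinner (?T z) (?T z)))"
        using C0(1) by (simp add: cinner_self norm_mult norm_power power2_eq_square ennreal_mult mult_ac)
      also have "\<dots> = ennreal (norm (\<integral>\<zeta>. ?g \<zeta> \<partial>sector_measure \<beta>))" using rp(1) by simp
      also have "\<dots> \<le> (\<integral>\<^sup>+\<zeta>. ennreal (norm (?g \<zeta>)) \<partial>sector_measure \<beta>)" by (rule integral_norm_bound_ennreal[OF rp(2)])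
      also have "\<dots> \<le> (\<integral>\<^sup>+\<zeta>. ennreal (norm (?T z)) * ennreal C0 * (?k z \<zeta> * ennreal (norm (op \<gamma> (\<lambda>w. \<psi> (\<zeta> * w)) x))) \<partial>sector_measure \<beta>)"
      proof (intro nn_integral_mono)
        fix \<zeta> assume "\<zeta> \<in> space (sector_measure \<beta>)"
        then have \<zeta>: "\<zeta> \<in> sector \<beta>" by simp
        let ?O = "op \<gamma> (\<lambda>w. f w * F (z * w) * cnj_fun \<psi> (cnj \<zeta> * w))"
        let ?P = "op \<gamma> (\<lambda>w. \<psi> (\<zeta> * w)) x"
        have pb1: "cmod (cnj_fun \<psi> (cnj \<zeta> * w)) \<le> c2 * exp (s2 * \<bar>ln (cmod (cnj \<zeta>))\<bar>)" if "w \<in> sector \<nu>" for w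
          by (rule sector_decay_bound[OF psc[OF \<zeta>] p(1) _ that]) (use \<psi>(2) in simp)
        have dec: "sector_decay \<nu> s1 (c2 * exp (s2 * \<bar>ln (cmod (cnj \<zeta>))\<bar>) * (B * (c1 * exp (s1 * \<bar>ln (cmod z)\<bar>)))) (\<lambda>w. f w * F (z * w) * cnj_fun \<psi> (cnj \<zeta> * w))"
          by (rule sector_decay_mult_bounded_right[OF fF[OF z] p(1) _ pb1]) (use psc[OF \<zeta>] in \<open>simp_all add: sector_decay_def\<close>)
        have "?O ?P = op \<gamma> (\<lambda>w. (f w * F (z * w) * cnj_fun \<psi> (cnj \<zeta> * w)) * \<psi> (\<zeta> * w)) x"
          by (rule op_mult[OF dec F(2) ps[OF \<zeta>] \<psi>(2) g(1,2) p(2)])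
        also have "(\<lambda>w. (f w * F (z * w) * cnj_fun \<psi> (cnj \<zeta> * w)) * \<psi> (\<zeta> * w)) = (\<lambda>w. (f w * F (z * w)) * square_kernel \<psi> \<zeta> w)"
          by (simp add: square_kernel_def mult_ac)
        finally have eq: "op \<gamma> (\<lambda>w. (f w * F (z * w)) * square_kernel \<psi> \<zeta> w) x = ?O ?P" by simp
        have "norm (?g \<zeta>) \<le> norm (?O ?P) * norm (?T z)" unfolding eq by (rule norm_cinner_le)
        also have "\<dots> \<le> (norm ?O * norm ?P) * norm (?T z)" by (intro mult_right_mono norm_blinfun) simp
        finally have "ennreal (norm (?g \<zeta>)) \<le> ennreal ((norm ?O * norm ?P) * norm (?T z))" by (rule ennreal_leI)
        also have "\<dots> = ennreal (norm ?O) * ennreal (norm ?P) * ennreal (norm (?T z))" by (simp add: ennreal_mult)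
        also have "\<dots> \<le> (ennreal (C0 * A * B) * decay_kernel s1 s2 z \<zeta>) * ennreal (norm ?P) * ennreal (norm (?T z))"
          by (intro mult_right_mono kn z \<zeta>) auto
        also have "ennreal (C0 * A * B) = ennreal C0 * ennreal (A * B)"
          using C0(1) A B by (simp add: ennreal_mult'[symmetric] mult.assoc)
        finally show "ennreal (norm (?g \<zeta>)) \<le> ennreal (norm (?T z)) * ennreal C0 * (?k z \<zeta> * ennreal (norm ?P))"
          by (simp add: mult_ac)
      qed
      also have "\<dots> = ennreal (norm (?T z)) * ennreal C0 * (\<integral>\<^sup>+\<zeta>. ?k z \<zeta> * ennreal (norm (op \<gamma> (\<lambda>w. \<psi> (\<zeta> * w)) x)) \<partial>sector_measure \<beta>)"
      proof (rule nn_integral_cmult)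
        have [measurable]: "(\<lambda>\<zeta>. ennreal (norm (op \<gamma> (\<lambda>w. \<psi> (\<zeta> * w)) x))) \<in> borel_measurable (sector_measure \<beta>)"
          by (rule norm_measurable_sector, intro bounded_linear.continuous_on[OF blinfun.bounded_linear_left] dilate_continuous[OF \<psi>(1-5) g(1)]) (use g in auto)
        have [measurable]: "decay_kernel s1 s2 z \<in> borel_measurable (sector_measure \<beta>)"
          using measurable_compose[OF measurable_Pair1' decay_kernel_measurable, of z \<alpha>] z by simp
        show "(\<lambda>\<zeta>. ?k z \<zeta> * ennreal (norm (op \<gamma> (\<lambda>w. \<psi> (\<zeta> * w)) x))) \<in> borel_measurable (sector_measure \<beta>)" by measurable
      qed
      finally have le: "ennreal (norm (?T z)) * ennreal C0 * ennreal (norm (?T z)) \<le> ennreal (norm (?T z)) * ennreal C0 * (\<integral>\<^sup>+\<zeta>. ?k z \<zeta> * ennreal (norm (op \<gamma> (\<lambda>w. \<psi> (\<zeta> * w)) x)) \<partial>sector_measure \<beta>)"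
        by (simp add: mult_ac)
      show ?thesis
      proof (cases "norm (?T z) = 0")
        case False
        then have "ennreal (norm (?T z)) * ennreal C0 \<noteq> 0" "ennreal (norm (?T z)) * ennreal C0 < top"
          using C0(1) by (auto simp: ennreal_mult_less_top)
        then show ?thesis using le by (subst (asm) ennreal_mult_le_mult_iff) auto
      qed simp
    qed
    have "(\<integral>\<^sup>+z. (ennreal (norm (?T z)))\<^sup>2 \<partial>sector_measure \<alpha>) \<le> (ennreal (A * B) * ennreal b1) * (ennreal (A * B) * ennreal b2) * (\<integral>\<^sup>+\<zeta>. (ennreal (norm (op \<gamma> (\<lambda>w. \<psi> (\<zeta> * w)) x)))\<^sup>2 \<partial>sector_measure \<beta>)"
    proof (rule schur_test[where k = ?k, OF sigma_finite_sector_measure[OF p(5)] sigma_finite_sector_measure[OF p(6)] _ _ T])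
      note [measurable] = decay_kernel_measurable[of s1 s2 \<alpha> \<beta>]
      show "(\<lambda>(z, \<zeta>). ?k z \<zeta>) \<in> borel_measurable (sector_measure \<alpha> \<Otimes>\<^sub>M sector_measure \<beta>)" by measurable
      show "(\<lambda>\<zeta>. ennreal (norm (op \<gamma> (\<lambda>w. \<psi> (\<zeta> * w)) x))) \<in> borel_measurable (sector_measure \<beta>)"
        by (rule norm_measurable_sector, intro bounded_linear.continuous_on[OF blinfun.bounded_linear_left] dilate_continuous[OF \<psi>(1-5) g(1)]) (use g in auto)
      fix z assume z: "z \<in> space (sector_measure \<alpha>)"
      have m: "decay_kernel s1 s2 z \<in> borel_measurable (sector_measure \<beta>)"
        using measurable_compose[OF measurable_Pair1' decay_kernel_measurable, of z \<alpha>] z by simp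
      have "(\<integral>\<^sup>+\<zeta>. decay_kernel s1 s2 z \<zeta> \<partial>sector_measure \<beta>) \<le> ennreal b1"
        unfolding be by (rule decay_kernel_row[OF F(2) \<psi>(2) p(6)])
      then show "(\<integral>\<^sup>+\<zeta>. ?k z \<zeta> \<partial>sector_measure \<beta>) \<le> ennreal (A * B) * ennreal b1"
        using m by (simp add: nn_integral_cmult mult_left_mono)
    next
      fix \<zeta> assume z: "\<zeta> \<in> space (sector_measure \<beta>)"
      have m: "(\<lambda>z. decay_kernel s1 s2 z \<zeta>) \<in> borel_measurable (sector_measure \<alpha>)"
        using measurable_compose[OF measurable_Pair2' decay_kernel_measurable, of \<zeta> \<beta>] z by simp
      have "(\<integral>\<^sup>+z. decay_kernel s1 s2 z \<zeta> \<partial>sector_measure \<alpha>) \<le> ennreal b2"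
        unfolding decay_kernel_commute[of s1 s2]
        unfolding be by (rule decay_kernel_row[OF \<psi>(2) F(2) p(5)])
      then show "(\<integral>\<^sup>+z. ?k z \<zeta> \<partial>sector_measure \<alpha>) \<le> ennreal (A * B) * ennreal b2"
        using m by (simp add: nn_integral_cmult mult_left_mono)
    qed
    also have "(ennreal (A * B) * ennreal b1) * (ennreal (A * B) * ennreal b2) = ennreal ((C * B)\<^sup>2)"
    proof -
      have "(C * B)\<^sup>2 = (A * B * b1) * (A * B * b2)"
        using b by (simp add: C_def power_mult_distrib) (simp add: power2_eq_square mult_ac)
      then show ?thesis using A B b by (simp add: ennreal_mult)
    qed
    finally show ?thesis by (simp add: area_def)
  qed
  moreover have "C \<ge> 0" using A b by (simp add: C_def)
  ultimately show ?thesis by blast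
qed

text \<open>
  The pairing of two square functions controls the functional calculus. In the reproducing formula for
  \<open>\<Phi> = F H\<close> the kernel has four factors: \<open>F(z w)\<close> acts on \<open>x\<close>, the conjugate of \<open>H\<close> is moved to \<open>y\<close>, and the
  remaining two give, together with \<open>f\<close>, uniformly bounded operators. The vectors \<open>Y z\<close> stand for the images
  of \<open>y\<close> under the adjoints, which belong to the adjoint family.
\<close>

lemma pairing_bound:
  assumes F: "sector_decay \<theta> s1 c1 F" "s1 > 0" and H: "sector_decay \<theta> s2 c2 H" "s2 > 0"
    and a: "0 < \<alpha>" "\<alpha> < \<theta>" "\<theta> \<le> pi" and nz: "\<exists>z\<in>sector \<theta>. F z * H z \<noteq> 0"
    and g: "\<omega> < \<gamma>" "\<gamma> < \<nu>" "\<nu> \<le> \<theta> - \<alpha>"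
  shows "\<exists>C\<ge>0. \<forall>f B s' d x y Y. sector_decay \<nu> s' d f \<longrightarrow> s' > 0 \<longrightarrow> (\<forall>w\<in>sector \<nu>. cmod (f w) \<le> B) \<longrightarrow>
     (\<forall>z\<in>sector \<alpha>. \<forall>v. cinner (op \<gamma> (\<lambda>w. cnj_fun H (cnj z * w)) v) y = cinner v (Y z)) \<longrightarrow> continuous_on (sector \<alpha>) Y \<longrightarrow>
     (ennreal (cmod (cinner (op \<gamma> f x) y)))\<^sup>2 \<le> ennreal ((C * B)\<^sup>2) * area \<alpha> \<gamma> F x * (\<integral>\<^sup>+z. (ennreal (norm (Y z)))\<^sup>2 \<partial>sector_measure \<alpha>)"
proof -
  have p: "0 < \<nu>" "\<nu> \<le> pi" "0 < \<theta>" "\<alpha> \<le> pi" "\<gamma> < pi" "0 < \<gamma>" using g omega a by linarith+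
  have sub: "w \<in> sector (\<theta> - \<alpha>)" if "w \<in> sector \<nu>" for w using sector_mono[OF g(3)] that by blast
  have c: "c1 \<ge> 0" "c2 \<ge> 0" using sector_decay_nonneg[OF F(1) p(3)] sector_decay_nonneg[OF H(1) p(3)] by auto
  obtain K where K: "K > 0" 
    "\<And>\<zeta> x y. \<gamma> \<le> \<bar>Im \<zeta>\<bar> \<Longrightarrow> \<bar>Im \<zeta>\<bar> \<le> 2 * pi - \<gamma> \<Longrightarrow> cmod (M \<zeta> x y) \<le> K * norm x * norm y"
    using M_bound[OF g(1) p(5)] by auto
  define \<Phi> where "\<Phi> w = F w * H w" for w
  have \<Phi>: "sector_decay \<theta> s1 (c2 * c1) \<Phi>" unfolding \<Phi>_def[abs_def]
    by (rule sector_decay_mult_bounded_right[OF F(1) p(3)])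
      (use H sector_decay_bound[OF H(1) p(3)] in \<open>auto simp: sector_decay_def\<close>)
  have nz': "\<exists>z\<in>sector \<theta>. \<Phi> z \<noteq> 0" using nz by (simp add: \<Phi>_def)
  obtain C0 where C0: "C0 > 0" "\<And>w. w \<in> sector (\<theta> - \<alpha>) \<Longrightarrow> (\<integral>z. square_kernel \<Phi> z w \<partial>sector_measure \<alpha>) = complex_of_real C0"
    using square_kernel_integral[OF \<Phi> F(2) a nz'] by metis
  define A where "A = K / pi * (c2 * c1 * (2 / s1))"
  have A: "A \<ge> 0" using K c F(2) by (simp add: A_def)
  define C where "C = A / C0"
  have C: "C \<ge> 0" using A C0(1) by (simp add: C_def)
  have "(ennreal (cmod (cinner (op \<gamma> f x) y)))\<^sup>2 \<le> ennreal ((C * B)\<^sup>2) * area \<alpha> \<gamma> F x * (\<integral>\<^sup>+z. (ennreal (norm (Y z)))\<^sup>2 \<partial>sector_measure \<alpha>)"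
    if f: "sector_decay \<nu> s' d f" "s' > 0" "\<forall>w\<in>sector \<nu>. cmod (f w) \<le> B"
      and Y: "\<forall>z\<in>sector \<alpha>. \<forall>v. cinner (op \<gamma> (\<lambda>w. cnj_fun H (cnj z * w)) v) y = cinner v (Y z)" "continuous_on (sector \<alpha>) Y"
    for f B s' d x y Y
  proof -
    let ?S = "sector_measure \<alpha>"
    let ?X = "\<lambda>z. op \<gamma> (\<lambda>w. F (z * w)) x"
    let ?g = "\<lambda>z. cinner (op \<gamma> (\<lambda>w. f w * square_kernel \<Phi> z w) x) y"
    have B: "B \<ge> 0" using f(3) one_in_sector[OF p(1)] norm_ge_zero order_trans by blast
    have fh: "f holomorphic_on sector \<nu>" using f by (simp add: sector_decay_def)
    note rp = reproducing[OF \<Phi> F(2) a g f(1,2) C0(2), of x y]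
    have mX [measurable]: "(\<lambda>z. ennreal (norm (?X z))) \<in> borel_measurable ?S"
      by (rule norm_measurable_sector, intro bounded_linear.continuous_on[OF blinfun.bounded_linear_left] dilate_continuous[OF F a g(1)]) (use g in auto)
    have mY [measurable]: "(\<lambda>z. ennreal (norm (Y z))) \<in> borel_measurable ?S"
      by (rule norm_measurable_sector[OF Y(2)])
    have pt: "ennreal (norm (?g z)) \<le> ennreal (A * B) * (ennreal (norm (?X z)) * ennreal (norm (Y z)))" if "z \<in> space ?S" for z
    proof -
      have z: "z \<in> sector \<alpha>" using that by simp
      have Fz: "sector_decay \<nu> s1 (c1 * exp (s1 * \<bar>ln (cmod z)\<bar>)) (\<lambda>w. F (z * w))"
        by (rule sector_decay_mono[OF sector_decay_dilate[OF F a(3) z p(3)] g(3)])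
      have Hz: "sector_decay \<nu> s2 (c2 * exp (s2 * \<bar>ln (cmod z)\<bar>)) (\<lambda>w. H (z * w))"
        by (rule sector_decay_mono[OF sector_decay_dilate[OF H a(3) z p(3)] g(3)])
      have Hzc: "sector_decay \<nu> s2 (c2 * exp (s2 * \<bar>ln (cmod (cnj z))\<bar>)) (\<lambda>w. cnj_fun H (cnj z * w))"
        by (rule sector_decay_mono[OF sector_decay_dilate[OF cnj_fun_decay[OF H(1) a(3)] H(2) a(3) sector_cnj[OF p(4) z] p(3)] g(3)])
      have Fzc: "sector_decay \<nu> s1 (c1 * exp (s1 * \<bar>ln (cmod (cnj z))\<bar>)) (\<lambda>w. cnj_fun F (cnj z * w))"
        by (rule sector_decay_mono[OF sector_decay_dilate[OF cnj_fun_decay[OF F(1) a(3)] F(2) a(3) sector_cnj[OF p(4) z] p(3)] g(3)])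
      have Hb: "cmod (H (z * w)) \<le> c2" if "w \<in> sector \<nu>" for w
        using sector_decay_bound[OF H(1) p(3), of "z * w"] sector_mult[OF z sub[OF that]] H(2) a(3) by simp
      let ?q = "\<lambda>w. H (z * w) * cnj_fun F (cnj z * w)"
      have Pz: "sector_decay \<nu> s1 (c2 * (c1 * exp (s1 * \<bar>ln (cmod (cnj z))\<bar>))) ?q"
        by (rule sector_decay_mult_bounded[OF Fzc p(1) _ Hb]) (use Hz in \<open>auto simp: sector_decay_def\<close>)
      have fPz: "sector_decay \<nu> s1 (B * (c2 * (c1 * exp (s1 * \<bar>ln (cmod (cnj z))\<bar>)))) (\<lambda>w. f w * ?q w)"
        by (rule sector_decay_mult_bounded[OF Pz p(1) fh]) (use f(3) in auto)
      let ?O = "op \<gamma> (\<lambda>w. f w * ?q w)"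
      have fPF: "sector_decay \<nu> s1 (B * (c2 * (c1 * exp (s1 * \<bar>ln (cmod (cnj z))\<bar>))) * (c1 * exp (s1 * \<bar>ln (cmod z)\<bar>))) (\<lambda>w. (f w * ?q w) * F (z * w))"
        by (rule sector_decay_mult_bounded[OF Fz p(1)])
          (use fPz sector_decay_bound[OF fPz p(1)] F(2) in \<open>auto simp: sector_decay_def\<close>)
      have "op \<gamma> (\<lambda>w. cnj_fun H (cnj z * w)) (?O (?X z)) = op \<gamma> (\<lambda>w. cnj_fun H (cnj z * w)) (op \<gamma> (\<lambda>w. (f w * ?q w) * F (z * w)) x)"
        by (subst op_mult[OF fPz F(2) Fz F(2) g(1,2) p(2)]) simp
      also have "\<dots> = op \<gamma> (\<lambda>w. cnj_fun H (cnj z * w) * ((f w * ?q w) * F (z * w))) x"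
        by (rule op_mult[OF Hzc H(2) fPF F(2) g(1,2) p(2)])
      also have "(\<lambda>w. cnj_fun H (cnj z * w) * ((f w * ?q w) * F (z * w))) = (\<lambda>w. f w * square_kernel \<Phi> z w)"
        by (simp add: square_kernel_def cnj_fun_def \<Phi>_def mult_ac)
      finally have "?g z = cinner (op \<gamma> (\<lambda>w. cnj_fun H (cnj z * w)) (?O (?X z))) y" by simp
      also have "\<dots> = cinner (?O (?X z)) (Y z)" using Y(1) z by simp
      finally have "norm (?g z) \<le> norm (?O (?X z)) * norm (Y z)" using norm_cinner_le by metis
      also have "\<dots> \<le> (norm ?O * norm (?X z)) * norm (Y z)" by (intro mult_right_mono norm_blinfun) simp
      also have "\<dots> \<le> (A * B * norm (?X z)) * norm (Y z)"
      proof (intro mult_right_mono)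
        have "norm ?O \<le> K / pi * (\<integral>u. B * (c2 * c1) * exp (- s1 * \<bar>u + ln (cmod z)\<bar>) \<partial>lborel)"
        proof (rule op_norm_le[OF fPz F(2) g(1,2) p(2)])
          show "cmod (M \<zeta> x y) \<le> K * norm x * norm y" if "\<bar>Im \<zeta>\<bar> = \<gamma>" for \<zeta> x y by (rule K(2)) (use that p in auto)
          show "integrable lborel (\<lambda>u. B * (c2 * c1) * exp (- s1 * \<bar>u + ln (cmod z)\<bar>))"
            by (intro integrable_mult_right integrable_exp_decay F)
          show "cmod (f (exp (Complex u v)) * ?q (exp (Complex u v))) \<le> B * (c2 * c1) * exp (- s1 * \<bar>u + ln (cmod z)\<bar>)" if v: "\<bar>v\<bar> = \<gamma>" for u v
          proof -
            have es: "exp (Complex u v) \<in> sector \<nu>" by (rule exp_in_sector) (use v g p in auto)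
            have "cmod (cnj_fun F (cnj z * exp (Complex u v))) \<le> c1 * exp (- s1 * \<bar>u + ln (cmod z)\<bar>)"
              using sector_decay_dilate_bound[OF cnj_fun_decay[OF F(1) a(3)] a(3) sector_cnj[OF p(4) z] sub[OF es]] by simp
            then have "cmod (?q (exp (Complex u v))) \<le> c2 * (c1 * exp (- s1 * \<bar>u + ln (cmod z)\<bar>))"
              unfolding norm_mult using Hb[OF es] c by (intro mult_mono) auto
            then have "cmod (f (exp (Complex u v)) * ?q (exp (Complex u v))) \<le> B * (c2 * (c1 * exp (- s1 * \<bar>u + ln (cmod z)\<bar>)))"
              unfolding norm_mult[of "f _"] using f(3) es B by (intro mult_mono) auto
            then show ?thesis by (simp only: mult.assoc)
          qed
        qed (use K in simp)
        also have "\<dots> \<le> K / pi * (B * (c2 * c1) * (2 / s1))"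
        proof (rule mult_left_mono)
          have "(\<integral>u. B * (c2 * c1) * exp (- s1 * \<bar>u + ln (cmod z)\<bar>) \<partial>lborel) = B * (c2 * c1) * (\<integral>u. exp (- s1 * \<bar>u + ln (cmod z)\<bar>) \<partial>lborel)"
            by simp
          also have "\<dots> \<le> B * (c2 * c1) * (2 / s1)" by (intro mult_left_mono integral_exp_decay F) (use B c in simp)
          finally show "(\<integral>u. B * (c2 * c1) * exp (- s1 * \<bar>u + ln (cmod z)\<bar>) \<partial>lborel) \<le> B * (c2 * c1) * (2 / s1)" .
        qed (use K in simp)
        also have "\<dots> = A * B" by (simp add: A_def)
        finally show "norm ?O \<le> A * B" .
      qed auto
      finally have "ennreal (norm (?g z)) \<le> ennreal ((A * B * norm (?X z)) * norm (Y z))" by (rule ennreal_leI)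
      then show ?thesis using A B by (simp add: ennreal_mult mult.assoc)
    qed
    have "ennreal C0 * ennreal (cmod (cinner (op \<gamma> f x) y)) = ennreal (norm (\<integral>z. ?g z \<partial>?S))"
      using rp(1) C0(1) by (simp add: norm_mult ennreal_mult)
    also have "\<dots> \<le> (\<integral>\<^sup>+z. ennreal (norm (?g z)) \<partial>?S)" by (rule integral_norm_bound_ennreal[OF rp(2)])
    also have "\<dots> \<le> (\<integral>\<^sup>+z. ennreal (A * B) * (ennreal (norm (?X z)) * ennreal (norm (Y z))) \<partial>?S)"
      by (rule nn_integral_mono) (rule pt)
    also have "\<dots> = ennreal (A * B) * (\<integral>\<^sup>+z. ennreal (norm (?X z)) * ennreal (norm (Y z)) \<partial>?S)"
      by (rule nn_integral_cmult) measurable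
    finally have "ennreal (1 / C0) * (ennreal C0 * ennreal (cmod (cinner (op \<gamma> f x) y))) \<le> ennreal (1 / C0) * (ennreal (A * B) * (\<integral>\<^sup>+z. ennreal (norm (?X z)) * ennreal (norm (Y z)) \<partial>?S))"
      by (rule mult_left_mono) simp
    also have "ennreal (1 / C0) * (ennreal C0 * ennreal (cmod (cinner (op \<gamma> f x) y))) = ennreal (cmod (cinner (op \<gamma> f x) y))"
      using C0(1) by (simp add: mult.assoc[symmetric] ennreal_mult'[symmetric])
    also have "ennreal (1 / C0) * (ennreal (A * B) * (\<integral>\<^sup>+z. ennreal (norm (?X z)) * ennreal (norm (Y z)) \<partial>?S)) = ennreal (C * B) * (\<integral>\<^sup>+z. ennreal (norm (?X z)) * ennreal (norm (Y z)) \<partial>?S)"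
      using C0(1) A B by (simp add: mult.assoc[symmetric] ennreal_mult'[symmetric] C_def)
    finally have "(ennreal (cmod (cinner (op \<gamma> f x) y)))\<^sup>2 \<le> (ennreal (C * B) * (\<integral>\<^sup>+z. ennreal (norm (?X z)) * ennreal (norm (Y z)) \<partial>?S))\<^sup>2"
      by (rule power_mono) simp
    also have "\<dots> = ennreal ((C * B)\<^sup>2) * (\<integral>\<^sup>+z. ennreal (norm (?X z)) * ennreal (norm (Y z)) \<partial>?S)\<^sup>2"
    proof -
      have "(ennreal (C * B))\<^sup>2 = ennreal ((C * B)\<^sup>2)" by (rule ennreal_power) (use C B in simp)
      then show ?thesis by (subst power_mult_distrib) (simp only:)
    qed
    also have "\<dots> \<le> ennreal ((C * B)\<^sup>2) * (area \<alpha> \<gamma> F x * (\<integral>\<^sup>+z. (ennreal (norm (Y z)))\<^sup>2 \<partial>?S))"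
      unfolding area_def by (intro mult_left_mono Cauchy_Schwarz_nn_integral mX mY) simp
    finally show ?thesis by (simp add: mult.assoc)
  qed
  then show ?thesis using C by blast
qed

lemma op_sum:
  fixes f :: "nat \<Rightarrow> complex \<Rightarrow> complex"
  assumes f: "\<And>k. sector_decay \<nu> s (c k) (f k)" "s > 0" and g: "\<omega> < \<gamma>" "\<gamma> < \<nu>" "\<nu> \<le> pi"
  shows "(\<exists>d. sector_decay \<nu> s d (\<lambda>w. \<Sum>k<n. a k * f k w)) \<and> op \<gamma> (\<lambda>w. \<Sum>k<n. a k * f k w) x = (\<Sum>k<n. a k *\<^sub>C op \<gamma> (f k) x)"
proof (induction n)
  case 0
  have z: "sector_decay \<nu> s 0 (\<lambda>w. 0)" by (simp add: sector_decay_def)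
  have "op \<gamma> (\<lambda>w. 0) x = 0"
    by (rule cinner_ext) (simp add: op_weak[OF z f(2) g] Cint_def, metis cinner_diff_left diff_self)
  then show ?case using z by auto
next
  case (Suc n)
  have p: "0 < \<nu>" using g omega by linarith
  obtain d where d: "sector_decay \<nu> s d (\<lambda>w. \<Sum>k<n. a k * f k w)" using Suc by blast
  have "sector_decay \<nu> s (d + cmod (a n) * c n) (\<lambda>w. (\<Sum>k<n. a k * f k w) + a n * f n w)"
    by (rule sector_decay_add_scaled[OF d f(1) p])
  moreover have "op \<gamma> (\<lambda>w. (\<Sum>k<n. a k * f k w) + a n * f n w) x = op \<gamma> (\<lambda>w. \<Sum>k<n. a k * f k w) x + a n *\<^sub>C op \<gamma> (f n) x"
    by (rule op_add_scaled[OF d f g])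
  ultimately show ?case using Suc by auto
qed

text \<open>
  Boundedness of the calculus bounds the area function: with suitable signs the squares of the norms
  \<open>\<psi>(e\<^sup>k z A) x\<close> sum up to at most the square of the norm of the signed sum, and the signed sums of
  \<open>\<psi>(e\<^sup>k z w)\<close> are bounded uniformly in \<open>w\<close>.
\<close>

lemma area_bound:
  assumes \<psi>: "sector_decay \<theta> s c \<psi>" "s > 0" and a: "0 < \<beta>" "\<beta> < \<theta>" "\<theta> \<le> pi"
    and g: "\<omega> < \<gamma>" "\<gamma> < \<nu>" "\<nu> \<le> \<theta> - \<beta>"
    and K: "K \<ge> 0" "\<And>f s d B. sector_decay \<nu> s d f \<Longrightarrow> s > 0 \<Longrightarrow> (\<And>w. w \<in> sector \<nu> \<Longrightarrow> cmod (f w) \<le> B) \<Longrightarrow> norm (op \<gamma> f) \<le> K * B"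
  shows "\<exists>L\<ge>0. \<forall>x. area \<beta> \<gamma> \<psi> x \<le> ennreal ((L * norm x)\<^sup>2)"
proof -
  have p: "0 < \<nu>" "\<nu> \<le> pi" "0 < \<theta>" "\<beta> \<le> pi" using g omega a by linarith+
  have sub: "w \<in> sector (\<theta> - \<beta>)" if "w \<in> sector \<nu>" for w using sector_mono[OF g(3)] that by blast
  have c: "c \<ge> 0" using sector_decay_nonneg[OF \<psi>(1) p(3)] .
  define B where "B = c * (exp s * (2 / s))"
  have B: "B \<ge> 0" using c \<psi>(2) by (simp add: B_def)
  have "area \<beta> \<gamma> \<psi> x \<le> ennreal ((K * B * norm x)\<^sup>2) * ennreal (4 * exp 2)" for x
    unfolding area_def
  proof (rule nn_integral_sector_orbit_bound[OF p(4)])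
    show "(\<lambda>z. (ennreal (norm (op \<gamma> (\<lambda>w. \<psi> (z * w)) x)))\<^sup>2) \<in> borel_measurable (sector_measure \<beta>)"
    proof -
      have [measurable]: "(\<lambda>z. ennreal (norm (op \<gamma> (\<lambda>w. \<psi> (z * w)) x))) \<in> borel_measurable (sector_measure \<beta>)"
        by (rule norm_measurable_sector, intro bounded_linear.continuous_on[OF blinfun.bounded_linear_left] dilate_continuous[OF \<psi> a g(1)]) (use g in auto)
      show ?thesis by measurable
    qed
    fix z N assume z: "z \<in> sector \<beta>"
    let ?z = "\<lambda>k. of_real (exp (real k - real N)) * z"
    let ?f = "\<lambda>k w. \<psi> (?z k * w)"
    have zk: "?z k \<in> sector \<beta>" for k using z by (simp add: sector_scale)
    have lnz: "ln (cmod (?z k)) = real k - real N + ln (cmod z)" for k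
      using sector_nonzero[OF z] by (simp add: norm_mult ln_mult)
    have fd: "sector_decay \<nu> s (c * exp (s * \<bar>ln (cmod (?z k))\<bar>)) (?f k)" for k
      by (rule sector_decay_mono[OF sector_decay_dilate[OF \<psi> a(3) zk p(3)] g(3)])
    obtain \<epsilon> :: "nat \<Rightarrow> real" where e: "\<And>k. \<epsilon> k = 1 \<or> \<epsilon> k = -1"
      and le: "(\<Sum>k<2*N. (norm (op \<gamma> (?f k) x))\<^sup>2) \<le> (norm (\<Sum>k<2*N. \<epsilon> k *\<^sub>R op \<gamma> (?f k) x))\<^sup>2"
      using exists_signs[of "\<lambda>k. op \<gamma> (?f k) x" "2*N"] by blast
    let ?h = "\<lambda>w. \<Sum>k<2*N. complex_of_real (\<epsilon> k) * ?f k w"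
    obtain d where d: "sector_decay \<nu> s d ?h" and eq: "op \<gamma> ?h x = (\<Sum>k<2*N. complex_of_real (\<epsilon> k) *\<^sub>C op \<gamma> (?f k) x)"
      using op_sum[where f = ?f and n = "2 * N" and a = "\<lambda>k. complex_of_real (\<epsilon> k)" and x = x, OF fd \<psi>(2) g(1,2) p(2)] by blast
    have hb: "cmod (?h w) \<le> B" if w: "w \<in> sector \<nu>" for w
    proof -
      have "cmod (?h w) \<le> (\<Sum>k<2*N. cmod (complex_of_real (\<epsilon> k) * ?f k w))" by (rule norm_sum)
      also have "\<dots> \<le> (\<Sum>k<2*N. c * exp (- s * \<bar>real k + (ln (cmod w) + ln (cmod z) - real N)\<bar>))"
      proof (rule sum_mono)
        fix k
        have "cmod (complex_of_real (\<epsilon> k)) = 1" using e[of k] by auto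
        then have "cmod (complex_of_real (\<epsilon> k) * ?f k w) = cmod (?f k w)" by (simp only: norm_mult mult_1)
        also have "\<dots> \<le> c * exp (- s * \<bar>ln (cmod w) + ln (cmod (?z k))\<bar>)"
          by (rule sector_decay_dilate_bound[OF \<psi>(1) a(3) zk sub[OF w]])
        also have "ln (cmod w) + ln (cmod (?z k)) = real k + (ln (cmod w) + ln (cmod z) - real N)" unfolding lnz by simp
        finally show "cmod (complex_of_real (\<epsilon> k) * ?f k w) \<le> c * exp (- s * \<bar>real k + (ln (cmod w) + ln (cmod z) - real N)\<bar>)" .
      qed
      also have "\<dots> \<le> B" unfolding B_def sum_distrib_left[symmetric]
        by (intro mult_left_mono sum_exp_decay_le \<psi>(2) c)
      finally show ?thesis .
    qed
    have "(\<Sum>k<2*N. (norm (op \<gamma> (?f k) x))\<^sup>2) \<le> (norm (op \<gamma> ?h x))\<^sup>2"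
      using le unfolding eq by (simp add: scaleC_of_real)
    also have "\<dots> \<le> (K * B * norm x)\<^sup>2"
    proof (rule power_mono)
      have "norm (op \<gamma> ?h x) \<le> norm (op \<gamma> ?h) * norm x" by (rule norm_blinfun)
      also have "\<dots> \<le> K * B * norm x" by (intro mult_right_mono K(2)[OF d \<psi>(2) hb]) auto
      finally show "norm (op \<gamma> ?h x) \<le> K * B * norm x" .
    qed simp
    finally have "ennreal (\<Sum>k<2*N. (norm (op \<gamma> (?f k) x))\<^sup>2) \<le> ennreal ((K * B * norm x)\<^sup>2)" by (rule ennreal_leI)
    then show "(\<Sum>k<2*N. (ennreal (norm (op \<gamma> (\<lambda>w. \<psi> (of_real (exp (real k - real N)) * z * w)) x)))\<^sup>2) \<le> ennreal ((K * B * norm x)\<^sup>2)"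
      by (simp add: ennreal_power)
  qed
  \<comment> \<open>\<open>2 e\<close> is the square root of the bound \<open>4 e\<^sup>2\<close> for the measure of the fundamental annulus.\<close>
  moreover have "ennreal ((K * B * norm x)\<^sup>2) * ennreal (4 * exp 2) = ennreal ((K * B * (2 * exp 1) * norm x)\<^sup>2)" for x
    by (simp add: ennreal_mult''[symmetric] power_mult_distrib exp_of_nat_mult[symmetric] mult_ac flip: exp_double)
  moreover have "K * B * (2 * exp 1) \<ge> 0" using K B by simp
  ultimately show ?thesis by (metis (no_types, lifting))
qed

end

section \<open>Approximate units and adjoint families\<close>

text \<open>
  For \<open>a\<close> tending to \<open>0\<close> and \<open>b\<close> to infinity these functions tend to \<open>1\<close> on a sector, boundedly. The
  corresponding operators are differences of multiples of resolvents on the negative axis.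
\<close>

definition approx_unit :: "real \<Rightarrow> real \<Rightarrow> complex \<Rightarrow> complex" where
  "approx_unit a b w = of_real b / (of_real b + w) - of_real a / (of_real a + w)"

lemma exp_Complex_pi: "a > 0 \<Longrightarrow> exp (Complex (ln a) pi) = - of_real a"
  by (simp add: complex_eq_iff Re_exp Im_exp)

lemma approx_unit_quotients:
  assumes "0 < \<theta>" "\<theta> < pi" "w \<in> sector \<theta>" "a > 0"
  shows "of_real a + w \<noteq> 0" "cmod (of_real a / (of_real a + w)) \<le> 1 / sin ((pi - \<theta>) / 2)" "cmod (w / (of_real a + w)) \<le> 1 / sin ((pi - \<theta>) / 2)"
    "sin ((pi - \<theta>) / 2) > 0"
proof -
  have e: "w = exp (Ln w)" "\<bar>Im (Ln w)\<bar> < \<theta>" using in_sector_Ln[OF assms(3)] by auto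
  have d: "pi - \<theta> \<le> \<bar>Im (Ln w) - Im (Complex (ln a) pi)\<bar>" "\<bar>Im (Ln w) - Im (Complex (ln a) pi)\<bar> \<le> 2 * pi - (pi - \<theta>)" "0 < pi - \<theta>"
    using e assms by auto
  note q = exp_quotient_le[OF d]
  have eq: "exp (Ln w) - exp (Complex (ln a) pi) = of_real a + w"
    using e(1) by (simp add: exp_Complex_pi[OF assms(4)])
  show "of_real a + w \<noteq> 0" using q(1) eq by auto
  show "cmod (of_real a / (of_real a + w)) \<le> 1 / sin ((pi - \<theta>) / 2)"
    using q(3) unfolding eq by (simp add: exp_Complex_pi[OF assms(4)] norm_divide)
  show "cmod (w / (of_real a + w)) \<le> 1 / sin ((pi - \<theta>) / 2)"
    using q(2) e(1) unfolding eq by simp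
  show "sin ((pi - \<theta>) / 2) > 0" by (rule q(4))
qed

lemma approx_unit_bound:
  assumes "0 < \<theta>" "\<theta> < pi" "w \<in> sector \<theta>" "a > 0" "b > 0"
  shows "cmod (approx_unit a b w) \<le> 2 / sin ((pi - \<theta>) / 2)"
  unfolding approx_unit_def
  using approx_unit_quotients(2)[OF assms(1-4)] approx_unit_quotients(2)[OF assms(1-3,5)]
  by (intro order_trans[OF norm_triangle_ineq4]) simp

text \<open>
  The difference equals \<open>(b - a) w / ((a + w) (b + w))\<close>, which is of order \<open>w\<close> at \<open>0\<close> and of order \<open>1 / w\<close>
  at infinity.
\<close>

lemma approx_unit_decay:
  assumes "0 < \<theta>" "\<theta> < pi" "0 < a" "a < b"
  shows "\<exists>c. sector_decay \<theta> 1 c (approx_unit a b)"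
proof -
  define S where "S = 1 / sin ((pi - \<theta>) / 2)"
  have b: "b > 0" using assms by simp
  have "cmod (approx_unit a b w) \<le> ((b - a) * (1 + 1 / (a * b)) * S\<^sup>2) * exp (- 1 * \<bar>ln (cmod w)\<bar>)" if w: "w \<in> sector \<theta>" for w
  proof -
    note qa = approx_unit_quotients[OF assms(1,2) w assms(3)] and qb = approx_unit_quotients[OF assms(1,2) w b]
    have S0: "S > 0" using qa(4) by (simp add: S_def)
    have nw: "cmod w > 0" using sector_nonzero[OF w] by simp
    have eq: "approx_unit a b w = of_real (b - a) * w / ((of_real a + w) * (of_real b + w))"
      using qa(1) qb(1) by (simp add: approx_unit_def field_simps)
    show ?thesis
    proof (cases "cmod w \<le> 1")
      case True
      have "approx_unit a b w = of_real ((b - a) / (a * b)) * w * ((of_real a / (of_real a + w)) * (of_real b / (of_real b + w)))"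
      proof -
        have "D * u / (P * Q) = D / (A * B) * u * ((A / P) * (B / Q))" if "A \<noteq> 0" "B \<noteq> 0" for A B D P Q u :: complex
          using that by (cases "P = 0"; cases "Q = 0") (simp_all add: divide_simps)
        from this[of "of_real a" "of_real b" "of_real (b - a)" w] show ?thesis
          unfolding eq using assms(3) b by (simp only: of_real_divide of_real_mult) simp
      qed
      then have "cmod (approx_unit a b w) = ((b - a) / (a * b)) * cmod w * (cmod (of_real a / (of_real a + w)) * cmod (of_real b / (of_real b + w)))"
        using assms(3,4) b by (simp only: norm_mult norm_of_real) simp
      also have "\<dots> \<le> ((b - a) / (a * b)) * cmod w * (S * S)"
        using qa(2) qb(2) S0 assms b by (intro mult_left_mono mult_mono) (auto simp: S_def)
      also have "\<dots> \<le> ((b - a) * (1 + 1 / (a * b))) * cmod w * (S * S)"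
      proof (intro mult_right_mono)
        have "(b - a) / (a * b) = (b - a) * (1 / (a * b))" by simp
        also have "\<dots> \<le> (b - a) * (1 + 1 / (a * b))" using assms by (intro mult_left_mono) auto
        finally show "(b - a) / (a * b) \<le> (b - a) * (1 + 1 / (a * b))" .
      qed (use S0 in auto)
      also have "cmod w = exp (- 1 * \<bar>ln (cmod w)\<bar>)" using True nw by simp
      finally show ?thesis by (simp add: power2_eq_square mult_ac)
    next
      case False
      have "approx_unit a b w = of_real (b - a) * (1 / w) * ((w / (of_real a + w)) * (w / (of_real b + w)))"
      proof -
        have "D * u / (P * Q) = D * (1 / u) * ((u / P) * (u / Q))" if "u \<noteq> 0" for D P Q u :: complex
          using that by (cases "P = 0"; cases "Q = 0") (simp_all add: divide_simps)
        from this[of w] nw show ?thesis unfolding eq by simp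
      qed
      then have "cmod (approx_unit a b w) = (b - a) * (1 / cmod w) * (cmod (w / (of_real a + w)) * cmod (w / (of_real b + w)))"
        using assms(4) by (simp only: norm_mult norm_of_real) (simp add: norm_divide)
      also have "\<dots> \<le> (b - a) * (1 / cmod w) * (S * S)"
        using qa(3) qb(3) S0 assms by (intro mult_left_mono mult_mono) (auto simp: S_def)
      also have "\<dots> \<le> ((b - a) * (1 + 1 / (a * b))) * (1 / cmod w) * (S * S)"
      proof (intro mult_right_mono)
        have "(b - a) * 1 \<le> (b - a) * (1 + 1 / (a * b))" using assms b by (intro mult_left_mono) auto
        then show "b - a \<le> (b - a) * (1 + 1 / (a * b))" by simp
      qed (use S0 in auto)
      also have "1 / cmod w = exp (- 1 * \<bar>ln (cmod w)\<bar>)" using False nw by (simp add: exp_minus inverse_eq_divide)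
      finally show ?thesis by (simp add: power2_eq_square mult_ac)
    qed
  qed
  moreover have "approx_unit a b holomorphic_on sector \<theta>"
    unfolding approx_unit_def[abs_def]
    by (intro holomorphic_intros) (use approx_unit_quotients(1)[OF assms(1,2)] assms b in auto)
  ultimately show ?thesis unfolding sector_decay_def by blast
qed

lemma cnj_fun_cnj_fun [simp]: "cnj_fun (cnj_fun f) = f"
  by (simp add: cnj_fun_def fun_eq_iff)

lemma cnj_closure_sector:
  assumes "\<theta> \<le> pi" "z \<in> - closure (sector \<theta>)"
  shows "cnj z \<in> - closure (sector \<theta>)"
proof
  assume "cnj z \<in> closure (sector \<theta>)"
  then have "z \<in> closure (sector \<theta>)"
    unfolding closure_approachable
  proof (intro allI impI)
    fix e :: real assume "e > 0" and "\<forall>e>0. \<exists>y\<in>sector \<theta>. dist y (cnj z) < e"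
    then obtain y where y: "y \<in> sector \<theta>" "dist y (cnj z) < e" by blast
    have "dist (cnj y) z = dist y (cnj z)" by (metis complex_cnj_cnj complex_cnj_diff complex_mod_cnj dist_norm)
    then show "\<exists>y\<in>sector \<theta>. dist y z < e" using y sector_cnj[OF assms(1) y(1)] by (intro bexI[of _ "cnj y"]) auto
  qed
  then show False using assms(2) by simp
qed

context sectorial_family
begin

lemma adjoint_family:
  fixes R' :: "complex \<Rightarrow> 'a \<Rightarrow>\<^sub>L 'a"
  assumes adj: "\<And>z x v. z \<in> - closure (sector \<omega>) \<Longrightarrow> cinner (R (cnj z) x) v = cinner x (R' z v)"
  shows "sectorial_family \<omega> R'"
proof
  let ?U = "- closure (sector \<omega>)"
  have cU: "cnj z \<in> ?U" if "z \<in> ?U" for z by (rule cnj_closure_sector[OF _ that]) (use omega in simp)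
  show "0 < \<omega>" "\<omega> < pi" by (rule omega)+
  show "R' z (c *\<^sub>C x) = c *\<^sub>C R' z x" if z: "z \<in> ?U" for z c x
    by (rule cinner_ext_right) (simp add: adj[OF z, symmetric] cinner_scaleC_right)
  show "R' z x - R' w x = (w - z) *\<^sub>C R' z (R' w x)" if z: "z \<in> ?U" and w: "w \<in> ?U" for z w x
  proof (rule cinner_ext_right)
    fix y
    have "cinner y (R' z x - R' w x) = cinner (R (cnj z) y - R (cnj w) y) x"
      by (simp add: cinner_diff_right cinner_diff_left adj[OF z] adj[OF w])
    also have "R (cnj z) y - R (cnj w) y = - (R (cnj w) y - R (cnj z) y)" by simp
    also have "R (cnj w) y - R (cnj z) y = (cnj z - cnj w) *\<^sub>C R (cnj w) (R (cnj z) y)" by (rule R_identity[OF cU[OF w] cU[OF z]])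
    also have "cinner (- ((cnj z - cnj w) *\<^sub>C R (cnj w) (R (cnj z) y))) x = cnj (w - z) * cinner y (R' z (R' w x))"
      by (simp add: cinner_minus_left cinner_scaleC_left adj[OF z] adj[OF w] algebra_simps)
    finally show "cinner y (R' z x - R' w x) = cinner y ((w - z) *\<^sub>C R' z (R' w x))" by (simp add: cinner_scaleC_right)
  qed
  have nle: "norm (R' z) \<le> norm (R (cnj z))" if z: "z \<in> ?U" for z
  proof (rule norm_blinfun_bound)
    fix v
    show "norm (R' z v) \<le> norm (R (cnj z)) * norm v"
    proof (rule norm_le_if_cinner_le)
      fix y
      have "cmod (cinner (R' z v) y) = cmod (cinner y (R' z v))" by (metis cinner_commute complex_mod_cnj)
      also have "\<dots> = cmod (cinner (R (cnj z) y) v)" by (simp only: adj[OF z])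
      also have "\<dots> \<le> (norm (R (cnj z)) * norm y) * norm v"
        by (rule order_trans[OF norm_cinner_le mult_right_mono[OF norm_blinfun]]) simp
      finally show "cmod (cinner (R' z v) y) \<le> norm (R (cnj z)) * norm v * norm y" by (simp add: mult_ac)
    qed simp
  qed simp
  show "\<exists>K>0. \<forall>z\<in>- closure (sector \<theta>'). cmod z * norm (R' z) \<le> K" if t: "\<omega> < \<theta>'" "\<theta>' < pi" for \<theta>'
  proof -
    obtain K where K: "K > 0" "\<And>z. z \<in> - closure (sector \<theta>') \<Longrightarrow> cmod z * norm (R z) \<le> K" using R_bound[OF t] by blast
    have "cmod z * norm (R' z) \<le> K" if z: "z \<in> - closure (sector \<theta>')" for z
    proof -
      have "z \<in> ?U" using z closure_mono[OF sector_mono[of \<omega> \<theta>']] t by auto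
      then have "cmod z * norm (R' z) \<le> cmod (cnj z) * norm (R (cnj z))" using nle by (simp add: mult_left_mono)
      also have "\<dots> \<le> K" by (rule K(2), rule cnj_closure_sector[OF _ z]) (use t in simp)
      finally show ?thesis .
    qed
    then show ?thesis using K(1) by blast
  qed
qed

text \<open>
  Complex conjugation exchanges the lines \<open>Im \<zeta> = \<gamma>\<close> and \<open>Im \<zeta> = -\<gamma>\<close>, and the sign this produces is
  cancelled by conjugating the factor \<open>1 / (2 \<pi> \<i>)\<close>.
\<close>

lemma op_adjoint:
  fixes R' :: "complex \<Rightarrow> 'a \<Rightarrow>\<^sub>L 'a"
  assumes adj: "\<And>z x v. z \<in> - closure (sector \<omega>) \<Longrightarrow> cinner (R (cnj z) x) v = cinner x (R' z v)"
    and f: "sector_decay \<theta> s c f" "s > 0" and g: "\<omega> < \<gamma>" "\<gamma> < \<theta>" "\<theta> \<le> pi"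
  shows "cinner (op \<gamma> (cnj_fun f) y) x = cinner y (sectorial_family.op R' \<gamma> f x)"
proof -
  interpret A: sectorial_family \<omega> R' by (rule adjoint_family[OF adj])
  have p: "0 < \<gamma>" "\<gamma> < pi" using g omega by linarith+
  let ?k = "\<lambda>\<zeta>. cnj_fun f (exp \<zeta>) * M \<zeta> y x"
  have pt: "f (exp \<zeta>) * A.M \<zeta> x y = cnj (?k (cnj \<zeta>))" if z: "\<bar>Im \<zeta>\<bar> = \<gamma>" for \<zeta>
  proof -
    have U: "exp \<zeta> \<in> - closure (sector \<omega>)" by (rule exp_outside_sector) (use omega g z p in auto)
    have "cinner (R' (exp \<zeta>) x) y = cnj (cinner (R (cnj (exp \<zeta>)) y) x)"
      by (simp only: adj[OF U] cinner_commute[of y])  simp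
    then show ?thesis by (simp add: A.M_def M_def cnj_fun_def exp_cnj)
  qed
  have "cinner (A.op \<gamma> f x) y = Cint \<gamma> (\<lambda>\<zeta>. f (exp \<zeta>) * A.M \<zeta> x y)" by (rule A.op_weak[OF f g])
  also have "\<dots> = Cint \<gamma> (\<lambda>\<zeta>. cnj (?k (cnj \<zeta>)))" by (rule Cint_cong) (use pt p in auto)
  also have "\<dots> = cnj (Cint \<gamma> ?k)"
  proof -
    have c: "cnj (Complex u v) = Complex u (- v)" for u v by (simp add: complex_eq_iff)
    show ?thesis unfolding Cint_def c Bochner_Integration.integral_cnj
      by (simp add: diff_divide_distrib)
  qed
  also have "Cint \<gamma> ?k = cinner (op \<gamma> (cnj_fun f) y) x"
    by (rule op_weak[OF cnj_fun_decay[OF f(1) g(3)] f(2) g, symmetric])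
  finally show ?thesis by (metis cinner_commute complex_cnj_cnj)
qed

text \<open>
  The contour is closed on the other side, where \<open>R\<close> is holomorphic: as the integrand has period \<open>2 \<pi> \<i>\<close>, the
  line \<open>Im \<zeta> = -\<gamma>\<close> may be replaced by \<open>Im \<zeta> = 2 \<pi> - \<gamma>\<close>, and the strip between this line and \<open>Im \<zeta> = \<gamma>\<close>
  contains the two poles \<open>ln a + \<i> \<pi>\<close> and \<open>ln b + \<i> \<pi>\<close>.
\<close>

lemma op_approx_unit:
  assumes g: "\<omega> < \<gamma>" "\<gamma> < pi" and ab: "0 < a" "a < b"
  shows "op \<gamma> (approx_unit a b) x = of_real a *\<^sub>C R (- of_real a) x - of_real b *\<^sub>C R (- of_real b) x"
proof (rule cinner_ext)
  fix y
  define \<theta> where "\<theta> = (\<gamma> + pi) / 2"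
  have t: "\<gamma> < \<theta>" "\<theta> < pi" "0 < \<theta>" "0 < \<gamma>" "\<theta> \<le> pi" "b > 0" using g omega ab by (auto simp: \<theta>_def)
  obtain c where f: "sector_decay \<theta> 1 c (approx_unit a b)" using approx_unit_decay[OF t(3,2) ab] by blast
  obtain K where K: "K > 0" 
    "\<And>\<zeta> x y. \<gamma> \<le> \<bar>Im \<zeta>\<bar> \<Longrightarrow> \<bar>Im \<zeta>\<bar> \<le> 2 * pi - \<gamma> \<Longrightarrow> cmod (M \<zeta> x y) \<le> K * norm x * norm y"
    using M_bound[OF g] by auto
  let ?Q = "\<lambda>\<zeta>. approx_unit a b (exp \<zeta>) * M \<zeta> x y"
  have per: "?Q (Complex u (2 * pi - \<gamma>)) = ?Q (Complex u (- \<gamma>))" for u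
  proof -
    have "Complex u (2 * pi - \<gamma>) = Complex u (- \<gamma>) + 2 * of_real pi * \<i>" by (simp add: complex_eq_iff)
    then have "exp (Complex u (2 * pi - \<gamma>)) = exp (Complex u (- \<gamma>))" by (simp add: exp_add)
    then show ?thesis by (simp add: M_def)
  qed
  have int: "integrable lborel (\<lambda>u. ?Q (Complex u \<gamma>))" "integrable lborel (\<lambda>u. ?Q (Complex u (- \<gamma>)))"
    by (rule integrand_integrable[OF f _ g(1) t(1,5)]; use t in simp)+
  let ?z1 = "Complex (ln b) pi" and ?z2 = "Complex (ln a) pi"
  \<comment> \<open>Beyond \<open>?N0\<close> either \<open>\<bar>exp \<zeta>\<bar> \<ge> 2 b\<close> or \<open>\<bar>exp \<zeta>\<bar> \<le> a / 2\<close>, so that the denominators are bounded below.\<close>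
  let ?N0 = "\<bar>ln a\<bar> + \<bar>ln b\<bar> + ln 2"
  let ?C = "4 * (b - a) * (1 + 1 / (a * b)) * (K * norm x * norm y)"
  have "(\<integral>u. ?Q (Complex u \<gamma>) \<partial>lborel) - (\<integral>u. ?Q (Complex u (2 * pi - \<gamma>)) \<partial>lborel) = 2 * pi * \<i> * ((-1) * M ?z1 x y + 1 * M ?z2 x y)"
  proof (rule strip_residue[where P = "\<lambda>\<zeta>. M \<zeta> x y" and ?P0.0 = "\<lambda>_. 0" and a = \<omega> and b = "2 * pi - \<omega>" and s = 1 and C = ?C and ?N0.0 = ?N0])
    show "(\<lambda>\<zeta>. M \<zeta> x y) holomorphic_on {\<zeta>. \<omega> < Im \<zeta> \<and> Im \<zeta> < 2 * pi - \<omega>}"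
      by (rule M_holomorphic) (use omega in auto)
    show "integrable lborel (\<lambda>u. ?Q (Complex u \<gamma>))" by (rule int)
    show "integrable lborel (\<lambda>u. ?Q (Complex u (2 * pi - \<gamma>)))" unfolding per by (rule int)
    show "?Q \<zeta> = 0 + M \<zeta> x y * ((-1) / (exp (\<zeta> - ?z1) - 1) + 1 / (exp (\<zeta> - ?z2) - 1))" for \<zeta>
    proof -
      have e: "1 / (exp (\<zeta> - Complex (ln r) pi) - 1) = - (of_real r / (of_real r + exp \<zeta>))" if "r > 0" for r
      proof -
        have "exp (\<zeta> - Complex (ln r) pi) - 1 = - ((of_real r + exp \<zeta>) / of_real r)"
          using that by (simp add: exp_diff exp_Complex_pi field_simps)
        then show ?thesis by simp
      qed
      have "(-1) / (exp (\<zeta> - ?z1) - 1) + 1 / (exp (\<zeta> - ?z2) - 1) = - (1 / (exp (\<zeta> - ?z1) - 1)) + 1 / (exp (\<zeta> - ?z2) - 1)"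
        by simp
      also have "\<dots> = approx_unit a b (exp \<zeta>)" unfolding e[OF t(6)] e[OF ab(1)] by (simp add: approx_unit_def)
      finally show ?thesis by simp
    qed
    show "cmod (?Q \<zeta>) \<le> ?C * exp (- 1 * \<bar>Re \<zeta>\<bar>)" if z: "\<gamma> \<le> Im \<zeta>" "Im \<zeta> \<le> 2 * pi - \<gamma>" "?N0 \<le> \<bar>Re \<zeta>\<bar>" for \<zeta>
    proof -
      let ?r = "exp (Re \<zeta>)"
      have Mb: "cmod (M \<zeta> x y) \<le> K * norm x * norm y" by (rule K(2)) (use z t in auto)
      have "cmod (approx_unit a b (exp \<zeta>)) \<le> 4 * (b - a) * (1 + 1 / (a * b)) * exp (- 1 * \<bar>Re \<zeta>\<bar>)"
      proof (cases "Re \<zeta> \<ge> 0")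
        case True
        have "ln (2 * b) \<le> Re \<zeta>" using True z(3) t(6) by (simp add: ln_mult)
        then have r: "2 * b \<le> ?r" using t(6) by (metis exp_le_cancel_iff exp_ln mult_pos_pos zero_less_numeral)
        have lo: "?r / 2 \<le> cmod (of_real q + exp \<zeta>)" if "0 < q" "q \<le> b" for q
          using norm_triangle_ineq2[of "exp \<zeta>" "- of_real q"] that r by (simp add: add.commute)
        have nza: "of_real a + exp \<zeta> \<noteq> 0" "of_real b + exp \<zeta> \<noteq> 0" using lo[of a] lo[of b] ab t(6) by (auto simp: not_le)
        have "approx_unit a b (exp \<zeta>) = of_real (b - a) * exp \<zeta> / ((of_real a + exp \<zeta>) * (of_real b + exp \<zeta>))"
          using nza by (simp add: approx_unit_def field_simps)
        then have "cmod (approx_unit a b (exp \<zeta>)) = (b - a) * ?r / (cmod (of_real a + exp \<zeta>) * cmod (of_real b + exp \<zeta>))"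
          using ab by (simp only: norm_divide norm_mult norm_of_real) simp
        also have "\<dots> \<le> (b - a) * ?r / ((?r / 2) * (?r / 2))"
          by (intro divide_left_mono mult_mono lo mult_pos_pos) (use ab t(6) nza in auto)
        also have "\<dots> = 4 * (b - a) * 1 * exp (- 1 * \<bar>Re \<zeta>\<bar>)" using True by (simp add: exp_minus field_simps)
        also have "\<dots> \<le> 4 * (b - a) * (1 + 1 / (a * b)) * exp (- 1 * \<bar>Re \<zeta>\<bar>)"
          using ab t(6) by (intro mult_right_mono mult_left_mono) auto
        finally show ?thesis .
      next
        case False
        have "Re \<zeta> \<le> ln (a / 2)" using False z(3) ab by (simp add: ln_div)
        then have r: "?r \<le> a / 2" using ab by (metis exp_le_cancel_iff exp_ln half_gt_zero)
        have lo: "q / 2 \<le> cmod (of_real q + exp \<zeta>)" if "a \<le> q" for q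
          using norm_triangle_ineq2[of "of_real q" "- exp \<zeta>"] that r ab by simp
        have nza: "of_real a + exp \<zeta> \<noteq> 0" "of_real b + exp \<zeta> \<noteq> 0" using lo[of a] lo[of b] ab t(6) by auto
        have "approx_unit a b (exp \<zeta>) = of_real (b - a) * exp \<zeta> / ((of_real a + exp \<zeta>) * (of_real b + exp \<zeta>))"
          using nza by (simp add: approx_unit_def field_simps)
        then have "cmod (approx_unit a b (exp \<zeta>)) = (b - a) * ?r / (cmod (of_real a + exp \<zeta>) * cmod (of_real b + exp \<zeta>))"
          using ab by (simp only: norm_divide norm_mult norm_of_real) simp
        also have "\<dots> \<le> (b - a) * ?r / ((a / 2) * (b / 2))"
          by (intro divide_left_mono mult_mono lo mult_pos_pos) (use ab t(6) nza in auto)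
        also have "\<dots> = 4 * (b - a) * (1 / (a * b)) * exp (- 1 * \<bar>Re \<zeta>\<bar>)" using False by simp
        also have "\<dots> \<le> 4 * (b - a) * (1 + 1 / (a * b)) * exp (- 1 * \<bar>Re \<zeta>\<bar>)"
          using ab t(6) by (intro mult_right_mono mult_left_mono) auto
        finally show ?thesis .
      qed
      then have "cmod (?Q \<zeta>) \<le> (4 * (b - a) * (1 + 1 / (a * b)) * exp (- 1 * \<bar>Re \<zeta>\<bar>)) * (K * norm x * norm y)"
        unfolding norm_mult using Mb ab t(6) by (intro mult_mono) auto
      then show ?thesis by (simp only: mult_ac)
    qed
  qed (use g omega in auto)
  then have "Cint \<gamma> ?Q = M ?z1 x y - M ?z2 x y"
    unfolding per Cint_def by (simp add: field_simps)
  then show "cinner (op \<gamma> (approx_unit a b) x) y = cinner (of_real a *\<^sub>C R (- of_real a) x - of_real b *\<^sub>C R (- of_real b) x) y"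
    using op_weak[OF f _ g(1) t(1,5), of x y] t(6) ab(1) by (simp add: M_def exp_Complex_pi cinner_diff_left cinner_scaleC_left)
qed

end

section \<open>Sectorial operators and their adjoints\<close>

lemma linear_operator_comb:
  assumes "linear_operator A" "x \<in> dom A" "y \<in> dom A"
  shows "c *\<^sub>C x + d *\<^sub>C y \<in> dom A" "the (A (c *\<^sub>C x + d *\<^sub>C y)) = c *\<^sub>C the (A x) + d *\<^sub>C the (A y)"
  using assms unfolding linear_operator_def by (auto simp: domI)

lemma linear_operator_scaleC:
  assumes "linear_operator A" "x \<in> dom A"
  shows "c *\<^sub>C x \<in> dom A" "the (A (c *\<^sub>C x)) = c *\<^sub>C the (A x)"
  using linear_operator_comb[OF assms assms(2), of c 0] by (simp_all add: scaleC_zero_left)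

lemma linear_operator_add:
  assumes "linear_operator A" "x \<in> dom A" "y \<in> dom A"
  shows "x + y \<in> dom A" "the (A (x + y)) = the (A x) + the (A y)"
  using linear_operator_comb[OF assms, of 1 1] by (simp_all add: scaleC_one)

lemma linear_operator_scaleR:
  assumes "linear_operator A" "x \<in> dom A"
  shows "r *\<^sub>R x \<in> dom A" "the (A (r *\<^sub>R x)) = r *\<^sub>R the (A x)"
  using linear_operator_scaleC[OF assms, of "of_real r"] by (simp_all add: scaleC_of_real)

lemma linear_operator_zero:
  assumes "linear_operator A" shows "0 \<in> dom A" "the (A 0) = 0"
proof -
  obtain x where x: "x \<in> dom A" using assms unfolding linear_operator_def by blast
  show "0 \<in> dom A" "the (A 0) = 0" using linear_operator_scaleC[OF assms x, of 0] by (simp_all add: scaleC_zero_left)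
qed

lemma resolvent_apply:
  assumes "z \<in> resolvent_set A"
  shows "resolvent A z y = inv_into (dom A) (\<lambda>x. z *\<^sub>C x - the (A x)) y"
proof -
  have "bounded_linear (resolvent_fun A z)" using assms by (simp add: resolvent_set_def)
  then have "blinfun_apply (resolvent A z) = resolvent_fun A z"
    unfolding resolvent_def by (rule bounded_linear_Blinfun_apply)
  then show ?thesis by (simp add: resolvent_fun_def)
qed

lemma resolvent_left:
  assumes "z \<in> resolvent_set A" "x \<in> dom A"
  shows "resolvent A z (z *\<^sub>C x - the (A x)) = x"
proof -
  have b: "bij_betw (\<lambda>x. z *\<^sub>C x - the (A x)) (dom A) UNIV"
    using assms by (auto simp: resolvent_set_def)
  have "inv_into (dom A) (\<lambda>x. z *\<^sub>C x - the (A x)) (z *\<^sub>C x - the (A x)) = x"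
    by (rule inv_into_f_f[OF bij_betw_imp_inj_on[OF b] assms(2)])
  then show ?thesis by (simp add: resolvent_apply[OF assms(1)])
qed

lemma resolvent_right:
  assumes "z \<in> resolvent_set A"
  shows "resolvent A z y \<in> dom A" "z *\<^sub>C resolvent A z y - the (A (resolvent A z y)) = y"
proof -
  have b: "bij_betw (\<lambda>x. z *\<^sub>C x - the (A x)) (dom A) UNIV"
    using assms by (auto simp: resolvent_set_def)
  note eq = resolvent_apply[OF assms, of y]
  have y: "y \<in> (\<lambda>x. z *\<^sub>C x - the (A x)) ` dom A" using bij_betw_imp_surj_on[OF b] by simp
  show "resolvent A z y \<in> dom A" unfolding eq by (rule inv_into_into[OF y])
  show "z *\<^sub>C resolvent A z y - the (A (resolvent A z y)) = y" unfolding eq by (rule f_inv_into_f[OF y])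
qed

lemma sectorial_resolvent_set:
  assumes "sectorial \<omega> A" "z \<in> - closure (sector \<omega>)" shows "z \<in> resolvent_set A"
  using assms by (auto simp: sectorial_def spectrum_def)

lemma scaleC_minus_left: "(- c) *\<^sub>C x = - (c *\<^sub>C x :: 'a::complex_inner)"
  by (metis scaleC_minus1 scaleC_scaleC mult_minus1)

lemma scaleC_diff_left: "(c - d) *\<^sub>C x = c *\<^sub>C x - d *\<^sub>C (x :: 'a::complex_inner)"
  by (metis diff_conv_add_uminus scaleC_add_left scaleC_minus_left)

lemma scaleC_minus_right: "c *\<^sub>C (- x) = - (c *\<^sub>C x :: 'a::complex_inner)"
  by (metis scaleC_minus1 scaleC_scaleC mult.commute)

lemma scaleC_diff_right: "c *\<^sub>C (x - y) = c *\<^sub>C x - c *\<^sub>C (y :: 'a::complex_inner)"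
  by (metis diff_conv_add_uminus scaleC_add_right scaleC_minus_right)

lemma sectorial_family_resolvent:
  fixes A :: "'a::complex_hilbert \<rightharpoonup> 'a"
  assumes "sectorial \<omega> A" "0 < \<omega>" "\<omega> < pi"
  shows "sectorial_family \<omega> (resolvent A)"
proof
  have lin: "linear_operator A" using assms(1) by (simp add: sectorial_def)
  show "0 < \<omega>" "\<omega> < pi" by fact+
  have sc: "resolvent A z (c *\<^sub>C x) = c *\<^sub>C resolvent A z x" if "z \<in> - closure (sector \<omega>)" for z c x
  proof -
    have z: "z \<in> resolvent_set A" by (rule sectorial_resolvent_set[OF assms(1) that])
    let ?u = "resolvent A z x"
    note u = resolvent_right[OF z, of x]
    have "c *\<^sub>C x = z *\<^sub>C (c *\<^sub>C ?u) - the (A (c *\<^sub>C ?u))"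
      using u(2) linear_operator_scaleC(2)[OF lin u(1), of c] by (metis scaleC_diff_right scaleC_scaleC mult.commute)
    then show ?thesis using resolvent_left[OF z linear_operator_scaleC(1)[OF lin u(1), of c]] by simp
  qed
  then show "resolvent A z (c *\<^sub>C x) = c *\<^sub>C resolvent A z x" if "z \<in> - closure (sector \<omega>)" for z c x
    using that by blast
  show "resolvent A z x - resolvent A w x = (w - z) *\<^sub>C resolvent A z (resolvent A w x)"
    if "z \<in> - closure (sector \<omega>)" "w \<in> - closure (sector \<omega>)" for z w x
  proof -
    have z: "z \<in> resolvent_set A" and w: "w \<in> resolvent_set A" by (rule sectorial_resolvent_set[OF assms(1)]; fact)+
    let ?u = "resolvent A w x"
    note u = resolvent_right[OF w, of x]
    have "x = w *\<^sub>C ?u - the (A ?u)" using u(2) by simp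
    also have "\<dots> = (z *\<^sub>C ?u - the (A ?u)) + (w - z) *\<^sub>C ?u" by (simp add: scaleC_diff_left)
    finally have "resolvent A z x = resolvent A z ((z *\<^sub>C ?u - the (A ?u)) + (w - z) *\<^sub>C ?u)" by simp
    also have "\<dots> = ?u + (w - z) *\<^sub>C resolvent A z ?u"
      by (simp add: blinfun.add_right resolvent_left[OF z u(1)] sc[OF that(1)])
    finally show ?thesis by simp
  qed
  show "\<exists>K>0. \<forall>z\<in>- closure (sector \<theta>'). cmod z * norm (resolvent A z) \<le> K" if "\<omega> < \<theta>'" "\<theta>' < pi" for \<theta>'
    using assms(1) that unfolding sectorial_def norm_scaleC_blinfun by auto
qed

lemma adjoint_op_eq:
  fixes A :: "'a::complex_hilbert \<rightharpoonup> 'a"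
  assumes "densely_defined A" "\<And>x. x \<in> dom A \<Longrightarrow> cinner (the (A x)) y = cinner x z"
  shows "adjoint_op A y = Some z"
proof -
  have uniq: "z' = z" if "\<forall>x\<in>dom A. cinner (the (A x)) y = cinner x z'" for z'
  proof (rule cinner_ext_right)
    fix x
    have cl: "closed {x. cinner x z' = cinner x z}"
      by (intro closed_Collect_eq bounded_linear.continuous_on[OF bounded_linear_cinner_left] continuous_on_id)
    have "dom A \<subseteq> {x. cinner x z' = cinner x z}"
    proof
      fix u assume u: "u \<in> dom A"
      have "cinner u z' = cinner (the (A u)) y" by (rule bspec[OF that u, symmetric])
      also have "\<dots> = cinner u z" by (rule assms(2)[OF u])
      finally show "u \<in> {x. cinner x z' = cinner x z}" by simp
    qed
    then have "closure (dom A) \<subseteq> {x. cinner x z' = cinner x z}" using cl by (rule closure_minimal)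
    then show "cinner x z' = cinner x z" using assms(1) by (auto simp: densely_defined_def)
  qed
  have "(THE z. \<forall>x\<in>dom A. cinner (the (A x)) y = cinner x z) = z"
    by (rule the_equality) (use assms(2) uniq in auto)
  then show ?thesis unfolding adjoint_op_def using assms(2) by auto
qed

lemma adjoint_op_SomeD:
  fixes A :: "'a::complex_hilbert \<rightharpoonup> 'a"
  assumes "densely_defined A" "y \<in> dom (adjoint_op A)" "x \<in> dom A"
  shows "cinner (the (A x)) y = cinner x (the (adjoint_op A y))"
proof -
  have "\<exists>z. \<forall>x\<in>dom A. cinner (the (A x)) y = cinner x z"
  proof (rule ccontr)
    assume "\<not> ?thesis"
    then have "adjoint_op A y = None" unfolding adjoint_op_def by (simp only: if_False)
    then show False using assms(2) by auto
  qed
  then obtain z where "\<forall>x\<in>dom A. cinner (the (A x)) y = cinner x z" by blast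
  then show ?thesis using adjoint_op_eq[OF assms(1), of y z] assms(3) by simp
qed

text \<open>
  The Hilbert space adjoint \<open>S\<close> of the resolvent at \<open>cnj z\<close> is a two-sided inverse of \<open>z\<close> minus the adjoint
  operator.
\<close>

lemma resolvent_adjoint_op:
  fixes A :: "'a::complex_hilbert \<rightharpoonup> 'a"
  assumes A: "sectorial \<omega> A" "0 < \<omega>" "\<omega> < pi" and z: "z \<in> - closure (sector \<omega>)"
  shows "cinner (resolvent A (cnj z) x) v = cinner x (resolvent (adjoint_op A) z v)"
proof -
  interpret sectorial_family \<omega> "resolvent A" by (rule sectorial_family_resolvent[OF A])
  have dd: "densely_defined A" using A by (simp add: sectorial_def)
  have cz: "cnj z \<in> - closure (sector \<omega>)" by (rule cnj_closure_sector[OF _ z]) (use A in simp)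
  have rz: "cnj z \<in> resolvent_set A" by (rule sectorial_resolvent_set[OF A(1) cz])
  have "\<exists>u. \<forall>x. cinner (resolvent A (cnj z) x) v = cinner x u" for v
    using adjoint_exists[of "resolvent A (cnj z)" v] R_scaleC[OF cz] by metis
  then obtain S where S: "\<And>v x. cinner (resolvent A (cnj z) x) v = cinner x (S v)" by metis
  have Sdom: "adjoint_op A (S v) = Some (z *\<^sub>C S v - v)" for v
  proof (rule adjoint_op_eq[OF dd])
    fix x assume x: "x \<in> dom A"
    have "cinner (the (A x)) (S v) = cinner (resolvent A (cnj z) (the (A x))) v" by (simp add: S)
    also have "resolvent A (cnj z) (the (A x)) = cnj z *\<^sub>C resolvent A (cnj z) x - x"
      using resolvent_left[OF rz x] by (simp add: blinfun.diff_right R_scaleC[OF cz] algebra_simps)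
    also have "cinner \<dots> v = cnj z * cinner (resolvent A (cnj z) x) v - cinner x v" by (simp add: cinner_diff_left cinner_scaleC_left)
    also have "\<dots> = cinner x (z *\<^sub>C S v - v)" by (simp add: S cinner_diff_right cinner_scaleC_right)
    finally show "cinner (the (A x)) (S v) = cinner x (z *\<^sub>C S v - v)" .
  qed
  let ?g = "\<lambda>x. z *\<^sub>C x - the (adjoint_op A x)"
  have gS: "S v \<in> dom (adjoint_op A)" "?g (S v) = v" for v using Sdom[of v] by (auto simp: domI)
  have Sg: "S (?g y) = y" if y: "y \<in> dom (adjoint_op A)" for y
  proof (rule cinner_ext_right)
    fix x
    let ?u = "resolvent A (cnj z) x"
    note u = resolvent_right[OF rz, of x]
    have "cinner x (S (?g y)) = cinner ?u (?g y)" by (simp add: S)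
    also have "\<dots> = cinner (cnj z *\<^sub>C ?u) y - cinner (the (A ?u)) y"
      by (simp add: cinner_diff_right cinner_scaleC_right cinner_scaleC_left adjoint_op_SomeD[OF dd y u(1)])
    also have "\<dots> = cinner x y" using u(2) by (simp flip: cinner_diff_left)
    finally show "cinner x (S (?g y)) = cinner x y" .
  qed
  have inj: "inj_on ?g (dom (adjoint_op A))" by (rule inj_on_inverseI[of _ S]) (rule Sg)
  have rf: "resolvent_fun (adjoint_op A) z = S"
  proof
    fix v
    show "resolvent_fun (adjoint_op A) z v = S v" unfolding resolvent_fun_def
      by (rule inv_into_f_eq[OF inj gS])
  qed
  have nS: "norm (S v) \<le> norm v * norm (resolvent A (cnj z))" for v
  proof (rule norm_le_if_cinner_le)
    fix y
    have "cmod (cinner (S v) y) = cmod (cinner y (S v))" by (metis cinner_commute complex_mod_cnj)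
    also have "\<dots> = cmod (cinner (resolvent A (cnj z) y) v)" by (simp add: S)
    also have "\<dots> \<le> (norm (resolvent A (cnj z)) * norm y) * norm v"
      by (rule order_trans[OF norm_cinner_le mult_right_mono[OF norm_blinfun]]) simp
    finally show "cmod (cinner (S v) y) \<le> norm v * norm (resolvent A (cnj z)) * norm y" by (simp add: mult_ac)
  qed simp
  have "bounded_linear S"
  proof (rule bounded_linear_intro[OF _ _ nS])
    show "S (v + w) = S v + S w" for v w by (rule cinner_ext_right) (simp add: S[symmetric] cinner_add_right)
    show "S (r *\<^sub>R v) = r *\<^sub>R S v" for r v
      by (rule cinner_ext_right) (simp add: S[symmetric] cinner_scaleC_right flip: scaleC_of_real)
  qed
  then have "resolvent (adjoint_op A) z v = S v" by (simp add: resolvent_def rf bounded_linear_Blinfun_apply)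
  then show ?thesis by (simp add: S)
qed

subsection \<open>Approximation of the identity\<close>

lemma dense_tendsto_zero:
  fixes T :: "nat \<Rightarrow> 'a::real_normed_vector \<Rightarrow> 'b::real_normed_vector"
  assumes lip: "\<And>n x y. norm (T n x - T n y) \<le> K * norm (x - y)" and D: "closure D = UNIV"
    and lim: "\<And>x. x \<in> D \<Longrightarrow> (\<lambda>n. T n x) \<longlonglongrightarrow> 0"
  shows "(\<lambda>n. T n x) \<longlonglongrightarrow> 0"
proof (rule LIMSEQ_I)
  fix e :: real assume e: "e > 0"
  define d where "d = e / (2 * (\<bar>K\<bar> + 1))"
  have d: "d > 0" using e by (simp add: d_def)
  have "x \<in> closure D" using D by simp
  then obtain y where y: "y \<in> D" "dist y x < d" using d unfolding closure_approachable by blast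
  obtain N where N: "\<And>n. n \<ge> N \<Longrightarrow> norm (T n y - 0) < e / 2" using LIMSEQ_D[OF lim[OF y(1)], of "e / 2"] e by auto
  have "norm (T n x - 0) < e" if "n \<ge> N" for n
  proof -
    have "norm (T n x) \<le> norm (T n x - T n y) + norm (T n y)" using norm_triangle_ineq[of "T n x - T n y" "T n y"] by simp
    moreover have "norm (T n x - T n y) \<le> e / 2"
    proof -
      have "norm (T n x - T n y) \<le> K * norm (x - y)" by (rule lip)
      also have "\<dots> \<le> (\<bar>K\<bar> + 1) * d" using y(2) by (intro mult_mono) (auto simp: dist_norm norm_minus_commute)
      also have "\<dots> = e / 2"
      proof -
        have "k * (e / (2 * k)) = e / 2" if "k > 0" for k :: real using that by simp
        from this[of "\<bar>K\<bar> + 1"] show ?thesis unfolding d_def by simp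
      qed
      finally show ?thesis .
    qed
    ultimately show ?thesis using N[OF that] by simp
  qed
  then show "\<exists>no. \<forall>n\<ge>no. norm (T n x - 0) < e" by blast
qed

lemma minus_of_real_outside:
  assumes "0 < \<theta>" "\<theta> < pi" "t > 0"
  shows "- complex_of_real t \<in> - closure (sector \<theta>)"
  using exp_outside_sector[of \<theta> "Complex (ln t) pi"] assms by (simp add: exp_Complex_pi)

text \<open>
  The mean ergodic argument: the vectors \<open>u = t (t + A)\<^sup>-\<^sup>1 x\<close> are bounded, differ from \<open>x\<close> by elements of
  the range, and satisfy \<open>A u = t (x - u)\<close>, which is small for small \<open>t\<close>. These properties define convex sets;
  a convergent selection from them has its limit in the kernel, because \<open>A\<close> is closed. If the kernel is
  trivial, \<open>x\<close> is therefore a limit of elements of the range.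
\<close>

lemma dense_range:
  fixes A :: "'a::complex_hilbert \<rightharpoonup> 'a"
  assumes A: "sectorial \<omega> A" "0 < \<omega>" "\<omega> < pi" and inj: "inj_on A (dom A)"
    and K: "K > 0" "\<And>t. t > 0 \<Longrightarrow> t * norm (resolvent A (- of_real t)) \<le> K"
  shows "closure ((\<lambda>u. the (A u)) ` dom A) = UNIV"
proof -
  have lin: "linear_operator A" and cl: "closed (Map.graph A)" using A(1) by (auto simp: sectorial_def closed_operator_def)
  let ?V = "(\<lambda>u. the (A u)) ` dom A"
  have Vadd: "r *\<^sub>R v + q *\<^sub>R w \<in> ?V" if v: "v \<in> ?V" "w \<in> ?V" for v w and r q :: real
  proof -
    obtain a b where ab: "a \<in> dom A" "b \<in> dom A" "v = the (A a)" "w = the (A b)" using v by blast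
    have "r *\<^sub>R a \<in> dom A" "q *\<^sub>R b \<in> dom A" by (rule linear_operator_scaleR[OF lin]; fact)+
    then show ?thesis using linear_operator_add[OF lin, of "r *\<^sub>R a" "q *\<^sub>R b"] linear_operator_scaleR(2)[OF lin] ab
      by (metis imageI)
  qed
  have "x \<in> closure ?V" for x
  proof -
    define k where "k n = {v \<in> dom A. norm (the (A v)) \<le> 1 / Suc n \<and> x - v \<in> ?V \<and> norm v \<le> K * norm x}" for n
    obtain v where v: "\<And>n. v n \<in> k n" "Cauchy v"
    proof (rule nested_convex_Cauchy[of k "K * norm x"])
      show "k n \<noteq> {}" for n
      proof -
        \<comment> \<open>Small enough for \<open>t * norm (x - u) \<le> 1 / Suc n\<close>, as \<open>norm (x - u) \<le> (1 + K) * norm x\<close>.\<close>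
        define t where "t = 1 / (real (Suc n) * ((1 + K) * norm x + 1))"
        have pos: "(1 + K) * norm x + 1 > 0" using K(1) by (simp add: add_nonneg_pos)
        have t: "t > 0" using pos by (simp add: t_def)
        have rt: "- of_real t \<in> resolvent_set A" by (rule sectorial_resolvent_set[OF A(1) minus_of_real_outside[OF A(2,3) t]])
        let ?r = "resolvent A (- of_real t) x"
        note r = resolvent_right[OF rt, of x]
        have Ar: "the (A ?r) = - (t *\<^sub>R ?r) - x" using r(2) by (simp add: scaleC_minus_left scaleC_of_real algebra_simps)
        define u where "u = (- t) *\<^sub>R ?r"
        have u: "u \<in> dom A" "the (A u) = t *\<^sub>R (x - u)"
          using linear_operator_scaleR[OF lin r(1), of "- t"] Ar by (auto simp: u_def algebra_simps)
        have nu: "norm u \<le> K * norm x"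
        proof -
          have "norm u = t * norm ?r" using t by (simp add: u_def)
          also have "\<dots> \<le> t * (norm (resolvent A (- of_real t)) * norm x)" using t by (intro mult_left_mono norm_blinfun) auto
          also have "\<dots> \<le> K * norm x" using K(2)[OF t] by (simp add: mult.assoc[symmetric] mult_right_mono)
          finally show ?thesis .
        qed
        have "norm (the (A u)) = t * norm (x - u)" using t by (simp add: u(2))
        also have "\<dots> \<le> t * ((1 + K) * norm x + 1)"
          using nu t by (intro mult_left_mono order_trans[OF norm_triangle_ineq4]) (auto simp: algebra_simps)
        also have "\<dots> = 1 / Suc n" using pos by (simp add: t_def)
        finally have n1: "norm (the (A u)) \<le> 1 / Suc n" .
        have "x - u = the (A ((-1) *\<^sub>R ?r))" using linear_operator_scaleR[OF lin r(1), of "-1"] Ar by (simp add: u_def)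
        then have "x - u \<in> ?V" using linear_operator_scaleR(1)[OF lin r(1), of "-1"] by blast
        then have "u \<in> k n" using u nu n1 by (simp add: k_def)
        then show ?thesis by blast
      qed
      show "convex (k n)" for n
      proof (rule convexI)
        fix a b and q w :: real assume ab: "a \<in> k n" "b \<in> k n" and qw: "0 \<le> q" "0 \<le> w" "q + w = 1"
        have d: "q *\<^sub>R a \<in> dom A" "w *\<^sub>R b \<in> dom A" "the (A (q *\<^sub>R a)) = q *\<^sub>R the (A a)" "the (A (w *\<^sub>R b)) = w *\<^sub>R the (A b)"
          using linear_operator_scaleR[OF lin, of a q] linear_operator_scaleR[OF lin, of b w] ab by (auto simp: k_def)
        have s: "q *\<^sub>R a + w *\<^sub>R b \<in> dom A" "the (A (q *\<^sub>R a + w *\<^sub>R b)) = q *\<^sub>R the (A a) + w *\<^sub>R the (A b)"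
          using linear_operator_add[OF lin d(1,2)] d(3,4) by auto
        have cvx: "norm (q *\<^sub>R a' + w *\<^sub>R b') \<le> c" if "norm a' \<le> c" "norm b' \<le> c" for a' b' :: 'a and c
        proof -
          have "norm (q *\<^sub>R a' + w *\<^sub>R b') \<le> q * norm a' + w * norm b'" using norm_triangle_ineq[of "q *\<^sub>R a'" "w *\<^sub>R b'"] qw by simp
          also have "\<dots> \<le> q * c + w * c" using that qw by (intro add_mono mult_left_mono) auto
          also have "\<dots> = c" using qw(3) by (metis distrib_right mult_1)
          finally show ?thesis .
        qed
        have "x - (q *\<^sub>R a + w *\<^sub>R b) = (q + w) *\<^sub>R x - (q *\<^sub>R a + w *\<^sub>R b)" by (simp only: qw(3) scaleR_one)
        also have "\<dots> = q *\<^sub>R (x - a) + w *\<^sub>R (x - b)" by (simp add: algebra_simps)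
        finally have "x - (q *\<^sub>R a + w *\<^sub>R b) \<in> ?V" using Vadd[of "x - a" "x - b" q w] ab by (simp add: k_def)
        then show "q *\<^sub>R a + w *\<^sub>R b \<in> k n" using s cvx ab by (simp add: k_def)
      qed
      show "k n \<subseteq> k m" if "m \<le> n" for m n
      proof -
        have "1 / real (Suc n) \<le> 1 / real (Suc m)" using that by (simp add: frac_le)
        then show ?thesis by (auto simp: k_def)
      qed
      show "norm v \<le> K * norm x" if "v \<in> k 0" for v using that by (simp add: k_def)
    qed blast
    obtain l where l: "v \<longlonglongrightarrow> l" using v(2) Cauchy_convergent convergent_def by blast
    have A0: "(\<lambda>n. the (A (v n))) \<longlonglongrightarrow> 0"
    proof (rule Lim_null_comparison)
      show "\<forall>\<^sub>F n in sequentially. norm (the (A (v n))) \<le> 1 / real (Suc n)" using v(1) by (auto simp: k_def)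
      show "(\<lambda>n. 1 / real (Suc n)) \<longlonglongrightarrow> 0" using LIMSEQ_Suc[OF lim_const_over_n[of 1]] by simp
    qed
    have "(v n, the (A (v n))) \<in> Map.graph A" for n using v(1)[of n] by (auto simp: k_def Map.graph_def)
    then have "(l, 0) \<in> Map.graph A"
      by (rule closed_sequentially[OF cl _ tendsto_Pair[OF l A0]])
    then have "A l = Some 0" by (simp add: Map.graph_def)
    moreover have "A 0 = Some 0" using linear_operator_zero[OF lin] by auto
    ultimately have "l = 0" using inj by (metis domI inj_onD)
    then have lim: "(\<lambda>n. x - v n) \<longlonglongrightarrow> x" using tendsto_diff[OF tendsto_const[of x] l] by simp
    have mem: "x - v n \<in> ?V" for n using v(1)[of n] by (simp add: k_def)
    show ?thesis unfolding closure_sequential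
      by (rule exI[of _ "\<lambda>n. x - v n"], rule conjI, rule allI, rule mem, rule lim)
  qed
  then show ?thesis by auto
qed

text \<open>
  Write \<open>t\<close> for the parameter. As it tends to infinity, \<open>t (t + A)\<^sup>-\<^sup>1 x\<close> tends to \<open>x\<close>, which for \<open>x\<close> in the
  domain is read off from \<open>x - t (t + A)\<^sup>-\<^sup>1 x = (t + A)\<^sup>-\<^sup>1 A x\<close>. As it tends to \<open>0\<close>, \<open>t (t + A)\<^sup>-\<^sup>1 x\<close> tends to
  \<open>0\<close>, which for \<open>x = A u\<close> follows from the boundedness of \<open>(t + A)\<^sup>-\<^sup>1 A\<close>. Both extend by density.
\<close>

lemma approx_unit_tendsto:
  fixes A :: "'a::complex_hilbert \<rightharpoonup> 'a"
  assumes A: "sectorial \<omega> A" "0 < \<omega>" "\<omega> < pi" and inj: "inj_on A (dom A)"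
  shows "(\<lambda>n. of_real (1 / real (n + 2)) *\<^sub>C resolvent A (- of_real (1 / real (n + 2))) x
      - of_real (real (n + 2)) *\<^sub>C resolvent A (- of_real (real (n + 2))) x) \<longlonglongrightarrow> x"
proof -
  interpret sectorial_family \<omega> "resolvent A" by (rule sectorial_family_resolvent[OF A])
  let ?R = "\<lambda>t. resolvent A (- of_real t)"
  obtain K where K0: "K > 0" "\<And>\<zeta>. (\<omega> + pi) / 2 \<le> \<bar>Im \<zeta>\<bar> \<Longrightarrow> \<bar>Im \<zeta>\<bar> \<le> 2 * pi - (\<omega> + pi) / 2 \<Longrightarrow> cmod (exp \<zeta>) * norm (resolvent A (exp \<zeta>)) \<le> K"
    using R_strip_bound[of "(\<omega> + pi) / 2"] A by auto
  have K: "t * norm (?R t) \<le> K" if "t > 0" for t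
    using K0(2)[of "Complex (ln t) pi"] A that by (simp add: exp_Complex_pi)
  have rs: "- of_real t \<in> resolvent_set A" if "t > 0" for t
    by (rule sectorial_resolvent_set[OF A(1) minus_of_real_outside[OF A(2,3) that]])
  have nK: "norm (t *\<^sub>R ?R t v) \<le> K * norm v" if "t > 0" for t v
  proof -
    have "norm (t *\<^sub>R ?R t v) \<le> t * (norm (?R t) * norm v)" using that by (simp add: norm_blinfun)
    also have "\<dots> \<le> K * norm v" using K[OF that] by (simp add: mult.assoc[symmetric] mult_right_mono)
    finally show ?thesis .
  qed
  have left: "?R t (- (t *\<^sub>R u) - the (A u)) = u" if "t > 0" "u \<in> dom A" for t u
    using resolvent_left[OF rs[OF that(1)] that(2)] by (simp add: scaleC_minus_left scaleC_of_real)
  have big: "(\<lambda>n. - (real (n + 2) *\<^sub>R ?R (real (n + 2)) x) - x) \<longlonglongrightarrow> 0" for x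
  proof (rule dense_tendsto_zero[where K = "K + 1" and D = "dom A" and T = "\<lambda>n x. - (real (n + 2) *\<^sub>R ?R (real (n + 2)) x) - x"])
    show "norm ((- (real (n + 2) *\<^sub>R ?R (real (n + 2)) x) - x) - (- (real (n + 2) *\<^sub>R ?R (real (n + 2)) y) - y)) \<le> (K + 1) * norm (x - y)" for n x y
    proof -
      have "(- (real (n + 2) *\<^sub>R ?R (real (n + 2)) x) - x) - (- (real (n + 2) *\<^sub>R ?R (real (n + 2)) y) - y)
        = - (real (n + 2) *\<^sub>R ?R (real (n + 2)) (x - y)) - (x - y)" by (simp add: blinfun.diff_right scaleR_diff_right)
      also have "norm \<dots> \<le> norm (real (n + 2) *\<^sub>R ?R (real (n + 2)) (x - y)) + norm (x - y)"
        by (rule order_trans[OF norm_triangle_ineq4]) simp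
      also have "\<dots> \<le> K * norm (x - y) + norm (x - y)" by (intro add_mono nK) auto
      finally show ?thesis by (simp add: algebra_simps)
    qed
    show "closure (dom A) = UNIV" using A(1) by (simp add: sectorial_def densely_defined_def)
    fix u assume u: "u \<in> dom A"
    show "(\<lambda>n. - (real (n + 2) *\<^sub>R ?R (real (n + 2)) u) - u) \<longlonglongrightarrow> 0"
    proof (rule Lim_null_comparison)
      show "\<forall>\<^sub>F n in sequentially. norm (- (real (n + 2) *\<^sub>R ?R (real (n + 2)) u) - u) \<le> (K * norm (the (A u))) / real (n + 2)"
      proof (intro always_eventually allI)
        fix n
        define t where "t = real (n + 2)"
        have t: "t > 0" by (simp add: t_def)
        have "- (t *\<^sub>R ?R t u) - u = ?R t (the (A u))"
          using left[OF t u] by (simp add: blinfun.diff_right blinfun.minus_right blinfun.scaleR_right algebra_simps)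
        then have "norm (- (t *\<^sub>R ?R t u) - u) = norm (t *\<^sub>R ?R t (the (A u))) / t" using t by simp
        also have "\<dots> \<le> (K * norm (the (A u))) / t" by (rule divide_right_mono[OF nK[OF t]]) (use t in simp)
        finally show "norm (- (real (n + 2) *\<^sub>R ?R (real (n + 2)) u) - u) \<le> (K * norm (the (A u))) / real (n + 2)"
          by (simp only: t_def)
      qed
      show "(\<lambda>n. (K * norm (the (A u))) / real (n + 2)) \<longlonglongrightarrow> 0"
        using LIMSEQ_ignore_initial_segment[OF lim_const_over_n[of "K * norm (the (A u))"], of 2] by simp
    qed
  qed
  have small: "(\<lambda>n. (1 / real (n + 2)) *\<^sub>R ?R (1 / real (n + 2)) x) \<longlonglongrightarrow> 0" for x
  proof (rule dense_tendsto_zero[where K = K and D = "(\<lambda>u. the (A u)) ` dom A" and T = "\<lambda>n x. (1 / real (n + 2)) *\<^sub>R ?R (1 / real (n + 2)) x"])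
    show "norm ((1 / real (n + 2)) *\<^sub>R ?R (1 / real (n + 2)) x - (1 / real (n + 2)) *\<^sub>R ?R (1 / real (n + 2)) y) \<le> K * norm (x - y)" for n x y
    proof -
      have "(1 / real (n + 2)) *\<^sub>R ?R (1 / real (n + 2)) x - (1 / real (n + 2)) *\<^sub>R ?R (1 / real (n + 2)) y = (1 / real (n + 2)) *\<^sub>R ?R (1 / real (n + 2)) (x - y)"
        by (simp only: blinfun.diff_right scaleR_diff_right)
      then show ?thesis using nK[of "1 / real (n + 2)" "x - y"] by simp
    qed
    show "closure ((\<lambda>u. the (A u)) ` dom A) = UNIV" by (rule dense_range[OF A inj K0(1) K])
    fix y assume "y \<in> (\<lambda>u. the (A u)) ` dom A"
    then obtain u where u: "u \<in> dom A" "y = the (A u)" by blast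
    show "(\<lambda>n. (1 / real (n + 2)) *\<^sub>R ?R (1 / real (n + 2)) y) \<longlonglongrightarrow> 0"
    proof (rule Lim_null_comparison)
      show "\<forall>\<^sub>F n in sequentially. norm ((1 / real (n + 2)) *\<^sub>R ?R (1 / real (n + 2)) y) \<le> ((1 + K) * norm u) / real (n + 2)"
      proof (intro always_eventually allI)
        fix n
        define t where "t = 1 / real (n + 2)"
        have t: "t > 0" by (simp add: t_def)
        have "?R t y = - u - t *\<^sub>R ?R t u"
        proof -
          have gen: "q = - u - p" if "- p - q = u" for p q :: 'a by (simp add: that[symmetric])
          show ?thesis
            by (rule gen) (use left[OF t u(1)] u(2) in \<open>simp add: blinfun.diff_right blinfun.minus_right blinfun.scaleR_right\<close>)
        qed
        then have "norm (?R t y) \<le> norm u + K * norm u"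
          using nK[OF t, of u] norm_triangle_ineq4[of "- u" "t *\<^sub>R ?R t u"] by simp
        then have "t * norm (?R t y) \<le> t * (norm u + K * norm u)" using t by (intro mult_left_mono) auto
        then have "norm (t *\<^sub>R ?R t y) \<le> ((1 + K) * norm u) / real (n + 2)"
          using t by (simp add: t_def algebra_simps add_divide_distrib)
        then show "norm ((1 / real (n + 2)) *\<^sub>R ?R (1 / real (n + 2)) y) \<le> ((1 + K) * norm u) / real (n + 2)" by (simp only: t_def)
      qed
      show "(\<lambda>n. ((1 + K) * norm u) / real (n + 2)) \<longlonglongrightarrow> 0"
        using LIMSEQ_ignore_initial_segment[OF lim_const_over_n[of "(1 + K) * norm u"], of 2] by simp
    qed
  qed
  have eq: "p + ((- q - x) + x) = p - q" for p q :: 'a by simp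
  have "(\<lambda>n. (1 / real (n + 2)) *\<^sub>R ?R (1 / real (n + 2)) x + ((- (real (n + 2) *\<^sub>R ?R (real (n + 2)) x) - x) + x)) \<longlonglongrightarrow> 0 + (0 + x)"
    by (intro tendsto_add small big tendsto_const)
  then show ?thesis by (simp only: scaleC_of_real add_0 eq)
qed

section \<open>Equivalence of bounded calculus and square function estimates\<close>

lemma power2_ennreal_le_cancel:
  assumes "(ennreal a)\<^sup>2 \<le> ennreal (b\<^sup>2)" "0 \<le> a" "0 \<le> b"
  shows "a \<le> b"
proof -
  have "ennreal (a\<^sup>2) \<le> ennreal (b\<^sup>2)" using assms(1,2) by (simp add: ennreal_power)
  then have "a\<^sup>2 \<le> b\<^sup>2" by simp
  then show ?thesis using assms(3) by (rule power2_le_imp_le)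
qed

lemma sector_product_nonzero:
  assumes F: "F holomorphic_on sector \<theta>1" "\<exists>z\<in>sector \<theta>1. F z \<noteq> 0" and G: "G holomorphic_on sector \<theta>2" "\<exists>z\<in>sector \<theta>2. G z \<noteq> 0"
    and t: "0 < \<theta>" "\<theta> \<le> \<theta>1" "\<theta> \<le> \<theta>2" "\<theta>1 \<le> pi" "\<theta>2 \<le> pi"
  shows "\<exists>z\<in>sector \<theta>. F z * G z \<noteq> 0"
proof -
  have p: "0 < \<theta>1" "0 < \<theta>2" "\<theta> \<le> pi" using t by auto
  have uniq: "\<forall>z\<in>sector \<theta>'. f z = 0" if "f holomorphic_on sector \<theta>'" "U \<subseteq> sector \<theta>'" "open U" "U \<noteq> {}" "\<And>z. z \<in> U \<Longrightarrow> f z = 0" "0 < \<theta>'" "\<theta>' \<le> pi" for f \<theta>' U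
  proof
    fix z assume z: "z \<in> sector \<theta>'"
    show "f z = 0"
      by (rule analytic_continuation_open[where s = U and s' = "sector \<theta>'" and f = f and g = "\<lambda>_. 0"])
        (use that z open_sector connected_sector in auto)
  qed
  have os: "open (sector \<theta>)" "sector \<theta> \<noteq> {}" using open_sector[OF p(3)] one_in_sector[OF t(1)] by auto
  obtain z0 where z0: "z0 \<in> sector \<theta>" "F z0 \<noteq> 0"
    using uniq[OF F(1) sector_mono[OF t(2)] os _ p(1) t(4)] F(2) by blast
  have cF: "continuous_on (sector \<theta>) F"
    by (rule continuous_on_subset[OF holomorphic_on_imp_continuous_on[OF F(1)] sector_mono[OF t(2)]])
  let ?U = "sector \<theta> \<inter> F -` (- {0})"
  have oU: "open ?U" by (rule continuous_open_preimage[OF cF os(1)]) auto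
  have neU: "?U \<noteq> {}" using z0 by blast
  have subU: "?U \<subseteq> sector \<theta>2" using sector_mono[OF t(3)] by blast
  have "\<exists>z\<in>?U. G z \<noteq> 0"
    using uniq[OF G(1) subU oU neU _ p(2) t(5)] G(2) by blast
  then show ?thesis by auto
qed

context sectorial_family
begin

text \<open>
  The three estimates of the theorem, in terms of \<open>sector_decay\<close> and with squared norms. The suprema are
  replaced by arbitrary upper bounds \<open>B\<close>.
\<close>

definition calc_bounded :: "real \<Rightarrow> bool" where
  "calc_bounded \<theta> \<longleftrightarrow> (\<exists>K\<ge>0. \<forall>f s d B. sector_decay \<theta> s d f \<longrightarrow> s > 0 \<longrightarrow> (\<forall>w\<in>sector \<theta>. cmod (f w) \<le> B) \<longrightarrow>
     norm (op ((\<omega> + \<theta>) / 2) f) \<le> K * B)"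

definition area_upper :: "real \<Rightarrow> real \<Rightarrow> (complex \<Rightarrow> complex) \<Rightarrow> bool" where
  "area_upper \<alpha> \<theta> F \<longleftrightarrow> (\<exists>L\<ge>0. \<forall>x. area \<alpha> ((\<omega> + (\<theta> - \<alpha>)) / 2) F x \<le> ennreal ((L * norm x)\<^sup>2))"

definition area_lower :: "real \<Rightarrow> real \<Rightarrow> (complex \<Rightarrow> complex) \<Rightarrow> bool" where
  "area_lower \<alpha> \<theta> F \<longleftrightarrow> (\<exists>C>0. \<forall>x. ennreal ((inverse C * norm x)\<^sup>2) \<le> area \<alpha> ((\<omega> + (\<theta> - \<alpha>)) / 2) F x)"

lemma area_independent:
  assumes F: "sector_decay \<theta> s c F" "s > 0" "\<theta> \<le> pi" "0 < \<alpha>" and g: "\<omega> < \<gamma>" "\<gamma> < \<theta> - \<alpha>" "\<omega> < \<delta>" "\<delta> < \<theta> - \<alpha>"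
  shows "area \<alpha> \<gamma> F x = area \<alpha> \<delta> F x"
  unfolding area_def
proof (rule nn_integral_cong)
  fix z assume "z \<in> space (sector_measure \<alpha>)"
  then have z: "z \<in> sector \<alpha>" by simp
  have "0 < \<theta>" using g omega F by linarith
  then have "op \<gamma> (\<lambda>w. F (z * w)) = op \<delta> (\<lambda>w. F (z * w))"
    using op_independent[OF sector_decay_dilate[OF F(1-3) z] F(2) g] F(3,4) by simp
  then show "(ennreal (norm (op \<gamma> (\<lambda>w. F (z * w)) x)))\<^sup>2 = (ennreal (norm (op \<delta> (\<lambda>w. F (z * w)) x)))\<^sup>2" by simp
qed

text \<open>
  The sign argument works for a function \<open>\<psi>\<close> whose dilations by a sector \<open>\<Sigma>\<^sub>\<beta>\<close> are holomorphic on \<open>\<Sigma>\<^sub>\<theta>\<close>;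
  there is room for this because \<open>\<theta> < \<pi>\<close>. Its bound is transferred to \<open>F\<close>.
\<close>

lemma calc_bounded_imp_area_upper:
  assumes b: "calc_bounded \<theta>" and t: "\<omega> < \<theta>" "\<theta> < pi"
    and F: "sector_decay \<theta>' s c F" "s > 0" and a: "0 < \<alpha>" "\<omega> + \<alpha> < \<theta>'" "\<theta>' \<le> pi"
  shows "area_upper \<alpha> \<theta>' F"
proof -
  define \<beta> where "\<beta> = (pi - \<theta>) / 2"
  define \<theta>1 where "\<theta>1 = \<theta> + \<beta>"
  define \<gamma> where "\<gamma> = (\<omega> + \<theta>) / 2"
  \<comment> \<open>The largest angle for which the dilations of \<open>F\<close> and those of \<open>\<psi>\<close> are both available.\<close>
  define \<nu> where "\<nu> = min (\<theta>' - \<alpha>) \<theta>"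
  define \<gamma>' where "\<gamma>' = (\<omega> + \<nu>) / 2"
  have \<beta>: "0 < \<beta>" "\<beta> < \<theta>1" "\<theta>1 < pi" "\<theta>1 \<le> pi" "0 < \<theta>1" "\<theta> \<le> \<theta>1 - \<beta>" "0 < \<theta>"
    using t omega by (auto simp: \<beta>_def \<theta>1_def field_simps)
  have g: "\<omega> < \<gamma>" "\<gamma> < \<theta>" "\<omega> < \<nu>" "\<nu> \<le> \<theta>' - \<alpha>" "\<nu> \<le> \<theta>" "\<omega> < \<gamma>'" "\<gamma>' < \<nu>" "\<gamma> < \<theta>1 - \<beta>" "\<nu> \<le> \<theta>1 - \<beta>" "\<gamma>' < \<theta>1 - \<beta>" "\<gamma>' < \<theta>' - \<alpha>" "\<alpha> < \<theta>'"
    using t a \<beta>(6) omega by (auto simp: \<gamma>_def \<nu>_def \<gamma>'_def min_def)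
  obtain c1 where \<psi>: "sector_decay \<theta>1 1 c1 (approx_unit 1 2)"
    using approx_unit_decay[OF \<beta>(5,3), of 1 2] by auto
  have nz: "\<exists>z\<in>sector \<theta>1. approx_unit 1 2 z \<noteq> 0"
    by (rule bexI[of _ 1]) (auto simp: approx_unit_def one_in_sector \<beta>)
  obtain K where K: "K \<ge> 0" "\<And>f s d B. sector_decay \<theta> s d f \<Longrightarrow> s > 0 \<Longrightarrow> (\<And>w. w \<in> sector \<theta> \<Longrightarrow> cmod (f w) \<le> B) \<Longrightarrow> norm (op \<gamma> f) \<le> K * B"
    using b unfolding calc_bounded_def \<gamma>_def by blast
  obtain L where L: "L \<ge> 0" "\<And>x. area \<beta> \<gamma> (approx_unit 1 2) x \<le> ennreal ((L * norm x)\<^sup>2)"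
  proof -
    have "\<exists>L\<ge>0. \<forall>x. area \<beta> \<gamma> (approx_unit 1 2) x \<le> ennreal ((L * norm x)\<^sup>2)"
      by (rule area_bound[OF \<psi> zero_less_one \<beta>(1,2,4) g(1,2) \<beta>(6) K(1)]) (rule K(2))
    then show ?thesis using that by blast
  qed
  obtain C where C: "C \<ge> 0" "\<And>f B x. f holomorphic_on sector \<nu> \<Longrightarrow> (\<forall>w\<in>sector \<nu>. cmod (f w) \<le> B) \<Longrightarrow>
      (\<integral>\<^sup>+z. (ennreal (norm (op \<gamma>' (\<lambda>w. f w * F (z * w)) x)))\<^sup>2 \<partial>sector_measure \<alpha>) \<le> ennreal ((C * B)\<^sup>2) * area \<beta> \<gamma>' (approx_unit 1 2) x"
    using area_transfer[OF F a(1) g(12) a(3) \<psi> zero_less_one \<beta>(1,2,4) nz g(6,7,4,9)] by auto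
  have "area \<alpha> ((\<omega> + (\<theta>' - \<alpha>)) / 2) F x \<le> ennreal ((C * L * norm x)\<^sup>2)" for x
  proof -
    have "area \<alpha> ((\<omega> + (\<theta>' - \<alpha>)) / 2) F x = area \<alpha> \<gamma>' F x"
      by (rule area_independent[OF F a(3,1)]) (use g a in auto)
    also have "\<dots> \<le> ennreal ((C * 1)\<^sup>2) * area \<beta> \<gamma>' (approx_unit 1 2) x"
      using C(2)[of "\<lambda>_. 1" 1 x] by (simp add: area_def)
    also have "area \<beta> \<gamma>' (approx_unit 1 2) x = area \<beta> \<gamma> (approx_unit 1 2) x"
      by (rule area_independent[OF \<psi> zero_less_one \<beta>(4,1)]) (use g in auto)
    also have "ennreal ((C * 1)\<^sup>2) * \<dots> \<le> ennreal ((C * 1)\<^sup>2) * ennreal ((L * norm x)\<^sup>2)"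
      by (intro mult_left_mono L) simp
    also have "\<dots> = ennreal ((C * L * norm x)\<^sup>2)" by (simp add: ennreal_mult[symmetric] power_mult_distrib mult.assoc)
    finally show ?thesis .
  qed
  moreover have "C * L \<ge> 0" using C L by simp
  ultimately show ?thesis unfolding area_upper_def by blast
qed

text \<open>
  The lower estimate bounds \<open>f(A) x\<close> by its area function, and \<open>area_transfer\<close> with \<open>\<psi> = F\<close> bounds this area
  function by the one of \<open>x\<close>.
\<close>

lemma area_equiv_imp_calc_bounded:
  assumes u: "area_upper \<alpha> \<theta>' F" and l: "area_lower \<alpha> \<theta>' F" and t: "\<omega> < \<theta>" "\<theta> \<le> pi"
    and F: "sector_decay \<theta>' s c F" "s > 0" and a: "0 < \<alpha>" "\<omega> + \<alpha> < \<theta>'" "\<theta>' \<le> pi" and nz: "\<exists>z\<in>sector \<theta>'. F z \<noteq> 0"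
  shows "calc_bounded \<theta>"
proof -
  define \<nu> where "\<nu> = min \<theta> (\<theta>' - \<alpha>)"
  define \<gamma> where "\<gamma> = (\<omega> + \<nu>) / 2"
  have g: "\<omega> < \<nu>" "\<nu> \<le> \<theta>' - \<alpha>" "\<nu> \<le> \<theta>" "\<omega> < \<gamma>" "\<gamma> < \<nu>" "\<alpha> < \<theta>'" "0 < \<nu>" "\<nu> \<le> pi" "0 < \<theta>'" "\<gamma> < \<theta>' - \<alpha>" "\<gamma> < \<theta>"
    using t a omega by (auto simp: \<nu>_def \<gamma>_def min_def)
  have ind: "area \<alpha> ((\<omega> + (\<theta>' - \<alpha>)) / 2) F x = area \<alpha> \<gamma> F x" for x
    by (rule area_independent[OF F a(3,1)]) (use g a in auto)
  obtain L where L: "L \<ge> 0" "\<And>x. area \<alpha> \<gamma> F x \<le> ennreal ((L * norm x)\<^sup>2)"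
    using u unfolding area_upper_def ind by blast
  obtain C1 where C1: "C1 > 0" "\<And>x. ennreal ((inverse C1 * norm x)\<^sup>2) \<le> area \<alpha> \<gamma> F x"
    using l unfolding area_lower_def ind by blast
  obtain C where C: "C \<ge> 0" "\<And>f B x. f holomorphic_on sector \<nu> \<Longrightarrow> (\<forall>w\<in>sector \<nu>. cmod (f w) \<le> B) \<Longrightarrow>
      (\<integral>\<^sup>+z. (ennreal (norm (op \<gamma> (\<lambda>w. f w * F (z * w)) x)))\<^sup>2 \<partial>sector_measure \<alpha>) \<le> ennreal ((C * B)\<^sup>2) * area \<alpha> \<gamma> F x"
    using area_transfer[OF F a(1) g(6) a(3) F a(1) g(6) a(3) nz g(4,5,2,2)] by auto
  have "norm (op ((\<omega> + \<theta>) / 2) f) \<le> (C1 * C * L) * B"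
    if f: "sector_decay \<theta> s' d f" "s' > 0" "\<forall>w\<in>sector \<theta>. cmod (f w) \<le> B" for f s' d B
  proof (rule norm_blinfun_bound)
    have f\<nu>: "sector_decay \<nu> s' d f" by (rule sector_decay_mono[OF f(1) g(3)])
    have fb: "\<forall>w\<in>sector \<nu>. cmod (f w) \<le> B" using f(3) sector_mono[OF g(3)] by blast
    have B: "B \<ge> 0" using fb one_in_sector[OF g(7)] norm_ge_zero order_trans by blast
    show "0 \<le> (C1 * C * L) * B" using B C C1 L by simp
    fix x
    have eq: "op ((\<omega> + \<theta>) / 2) f = op \<gamma> f" by (rule op_independent[OF f(1,2)]) (use g t in auto)
    have "area \<alpha> \<gamma> F (op \<gamma> f x) = (\<integral>\<^sup>+z. (ennreal (norm (op \<gamma> (\<lambda>w. f w * F (z * w)) x)))\<^sup>2 \<partial>sector_measure \<alpha>)"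
      unfolding area_def
    proof (rule nn_integral_cong)
      fix z assume "z \<in> space (sector_measure \<alpha>)"
      then have z: "z \<in> sector \<alpha>" by simp
      have "op \<gamma> (\<lambda>w. F (z * w)) (op \<gamma> f x) = op \<gamma> (\<lambda>w. F (z * w) * f w) x"
        by (rule op_mult[OF sector_decay_mono[OF sector_decay_dilate[OF F a(3) z g(9)] g(2)] F(2) f\<nu> f(2) g(4,5,8)])
      then show "(ennreal (norm (op \<gamma> (\<lambda>w. F (z * w)) (op \<gamma> f x))))\<^sup>2 = (ennreal (norm (op \<gamma> (\<lambda>w. f w * F (z * w)) x)))\<^sup>2"
        by (simp add: mult.commute)
    qed
    also have "\<dots> \<le> ennreal ((C * B)\<^sup>2) * area \<alpha> \<gamma> F x"
      by (rule C(2)[OF _ fb]) (use f\<nu> in \<open>simp add: sector_decay_def\<close>)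
    also have "\<dots> \<le> ennreal ((C * B)\<^sup>2) * ennreal ((L * norm x)\<^sup>2)" by (intro mult_left_mono L) simp
    also have "\<dots> = ennreal ((C * B * (L * norm x))\<^sup>2)" by (simp add: ennreal_mult[symmetric] power_mult_distrib)
    finally have "ennreal ((inverse C1 * norm (op \<gamma> f x))\<^sup>2) \<le> ennreal ((C * B * (L * norm x))\<^sup>2)"
      using C1(2)[of "op \<gamma> f x"] order_trans by blast
    then have "(inverse C1 * norm (op \<gamma> f x))\<^sup>2 \<le> (C * B * (L * norm x))\<^sup>2" by simp
    then have "inverse C1 * norm (op \<gamma> f x) \<le> C * B * (L * norm x)"
      by (rule power2_le_imp_le) (use B C L in simp)
    then have "C1 * (inverse C1 * norm (op \<gamma> f x)) \<le> C1 * (C * B * (L * norm x))" by (rule mult_left_mono) (use C1 in simp)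
    then show "norm (op ((\<omega> + \<theta>) / 2) f x) \<le> C1 * C * L * B * norm x"
    proof -
      have "C1 * (inverse C1 * norm (op \<gamma> f x)) = norm (op \<gamma> f x)" using C1(1) by (simp flip: mult.assoc)
      moreover have "C1 * (C * B * (L * norm x)) = C1 * C * L * B * norm x" by (simp only: mult_ac)
      ultimately show ?thesis using \<open>C1 * (inverse C1 * norm (op \<gamma> f x)) \<le> C1 * (C * B * (L * norm x))\<close> unfolding eq by linarith
    qed
  qed
  moreover have "C1 * C * L \<ge> 0" using C C1 L by simp
  ultimately show ?thesis unfolding calc_bounded_def by blast
qed

end

locale adjoint_families = sectorial_family \<omega> R + adj: sectorial_family \<omega> R'
  for \<omega> and R R' :: "complex \<Rightarrow> 'a::complex_hilbert \<Rightarrow>\<^sub>L 'a" +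
  assumes adjoint: "\<And>z x v. z \<in> - closure (sector \<omega>) \<Longrightarrow> cinner (R (cnj z) x) v = cinner x (R' z v)"
begin

lemma dilate_adjoint:
  assumes G: "sector_decay \<theta> s c G" "s > 0" "\<theta> \<le> pi" and z: "z \<in> sector \<alpha>" and g: "\<omega> < \<gamma>" "\<gamma> < \<theta> - \<alpha>" "0 < \<alpha>"
  shows "cinner (op \<gamma> (\<lambda>w. cnj_fun G (cnj z * w)) v) y = cinner v (adj.op \<gamma> (\<lambda>w. G (z * w)) y)"
proof -
  have t: "0 < \<theta>" "\<theta> - \<alpha> \<le> pi" using g omega G by linarith+
  have "cinner (op \<gamma> (cnj_fun (\<lambda>w. G (z * w))) v) y = cinner v (adj.op \<gamma> (\<lambda>w. G (z * w)) y)"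
    by (rule op_adjoint[OF adjoint sector_decay_dilate[OF G z t(1)] G(2) g(1,2) t(2)])
  moreover have "cnj_fun (\<lambda>w. G (z * w)) = (\<lambda>w. cnj_fun G (cnj z * w))" by (simp add: cnj_fun_def fun_eq_iff)
  ultimately show ?thesis by simp
qed

lemma adjoint_calc_bounded:
  assumes b: "calc_bounded \<theta>" and t: "\<omega> < \<theta>" "\<theta> \<le> pi"
  shows "adj.calc_bounded \<theta>"
proof -
  let ?g = "(\<omega> + \<theta>) / 2"
  have g: "\<omega> < ?g" "?g < \<theta>" using t by auto
  obtain K where K: "K \<ge> 0" "\<And>f s d B. sector_decay \<theta> s d f \<Longrightarrow> s > 0 \<Longrightarrow> (\<forall>w\<in>sector \<theta>. cmod (f w) \<le> B) \<Longrightarrow> norm (op ?g f) \<le> K * B"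
    using b unfolding calc_bounded_def by blast
  have "norm (adj.op ?g f) \<le> K * B" if f: "sector_decay \<theta> s d f" "s > 0" "\<forall>w\<in>sector \<theta>. cmod (f w) \<le> B" for f s d B
  proof -
    have fb: "\<forall>w\<in>sector \<theta>. cmod (cnj_fun f w) \<le> B" using f(3) sector_cnj[OF t(2)] by (simp add: cnj_fun_def)
    have n: "norm (op ?g (cnj_fun f)) \<le> K * B" by (rule K(2)[OF cnj_fun_decay[OF f(1) t(2)] f(2) fb])
    then have KB: "0 \<le> K * B" using norm_ge_zero order_trans by blast
    show ?thesis
    proof (rule norm_blinfun_bound[OF KB], rule norm_le_if_cinner_le)
      fix x y
      have "cmod (cinner (adj.op ?g f x) y) = cmod (cinner y (adj.op ?g f x))" by (metis cinner_commute complex_mod_cnj)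
      also have "\<dots> = cmod (cinner (op ?g (cnj_fun f) y) x)"
        by (simp only: op_adjoint[OF adjoint f(1,2) g t(2)])
      also have "\<dots> \<le> (norm (op ?g (cnj_fun f)) * norm y) * norm x"
        by (rule order_trans[OF norm_cinner_le mult_right_mono[OF norm_blinfun]]) simp
      also have "\<dots> \<le> (K * B * norm y) * norm x" by (intro mult_right_mono n) auto
      finally show "cmod (cinner (adj.op ?g f x) y) \<le> K * B * norm x * norm y" by (simp add: mult_ac)
    next
      fix x show "0 \<le> K * B * norm x" using KB by simp
    qed
  qed
  then show ?thesis unfolding adj.calc_bounded_def using K(1) by blast
qed

text \<open>
  Restricted to the smaller of their two sectors, \<open>F\<close> and \<open>G\<close> have a nonzero product, to which
  \<open>pairing_bound\<close> applies.
\<close>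

lemma area_upper_pair_imp_calc_bounded:
  assumes u: "area_upper \<alpha> \<theta>1 F" "adj.area_upper \<alpha> \<theta>2 G" and t: "\<omega> < \<theta>" "\<theta> \<le> pi"
    and F: "sector_decay \<theta>1 s1 c1 F" "s1 > 0" "\<omega> + \<alpha> < \<theta>1" "\<theta>1 \<le> pi" "\<exists>z\<in>sector \<theta>1. F z \<noteq> 0"
    and G: "sector_decay \<theta>2 s2 c2 G" "s2 > 0" "\<omega> + \<alpha> < \<theta>2" "\<theta>2 \<le> pi" "\<exists>z\<in>sector \<theta>2. G z \<noteq> 0"
    and a: "0 < \<alpha>"
  shows "calc_bounded \<theta>"
proof -
  define \<theta>0 where "\<theta>0 = min \<theta>1 \<theta>2"
  define \<nu> where "\<nu> = min \<theta> (\<theta>0 - \<alpha>)"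
  define \<gamma> where "\<gamma> = (\<omega> + \<nu>) / 2"
  have t0: "\<theta>0 \<le> \<theta>1" "\<theta>0 \<le> \<theta>2" "\<omega> + \<alpha> < \<theta>0" "\<theta>0 \<le> pi" using F G by (auto simp: \<theta>0_def)
  have g: "\<omega> < \<nu>" "\<nu> \<le> \<theta>0 - \<alpha>" "\<nu> \<le> \<theta>" "\<omega> < \<gamma>" "\<gamma> < \<nu>" "\<alpha> < \<theta>0" "0 < \<nu>" "\<nu> \<le> pi" "0 < \<theta>0" "\<gamma> < \<theta>0 - \<alpha>" "\<gamma> < \<theta>" "\<gamma> < \<theta>1 - \<alpha>" "\<gamma> < \<theta>2 - \<alpha>"
    using t t0 a omega by (auto simp: \<nu>_def \<gamma>_def min_def)
  have F0: "sector_decay \<theta>0 s1 c1 F" by (rule sector_decay_mono[OF F(1) t0(1)])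
  have G0: "sector_decay \<theta>0 s2 c2 G" by (rule sector_decay_mono[OF G(1) t0(2)])
  have nz: "\<exists>z\<in>sector \<theta>0. F z * G z \<noteq> 0"
    by (rule sector_product_nonzero[OF _ F(5) _ G(5) g(9) t0(1,2) F(4) G(4)]) (use F G in \<open>auto simp: sector_decay_def\<close>)
  obtain L1 where L1: "L1 \<ge> 0" "\<And>x. area \<alpha> \<gamma> F x \<le> ennreal ((L1 * norm x)\<^sup>2)"
  proof -
    have "area \<alpha> ((\<omega> + (\<theta>1 - \<alpha>)) / 2) F x = area \<alpha> \<gamma> F x" for x
      by (rule area_independent[OF F(1,2,4) a]) (use g F a in auto)
    then show ?thesis using u(1) that unfolding area_upper_def by auto
  qed
  obtain L2 where L2: "L2 \<ge> 0" "\<And>x. adj.area \<alpha> \<gamma> G x \<le> ennreal ((L2 * norm x)\<^sup>2)"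
  proof -
    have "adj.area \<alpha> ((\<omega> + (\<theta>2 - \<alpha>)) / 2) G x = adj.area \<alpha> \<gamma> G x" for x
      by (rule adj.area_independent[OF G(1,2,4) a]) (use g G a in auto)
    then show ?thesis using u(2) that unfolding adj.area_upper_def by auto
  qed
  obtain C where C: "C \<ge> 0" "\<And>f B s' d x y Y. sector_decay \<nu> s' d f \<Longrightarrow> s' > 0 \<Longrightarrow> (\<forall>w\<in>sector \<nu>. cmod (f w) \<le> B) \<Longrightarrow>
     (\<forall>z\<in>sector \<alpha>. \<forall>v. cinner (op \<gamma> (\<lambda>w. cnj_fun G (cnj z * w)) v) y = cinner v (Y z)) \<Longrightarrow> continuous_on (sector \<alpha>) Y \<Longrightarrow>
     (ennreal (cmod (cinner (op \<gamma> f x) y)))\<^sup>2 \<le> ennreal ((C * B)\<^sup>2) * area \<alpha> \<gamma> F x * (\<integral>\<^sup>+z. (ennreal (norm (Y z)))\<^sup>2 \<partial>sector_measure \<alpha>)"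
    using pairing_bound[OF F0 F(2) G0 G(2) a g(6) t0(4) nz g(4,5,2)] by metis
  have "norm (op ((\<omega> + \<theta>) / 2) f) \<le> (C * L1 * L2) * B"
    if f: "sector_decay \<theta> s' d f" "s' > 0" "\<forall>w\<in>sector \<theta>. cmod (f w) \<le> B" for f s' d B
  proof -
    have f\<nu>: "sector_decay \<nu> s' d f" by (rule sector_decay_mono[OF f(1) g(3)])
    have fb: "\<forall>w\<in>sector \<nu>. cmod (f w) \<le> B" using f(3) sector_mono[OF g(3)] by blast
    have B: "B \<ge> 0" using fb one_in_sector[OF g(7)] norm_ge_zero order_trans by blast
    have eq: "op ((\<omega> + \<theta>) / 2) f = op \<gamma> f" by (rule op_independent[OF f(1,2)]) (use g t in auto)
    have K0: "0 \<le> C * L1 * L2 * B" using B C L1 L2 by simp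
    show ?thesis unfolding eq
    proof (rule norm_blinfun_bound[OF K0], rule norm_le_if_cinner_le)
      fix x y
      let ?Y = "\<lambda>z. adj.op \<gamma> (\<lambda>w. G (z * w)) y"
      have cY: "continuous_on (sector \<alpha>) ?Y"
        by (intro bounded_linear.continuous_on[OF blinfun.bounded_linear_left] adj.dilate_continuous[OF G0 G(2) a g(6) t0(4) g(4,10)])
      have "(ennreal (cmod (cinner (op \<gamma> f x) y)))\<^sup>2 \<le> ennreal ((C * B)\<^sup>2) * area \<alpha> \<gamma> F x * (\<integral>\<^sup>+z. (ennreal (norm (?Y z)))\<^sup>2 \<partial>sector_measure \<alpha>)"
        by (rule C(2)[OF f\<nu> f(2) fb _ cY]) (use dilate_adjoint[OF G0 G(2) t0(4) _ g(4,10) a] in blast)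
      also have "\<dots> = ennreal ((C * B)\<^sup>2) * area \<alpha> \<gamma> F x * adj.area \<alpha> \<gamma> G y" by (simp add: adj.area_def)
      also have "\<dots> \<le> ennreal ((C * B)\<^sup>2) * ennreal ((L1 * norm x)\<^sup>2) * ennreal ((L2 * norm y)\<^sup>2)"
        by (intro mult_mono L1 L2 order_refl) auto
      also have "\<dots> = ennreal ((C * L1 * L2 * B * norm x * norm y)\<^sup>2)"
        by (simp add: ennreal_mult[symmetric] power_mult_distrib mult_ac)
      finally show "cmod (cinner (op \<gamma> f x) y) \<le> C * L1 * L2 * B * norm x * norm y"
        by (rule power2_ennreal_le_cancel) (use K0 in auto)
    next
      fix x show "0 \<le> C * L1 * L2 * B * norm x" using K0 by simp
    qed
  qed
  moreover have "C * L1 * L2 \<ge> 0" using C L1 L2 by simp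
  ultimately show ?thesis unfolding calc_bounded_def by blast
qed

text \<open>
  With \<open>u = e\<^sub>n(A) x\<close> for an approximate unit \<open>e\<^sub>n\<close>, pairing \<open>e\<^sub>n(A) x\<close> with \<open>u\<close> gives
  \<open>norm u\<^sup>2 \<le> D * area(x)\<^sup>1\<^sup>/\<^sup>2 * norm u\<close>, where the upper estimate for the adjoint has been used on \<open>u\<close>. The
  constant does not depend on \<open>n\<close> since \<open>e\<^sub>n\<close> is bounded uniformly in \<open>n\<close>; then \<open>u\<close> tends to \<open>x\<close>.
\<close>

lemma calc_bounded_imp_area_lower:
  assumes b: "calc_bounded \<theta>" and t: "\<omega> < \<theta>" "\<theta> < pi"
    and F: "sector_decay \<theta>' s c F" "s > 0" and a: "0 < \<alpha>" "\<omega> + \<alpha> < \<theta>'" "\<theta>' \<le> pi" and nz: "\<exists>z\<in>sector \<theta>'. F z \<noteq> 0"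
    and lim: "\<And>\<gamma> x. \<omega> < \<gamma> \<Longrightarrow> \<gamma> < pi \<Longrightarrow> (\<lambda>n. op \<gamma> (approx_unit (1 / real (n + 2)) (real (n + 2))) x) \<longlonglongrightarrow> x"
  shows "area_lower \<alpha> \<theta>' F"
proof -
  define \<nu> where "\<nu> = \<theta>' - \<alpha>"
  define \<gamma> where "\<gamma> = (\<omega> + \<nu>) / 2"
  have g: "\<omega> < \<nu>" "\<nu> \<le> \<theta>' - \<alpha>" "\<omega> < \<gamma>" "\<gamma> < \<nu>" "\<alpha> < \<theta>'" "0 < \<nu>" "\<nu> < pi" "0 < \<theta>'" "\<gamma> < \<theta>' - \<alpha>" "\<gamma> < pi"
    using t a omega by (auto simp: \<nu>_def \<gamma>_def)
  have gdef: "(\<omega> + (\<theta>' - \<alpha>)) / 2 = \<gamma>" by (simp add: \<gamma>_def \<nu>_def)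
  have "adj.area_upper \<alpha> \<theta>' F"
    by (rule adj.calc_bounded_imp_area_upper[OF adjoint_calc_bounded[OF b t(1)] t F a]) (use t in simp)
  then obtain L where L: "L \<ge> 0" "\<And>x. adj.area \<alpha> \<gamma> F x \<le> ennreal ((L * norm x)\<^sup>2)"
    unfolding adj.area_upper_def gdef by blast
  have nz': "\<exists>z\<in>sector \<theta>'. F z * F z \<noteq> 0" using nz by auto
  obtain C where C: "C \<ge> 0" "\<And>f B s' d x y Y. sector_decay \<nu> s' d f \<Longrightarrow> s' > 0 \<Longrightarrow> (\<forall>w\<in>sector \<nu>. cmod (f w) \<le> B) \<Longrightarrow>
     (\<forall>z\<in>sector \<alpha>. \<forall>v. cinner (op \<gamma> (\<lambda>w. cnj_fun F (cnj z * w)) v) y = cinner v (Y z)) \<Longrightarrow> continuous_on (sector \<alpha>) Y \<Longrightarrow>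
     (ennreal (cmod (cinner (op \<gamma> f x) y)))\<^sup>2 \<le> ennreal ((C * B)\<^sup>2) * area \<alpha> \<gamma> F x * (\<integral>\<^sup>+z. (ennreal (norm (Y z)))\<^sup>2 \<partial>sector_measure \<alpha>)"
    using pairing_bound[OF F F a(1) g(5) a(3) nz' g(3,4,2)] by metis
  \<comment> \<open>The bound of \<open>approx_unit_bound\<close> on the sector of angle \<open>\<nu>\<close>.\<close>
  define S where "S = 2 / sin ((pi - \<nu>) / 2)"
  define D where "D = C * S * L"
  have S: "S > 0" unfolding S_def using g by (intro divide_pos_pos sin_gt_zero) auto
  have D: "D \<ge> 0" using C S L by (simp add: D_def)
  have main: "norm x \<le> D * r" if r: "area \<alpha> \<gamma> F x = ennreal (r\<^sup>2)" "r \<ge> 0" for x r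
  proof (rule LIMSEQ_le_const2[OF tendsto_norm[OF lim[OF g(3,10), of x]]], intro exI allI impI)
    fix n :: nat
    let ?f = "approx_unit (1 / real (n + 2)) (real (n + 2))"
    let ?u = "op \<gamma> ?f x"
    have ab: "0 < 1 / real (n + 2)" "1 / real (n + 2) < real (n + 2)"
    proof -
      have "1 / real (n + 2) \<le> 1" by simp
      also have "1 < real (n + 2)" by simp
      finally show "1 / real (n + 2) < real (n + 2)" .
    qed simp
    obtain d where fd: "sector_decay \<nu> 1 d ?f" using approx_unit_decay[OF g(6,7) ab] by blast
    have fb: "\<forall>w\<in>sector \<nu>. cmod (?f w) \<le> S"
      unfolding S_def using approx_unit_bound[OF g(6,7)] ab by simp
    let ?Y = "\<lambda>z. adj.op \<gamma> (\<lambda>w. F (z * w)) ?u"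
    have cY: "continuous_on (sector \<alpha>) ?Y"
      by (intro bounded_linear.continuous_on[OF blinfun.bounded_linear_left] adj.dilate_continuous[OF F a(1) g(5) a(3) g(3,9)])
    have "(ennreal (cmod (cinner ?u ?u)))\<^sup>2 \<le> ennreal ((C * S)\<^sup>2) * area \<alpha> \<gamma> F x * (\<integral>\<^sup>+z. (ennreal (norm (?Y z)))\<^sup>2 \<partial>sector_measure \<alpha>)"
      by (rule C(2)[OF fd zero_less_one fb _ cY]) (use dilate_adjoint[OF F a(3) _ g(3,9) a(1)] in blast)
    also have "\<dots> = ennreal ((C * S)\<^sup>2) * ennreal (r\<^sup>2) * adj.area \<alpha> \<gamma> F ?u" by (simp add: adj.area_def r(1))
    also have "\<dots> \<le> ennreal ((C * S)\<^sup>2) * ennreal (r\<^sup>2) * ennreal ((L * norm ?u)\<^sup>2)"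
      by (intro mult_left_mono L) simp
    also have "\<dots> = ennreal ((D * r * norm ?u)\<^sup>2)"
      by (simp add: ennreal_mult[symmetric] power_mult_distrib mult_ac D_def)
    finally have "cmod (cinner ?u ?u) \<le> D * r * norm ?u"
      by (rule power2_ennreal_le_cancel) (use D r in auto)
    then have "norm ?u * norm ?u \<le> (D * r) * norm ?u"
    proof -
      have "cmod (cinner v v) = norm v * norm v" for v :: 'a
        by (simp add: cinner_self norm_mult power2_eq_square)
      then show ?thesis using \<open>cmod (cinner ?u ?u) \<le> D * r * norm ?u\<close> by metis
    qed
    then show "norm ?u \<le> D * r"
      by (cases "norm ?u = 0") (use D r in \<open>auto simp: mult_le_cancel_right\<close>)
  qed
  have "ennreal ((inverse (D + 1) * norm x)\<^sup>2) \<le> area \<alpha> \<gamma> F x" for x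
  proof (cases "area \<alpha> \<gamma> F x")
    case (real q)
    have eq: "area \<alpha> \<gamma> F x = ennreal ((sqrt q)\<^sup>2)" using real by simp
    have "norm x \<le> D * sqrt q" by (rule main[OF eq]) (use real in simp)
    also have "\<dots> \<le> (D + 1) * sqrt q" using real by (intro mult_right_mono) auto
    finally have "inverse (D + 1) * norm x \<le> inverse (D + 1) * ((D + 1) * sqrt q)" using D by (intro mult_left_mono) auto
    also have "\<dots> = sqrt q"
    proof -
      have "D + 1 \<noteq> 0" using D by linarith
      then show ?thesis by (simp add: mult.assoc[symmetric])
    qed
    finally have "(inverse (D + 1) * norm x)\<^sup>2 \<le> (sqrt q)\<^sup>2" by (rule power_mono) (use D in simp)
    then show ?thesis unfolding eq by (rule ennreal_leI)
  qed simp
  moreover have "D + 1 > 0" using D by simp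
  ultimately show ?thesis unfolding area_lower_def gdef by blast
qed

end

subsection \<open>Translation of the estimates\<close>

text \<open>
  The quotient is \<open>exp (s (l - 2 ln (1 + r)))\<close> with \<open>l = ln r\<close>, and \<open>max 0 l \<le> ln (1 + r) \<le> ln 2 + max 0 l\<close>.
\<close>

lemma decay_powr:
  fixes r s :: real
  assumes "r > 0" "s > 0"
  shows "r powr s / (1 + r) powr (2 * s) \<le> exp (- s * \<bar>ln r\<bar>)"
    and "exp (- s * \<bar>ln r\<bar>) \<le> 4 powr s * (r powr s / (1 + r) powr (2 * s))"
proof -
  have eq: "r powr s / (1 + r) powr (2 * s) = exp (s * (ln r - 2 * ln (1 + r)))"
    using assms by (simp add: powr_def exp_diff[symmetric] algebra_simps)
  have l1: "ln (1 + r) \<ge> 0" "ln r \<le> ln (1 + r)" using assms by auto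
  have "ln r - 2 * ln (1 + r) \<le> - \<bar>ln r\<bar>" using l1 by auto
  then have "s * (ln r - 2 * ln (1 + r)) \<le> s * (- \<bar>ln r\<bar>)" using assms(2) by (intro mult_left_mono) auto
  then show "r powr s / (1 + r) powr (2 * s) \<le> exp (- s * \<bar>ln r\<bar>)" unfolding eq by simp
  have l2: "ln (1 + r) \<le> ln 2 + max 0 (ln r)"
  proof (cases "r \<le> 1")
    case True
    then have "ln (1 + r) \<le> ln 2" using assms by (intro ln_mono) auto
    then show ?thesis by simp
  next
    case False
    then have "ln (1 + r) \<le> ln (2 * r)" by (intro ln_mono) auto
    then show ?thesis using False by (simp add: ln_mult)
  qed
  have l4: "ln 4 = 2 * ln (2::real)" using ln_realpow[of 2 2] by simp
  have "- \<bar>ln r\<bar> \<le> ln 4 + (ln r - 2 * ln (1 + r))" using l2 unfolding l4 by (auto simp: max_def split: if_splits)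
  then have "s * (- \<bar>ln r\<bar>) \<le> s * (ln 4 + (ln r - 2 * ln (1 + r)))" using assms(2) by (intro mult_left_mono) auto
  then have "exp (- s * \<bar>ln r\<bar>) \<le> exp (s * ln 4 + s * (ln r - 2 * ln (1 + r)))" by (simp add: distrib_left)
  then show "exp (- s * \<bar>ln r\<bar>) \<le> 4 powr s * (r powr s / (1 + r) powr (2 * s))"
    unfolding eq by (simp add: powr_def exp_add)
qed

lemma Hinf0_imp_sector_decay:
  assumes "f \<in> Hinf0 \<theta>" shows "\<exists>s>0. \<exists>c. sector_decay \<theta> s c f"
proof -
  obtain s c where s: "s > 0" "c > 0" "\<And>z. z \<in> sector \<theta> \<Longrightarrow> cmod (f z) \<le> c * (cmod z powr s / (1 + cmod z) powr (2 * s))"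
    and h: "f holomorphic_on sector \<theta>"
    using assms by (auto simp: Hinf0_def Hinf_def)
  have "cmod (f z) \<le> c * exp (- s * \<bar>ln (cmod z)\<bar>)" if "z \<in> sector \<theta>" for z
    using s(3)[OF that] decay_powr(1)[of "cmod z" s] sector_nonzero[OF that] s(1,2)
    by (meson less_imp_le mult_left_mono order_trans zero_less_norm_iff)
  then show ?thesis using s(1) h unfolding sector_decay_def by blast
qed

lemma sector_decay_imp_Hinf0:
  assumes f: "sector_decay \<theta> s c f" "s > 0" "0 < \<theta>"
  shows "f \<in> Hinf0 \<theta>"
proof -
  have c: "c \<ge> 0" by (rule sector_decay_nonneg[OF f(1,3)])
  have h: "f holomorphic_on sector \<theta>" using f by (simp add: sector_decay_def)
  have "bounded (f ` sector \<theta>)"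
    unfolding bounded_iff using sector_decay_bound[OF f(1,3)] f(2) by (intro exI[of _ c]) auto
  moreover have "cmod (f z) \<le> ((c + 1) * 4 powr s) * (cmod z powr s / (1 + cmod z) powr (2 * s))" if z: "z \<in> sector \<theta>" for z
  proof -
    have "cmod (f z) \<le> c * exp (- s * \<bar>ln (cmod z)\<bar>)" using f z by (simp add: sector_decay_def)
    also have "\<dots> \<le> (c + 1) * exp (- s * \<bar>ln (cmod z)\<bar>)" by (intro mult_right_mono) auto
    also have "\<dots> \<le> (c + 1) * (4 powr s * (cmod z powr s / (1 + cmod z) powr (2 * s)))"
      using decay_powr(2)[of "cmod z" s] sector_nonzero[OF z] f(2) c by (intro mult_left_mono) auto
    finally show ?thesis by (simp only: mult.assoc)
  qed
  moreover have "(c + 1) * 4 powr s > 0" using c by simp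
  ultimately show ?thesis using h f(2) unfolding Hinf0_def Hinf_def by blast
qed

lemma fcalc_eq_op:
  assumes "sectorial_family \<omega> (resolvent A)"
  shows "fcalc \<omega> \<theta> A f = sectorial_family.op (resolvent A) ((\<omega> + \<theta>) / 2) f"
  unfolding fcalc_def fcalc_path_def sectorial_family.op_def[OF assms] ..

lemma bounded_Hinf_calculus_iff:
  fixes A :: "'a::complex_hilbert \<rightharpoonup> 'a"
  assumes "sectorial_family \<omega> (resolvent A)" and t: "\<omega> < \<theta>" "\<theta> \<le> pi"
  shows "bounded_Hinf_calculus \<omega> \<theta> A \<longleftrightarrow> sectorial_family.calc_bounded \<omega> (resolvent A) \<theta>"
proof -
  interpret sectorial_family \<omega> "resolvent A" by fact
  have t0: "0 < \<theta>" using t omega by simp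
  show ?thesis
  proof
    assume "bounded_Hinf_calculus \<omega> \<theta> A"
    then obtain K where K: "K > 0" "\<And>f. f \<in> Hinf0 \<theta> \<Longrightarrow> norm (op ((\<omega> + \<theta>) / 2) f) \<le> K * Hinf_norm \<theta> f"
      unfolding bounded_Hinf_calculus_def fcalc_eq_op[OF assms(1)] by blast
    have "norm (op ((\<omega> + \<theta>) / 2) f) \<le> K * B" if f: "sector_decay \<theta> s d f" "s > 0" "\<forall>w\<in>sector \<theta>. cmod (f w) \<le> B" for f s d B
    proof -
      have "Hinf_norm \<theta> f \<le> B" unfolding Hinf_norm_def
        by (rule cSUP_least) (use one_in_sector[OF t0] f(3) in auto)
      then have "K * Hinf_norm \<theta> f \<le> K * B" using K(1) by (intro mult_left_mono) auto
      then show ?thesis using K(2)[OF sector_decay_imp_Hinf0[OF f(1,2) t0]] by simp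
    qed
    then show "calc_bounded \<theta>" unfolding calc_bounded_def using K(1) by (intro exI[of _ K]) auto
  next
    assume "calc_bounded \<theta>"
    then obtain K where K: "K \<ge> 0" "\<And>f s d B. sector_decay \<theta> s d f \<Longrightarrow> s > 0 \<Longrightarrow> (\<forall>w\<in>sector \<theta>. cmod (f w) \<le> B) \<Longrightarrow> norm (op ((\<omega> + \<theta>) / 2) f) \<le> K * B"
      unfolding calc_bounded_def by blast
    have "norm (fcalc \<omega> \<theta> A f) \<le> (K + 1) * Hinf_norm \<theta> f" if f: "f \<in> Hinf0 \<theta>" for f
    proof -
      obtain s c where sc: "s > 0" "sector_decay \<theta> s c f" using Hinf0_imp_sector_decay[OF f] by blast
      have "bounded (f ` sector \<theta>)" using f by (simp add: Hinf0_def Hinf_def)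
      then have bdd: "bdd_above ((\<lambda>z. cmod (f z)) ` sector \<theta>)"
        unfolding bounded_iff bdd_above_def by auto
      have le: "\<forall>w\<in>sector \<theta>. cmod (f w) \<le> Hinf_norm \<theta> f"
        unfolding Hinf_norm_def using cSUP_upper[OF _ bdd] by blast
      have "0 \<le> Hinf_norm \<theta> f" using le one_in_sector[OF t0] norm_ge_zero order_trans by blast
      then show ?thesis using K(2)[OF sc(2,1) le] by (simp add: fcalc_eq_op[OF assms(1)] distrib_right)
    qed
    then show "bounded_Hinf_calculus \<omega> \<theta> A" unfolding bounded_Hinf_calculus_def using K(1) by (intro exI[of _ "K + 1"]) auto
  qed
qed

lemma ennreal_sqrt_le_iff: "c \<ge> 0 \<Longrightarrow> ennreal_sqrt r \<le> ennreal c \<longleftrightarrow> r \<le> ennreal (c\<^sup>2)"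
  by (cases r) (auto simp: ennreal_sqrt_def top_unique real_le_lsqrt dest: sqrt_le_D)

lemma le_ennreal_sqrt_iff: "c \<ge> 0 \<Longrightarrow> ennreal c \<le> ennreal_sqrt r \<longleftrightarrow> ennreal (c\<^sup>2) \<le> r"
  by (cases r) (auto simp: ennreal_sqrt_def real_le_rsqrt dest: real_le_rsqrt power_mono[where n=2])

lemma area_norm_eq:
  fixes A :: "'a::complex_hilbert \<rightharpoonup> 'a"
  assumes "sectorial_family \<omega> (resolvent A)" and F: "sector_decay \<theta> s c F" "s > 0" and a: "0 < \<alpha>" "\<omega> + \<alpha> < \<theta>" "\<theta> \<le> pi"
  shows "area_norm \<omega> \<alpha> A (\<theta>, F) x = ennreal_sqrt (sectorial_family.area (resolvent A) \<alpha> ((\<omega> + (\<theta> - \<alpha>)) / 2) F x)"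
proof -
  interpret sectorial_family \<omega> "resolvent A" by fact
  let ?g = "(\<omega> + (\<theta> - \<alpha>)) / 2"
  have g: "\<omega> < ?g" "?g < \<theta> - \<alpha>" "\<alpha> < \<theta>" "\<alpha> \<le> pi" using a omega by auto
  have m: "(\<lambda>z. (ennreal (norm (op ?g (\<lambda>w. F (z * w)) x)))\<^sup>2) \<in> borel_measurable (sector_measure \<alpha>)"
  proof -
    have [measurable]: "(\<lambda>z. ennreal (norm (op ?g (\<lambda>w. F (z * w)) x))) \<in> borel_measurable (sector_measure \<alpha>)"
      by (rule norm_measurable_sector, intro bounded_linear.continuous_on[OF blinfun.bounded_linear_left] dilate_continuous[OF F a(1) g(3) a(3) g(1,2)])
    show ?thesis by measurable
  qed
  have "area \<alpha> ?g F x = (\<integral>\<^sup>+z\<in>sector \<alpha>. ((ennreal (norm (op ?g (\<lambda>w. F (z * w)) x)))\<^sup>2 * ennreal (1 / (cmod z)\<^sup>2)) \<partial>lborel)"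
    unfolding area_def by (rule nn_integral_sector_measure[OF g(4) m])
  also have "\<dots> = (\<integral>\<^sup>+z\<in>sector \<alpha>. ennreal ((norm (fcalc \<omega> (\<theta> - \<alpha>) A (\<lambda>w. F (z * w)) x))\<^sup>2 / (cmod z)\<^sup>2) \<partial>lborel)"
    by (intro nn_integral_cong) (simp add: fcalc_eq_op[OF assms(1)] ennreal_power ennreal_mult''[symmetric])
  finally show ?thesis by (simp add: area_norm_def)
qed

theorem theorem2p3:
  fixes A :: "'a::complex_hilbert \<rightharpoonup> 'a" and \<omega> \<theta> \<alpha> :: real
  assumes "0 < \<omega>" and "\<omega> < pi"
    and "sectorial \<omega> A"
    and "inj_on A (dom A)"
    and "\<omega> < \<theta>" and "\<theta> < pi"
    and "0 < \<alpha>" and "\<alpha> < (\<theta> - \<omega>) / 2"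
  shows
    "(bounded_Hinf_calculus \<omega> \<theta> A \<longleftrightarrow>
        (\<exists>F\<in>nonzero_Hinf0_plus (\<omega> + \<alpha>). \<exists>G\<in>nonzero_Hinf0_plus (\<omega> + \<alpha>). \<exists>K>0. \<forall>x.
           area_norm \<omega> \<alpha> A F x \<le> ennreal (K * norm x) \<and>
           area_norm \<omega> \<alpha> (adjoint_op A) G x \<le> ennreal (K * norm x))) \<and>
     (bounded_Hinf_calculus \<omega> \<theta> A \<longleftrightarrow>
        (\<forall>F\<in>nonzero_Hinf0_plus (\<omega> + \<alpha>). \<forall>G\<in>nonzero_Hinf0_plus (\<omega> + \<alpha>). \<exists>K>0. \<forall>x.
           area_norm \<omega> \<alpha> A F x \<le> ennreal (K * norm x) \<and>
           area_norm \<omega> \<alpha> (adjoint_op A) G x \<le> ennreal (K * norm x))) \<and>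
     (bounded_Hinf_calculus \<omega> \<theta> A \<longleftrightarrow>
        (\<exists>F\<in>nonzero_Hinf0_plus (\<omega> + \<alpha>). \<exists>C>0. \<forall>x.
           ennreal (inverse C * norm x) \<le> area_norm \<omega> \<alpha> A F x \<and>
           area_norm \<omega> \<alpha> A F x \<le> ennreal (C * norm x))) \<and>
     (bounded_Hinf_calculus \<omega> \<theta> A \<longleftrightarrow>
        (\<forall>F\<in>nonzero_Hinf0_plus (\<omega> + \<alpha>). \<exists>C>0. \<forall>x.
           ennreal (inverse C * norm x) \<le> area_norm \<omega> \<alpha> A F x \<and>
           area_norm \<omega> \<alpha> A F x \<le> ennreal (C * norm x)))"
proof -
  have SA: "sectorial_family \<omega> (resolvent A)" by (rule sectorial_family_resolvent) fact+
  interpret sectorial_family \<omega> "resolvent A" by (rule SA)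
  have adj: "cinner (resolvent A (cnj z) x) v = cinner x (resolvent (adjoint_op A) z v)" if "z \<in> - closure (sector \<omega>)" for z x v
    by (rule resolvent_adjoint_op[OF assms(3,1,2) that])
  have SB: "sectorial_family \<omega> (resolvent (adjoint_op A))" by (rule adjoint_family[OF adj])
  interpret AF: adjoint_families \<omega> "resolvent A" "resolvent (adjoint_op A)"
    by (intro adjoint_families.intro SA SB adjoint_families_axioms.intro adj)
  let ?N = "nonzero_Hinf0_plus (\<omega> + \<alpha>)"
  have N: "\<omega> + \<alpha> < \<theta>'" "\<theta>' < pi" "\<exists>s>0. \<exists>c. sector_decay \<theta>' s c F" "\<exists>z\<in>sector \<theta>'. F z \<noteq> 0"
    if "(\<theta>', F) \<in> ?N" for \<theta>' F
    using that Hinf0_imp_sector_decay[of F \<theta>'] by (auto simp: nonzero_Hinf0_plus_def Hinf0_plus_def)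
  define Up where "Up = (\<lambda>(\<theta>', F). area_upper \<alpha> \<theta>' F)"
  define Low where "Low = (\<lambda>(\<theta>', F). area_lower \<alpha> \<theta>' F)"
  define Up' where "Up' = (\<lambda>(\<theta>', F). AF.adj.area_upper \<alpha> \<theta>' F)"
  have up: "area_norm \<omega> \<alpha> A (\<theta>', F) x \<le> ennreal (K * norm x) \<longleftrightarrow> area \<alpha> ((\<omega> + (\<theta>' - \<alpha>)) / 2) F x \<le> ennreal ((K * norm x)\<^sup>2)"
    and low: "ennreal (K * norm x) \<le> area_norm \<omega> \<alpha> A (\<theta>', F) x \<longleftrightarrow> ennreal ((K * norm x)\<^sup>2) \<le> area \<alpha> ((\<omega> + (\<theta>' - \<alpha>)) / 2) F x"
    and up': "area_norm \<omega> \<alpha> (adjoint_op A) (\<theta>', F) x \<le> ennreal (K * norm x) \<longleftrightarrow> AF.adj.area \<alpha> ((\<omega> + (\<theta>' - \<alpha>)) / 2) F x \<le> ennreal ((K * norm x)\<^sup>2)"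
    if F: "(\<theta>', F) \<in> ?N" and K: "K \<ge> 0" for \<theta>' F K x
  proof -
    obtain s c where sc: "s > 0" "sector_decay \<theta>' s c F" using N(3)[OF F] by blast
    have t': "\<omega> + \<alpha> < \<theta>'" "\<theta>' \<le> pi" using N(1,2)[OF F] by auto
    have K0: "K * norm x \<ge> 0" using K by simp
    show "area_norm \<omega> \<alpha> A (\<theta>', F) x \<le> ennreal (K * norm x) \<longleftrightarrow> area \<alpha> ((\<omega> + (\<theta>' - \<alpha>)) / 2) F x \<le> ennreal ((K * norm x)\<^sup>2)"
      unfolding area_norm_eq[OF SA sc(2,1) assms(7) t'] by (rule ennreal_sqrt_le_iff[OF K0])
    show "ennreal (K * norm x) \<le> area_norm \<omega> \<alpha> A (\<theta>', F) x \<longleftrightarrow> ennreal ((K * norm x)\<^sup>2) \<le> area \<alpha> ((\<omega> + (\<theta>' - \<alpha>)) / 2) F x"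
      unfolding area_norm_eq[OF SA sc(2,1) assms(7) t'] by (rule le_ennreal_sqrt_iff[OF K0])
    show "area_norm \<omega> \<alpha> (adjoint_op A) (\<theta>', F) x \<le> ennreal (K * norm x) \<longleftrightarrow> AF.adj.area \<alpha> ((\<omega> + (\<theta>' - \<alpha>)) / 2) F x \<le> ennreal ((K * norm x)\<^sup>2)"
      unfolding area_norm_eq[OF SB sc(2,1) assms(7) t'] by (rule ennreal_sqrt_le_iff[OF K0])
  qed
  have mono: "ennreal ((L * norm x)\<^sup>2) \<le> ennreal ((K * norm x)\<^sup>2)" if "0 \<le> L" "L \<le> K" for L K and x :: 'a
    using that by (intro ennreal_leI power_mono mult_right_mono) auto
  have ii: "(\<exists>K>0. \<forall>x. area_norm \<omega> \<alpha> A F x \<le> ennreal (K * norm x) \<and> area_norm \<omega> \<alpha> (adjoint_op A) G x \<le> ennreal (K * norm x)) \<longleftrightarrow> Up F \<and> Up' G"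
    if FG: "F \<in> ?N" "G \<in> ?N" for F G
  proof -
    obtain t1 f t2 g where eq: "F = (t1, f)" "G = (t2, g)" by (cases F, cases G)
    note u1 = up[OF FG(1)[unfolded eq]] and u2 = up'[OF FG(2)[unfolded eq]]
    show ?thesis
    proof
      assume "\<exists>K>0. \<forall>x. area_norm \<omega> \<alpha> A F x \<le> ennreal (K * norm x) \<and> area_norm \<omega> \<alpha> (adjoint_op A) G x \<le> ennreal (K * norm x)"
      then obtain K where K: "K > 0" "\<And>x. area_norm \<omega> \<alpha> A F x \<le> ennreal (K * norm x)" "\<And>x. area_norm \<omega> \<alpha> (adjoint_op A) G x \<le> ennreal (K * norm x)"
        by blast
      then show "Up F \<and> Up' G"
        using u1[of K] u2[of K] unfolding eq Up_def Up'_def area_upper_def AF.adj.area_upper_def by (auto intro!: exI[of _ K])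
    next
      assume "Up F \<and> Up' G"
      then obtain L1 L2 where L: "L1 \<ge> 0" "L2 \<ge> 0" "\<And>x. area \<alpha> ((\<omega> + (t1 - \<alpha>)) / 2) f x \<le> ennreal ((L1 * norm x)\<^sup>2)"
        "\<And>x. AF.adj.area \<alpha> ((\<omega> + (t2 - \<alpha>)) / 2) g x \<le> ennreal ((L2 * norm x)\<^sup>2)"
        unfolding eq Up_def Up'_def area_upper_def AF.adj.area_upper_def by auto
      define K where "K = L1 + L2 + 1"
      have K: "K > 0" "L1 \<le> K" "L2 \<le> K" "K \<ge> 0" using L by (auto simp: K_def)
      have "area_norm \<omega> \<alpha> A F x \<le> ennreal (K * norm x) \<and> area_norm \<omega> \<alpha> (adjoint_op A) G x \<le> ennreal (K * norm x)" for x
        unfolding eq u1[OF K(4)] u2[OF K(4)]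
        using order_trans[OF L(3)[of x] mono[OF L(1) K(2)]] order_trans[OF L(4)[of x] mono[OF L(2) K(3)]] by simp
      then show "\<exists>K>0. \<forall>x. area_norm \<omega> \<alpha> A F x \<le> ennreal (K * norm x) \<and> area_norm \<omega> \<alpha> (adjoint_op A) G x \<le> ennreal (K * norm x)"
        using K(1) by blast
    qed
  qed
  have iii: "(\<exists>C>0. \<forall>x. ennreal (inverse C * norm x) \<le> area_norm \<omega> \<alpha> A F x \<and> area_norm \<omega> \<alpha> A F x \<le> ennreal (C * norm x)) \<longleftrightarrow> Up F \<and> Low F"
    if F: "F \<in> ?N" for F
  proof -
    obtain t1 f where eq: "F = (t1, f)" by (cases F)
    note u = up[OF F[unfolded eq]] and l = low[OF F[unfolded eq]]
    show ?thesis
    proof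
      assume "\<exists>C>0. \<forall>x. ennreal (inverse C * norm x) \<le> area_norm \<omega> \<alpha> A F x \<and> area_norm \<omega> \<alpha> A F x \<le> ennreal (C * norm x)"
      then obtain C where C: "C > 0" "\<And>x. ennreal (inverse C * norm x) \<le> area_norm \<omega> \<alpha> A F x" "\<And>x. area_norm \<omega> \<alpha> A F x \<le> ennreal (C * norm x)"
        by blast
      have i: "inverse C \<ge> 0" "C \<ge> 0" using C(1) by auto
      have "area_upper \<alpha> t1 f" unfolding area_upper_def using C(3) i(2) unfolding eq u[OF i(2)] by blast
      moreover have "area_lower \<alpha> t1 f" unfolding area_lower_def using C(1,2) unfolding eq l[OF i(1)] by blast
      ultimately show "Up F \<and> Low F" by (simp add: eq Up_def Low_def)
    next
      assume "Up F \<and> Low F"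
      then obtain L C1 where L: "L \<ge> 0" "\<And>x. area \<alpha> ((\<omega> + (t1 - \<alpha>)) / 2) f x \<le> ennreal ((L * norm x)\<^sup>2)"
        and C1: "C1 > 0" "\<And>x. ennreal ((inverse C1 * norm x)\<^sup>2) \<le> area \<alpha> ((\<omega> + (t1 - \<alpha>)) / 2) f x"
        unfolding eq Up_def Low_def area_upper_def area_lower_def by auto
      define C where "C = L + C1"
      have C: "C > 0" "L \<le> C" "C \<ge> 0" "inverse C \<ge> 0" "inverse C \<le> inverse C1" using L(1) C1(1) by (auto simp: C_def le_imp_inverse_le)
      have "ennreal (inverse C * norm x) \<le> area_norm \<omega> \<alpha> A F x \<and> area_norm \<omega> \<alpha> A F x \<le> ennreal (C * norm x)" for x
        unfolding eq u[OF C(3)] l[OF C(4)]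
        using order_trans[OF L(2)[of x] mono[OF L(1) C(2)]] order_trans[OF mono[OF C(4,5)] C1(2)[of x]] by simp
      then show "\<exists>C>0. \<forall>x. ennreal (inverse C * norm x) \<le> area_norm \<omega> \<alpha> A F x \<and> area_norm \<omega> \<alpha> A F x \<le> ennreal (C * norm x)"
        using C(1) by blast
    qed
  qed
  have tp: "\<theta> \<le> pi" using assms by simp
  have i: "bounded_Hinf_calculus \<omega> \<theta> A \<longleftrightarrow> calc_bounded \<theta>"
    by (rule bounded_Hinf_calculus_iff[OF SA assms(5) tp])
  have lim: "(\<lambda>n. op \<gamma> (approx_unit (1 / real (n + 2)) (real (n + 2))) x) \<longlonglongrightarrow> x" if g: "\<omega> < \<gamma>" "\<gamma> < pi" for \<gamma> x
  proof -
    have "1 / real (n + 2) < real (n + 2)" for n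
    proof -
      have "1 / real (n + 2) \<le> 1" by simp
      also have "1 < real (n + 2)" by simp
      finally show ?thesis .
    qed
    then show ?thesis
      using approx_unit_tendsto[OF assms(3,1,2,4), of x] by (subst op_approx_unit[OF g]) simp_all
  qed
  have "Up F \<and> Up' F \<and> Low F" if "calc_bounded \<theta>" and F: "F \<in> ?N" for F
  proof -
    obtain t1 f where eq: "F = (t1, f)" by (cases F)
    note n = N[OF F[unfolded eq]]
    obtain s c where sc: "s > 0" "sector_decay t1 s c f" using n(3) by blast
    have t1: "t1 \<le> pi" using n(2) by simp
    show ?thesis unfolding eq Up_def Up'_def Low_def
      using calc_bounded_imp_area_upper[OF that(1) assms(5,6) sc(2,1) assms(7) n(1) t1]
        AF.adj.calc_bounded_imp_area_upper[OF AF.adjoint_calc_bounded[OF that(1) assms(5) tp] assms(5,6) sc(2,1) assms(7) n(1) t1]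
        AF.calc_bounded_imp_area_lower[OF that(1) assms(5,6) sc(2,1) assms(7) n(1) t1 n(4) lim] by simp
  qed
  note fwd = this
  have bwd2: "calc_bounded \<theta>" if FG: "F \<in> ?N" "G \<in> ?N" "Up F" "Up' G" for F G
  proof -
    obtain t1 f t2 g where eq: "F = (t1, f)" "G = (t2, g)" by (cases F, cases G)
    note n = N[OF FG(1)[unfolded eq]] and m = N[OF FG(2)[unfolded eq]]
    obtain s c where sc: "s > 0" "sector_decay t1 s c f" using n(3) by blast
    obtain s' c' where sc': "s' > 0" "sector_decay t2 s' c' g" using m(3) by blast
    show ?thesis
      by (rule AF.area_upper_pair_imp_calc_bounded[OF _ _ assms(5) tp sc(2,1) n(1) _ n(4) sc'(2,1) m(1) _ m(4) assms(7)])
        (use FG(3,4) n(2) m(2) in \<open>auto simp: eq Up_def Up'_def\<close>)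
  qed
  have bwd3: "calc_bounded \<theta>" if F: "F \<in> ?N" "Up F" "Low F" for F
  proof -
    obtain t1 f where eq: "F = (t1, f)" by (cases F)
    note n = N[OF F(1)[unfolded eq]]
    obtain s c where sc: "s > 0" "sector_decay t1 s c f" using n(3) by blast
    show ?thesis
      by (rule area_equiv_imp_calc_bounded[OF _ _ assms(5) tp sc(2,1) assms(7) n(1) _ n(4)])
        (use F(2,3) n(2) in \<open>auto simp: eq Up_def Low_def\<close>)
  qed
  have ex: "\<exists>F. F \<in> ?N"
  proof -
    define t where "t = (\<omega> + \<alpha> + pi) / 2"
    have "\<omega> + \<alpha> < pi" using assms by (simp add: field_simps)
    then have t: "\<omega> + \<alpha> < t" "t < pi" "0 < t" using assms by (auto simp: t_def)
    obtain c where "sector_decay t 1 c (approx_unit 1 2)" using approx_unit_decay[OF t(3,2), of 1 2] by auto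
    then have "approx_unit 1 2 \<in> Hinf0 t" by (rule sector_decay_imp_Hinf0) (use t in auto)
    moreover have "\<exists>z\<in>sector t. approx_unit 1 2 z \<noteq> 0"
      by (rule bexI[of _ 1]) (auto simp: approx_unit_def one_in_sector t)
    ultimately have "(t, approx_unit 1 2) \<in> ?N" using t by (auto simp: nonzero_Hinf0_plus_def Hinf0_plus_def)
    then show ?thesis by blast
  qed
  have "calc_bounded \<theta> \<longleftrightarrow> (\<exists>F\<in>?N. \<exists>G\<in>?N. Up F \<and> Up' G)"
    and "calc_bounded \<theta> \<longleftrightarrow> (\<forall>F\<in>?N. \<forall>G\<in>?N. Up F \<and> Up' G)"
    and "calc_bounded \<theta> \<longleftrightarrow> (\<exists>F\<in>?N. Up F \<and> Low F)"
    and "calc_bounded \<theta> \<longleftrightarrow> (\<forall>F\<in>?N. Up F \<and> Low F)"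
    using fwd bwd2 bwd3 ex by blast+
  then show ?thesis unfolding i using ii iii by (simp cong: bex_cong ball_cong)
qed

end
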